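(* Let $(X,\omega)$ be a compact Hermitian manifold, let $K\subset X$ be a compact subset and let $a\in K$. Let $\bar B(a,r)$ be a closed holomorphic coordinate ball in $X$ with center $a$ and finite radius $r>0$. Then: (i) $V_K$ is continuous at $a$ if and only if $V_{K\cap \bar B(a,r)}$ is continuous at $a$. (ii) If $\phi:X\to\mathbb{R}$ is continuous and $V_K$ is continuous (on $X$), then the weighted extremal function $V_{K,\phi}$ is continuous (on $X$).
   Context: $(X,\omega)$ is a compact Hermitian manifold of complex dimension $n$, with no additional assumption on the Hermitian metric $\omega$ (identified with its smooth positive $(1,1)$-form). Write $d=\partial+\bar\partial$, $d^c=i(\bar\partial-\partial)$. A function $v:X\to\mathbb{R}\cup\{-\infty\}$ is quasi-plurisubharmonic (quasi-psh) if $v\not\equiv-\infty$ and $v$ is locally the sum of a smooth function and a plurisubharmonic function. Set $PSH(X,\omega)=\{v:X\to\mathbb{R}\cup\{-\infty\} : v \text{ quasi-psh},\ \omega+dd^c v\ge 0\}$ (inequality of currents). For $E\subset X$, the extremal function is $V_E(x)=\sup\{v(x): v\in PSH(X,\omega),\ v|_E\le 0\}$, $x\in X$. For a real-valued function $\phi$ whose domain contains $E$, the weighted extremal function is $V_{E,\phi}(x)=\sup\{v(x): v\in PSH(X,\omega),\ v|_E\le\phi|_E\}$, $x\in X$. These functions may take the value $+\infty$. A closed holomorphic coordinate ball $\bar B(a,r)$ with center $a$ and radius $r\in(0,\infty)$ is a set of the form $f^{-1}(\{z\in\mathbb{C}^n:\|z-f(a)\|\le r\})$, where $(U,f)$ is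 a holomorphic chart of $X$ with $a\in U$ and $\{z:\|z-f(a)\|\le r\}\subset f(U)$. *)

theory Defs
  imports "HOL-Analysis.Analysis"
begin

section \<open>Smooth and holomorphic maps\<close>

fun times_continuously_differentiable_on ::
    "nat \<Rightarrow> ('a::real_normed_vector \<Rightarrow> 'b::real_normed_vector) \<Rightarrow> 'a set \<Rightarrow> bool" where
  "times_continuously_differentiable_on 0 f S \<longleftrightarrow> continuous_on S f"
| "times_continuously_differentiable_on (Suc k) f S \<longleftrightarrow>
     (\<forall>x\<in>S. f differentiable (at x)) \<and>
     (\<forall>v. times_continuously_differentiable_on k (\<lambda>x. frechet_derivative f (at x) v) S)"

text \<open>Real smoothness, also for complex-valued functions; meant for open \<open>S\<close> in a
  finite-dimensional space, where control of all directional derivatives suffices.\<close>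

definition smooth_on ::
    "('a::real_normed_vector \<Rightarrow> 'b::real_normed_vector) \<Rightarrow> 'a set \<Rightarrow> bool" where
  "smooth_on f S \<longleftrightarrow> (\<forall>k. times_continuously_differentiable_on k f S)"

definition holomorphic_map_on :: "(complex^'n \<Rightarrow> complex^'m) \<Rightarrow> (complex^'n) set \<Rightarrow> bool" where
  "holomorphic_map_on F S \<longleftrightarrow>
     (\<forall>z\<in>S. \<exists>L. (F has_derivative L) (at z) \<and> (\<forall>c v. L (c *s v) = c *s L v))"

text \<open>Wirtinger operators: with \<open>z\<^sub>j = x\<^sub>j + i y\<^sub>j\<close>, the vector \<open>axis j 1\<close> is the direction of
  \<open>x\<^sub>j\<close> and \<open>axis j \<i>\<close> that of \<open>y\<^sub>j\<close>.\<close>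

definition partial_z :: "'n \<Rightarrow> (complex^'n \<Rightarrow> complex) \<Rightarrow> complex^'n \<Rightarrow> complex" where
  "partial_z j h z = (frechet_derivative h (at z) (axis j 1)
                       - \<i> * frechet_derivative h (at z) (axis j \<i>)) / 2"

definition partial_zbar :: "'n \<Rightarrow> (complex^'n \<Rightarrow> complex) \<Rightarrow> complex^'n \<Rightarrow> complex" where
  "partial_zbar j h z = (frechet_derivative h (at z) (axis j 1)
                          + \<i> * frechet_derivative h (at z) (axis j \<i>)) / 2"


section \<open>Complex manifolds\<close>

text \<open>The underlying topological space is a type \<open>'a\<close>, the complex dimension is \<open>CARD('n)\<close>.
  A chart \<open>(U, f)\<close> is a total function \<open>f\<close> of which only the values on \<open>U\<close> matter.\<close>

type_synonym ('a, 'n) chart = "'a set \<times> ('a \<Rightarrow> complex^'n)"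

abbreviation chart_image :: "('a, 'n::finite) chart \<Rightarrow> (complex^'n) set" where
  "chart_image c \<equiv> snd c ` fst c"

abbreviation chart_inv :: "('a, 'n::finite) chart \<Rightarrow> complex^'n \<Rightarrow> 'a" where
  "chart_inv c \<equiv> inv_into (fst c) (snd c)"

definition topological_chart :: "('a::topological_space, 'n::finite) chart \<Rightarrow> bool" where
  "topological_chart c \<longleftrightarrow>
     open (fst c) \<and> open (chart_image c) \<and>
     homeomorphism (fst c) (chart_image c) (snd c) (chart_inv c)"

definition transition :: "('a, 'n::finite) chart \<Rightarrow> ('a, 'n) chart \<Rightarrow> complex^'n \<Rightarrow> complex^'n" where
  "transition c c' = snd c' \<circ> chart_inv c"

definition holomorphically_compatible :: "('a, 'n::finite) chart \<Rightarrow> ('a, 'n) chart \<Rightarrow> bool" where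
  "holomorphically_compatible c c' \<longleftrightarrow>
     holomorphic_map_on (transition c c') (snd c ` (fst c \<inter> fst c')) \<and>
     holomorphic_map_on (transition c' c) (snd c' ` (fst c \<inter> fst c'))"

definition holomorphic_atlas :: "('a::topological_space, 'n::finite) chart set \<Rightarrow> bool" where
  "holomorphic_atlas A \<longleftrightarrow>
     (\<forall>c\<in>A. topological_chart c) \<and> (\<Union>c\<in>A. fst c) = UNIV \<and>
     (\<forall>c\<in>A. \<forall>c'\<in>A. holomorphically_compatible c c')"

text \<open>The charts of the maximal atlas generated by \<open>A\<close>.\<close>

definition holomorphic_charts ::
    "('a::topological_space, 'n::finite) chart set \<Rightarrow> ('a, 'n) chart set" where
  "holomorphic_charts A =
     {c. topological_chart c \<and> (\<forall>c'\<in>A. holomorphically_compatible c c')}"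

text \<open>\<open>B\<close> is a closed holomorphic coordinate ball with center \<open>a\<close> and radius \<open>r\<close>; it also
  depends on the chart, hence a predicate.\<close>

definition closed_coordinate_ball ::
    "('a::topological_space, 'n::finite) chart set \<Rightarrow> 'a \<Rightarrow> real \<Rightarrow> 'a set \<Rightarrow> bool" where
  "closed_coordinate_ball A a r B \<longleftrightarrow>
     0 < r \<and>
     (\<exists>(U, f) \<in> holomorphic_charts A.
        a \<in> U \<and> cball (f a) r \<subseteq> f ` U \<and> B = {x \<in> U. f x \<in> cball (f a) r})"


section \<open>Hermitian metrics\<close>

text \<open>In a chart \<open>c\<close> the positive (1,1)-form is
  \<open>\<omega> = i \<Sum>\<^sub>j\<^sub>k (g c z)\<^sub>j\<^sub>k dz\<^sub>j \<and> dzbar\<^sub>k\<close>, with \<open>z\<close> ranging over the image of the chart. The last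
  condition says that the local expressions agree on overlaps.\<close>

type_synonym ('a, 'n) metric_coeffs = "('a, 'n) chart \<Rightarrow> complex^'n \<Rightarrow> complex^'n^'n"

definition hermitian_pos_def :: "complex^'n^'n \<Rightarrow> bool" where
  "hermitian_pos_def H \<longleftrightarrow>
     (\<forall>j k. H $ k $ j = cnj (H $ j $ k)) \<and>
     (\<forall>\<xi>. \<xi> \<noteq> 0 \<longrightarrow> Re (\<Sum>j\<in>UNIV. \<Sum>k\<in>UNIV. H $ j $ k * \<xi> $ j * cnj (\<xi> $ k)) > 0)"

definition hermitian_metric ::
    "('a::topological_space, 'n::finite) chart set \<Rightarrow> ('a, 'n) metric_coeffs \<Rightarrow> bool" where
  "hermitian_metric A g \<longleftrightarrow>
     (\<forall>c\<in>holomorphic_charts A.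
        (\<forall>z\<in>chart_image c. hermitian_pos_def (g c z)) \<and>
        (\<forall>j k. smooth_on (\<lambda>z. g c z $ j $ k) (chart_image c))) \<and>
     (\<forall>c\<in>holomorphic_charts A. \<forall>c'\<in>holomorphic_charts A.
        \<forall>z\<in>snd c ` (fst c \<inter> fst c'). \<forall>j k.
          g c z $ j $ k =
            (\<Sum>l\<in>UNIV. \<Sum>m\<in>UNIV. g c' (transition c c' z) $ l $ m
               * partial_z j (\<lambda>w. transition c c' w $ l) z
               * cnj (partial_z k (\<lambda>w. transition c c' w $ m) z)))"

definition compact_hermitian_manifold ::
    "('a::t2_space, 'n::finite) chart set \<Rightarrow> ('a, 'n) metric_coeffs \<Rightarrow> bool" where
  "compact_hermitian_manifold A g \<longleftrightarrow>
     compact (UNIV :: 'a set) \<and> holomorphic_atlas A \<and> hermitian_metric A g"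


section \<open>Plurisubharmonic and quasi-plurisubharmonic functions\<close>

definition usc_on :: "('a::topological_space \<Rightarrow> ereal) \<Rightarrow> 'a set \<Rightarrow> bool" where
  "usc_on u S \<longleftrightarrow> (\<forall>t. openin (top_of_set S) {x \<in> S. u x < t})"

text \<open>The mean of \<open>u\<close> over the circle \<open>z + e\<^sup>i\<^sup>\<theta> w\<close>, as integral of the positive minus integral
  of the negative part (\<open>e2ennreal\<close> sends negative numbers to 0). It is used for \<open>u\<close> bounded
  above on the circle, so the first integral is finite and the mean may be \<open>-\<infinity>\<close>.\<close>

definition circle_mean :: "(complex^'n \<Rightarrow> ereal) \<Rightarrow> complex^'n \<Rightarrow> complex^'n \<Rightarrow> ereal" where
  "circle_mean u z w = ereal (1 / (2 * pi)) *
     (enn2ereal (\<integral>\<^sup>+ \<theta> \<in> {0..2 * pi}. e2ennreal (u (z + cis \<theta> *s w)) \<partial>lborel)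
      - enn2ereal (\<integral>\<^sup>+ \<theta> \<in> {0..2 * pi}. e2ennreal (- u (z + cis \<theta> *s w)) \<partial>lborel))"

text \<open>A psh function is by convention not identically \<open>-\<infinity>\<close> on any connected component of its
  domain.\<close>

definition psh_on :: "(complex^'n \<Rightarrow> ereal) \<Rightarrow> (complex^'n) set \<Rightarrow> bool" where
  "psh_on u \<Omega> \<longleftrightarrow>
     (\<forall>z\<in>\<Omega>. u z \<noteq> \<infinity>) \<and>
     (\<forall>C\<in>components \<Omega>. \<exists>z\<in>C. u z \<noteq> -\<infinity>) \<and>
     usc_on u \<Omega> \<and>
     (\<forall>z w. (\<forall>\<zeta>\<in>cball 0 1. z + \<zeta> *s w \<in> \<Omega>) \<longrightarrow> u z \<le> circle_mean u z w)"

definition quasi_psh ::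
    "('a::topological_space, 'n::finite) chart set \<Rightarrow> ('a \<Rightarrow> ereal) \<Rightarrow> bool" where
  "quasi_psh A v \<longleftrightarrow>
     (\<forall>x. v x \<noteq> \<infinity>) \<and> (\<exists>x. v x \<noteq> -\<infinity>) \<and>
     (\<forall>x. \<exists>(U, f) \<in> holomorphic_charts A. x \<in> U \<and>
        (\<exists>(s :: complex^'n \<Rightarrow> real) u. smooth_on s (f ` U) \<and> psh_on u (f ` U) \<and>
           (\<forall>y\<in>U. v y = ereal (s (f y)) + u (f y))))"


section \<open>Currents of bidegree (1,1) and \<open>\<omega>\<close>-psh functions\<close>

definition test_function :: "(complex^'n) set \<Rightarrow> (complex^'n \<Rightarrow> real) \<Rightarrow> bool" where
  "test_function \<Omega> \<psi> \<longleftrightarrow>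
     smooth_on \<psi> UNIV \<and> (\<exists>C. compact C \<and> C \<subseteq> \<Omega> \<and> (\<forall>z. z \<notin> C \<longrightarrow> \<psi> z = 0))"

text \<open>A current \<open>i \<Sum>\<^sub>j\<^sub>k T\<^sub>j\<^sub>k dz\<^sub>j \<and> dzbar\<^sub>k\<close> on an open set is given by its coefficients \<open>T j k\<close>,
  which are distributions. It is nonnegative if all the distributions
  \<open>\<Sum>\<^sub>j\<^sub>k \<xi>\<^sub>j cnj \<xi>\<^sub>k T\<^sub>j\<^sub>k\<close> are nonnegative on nonnegative test functions; for constant \<open>\<xi>\<close>
  these are, up to positive constants, the wedge products of the current with
  \<open>i \<alpha>\<^sub>1 \<and> cnj \<alpha>\<^sub>1 \<and> \<dots> \<and> i \<alpha>\<^sub>n\<^sub>-\<^sub>1 \<and> cnj \<alpha>\<^sub>n\<^sub>-\<^sub>1\<close> for constant (1,0)-forms \<open>\<alpha>\<close> with common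
  kernel spanned by \<open>\<xi>\<close>.\<close>

type_synonym 'n current11 = "'n \<Rightarrow> 'n \<Rightarrow> (complex^'n \<Rightarrow> real) \<Rightarrow> complex"

definition current11_nonneg :: "(complex^'n) set \<Rightarrow> 'n::finite current11 \<Rightarrow> bool" where
  "current11_nonneg \<Omega> T \<longleftrightarrow>
     (\<forall>\<xi> :: complex^'n. \<forall>\<psi>. test_function \<Omega> \<psi> \<and> (\<forall>z. 0 \<le> \<psi> z) \<longrightarrow>
        (\<Sum>j\<in>UNIV. \<Sum>k\<in>UNIV. \<xi> $ j * cnj (\<xi> $ k) * T j k \<psi>) \<in> \<real>\<^sub>\<ge>\<^sub>0)"

definition form_current :: "(complex^'n) set \<Rightarrow> (complex^'n \<Rightarrow> complex^'n^'n) \<Rightarrow> 'n::finite current11" where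
  "form_current \<Omega> G j k \<psi> = (LINT z:\<Omega>|lborel. G z $ j $ k * of_real (\<psi> z))"

text \<open>Since \<open>d = \<partial> + \<partial>bar\<close> and \<open>d\<^sup>c = i (\<partial>bar - \<partial>)\<close>, one has \<open>dd\<^sup>c = 2 i \<partial> \<partial>bar\<close>; the coefficients
  are distributional derivatives. A quasi-psh \<open>u\<close> is locally integrable and takes
  the value \<open>-\<infinity>\<close>, which \<open>real_of_ereal\<close> sends to 0, on a null set only.\<close>

definition ddc_current :: "(complex^'n) set \<Rightarrow> (complex^'n \<Rightarrow> ereal) \<Rightarrow> 'n::finite current11" where
  "ddc_current \<Omega> u j k \<psi> =
     2 * (LINT z:\<Omega>|lborel. of_real (real_of_ereal (u z))
            * partial_z j (partial_zbar k (\<lambda>w. of_real (\<psi> w))) z)"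

definition PSH ::
    "('a::topological_space, 'n::finite) chart set \<Rightarrow> ('a, 'n) metric_coeffs \<Rightarrow> ('a \<Rightarrow> ereal) set" where
  "PSH A g =
     {v. quasi_psh A v \<and>
         (\<forall>c\<in>holomorphic_charts A.
            current11_nonneg (chart_image c)
              (\<lambda>j k \<psi>. form_current (chart_image c) (g c) j k \<psi>
                       + ddc_current (chart_image c) (v \<circ> chart_inv c) j k \<psi>))}"


section \<open>Extremal functions\<close>

definition extremal_fun ::
    "('a::topological_space, 'n::finite) chart set \<Rightarrow> ('a, 'n) metric_coeffs \<Rightarrow> 'a set \<Rightarrow> 'a \<Rightarrow> ereal" where
  "extremal_fun A g E x = (SUP v \<in> {v \<in> PSH A g. \<forall>y\<in>E. v y \<le> 0}. v x)"

definition weighted_extremal_fun ::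
    "('a::topological_space, 'n::finite) chart set \<Rightarrow> ('a, 'n) metric_coeffs \<Rightarrow> 'a set \<Rightarrow>
     ('a \<Rightarrow> real) \<Rightarrow> 'a \<Rightarrow> ereal" where
  "weighted_extremal_fun A g E \<phi> x = (SUP v \<in> {v \<in> PSH A g. \<forall>y\<in>E. v y \<le> ereal (\<phi> y)}. v x)"

end

theory Submission
  imports Defs "HOL-Complex_Analysis.Cauchy_Integral_Formula"
begin

text \<open>
  The condition \<open>\<omega> + dd\<^sup>c v \<ge> 0\<close> is equivalent, for usc functions bounded from below, to a
  sub-mean value inequality tested against real parts of holomorphic functions on infinitesimal
  holomorphic discs. Phrased like this it is local, independent of charts and inherited by any
  function touched from below, so that maxima and glued functions are competitors without further
  work.

  For (i), a competitor \<open>v\<close> for \<open>K \<inter> B\<close> is scaled by a small factor, bent down by a multiple of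
  \<open>|z - p|\<^sup>2\<close> and glued with 0 to a competitor for \<open>K\<close>; a Harnack inequality bounds the factor from
  below, uniformly in \<open>v\<close>. For (ii), (i) shows that competitors are uniformly at most \<open>\<phi> + \<epsilon>\<close> near
  \<open>K\<close>. Regularizing them by suprema over coordinate balls of a common radius, glued with the help of
  Hadamard's three circles theorem, yields new competitors which dominate the old ones on whole
  neighbourhoods. This bounds the oscillation of \<open>V\<^bsub>K,\<phi>\<^esub>\<close> near each point.
\<close>

section \<open>Sub-mean values on discs\<close>

text \<open>The metric need not be closed, so \<open>\<omega>\<close> has no local potentials and
  competitors cannot be made psh by adding one. Positivity is therefore measured pointwise, with a
  small error \<open>\<eta>\<close>, and every construction must leave a margin: a scaling factor
  below 1, or a factor \<open>1 + 2 * \<epsilon>1\<close> removed at the end. The factor 1/2 in the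
  defects comes from \<open>\<omega> = i \<Sum> g dz dzbar\<close> and dd^c = 2i del delbar:
  positivity along \<open>z + \<zeta> w\<close> says that the Laplacian in \<open>\<zeta>\<close> is
  at least -2 Q(w), so a circle mean of radius \<open>\<rho>\<close> falls below the central value
  by at most about \<rho>^2 Q(w) / 2. The return to \<open>PSH\<close> uses a lower bound, hence
  competitors are truncated at a constant below the weight. The manifold may be disconnected:
  estimates propagate only inside a component, and the extremal functions are infinite on components
  that miss the compact set. Suprema over balls replace convolutions because a supremum is touched
  from below by a translate. A change of chart distorts the balls by a bounded factor, which
  subharmonicity makes negligible.\<close>

text \<open>Only majorants and the central value occur, so no measurability is presupposed and a
  function touched from below at the centre inherits the property. For bounded usc \<open>h\<close>
  it means that \<open>h 0\<close> is at most the circle mean plus \<open>m\<close>.\<close>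

definition disc_sub :: "(complex \<Rightarrow> ereal) \<Rightarrow> real \<Rightarrow> bool" where
  "disc_sub h m \<longleftrightarrow>
     (\<forall>H. continuous_on (cball 0 1) H \<and> H holomorphic_on ball 0 1 \<and>
        (\<forall>\<zeta>\<in>sphere 0 1. h \<zeta> \<le> ereal (Re (H \<zeta>))) \<longrightarrow> h 0 \<le> ereal (Re (H 0) + m))"

text \<open>Cauchy's formula at the centre: the parametrization contributes
  \<open>\<i> * cis t\<close>, which cancels the kernel. Continuity up to the circle is enough for
  it.\<close>

lemma holomorphic_mean_value:
  assumes "continuous_on (cball 0 1) H" "H holomorphic_on ball 0 1"
  shows "((\<lambda>s. H (cis s)) has_integral (2 * of_real pi * H 0)) {0..2*pi}"
proof -
  have "((\<lambda>u. H u/(u-0)) has_contour_integral (2 * of_real pi * \<i> * H 0)) (circlepath 0 1)"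
    using assms by (intro Cauchy_integral_circlepath) auto
  then have "((\<lambda>t. H (cis t) / (cis t) * \<i> * cis t) has_integral (2 * of_real pi * \<i> * H 0)) {0..2*pi}"
    by (simp add: circlepath_def has_contour_integral_part_circlepath_iff)
  then have "((\<lambda>t. \<i> * H (cis t)) has_integral (\<i> * (2 * of_real pi * H 0))) {0..2*pi}"
    by (simp add: algebra_simps)
  from has_integral_mult_right[OF this, of "- \<i>"] show ?thesis
    by (simp add: algebra_simps)
qed

lemma continuous_on_cis_circle:
  fixes f :: "complex \<Rightarrow> 'b::topological_space"
  assumes "continuous_on (sphere 0 1) f"
  shows "continuous_on S (\<lambda>t. f (cis t))"
  by (rule continuous_on_compose2[OF assms]) (auto intro!: continuous_intros)

lemma set_integrable_cis:
  fixes f :: "complex \<Rightarrow> real"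
  assumes "continuous_on (sphere 0 1) f"
  shows "set_integrable lborel {0..2*pi} (\<lambda>t. f (cis t))"
  using continuous_on_cis_circle[OF assms] by (intro borel_integrable_atLeastAtMost') auto

lemma mean_Re_holomorphic:
  assumes "continuous_on (cball 0 1) H" "H holomorphic_on ball 0 1"
  shows "(LINT t:{0..2*pi}|lborel. Re (H (cis t))) = 2 * pi * Re (H 0)"
proof -
  have "((\<lambda>t. Re (H (cis t))) has_integral (Re (2 * of_real pi * H 0))) {0..2*pi}"
    using has_integral_Re[OF holomorphic_mean_value[OF assms]] by simp
  moreover have "set_integrable lborel {0..2*pi} (\<lambda>t. Re (H (cis t)))"
    using assms(1) by (intro set_integrable_cis continuous_intros) (auto elim: continuous_on_subset)
  ultimately show ?thesis by (simp add: set_borel_integral_eq_integral integral_unique)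
qed

text \<open>On the circle \<open>cnj z\<close> is the inverse of \<open>z\<close>, so the product is
  a Laurent polynomial, and conjugation turns its negative powers into positive ones without
  changing the real part. Each induction step strips the constant coefficients of both
  factors.\<close>

lemma Re_mult_cnj_on_circle:
  "\<exists>s::complex poly. \<forall>z\<in>sphere 0 1. Re (poly p z * cnj (poly q z)) = Re (poly s z)"
proof (induction p arbitrary: q)
  case 0
  show ?case by (intro exI[of _ 0]) auto
next
  case (pCons c p)
  obtain d q' where q: "q = pCons d q'" by (cases q)
  obtain s where s: "\<forall>z\<in>sphere 0 1. Re (poly p z * cnj (poly q' z)) = Re (poly s z)"
    using pCons.IH by blast
  have "Re (poly (pCons c p) z * cnj (poly q z))
        = Re (poly (smult (cnj c) q + smult (cnj d) (pCons 0 p) + s) z)" if "z \<in> sphere 0 1" for z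
  proof -
    have 1: "z * cnj z = 1" using that by (simp add: complex_norm_square [symmetric])
    have "poly (pCons c p) z * cnj (poly q z)
       = c * cnj (poly q z) + z * poly p z * cnj d + (z * cnj z) * (poly p z * cnj (poly q' z))"
      by (simp add: q algebra_simps)
    also have "Re \<dots> = Re (cnj c * poly q z) + Re (cnj d * (z * poly p z)) + Re (poly s z)"
    proof -
      have "Re (c * cnj (poly q z)) = Re (cnj c * poly q z)"
        "Re (z * poly p z * cnj d) = Re (cnj d * (z * poly p z))" by (simp_all add: algebra_simps)
      moreover have "Re (poly p z * cnj (poly q' z)) = Re (poly s z)" using s that by blast
      ultimately show ?thesis by (simp only: 1 plus_complex.simps mult_1_left)
    qed
    finally show ?thesis by (simp only: poly_add poly_smult poly_pCons plus_complex.simps add_0_left)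
  qed
  then show ?case by blast
qed

text \<open>Stone-Weierstrass for the real parts of polynomials. That they form an algebra on the
  circle is the content of \<open>Re_mult_cnj_on_circle\<close>.\<close>

lemma continuous_circle_approx:
  fixes f :: "complex \<Rightarrow> real"
  assumes "continuous_on (sphere 0 1) f" "0 < e"
  obtains p where "\<And>z. z \<in> sphere 0 1 \<Longrightarrow> \<bar>f z - Re (poly p z)\<bar> < e"
proof -
  define P where "P = (\<lambda>f::complex \<Rightarrow> real. \<exists>p. \<forall>z\<in>sphere 0 1. f z = Re (poly p z))"
  have "\<exists>g. P g \<and> (\<forall>x\<in>sphere 0 1. \<bar>f x - g x\<bar> < e)"
  proof (rule Stone_Weierstrass_HOL)
    show "P (\<lambda>x. c)" for c unfolding P_def by (intro exI[of _ "[:of_real c:]"]) simp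
    show "continuous_on (sphere 0 1) g" if "P g" for g
    proof -
      obtain p where p: "\<forall>z\<in>sphere 0 1. g z = Re (poly p z)" using \<open>P g\<close> unfolding P_def by auto
      have "continuous_on (sphere 0 1) (\<lambda>z. Re (poly p z))" by (intro continuous_intros)
      then show ?thesis by (rule continuous_on_eq) (use p in auto)
    qed
    show "P (\<lambda>x. g x + h x)" if gh: "P g \<and> P h" for g h
    proof -
      obtain p q where p: "\<forall>z\<in>sphere 0 1. g z = Re (poly p z)" "\<forall>z\<in>sphere 0 1. h z = Re (poly q z)" using gh unfolding P_def by auto
      then show ?thesis unfolding P_def by (intro exI[of _ "p+q"]) auto
    qed
    show "P (\<lambda>x. g x * h x)" if gh: "P g \<and> P h" for g h
    proof -
      obtain p q where p: "\<forall>z\<in>sphere 0 1. g z = Re (poly p z)" "\<forall>z\<in>sphere 0 1. h z = Re (poly q z)" using gh unfolding P_def by auto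
      obtain s where s: "\<forall>z\<in>sphere 0 1. Re (poly p z * cnj (poly q z)) = Re (poly s z)" using Re_mult_cnj_on_circle by blast
      \<comment> \<open>The identity Re a * Re b = (Re (a b) + Re (a cnj b)) / 2.\<close>
      have "g z * h z = Re (poly (smult (1/2) (p*q) + smult (1/2) s) z)" if "z \<in> sphere 0 1" for z
      proof -
        have "g z * h z = (Re (poly p z * poly q z) + Re (poly p z * cnj (poly q z))) / 2"
          using p that by (simp add: field_simps)
        also have "\<dots> = (Re (poly p z * poly q z) + Re (poly s z)) / 2" using s that by metis
        finally show ?thesis by (simp only: poly_add poly_smult poly_mult plus_complex.simps) (simp add: add_divide_distrib del: times_complex.simps)
      qed
      then show ?thesis unfolding P_def by blast
    qed
    show "\<exists>f. P f \<and> f x \<noteq> f y" if "x \<in> sphere 0 1 \<and> y \<in> sphere 0 1 \<and> x \<noteq> y" for x y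
    proof (cases "Re x = Re y")
      case True
      have "P (\<lambda>x. Re (poly [:0,-\<i>:] x))" unfolding P_def by blast
      moreover have "Im x \<noteq> Im y" using True that complex_eq_iff by auto
      ultimately show ?thesis by (intro exI[of _ "\<lambda>x. Re (poly [:0,-\<i>:] x)"]) auto
    next
      case False
      have "P (\<lambda>x. Re (poly [:0,1:] x))" unfolding P_def by blast
      with False show ?thesis by (intro exI[of _ "\<lambda>x. Re (poly [:0,1:] x)"]) auto
    qed
  qed (use assms in auto)
  then show ?thesis using that unfolding P_def by metis
qed

text \<open>The holomorphic majorants are dense enough to recover the mean: \<open>h\<close> is the
  limit of continuous functions above it, each of which is nearly the real part of a polynomial.
  Measurability of \<open>h\<close> comes out as a by-product.\<close>

lemma mean_le_of_bounded_usc: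
  fixes h :: "complex \<Rightarrow> real"
  assumes sub: "disc_sub (\<lambda>u. ereal (h u)) m"
    and bdd: "\<And>u. u \<in> sphere 0 1 \<Longrightarrow> \<bar>h u\<bar> \<le> M"
    and usc: "usc_on (\<lambda>u. ereal (h u)) (sphere 0 1)"
  shows "set_integrable lborel {0..2*pi} (\<lambda>t. h (cis t))"
    and "h 0 \<le> 1 / (2 * pi) * (LINT t:{0..2*pi}|lborel. h (cis t)) + m"
proof -
  let ?S = "sphere 0 1 :: complex set"
  \<comment> \<open>Sup-convolutions: \<open>f k\<close> is Lipschitz with constant
    \<open>k\<close>, lies above \<open>h\<close> and tends to \<open>h\<close> by upper
    semicontinuity.\<close>
  define f where "f = (\<lambda>(k::nat) u. SUP \<xi>\<in>?S. h \<xi> - real k * norm (\<xi> - u))"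
  have ne: "?S \<noteq> {}" by (metis empty_iff mem_sphere_0 norm_one)
  have M0: "0 \<le> M" using bdd ne by fastforce
  have bd: "bdd_above ((\<lambda>\<xi>. h \<xi> - real k * norm (\<xi> - u)) ` ?S)" for k u
  proof (rule bdd_aboveI2)
    fix \<xi> assume "\<xi> \<in> ?S"
    then have "h \<xi> \<le> M" using bdd by fastforce
    moreover have "0 \<le> real k * norm (\<xi> - u)" by simp
    ultimately show "h \<xi> - real k * norm (\<xi> - u) \<le> M" by linarith
  qed
  have ge: "h u \<le> f k u" if "u \<in> ?S" for k u
    using cSUP_upper[OF that bd, of k u] by (simp add: f_def)
  have le: "f k u \<le> M" for k u unfolding f_def
  proof (rule cSUP_least[OF ne])
    fix \<xi> assume "\<xi> \<in> ?S"
    then have "h \<xi> \<le> M" using bdd by fastforce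
    moreover have "0 \<le> real k * norm (\<xi> - u)" by simp
    ultimately show "h \<xi> - real k * norm (\<xi> - u) \<le> M" by linarith
  qed
  have lip: "f k u \<le> f k u' + real k * norm (u - u')" for k u u'
    unfolding f_def
  proof (rule cSUP_least[OF ne])
    fix \<xi> assume xi: "\<xi> \<in> ?S"
    have "norm (\<xi> - u') \<le> norm (\<xi> - u) + norm (u - u')"
      using norm_triangle_ineq[of "\<xi> - u" "u - u'"] by simp
    then have "real k * norm (\<xi> - u') \<le> real k * norm (\<xi> - u) + real k * norm (u - u')"
      by (metis mult_left_mono of_nat_0_le_iff distrib_left)
    then show "h \<xi> - real k * norm (\<xi> - u) \<le> (SUP \<xi>\<in>?S. h \<xi> - real k * norm (\<xi> - u')) + real k * norm (u - u')"
      using cSUP_upper[OF xi bd, of k u'] by linarith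
  qed
  have cont: "continuous_on ?S (f k)" for k
  proof (rule lipschitz_on_continuous_on)
    show "(real k)-lipschitz_on ?S (f k)"
    proof (rule lipschitz_onI)
      fix x y show "dist (f k x) (f k y) \<le> real k * dist x y"
        using lip[of k x y] lip[of k y x] by (simp add: dist_norm norm_minus_commute abs_le_iff)
    qed simp
  qed
  have lim: "(\<lambda>k. f k u) \<longlonglongrightarrow> h u" if z: "u \<in> ?S" for u
  proof (rule LIMSEQ_I)
    fix e :: real assume e: "0 < e"
    have "openin (top_of_set ?S) {x \<in> ?S. ereal (h x) < ereal (h u + e/2)}"
      using usc unfolding usc_on_def by blast
    then obtain d where d: "d > 0" "\<And>\<xi>. \<xi> \<in> ?S \<Longrightarrow> dist \<xi> u < d \<Longrightarrow> h \<xi> < h u + e/2"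
      using z e unfolding openin_euclidean_subtopology_iff by force
    obtain N :: nat where N: "2 * M / d < real N" using reals_Archimedean2 by blast
    have "norm (f k u - h u) < e" if k: "N \<le> k" for k
    proof -
      have "f k u \<le> h u + e/2" unfolding f_def
      proof (rule cSUP_least[OF ne])
        fix \<xi> assume xi: "\<xi> \<in> ?S"
        show "h \<xi> - real k * norm (\<xi> - u) \<le> h u + e/2"
        proof (cases "dist \<xi> u < d")
          case True
          have "0 \<le> real k * norm (\<xi> - u)" by simp
          with d(2)[OF xi True] show ?thesis by linarith
        next
          case False
          \<comment> \<open>Beyond distance \<open>d\<close> the penalty is at least
            \<open>2 * M\<close>, more than \<open>h\<close> can gain between two points.\<close>
          have "2 * M \<le> real N * d" using N d(1) by (simp add: field_simps)
          also have "\<dots> \<le> real k * norm (\<xi> - u)"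
            using False k d(1) by (intro mult_mono) (auto simp: dist_norm)
          finally show ?thesis using bdd[OF xi] bdd[OF z] e by (simp add: abs_le_iff)
        qed
      qed
      then show ?thesis using ge[OF z, of k] e by simp
    qed
    then show "\<exists>no. \<forall>n\<ge>no. norm (f n u - h u) < e" by blast
  qed
  have cisS: "cis t \<in> ?S" for t by simp
  define F where "F = (\<lambda>k t. indicator {0..2*pi} t *\<^sub>R f k (cis t))"
  define G where "G = (\<lambda>t. indicator {0..2*pi} t *\<^sub>R h (cis t))"
  have Fint: "integrable lborel (F k)" for k
    using set_integrable_cis[OF cont, of k] unfolding set_integrable_def F_def .
  have FG: "(\<lambda>k. F k t) \<longlonglongrightarrow> G t" for t unfolding F_def G_def
    by (intro tendsto_intros lim cisS)
  have meas: "G \<in> borel_measurable lborel"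
    using Fint by (intro borel_measurable_LIMSEQ_real[of _ F, OF FG]) auto
  have Fb: "norm (F k t) \<le> indicator {0..2*pi} t *\<^sub>R M" for k t
    using le[of k "cis t"] ge[OF cisS[of t], of k] bdd[OF cisS[of t]] M0 unfolding F_def
    by (auto simp: indicator_def abs_le_iff)
  have Mint: "integrable lborel (\<lambda>t. indicator {0..2*pi} t *\<^sub>R M)"
    using borel_integrable_atLeastAtMost'[of 0 "2*pi" "\<lambda>_. M"] unfolding set_integrable_def by simp
  have Gb: "norm (G t) \<le> norm (indicator {0..2*pi} t *\<^sub>R M)" for t
  proof (cases "t \<in> {0..2*pi}")
    case True
    then have *: "G t = h (cis t)" "indicator {0..2*pi} t *\<^sub>R M = M" unfolding G_def by simp_all
    show ?thesis unfolding * real_norm_def using bdd[OF cisS[of t]] by linarith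
  next
    case False
    then show ?thesis unfolding G_def by simp
  qed
  have Gint: "integrable lborel G"
    by (rule Bochner_Integration.integrable_bound[OF Mint meas]) (rule AE_I2, rule Gb)
  have lims: "(\<lambda>k. integral\<^sup>L lborel (F k)) \<longlonglongrightarrow> integral\<^sup>L lborel G"
    by (rule integral_dominated_convergence[OF meas borel_measurable_integrable[OF Fint] Mint AE_I2[OF FG] AE_I2[OF Fb]])
  show "set_integrable lborel {0..2*pi} (\<lambda>t. h (cis t))"
    using Gint unfolding set_integrable_def G_def .
  have key: "h 0 \<le> 1 / (2 * pi) * integral\<^sup>L lborel (F k) + m" for k
  proof (rule field_le_epsilon)
    fix e :: real assume e: "0 < e"
    \<comment> \<open>Approximating the function raised by \<open>e/2\<close> to within
      \<open>e/2\<close> puts the polynomial between \<open>f k\<close> and \<open>f k + e\<close>,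
      so it is an admissible majorant of \<open>h\<close>.\<close>
    obtain p where p: "\<And>u. u \<in> ?S \<Longrightarrow> \<bar>(f k u + e/2) - Re (poly p u)\<bar> < e/2"
      using continuous_circle_approx[OF continuous_on_add[OF cont continuous_on_const], of "e/2" k "e/2"] e
      by auto
    have maj: "h u \<le> Re (poly p u)" if "u \<in> ?S" for u
      using p[OF that] ge[OF that, of k] by linarith
    have holo: "continuous_on (cball 0 1) (poly p)" "poly p holomorphic_on ball 0 1"
      by (auto intro!: continuous_intros holomorphic_intros)
    have "ereal (h 0) \<le> ereal (Re (poly p 0) + m)"
      using sub holo maj unfolding disc_sub_def by (metis ereal_less_eq(3))
    then have "h 0 \<le> Re (poly p 0) + m" by simp
    moreover have "2 * pi * Re (poly p 0) \<le> integral\<^sup>L lborel (F k) + 2 * pi * e"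
    proof -
      have "2 * pi * Re (poly p 0) = (LINT t:{0..2*pi}|lborel. Re (poly p (cis t)))"
        using mean_Re_holomorphic[OF holo] by simp
      also have "\<dots> \<le> (LINT t:{0..2*pi}|lborel. f k (cis t) + e)"
      proof (rule set_integral_mono)
        show "set_integrable lborel {0..2*pi} (\<lambda>t. Re (poly p (cis t)))"
          by (rule set_integrable_cis) (intro continuous_intros)
        show "set_integrable lborel {0..2*pi} (\<lambda>t. f k (cis t) + e)"
          using set_integrable_cis[of "\<lambda>u. f k u + e"] cont by (simp add: continuous_on_add)
        show "Re (poly p (cis t)) \<le> f k (cis t) + e" for t
          using p[OF cisS[of t]] by linarith
      qed
      also have "\<dots> = (LINT t:{0..2*pi}|lborel. f k (cis t)) + (LINT t:{0..2*pi}|lborel. e)"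
        by (rule set_integral_add) (use set_integrable_cis[OF cont, of k] borel_integrable_atLeastAtMost'[of 0 "2*pi" "\<lambda>_. e"] in auto)
      also have "(LINT t:{0..2*pi}|lborel. e) = 2 * pi * e"
        by (simp add: set_integral_const)
      finally show ?thesis by (simp add: F_def set_lebesgue_integral_def)
    qed
    then have "Re (poly p 0) \<le> 1 / (2 * pi) * integral\<^sup>L lborel (F k) + e"
      by (simp add: field_simps)
    ultimately show "h 0 \<le> 1 / (2 * pi) * integral\<^sup>L lborel (F k) + m + e" by linarith
  qed
  have "(\<lambda>k. 1 / (2 * pi) * integral\<^sup>L lborel (F k) + m) \<longlonglongrightarrow> 1 / (2 * pi) * integral\<^sup>L lborel G + m"
    by (intro tendsto_intros lims)
  then have "h 0 \<le> 1 / (2 * pi) * integral\<^sup>L lborel G + m"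
    using key by (intro LIMSEQ_le_const) auto
  then show "h 0 \<le> 1 / (2 * pi) * (LINT t:{0..2*pi}|lborel. h (cis t)) + m"
    unfolding G_def set_lebesgue_integral_def .
qed

section \<open>Upper semicontinuous functions\<close>

lemma usc_on_subset: "usc_on h S \<Longrightarrow> T \<subseteq> S \<Longrightarrow> usc_on h T"
  unfolding usc_on_def
proof (intro allI)
  fix t assume *: "\<forall>t. openin (top_of_set S) {x \<in> S. h x < t}" "T \<subseteq> S"
  obtain U where U: "open U" "{x \<in> S. h x < t} = S \<inter> U"
    using *(1)[rule_format, of t] unfolding openin_open by auto
  then have "{x \<in> T. h x < t} = T \<inter> U" using *(2) by blast
  then show "openin (top_of_set T) {x \<in> T. h x < t}"
    using U(1) unfolding openin_open by auto
qed

lemma usc_on_open_iff: "open S \<Longrightarrow> usc_on h S \<longleftrightarrow> (\<forall>t. open {x\<in>S. h x < t})"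
  unfolding usc_on_def by (auto simp: openin_open_eq)

text \<open>A real level between \<open>h z\<close> and \<open>c z\<close> separates the two
  functions, so the set is a union of sublevel sets of \<open>h\<close> met with superlevel sets of
  \<open>c\<close>.\<close>

lemma usc_on_less_continuous:
  assumes "usc_on h S" "continuous_on S c"
  shows "openin (top_of_set S) {z \<in> S. h z < ereal (c z)}"
proof -
  have eq: "{z \<in> S. h z < ereal (c z)} = (\<Union>t::real. {z \<in> S. h z < ereal t} \<inter> (S \<inter> c -` {t<..}))"
  proof (intro equalityI subsetI)
    fix z assume z: "z \<in> {z \<in> S. h z < ereal (c z)}"
    then obtain t where "h z < ereal t" "ereal t < ereal (c z)" using ereal_dense2 by blast
    then show "z \<in> (\<Union>t::real. {z \<in> S. h z < ereal t} \<inter> (S \<inter> c -` {t<..}))" using z by auto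
  next
    fix z assume "z \<in> (\<Union>t::real. {z \<in> S. h z < ereal t} \<inter> (S \<inter> c -` {t<..}))"
    then obtain t where "z \<in> S" "h z < ereal t" "t < c z" by auto
    then show "z \<in> {z \<in> S. h z < ereal (c z)}"
      using order_less_trans[of "h z" "ereal t" "ereal (c z)"] by simp
  qed
  show ?thesis unfolding eq
    by (intro openin_Union ballI openin_Int)
      (use assms in \<open>auto simp: usc_on_def intro!: openin_Int continuous_openin_preimage_gen\<close>)
qed

lemma usc_on_minus_continuous:
  assumes "usc_on h S" "continuous_on S c"
  shows "usc_on (\<lambda>z. h z - ereal (c z)) S"
  unfolding usc_on_def
proof
  fix t :: ereal
  show "openin (top_of_set S) {x \<in> S. h x - ereal (c x) < t}"
  proof (cases t)
    case (real r)
    have "{x \<in> S. h x - ereal (c x) < t} = {x \<in> S. h x < ereal (c x + r)}"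
      unfolding real by (auto simp: ereal_minus_less_iff add.commute)
    moreover have "continuous_on S (\<lambda>x. c x + r)" using assms(2) by (intro continuous_intros)
    ultimately show ?thesis using usc_on_less_continuous[OF assms(1), of "\<lambda>x. c x + r"] by simp
  next
    case PInf
    have "{x \<in> S. h x - ereal (c x) < t} = {x \<in> S. h x < \<infinity>}"
      unfolding PInf by (auto simp: ereal_minus_eq_PInfty_iff)
    then show ?thesis using assms(1)[unfolded usc_on_def, rule_format, of \<infinity>] by (simp only:)
  next
    case MInf
    then show ?thesis by auto
  qed
qed

text \<open>Without a maximum the strict sublevel sets at the values of \<open>h\<close> would cover
  \<open>S\<close>, and a finite subcover would miss the point with its largest value.\<close>

lemma usc_attains_max:
  assumes "compact S" "S \<noteq> {}" "usc_on h S"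
  shows "\<exists>y\<in>S. \<forall>z\<in>S. h z \<le> h y"
proof (rule ccontr)
  assume "\<not> ?thesis"
  then have *: "\<forall>y\<in>S. \<exists>z\<in>S. h y < h z" by (auto simp: not_le)
  define C where "C = (\<lambda>z. {x\<in>S. h x < h z}) ` S"
  have "\<forall>c\<in>C. openin (top_of_set S) c" using assms(3) unfolding C_def usc_on_def by auto
  moreover have "S \<subseteq> \<Union>C" using * unfolding C_def by auto
  ultimately obtain D where D: "D \<subseteq> C" "finite D" "S \<subseteq> \<Union>D"
    using assms(1) unfolding compact_eq_openin_cover by metis
  obtain F where F: "F \<subseteq> S" "finite F" "D = (\<lambda>z. {x\<in>S. h x < h z}) ` F"
    using finite_subset_image[OF D(2) D(1)[unfolded C_def]] by auto
  have "F \<noteq> {}" using D(3) F(3) assms(2) by auto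
  define y where "y = Max (h ` F)"
  have "y \<in> h ` F" unfolding y_def using F \<open>F \<noteq> {}\<close> by (intro Max_in) auto
  then obtain f where f: "f \<in> F" "h f = y" by auto
  then obtain f' where "f' \<in> F" "h f < h f'" using D(3) F by auto
  moreover have "h f' \<le> y" unfolding y_def using F \<open>f' \<in> F\<close> by auto
  ultimately show False using f by simp
qed

lemma disc_subD:
  assumes "disc_sub h m" "continuous_on (cball 0 1) H" "H holomorphic_on ball 0 1"
    "\<And>z. norm z = 1 \<Longrightarrow> h z \<le> ereal (Re (H z))"
  shows "h 0 \<le> ereal (Re (H 0) + m)"
  using assms unfolding disc_sub_def by auto

text \<open>The dilation \<open>H (t * u)\<close> with \<open>t < 1\<close> extends across the
  circle, and adding \<open>e\<close> makes the majorization strict; uniform continuity lets both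
  changes vanish. The strict inequality on a larger disc gives later proofs room around the closed
  disc.\<close>

lemma disc_subI_strict:
  assumes "\<And>R H. 1 < R \<Longrightarrow> H holomorphic_on ball 0 R \<Longrightarrow>
       (\<And>u. norm u = 1 \<Longrightarrow> h u < ereal (Re (H u))) \<Longrightarrow> h 0 \<le> ereal (Re (H 0) + m)"
  shows "disc_sub h m"
  unfolding disc_sub_def
proof (intro allI impI)
  fix H assume H: "continuous_on (cball 0 1) H \<and> H holomorphic_on ball 0 1 \<and> (\<forall>u\<in>sphere 0 1. h u \<le> ereal (Re (H u)))"
  have "h 0 \<le> ereal (Re (H 0) + m) + ereal e" if e: "0 < e" for e
  proof -
    have "uniformly_continuous_on (cball 0 1) H" using H by (intro compact_uniformly_continuous) auto
    then obtain d where d: "d > 0" "\<And>x y. x \<in> cball 0 1 \<Longrightarrow> y \<in> cball 0 1 \<Longrightarrow> dist x y < d \<Longrightarrow> dist (H x) (H y) < e"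
      using e unfolding uniformly_continuous_on_def by metis
    define t where "t = 1 - min (d/2) (1/2)"
    have t: "0 < t" "t < 1" "1 - t < d" using d(1) unfolding t_def by (auto simp: min_def)
    define G where "G = (\<lambda>u. H (of_real t * u) + of_real e)"
    have "G holomorphic_on ball 0 (1/t)"
    proof -
      have "(H \<circ> (\<lambda>u. of_real t * u)) holomorphic_on ball 0 (1/t)"
      proof (rule holomorphic_on_compose_gen)
        show "(\<lambda>u. complex_of_real t * u) ` ball 0 (1 / t) \<subseteq> ball 0 1"
          using t by (auto simp: norm_mult field_simps)
      qed (use H in \<open>auto intro!: holomorphic_intros\<close>)
      then show ?thesis unfolding G_def comp_def by (intro holomorphic_intros)
    qed
    moreover have "h u < ereal (Re (G u))" if z: "norm u = 1" for u
    proof -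
      have "dist (H (of_real t * u)) (H u) < e"
      proof (rule d(2))
        have "of_real t * u - u = of_real (t - 1) * u" by (simp add: algebra_simps)
        then have "dist (of_real t * u) u = \<bar>t - 1\<bar>" using z by (simp only: dist_norm norm_mult norm_of_real mult_1_right)
        then show "dist (of_real t * u) u < d" using t by simp
      qed (use z t in \<open>auto simp: norm_mult\<close>)
      then have "\<bar>Re (H (of_real t * u)) - Re (H u)\<bar> < e"
        by (metis abs_Re_le_cmod dist_norm le_less_trans minus_complex.simps(1))
      then have "Re (H u) < Re (G u)" unfolding G_def by simp
      moreover have "h u \<le> ereal (Re (H u))" using H z by simp
      ultimately show ?thesis by (metis less_ereal.simps(1) order_le_less_trans)
    qed
    ultimately have "h 0 \<le> ereal (Re (G 0) + m)" using t by (intro assms[of "1/t"]) auto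
    moreover have "Re (G 0) + m = (Re (H 0) + m) + e" unfolding G_def by simp
    ultimately show ?thesis by (simp only: plus_ereal.simps)
  qed
  then show "h 0 \<le> ereal (Re (H 0) + m)" by (rule ereal_le_epsilon2[rule_format])
qed

section \<open>Affine discs and local sub-mean values\<close>

text \<open>The standard Hermitian product, linear in the second argument so that it can be composed
  with holomorphic curves.\<close>

definition clin :: "complex^'n \<Rightarrow> complex^'n \<Rightarrow> complex" where
  "clin w u = (\<Sum>i\<in>UNIV. cnj (w $ i) * u $ i)"

lemma norm_vec_sq: "(norm (u::complex^'n))\<^sup>2 = (\<Sum>i\<in>UNIV. (norm (u $ i))\<^sup>2)"
  by (simp add: norm_vec_def L2_set_def sum_nonneg)

lemma clin_self: "clin w w = of_real ((norm w)\<^sup>2)"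
  unfolding clin_def norm_vec_sq of_real_sum by (intro sum.cong refl) (simp add: complex_norm_square[symmetric] mult.commute)

lemma clin_add: "clin w (u + v) = clin w u + clin w v"
  and clin_diff: "clin w (u - v) = clin w u - clin w v"
  and clin_smult: "clin w (c *s u) = c * clin w u"
  and clin_zero: "clin w 0 = 0"
  unfolding clin_def by (simp_all add: algebra_simps sum.distrib sum_subtractf sum_distrib_left)

lemma continuous_on_clin [continuous_intros]: "continuous_on S f \<Longrightarrow> continuous_on S (\<lambda>x. clin w (f x))"
  unfolding clin_def by (intro continuous_intros)

lemma continuous_on_smult [continuous_intros]:
  "continuous_on S f \<Longrightarrow> continuous_on S g \<Longrightarrow> continuous_on S (\<lambda>x. f x *s (g x :: complex^'n))"
  unfolding vector_scalar_mult_def by (intro continuous_intros)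

lemma norm_smult: "norm (c *s (u::complex^'n)) = norm c * norm u"
  by (simp add: norm_vec_def norm_mult L2_set_right_distrib)

text \<open>Separates the square of the modulus into a part that is pluriharmonic in
  \<open>a\<close> and the square of the increment. Only the latter contributes to circle means
  beyond the central value.\<close>

lemma norm_sq_expand: "(norm (a::complex))\<^sup>2 = (norm b)\<^sup>2 + 2 * Re (cnj b * (a - b)) + (norm (a - b))\<^sup>2"
  unfolding cmod_power2 by (simp add: power2_eq_square algebra_simps)

text \<open>Covers the direction \<open>w = 0\<close>, in which there is no coordinate along the
  disc, and constant competitors.\<close>

lemma disc_sub_degenerate:
  assumes "0 \<le> m" and "\<And>z. h z = h 0"
  shows "disc_sub h m"
proof (rule disc_subI_strict)
  fix R :: real and H assume R: "1 < R" "H holomorphic_on ball 0 R" and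
    maj: "\<And>z. norm z = 1 \<Longrightarrow> h z < ereal (Re (H z))"
  have cont: "continuous_on (cball 0 1) H" and hol: "H holomorphic_on ball 0 1"
    using R holomorphic_on_imp_continuous_on[OF R(2)] by (auto elim!: continuous_on_subset holomorphic_on_subset)
  show "h 0 \<le> ereal (Re (H 0) + m)"
  proof (cases "h 0")
    case (real x)
    have "2 * pi * x = (LINT t:{0..2*pi}|lborel. x)" by (simp add: set_integral_const)
    also have "\<dots> \<le> (LINT t:{0..2*pi}|lborel. Re (H (cis t)))"
    proof (rule set_integral_mono)
      show "set_integrable lborel {0..2*pi} (\<lambda>t. Re (H (cis t)))"
        using cont by (intro set_integrable_cis continuous_intros) (auto elim: continuous_on_subset)
      show "x \<le> Re (H (cis t))" for t
        using maj[of "cis t"] assms(2)[of "cis t"] real by simp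
    qed (use borel_integrable_atLeastAtMost'[of 0 "2*pi" "\<lambda>_. x"] in simp)
    also have "\<dots> = 2 * pi * Re (H 0)" by (rule mean_Re_holomorphic[OF cont hol])
    finally show ?thesis using assms(1) real by simp
  next
    case PInf
    then show ?thesis using maj[of 1] assms(2)[of 1] by simp
  qed simp
qed

text \<open>Every function with the sub-mean value property along some infinitesimal holomorphic disc
  in each direction has it along all affine discs: at a maximum of the difference to a quadratic
  perturbation of a pluriharmonic majorant, the local property is violated. Since the local discs
  are arbitrary, this also gives invariance under coordinate changes.\<close>

lemma disc_sub_of_local:
  fixes h :: "complex^'n \<Rightarrow> ereal" and z0 w :: "complex^'n"
  assumes X: "open X" and usc: "usc_on h X" and fin: "\<And>z. z \<in> X \<Longrightarrow> h z \<noteq> \<infinity>"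
    and Q: "continuous_on X Q" and m0: "0 \<le> m"
    and disc: "\<And>u. norm u \<le> 1 \<Longrightarrow> z0 + u *s w \<in> X"
    and Qm: "\<And>u. norm u \<le> 1 \<Longrightarrow> Q (z0 + u *s w) \<le> m"
    and loc: "\<And>y e. y \<in> X \<Longrightarrow> 0 < e \<Longrightarrow>
       \<exists>\<gamma> R. 0 < R \<and> (\<forall>i. (\<lambda>\<xi>. \<gamma> \<xi> $ i) holomorphic_on ball 0 R) \<and> \<gamma> 0 = y \<and>
          (\<forall>i. ((\<lambda>\<xi>. \<gamma> \<xi> $ i) has_field_derivative w $ i) (at 0)) \<and>
          (\<exists>t0>0. \<forall>t. 0 < t \<and> t < t0 \<longrightarrow>
              disc_sub (\<lambda>u. h (\<gamma> (of_real t * u))) (t\<^sup>2 * (Q y + e) / 2))"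
  shows "disc_sub (\<lambda>u. h (z0 + u *s w)) (m / 2)"
proof (cases "w = 0")
  case True
  then show ?thesis using m0 by (intro disc_sub_degenerate) auto
next
  case False
  define nw where "nw = complex_of_real ((norm w)\<^sup>2)"
  have nw: "nw \<noteq> 0" using False by (simp add: nw_def)
  \<comment> \<open>\<open>l\<close> is the coordinate along the disc and \<open>p\<close> the
    component orthogonal to \<open>w\<close>.\<close>
  define l where "l = (\<lambda>z. clin w (z - z0) / nw)"
  define p where "p = (\<lambda>z. z - z0 - l z *s w)"
  have lcont: "continuous_on S l" for S unfolding l_def using nw by (intro continuous_intros) auto
  have pcont: "continuous_on S p" for S unfolding p_def by (intro continuous_intros lcont)
  have l_line: "l (z0 + u *s w) = u" for u
    using nw unfolding l_def by (simp add: clin_smult clin_self nw_def)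
  have decomp: "z = z0 + l z *s w + p z" for z by (simp add: p_def)
  show ?thesis
  proof (rule disc_subI_strict)
    fix R :: real and H assume R: "1 < R" and H: "H holomorphic_on ball 0 R" and
      maj: "\<And>u. norm u = 1 \<Longrightarrow> h (z0 + u *s w) < ereal (Re (H u))"
    show "h (z0 + 0 *s w) \<le> ereal (Re (H 0) + m / 2)"
    proof (rule ccontr)
      assume "\<not> ?thesis"
      then have less: "ereal (Re (H 0) + m / 2) < h z0" by simp
      have z0: "z0 \<in> X" using disc[of 0] by simp
      obtain h0 where h0: "h z0 = ereal h0" using less fin[OF z0] by (cases "h z0") auto
      \<comment> \<open>A quarter of the assumed violation: with \<open>\<mu> = m + 4 * e\<close>
        half of the violation is kept at the centre, and the rest pays for the variation of
        \<open>Q\<close> and the Taylor errors.\<close>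
      define e where "e = (h0 - (Re (H 0) + m / 2)) / 4"
      have e: "0 < e" using less unfolding h0 e_def by simp
      define \<mu> where "\<mu> = m + 4 * e"
      have \<mu>: "0 < \<mu>" using m0 e unfolding \<mu>_def by simp
      \<comment> \<open>\<open>c\<close> equals the real part of \<open>H\<close> for
        \<open>norm (l z) = 1\<close>, while its Laplacian in \<open>l\<close> is
        \<open>- 2 * \<mu>\<close>, strictly below the bound that the local property allows for
        \<open>h\<close>.\<close>
      define c where "c = (\<lambda>z. Re (H (l z)) + \<mu> / 2 * (1 - (norm (l z))\<^sup>2))"
      have c0: "c z0 < h0"
        using e l_line[of 0] unfolding c_def \<mu>_def by (simp add: e_def field_simps)
      define V where "V = {z \<in> X. norm (l z) < R}"
      have openV: "open V"
      proof -
        have "V = X \<inter> (\<lambda>z. norm (l z)) -` {..<R}" unfolding V_def by auto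
        moreover have "continuous_on UNIV (\<lambda>z. norm (l z))" by (intro continuous_intros lcont)
        ultimately show ?thesis using X by (metis open_Int open_lessThan open_vimage)
      qed
      have contHl: "continuous_on V (\<lambda>z. H (l z))"
        by (rule continuous_on_compose2[OF holomorphic_on_imp_continuous_on[OF H] lcont]) (auto simp: V_def)
      have contc: "continuous_on V c" unfolding c_def
        by (intro continuous_intros lcont contHl)
      \<comment> \<open>The majorization is known on the circle only; semicontinuity extends it to a
        neighbourhood. \<open>W\<close> also keeps \<open>Q\<close> within \<open>e\<close> of its
        bound.\<close>
      define W where "W = {z \<in> V. Q z < m + e} \<inter> (V \<inter> {z. norm (l z) \<noteq> 1} \<union> {z \<in> V. h z < ereal (c z)})"
      have uscV: "usc_on h V" using usc by (rule usc_on_subset) (auto simp: V_def)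
      have openW: "open W" unfolding W_def
      proof (intro open_Int open_Un openV)
        have "open (V \<inter> Q -` {..<m + e})"
          by (rule continuous_open_preimage[OF _ openV open_lessThan]) (rule continuous_on_subset[OF Q], auto simp: V_def)
        moreover have "V \<inter> Q -` {..<m + e} = {z \<in> V. Q z < m + e}" by auto
        ultimately show "open {z \<in> V. Q z < m + e}" by simp
        show "open {z. norm (l z) \<noteq> 1}"
          by (rule open_Collect_neq) (intro continuous_intros lcont)+
        show "open {z \<in> V. h z < ereal (c z)}"
          using usc_on_less_continuous[OF uscV contc] openV by (simp add: openin_open_eq)
      qed
      define \<Delta> where "\<Delta> = (\<lambda>u. z0 + u *s w) ` cball 0 1"
      have "compact \<Delta>" unfolding \<Delta>_def
        by (intro compact_continuous_image continuous_intros compact_cball)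
      moreover have "\<Delta> \<subseteq> W"
      proof
        fix z assume "z \<in> \<Delta>"
        then obtain u where z: "z = z0 + u *s w" "norm u \<le> 1" unfolding \<Delta>_def image_iff by (metis mem_cball_0)
        have lz: "l z = u" using l_line z by simp
        moreover have "z \<in> V" unfolding V_def using z lz disc R by auto
        moreover have "Q z < m + e" using Qm[OF z(2)] z(1) e by auto
        moreover have "h z < ereal (c z)" if "norm (l z) = 1"
          using maj[of u] that unfolding c_def lz using z by simp
        ultimately show "z \<in> W" unfolding W_def by auto
      qed
      ultimately obtain s where s: "0 < s" "(\<Union>x\<in>\<Delta>. cball x s) \<subseteq> W"
        using compact_subset_open_imp_cball_epsilon_subset openW by metis
      \<comment> \<open>A closed tube around the disc. It lies in \<open>W\<close> because
        \<open>norm (p z)\<close> is the distance of \<open>z\<close> to a point of the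
        disc.\<close>
      define D where "D = {z. norm (l z) \<le> 1 \<and> norm (p z) \<le> s}"
      have DW: "D \<subseteq> W"
      proof
        fix z assume z: "z \<in> D"
        have "z0 + l z *s w \<in> \<Delta>" using z unfolding \<Delta>_def D_def by auto
        moreover have "dist (z0 + l z *s w) z \<le> s" using z unfolding D_def p_def by (simp add: dist_norm norm_minus_commute algebra_simps)
        ultimately have "z \<in> (\<Union>x\<in>\<Delta>. cball x s)" unfolding UN_iff mem_cball by (rule bexI[rotated])
        then show "z \<in> W" using s(2) by (rule subsetD[rotated])
      qed
      then have DV: "D \<subseteq> V" unfolding W_def by auto
      have "compact D"
      proof (rule compact_eq_bounded_closed[THEN iffD2], intro conjI)
        have "norm z \<le> norm z0 + norm w + s" if "z \<in> D" for z
        proof -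
          have "norm z \<le> norm z0 + norm (l z *s w) + norm (p z)"
            by (subst decomp[of z]) (intro order_trans[OF norm_triangle_ineq] add_right_mono norm_triangle_ineq)
          moreover have "norm (l z *s w) \<le> norm w" using that unfolding D_def norm_smult
            by (simp add: mult_left_le_one_le)
          ultimately show ?thesis using that unfolding D_def by auto
        qed
        then show "bounded D" unfolding bounded_iff by blast
        show "closed D" unfolding D_def
          by (intro closed_Collect_conj closed_Collect_le continuous_intros lcont pcont)
      qed
      have z0D: "z0 \<in> D" using s(1) l_line[of 0] unfolding D_def p_def by simp
      have uscD: "usc_on h D" using uscV DV by (rule usc_on_subset)
      obtain ym where ym: "ym \<in> D" "\<And>z. z \<in> D \<Longrightarrow> h z \<le> h ym"
        using usc_attains_max[OF \<open>compact D\<close> _ uscD] z0D by auto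
      have "h ym \<noteq> \<infinity>" using ym(1) DV fin unfolding V_def by auto
      then obtain M where M: "h ym = ereal M" using ym(2)[OF z0D] h0 by (cases "h ym") auto
      have contcD: "continuous_on D c" using contc DV by (rule continuous_on_subset)
      obtain yc where yc: "yc \<in> D" "\<And>z. z \<in> D \<Longrightarrow> c yc \<le> c z"
        using continuous_attains_inf[OF \<open>compact D\<close> _ contcD] z0D by auto
      \<comment> \<open>The penalty \<open>k * (norm (p z))\<^sup>2\<close> must beat the full
        oscillation \<open>M - c yc\<close> on the side of the tube, so that no maximum is found
        there.\<close>
      define k where "k = (max 0 (M - c yc)) / s\<^sup>2 + 1"
      have k: "0 < k" "M - c yc < k * s\<^sup>2"
      proof -
        show "0 < k" unfolding k_def by (intro add_nonneg_pos divide_nonneg_nonneg) auto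
        have "k * s\<^sup>2 = max 0 (M - c yc) + s\<^sup>2" using s(1) unfolding k_def by (simp add: field_simps)
        then show "M - c yc < k * s\<^sup>2" using s(1) by (smt (verit) zero_less_power)
      qed
      define q where "q = (\<lambda>z. c z + k * (norm (p z))\<^sup>2)"
      have "continuous_on D q" unfolding q_def by (intro continuous_intros contcD pcont)
      from usc_attains_max[OF \<open>compact D\<close> _ usc_on_minus_continuous[OF uscD this]] z0D
      obtain y where y: "y \<in> D" "\<And>z. z \<in> D \<Longrightarrow> h z - ereal (q z) \<le> h y - ereal (q y)" by auto
      have qz0: "q z0 = c z0" using l_line[of 0] unfolding q_def p_def by simp
      have pos: "0 < h y - ereal (q y)" using y(2)[OF z0D] c0 h0 qz0
        by (smt (verit) diff_gt_0_iff_gt ereal_minus(1) less_ereal.simps(1) order_less_le_trans zero_ereal_def)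
      have "y \<in> X" using y(1) DV unfolding V_def by auto
      obtain hy where hy: "h y = ereal hy" using pos fin[OF \<open>y \<in> X\<close>] by (cases "h y") auto
      have hq: "q y < hy" using pos unfolding hy by simp
      \<comment> \<open>\<open>h - q\<close> is positive at \<open>z0\<close> but negative on both
        boundary pieces of the tube, so the maximum point is interior and \<open>h\<close> is
        touched there from above by a translate of \<open>q\<close>.\<close>
      have ly: "norm (l y) < 1"
      proof (rule ccontr)
        assume "\<not> ?thesis"
        then have "norm (l y) = 1" using y(1) unfolding D_def by auto
        then have "hy < c y" using y(1) DW hy unfolding W_def by auto
        moreover have "c y \<le> q y" unfolding q_def using k by simp
        ultimately show False using hq by simp
      qed
      have py: "norm (p y) < s"
      proof (rule ccontr)
        assume "\<not> ?thesis"
        then have "norm (p y) = s" using y(1) unfolding D_def by auto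
        then have "q y = c y + k * s\<^sup>2" unfolding q_def by simp
        moreover have "hy \<le> M" using ym(2)[OF y(1)] hy M by simp
        ultimately show False using hq k(2) yc(2)[OF y(1)] by simp
      qed
      define N where "N = {z. norm (l z) < 1 \<and> norm (p z) < s}"
      have "open N" unfolding N_def
        by (intro open_Collect_conj open_Collect_less continuous_intros lcont pcont)
      have yN: "y \<in> N" using ly py unfolding N_def by simp
      have touch: "h z \<le> ereal (hy + (q z - q y))" if "z \<in> N" for z
        using y(2)[of z] that unfolding hy N_def D_def by (cases "h z") auto
      have Qy: "Q y < m + e" using y(1) DW unfolding W_def by auto
      obtain \<gamma> R1 where \<gamma>: "0 < R1" "\<forall>i. (\<lambda>\<xi>. \<gamma> \<xi> $ i) holomorphic_on ball 0 R1" "\<gamma> 0 = y"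
        "\<forall>i. ((\<lambda>\<xi>. \<gamma> \<xi> $ i) has_field_derivative w $ i) (at 0)"
        "\<exists>t0>0. \<forall>t. 0 < t \<and> t < t0 \<longrightarrow>
              disc_sub (\<lambda>u. h (\<gamma> (of_real t * u))) (t\<^sup>2 * (Q y + e) / 2)"
        using loc[OF \<open>y \<in> X\<close> e] by (elim exE conjE) (rule that, assumption+, intro exI conjI)
      note R1 = \<gamma>(1) and hol\<gamma> = \<gamma>(2)[rule_format] and \<gamma>0 = \<gamma>(3) and der = \<gamma>(4)[rule_format]
      obtain t0 where t0: "0 < t0" and sub: "\<And>t. 0 < t \<Longrightarrow> t < t0 \<Longrightarrow>
              disc_sub (\<lambda>u. h (\<gamma> (of_real t * u))) (t\<^sup>2 * (Q y + e) / 2)"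
        using \<gamma>(5) by auto
      \<comment> \<open>The curve has velocity \<open>w\<close>, so \<open>l\<close> has derivative
        1 along it and \<open>p\<close> has derivative 0. \<open>\<tau>\<close> bounds the relative
        errors and is chosen such that their total cost stays below \<open>e\<close>.\<close>
      define \<tau> where "\<tau> = e / (\<mu> / 2 + k + 1)"
      have \<tau>: "0 < \<tau>" "\<tau> * (\<mu> / 2 + k) < e"
        using e \<mu> k by (auto simp: \<tau>_def field_simps add_pos_pos)
      define g where "g = (\<lambda>\<xi>. l (\<gamma> \<xi>))"
      define pr where "pr = (\<lambda>i \<xi>. p (\<gamma> \<xi>) $ i)"
      have g_eq: "g = (\<lambda>\<xi>. (\<Sum>i\<in>UNIV. cnj (w $ i) * (\<gamma> \<xi> $ i - z0 $ i)) / nw)"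
        unfolding g_def l_def clin_def by simp
      have pr_eq: "pr i = (\<lambda>\<xi>. \<gamma> \<xi> $ i - z0 $ i - g \<xi> * w $ i)" for i
        unfolding pr_def p_def g_def by simp
      have hol_g: "g holomorphic_on ball 0 R1" unfolding g_eq
        using nw by (intro holomorphic_intros hol\<gamma>) auto
      have hol_pr: "pr i holomorphic_on ball 0 R1" for i unfolding pr_eq
        by (intro holomorphic_intros hol\<gamma> hol_g)
      have der_g: "(g has_field_derivative 1) (at 0)"
      proof -
        have "(g has_field_derivative (\<Sum>i\<in>UNIV. cnj (w $ i) * (w $ i - 0)) / nw) (at 0)"
          unfolding g_eq by (intro DERIV_cdivide DERIV_sum DERIV_cmult DERIV_diff der DERIV_const)
        moreover have "(\<Sum>i\<in>UNIV. cnj (w $ i) * (w $ i - 0)) / nw = 1"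
          using clin_self[of w] nw unfolding clin_def nw_def by simp
        ultimately show ?thesis by metis
      qed
      have der_pr: "(pr i has_field_derivative 0) (at 0)" for i
      proof -
        have "(pr i has_field_derivative w $ i - 0 - 1 * w $ i) (at 0)"
          unfolding pr_eq by (intro derivative_intros der DERIV_cmult_right der_g)
        then show ?thesis by simp
      qed
      have "((\<lambda>\<xi>. (norm ((g \<xi> - g 0) / (\<xi> - 0)))\<^sup>2) \<longlongrightarrow> (norm (1::complex))\<^sup>2) (at 0)"
        using der_g unfolding has_field_derivative_iff by (intro tendsto_intros)
      then have ev1: "\<forall>\<^sub>F \<xi> in at 0. 1 - \<tau> < (norm ((g \<xi> - g 0) / (\<xi> - 0)))\<^sup>2"
        using \<tau> by (intro order_tendstoD(1)) auto
      have "((\<lambda>\<xi>. \<Sum>i\<in>UNIV. (norm ((pr i \<xi> - pr i 0) / (\<xi> - 0)))\<^sup>2) \<longlongrightarrow> (\<Sum>i\<in>(UNIV::'n set). (norm (0::complex))\<^sup>2)) (at 0)"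
        using der_pr unfolding has_field_derivative_iff by (intro tendsto_intros)
      then have ev2: "\<forall>\<^sub>F \<xi> in at 0. (\<Sum>i\<in>UNIV. (norm ((pr i \<xi> - pr i 0) / (\<xi> - 0)))\<^sup>2) < \<tau>"
        using \<tau> by (intro order_tendstoD(2)) auto
      have "(\<gamma> \<longlongrightarrow> y) (at 0)"
        using DERIV_isCont[OF der] unfolding isCont_def \<gamma>0 by (intro vec_tendstoI)
      then have ev3: "\<forall>\<^sub>F \<xi> in at 0. \<gamma> \<xi> \<in> N" using \<open>open N\<close> yN by (metis topological_tendstoD)
      obtain d0 where d0: "0 < d0" "\<And>\<xi>. \<xi> \<noteq> 0 \<Longrightarrow> norm \<xi> < d0 \<Longrightarrow>
          1 - \<tau> < (norm ((g \<xi> - g 0) / \<xi>))\<^sup>2 \<and> (\<Sum>i\<in>UNIV. (norm ((pr i \<xi> - pr i 0) / \<xi>))\<^sup>2) < \<tau> \<and> \<gamma> \<xi> \<in> N"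
        using eventually_conj[OF ev1 eventually_conj[OF ev2 ev3]] unfolding eventually_at by (auto simp: dist_norm)
      define d where "d = min d0 R1"
      have d: "0 < d" using d0 R1 by (simp add: d_def)
      define t where "t = min d t0 / 2"
      have t: "0 < t" "t < t0" "t < d" using d t0 unfolding t_def by auto
      have inN: "\<gamma> \<xi> \<in> N" if "norm \<xi> < d" for \<xi>
        using d0(2)[of \<xi>] that yN \<gamma>0 unfolding d_def by (cases "\<xi> = 0") auto
      \<comment> \<open>The holomorphic part of \<open>q\<close> along the curve: by
        \<open>norm_sq_expand\<close> the remainder consists of constants and squares of
        increments.\<close>
      define G where "G = (\<lambda>\<xi>. H (g \<xi>) - of_real \<mu> * (cnj (g 0) * (g \<xi> - g 0))
           + of_real (2 * k) * (\<Sum>i\<in>UNIV. cnj (pr i 0) * (pr i \<xi> - pr i 0)))"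
      have "(H \<circ> g) holomorphic_on ball 0 d"
      proof (rule holomorphic_on_compose_gen[OF _ H])
        show "g holomorphic_on ball 0 d" using hol_g by (rule holomorphic_on_subset) (auto simp: d_def)
        show "g ` ball 0 d \<subseteq> ball 0 R" using inN R unfolding g_def N_def by fastforce
      qed
      moreover have "g holomorphic_on ball 0 d" "pr i holomorphic_on ball 0 d" for i
        using holomorphic_on_subset[OF hol_g, of "ball 0 d"] holomorphic_on_subset[OF hol_pr, of "ball 0 d" i] subset_ball[of d R1 0] by (auto simp: d_def)
      ultimately have holG: "G holomorphic_on ball 0 d" unfolding G_def comp_def
        by (intro holomorphic_intros)
      define K where "K = hy - q y + \<mu> / 2 * (1 - (norm (g 0))\<^sup>2) + k * (norm (p y))\<^sup>2 - \<mu> / 2 * (1 - \<tau>) * t\<^sup>2 + k * \<tau> * t\<^sup>2"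
      define H' where "H' = (\<lambda>u. G (of_real t * u) + of_real K)"
      have "(G \<circ> (\<lambda>u. of_real t * u)) holomorphic_on ball 0 (d / t)"
      proof (rule holomorphic_on_compose_gen[OF _ holG])
        show "(\<lambda>u. complex_of_real t * u) ` ball 0 (d / t) \<subseteq> ball 0 d"
          using t by (auto simp: norm_mult field_simps)
      qed (intro holomorphic_intros)
      then have holH': "H' holomorphic_on ball 0 (d / t)" unfolding H'_def comp_def by (intro holomorphic_intros)
      have d1: "1 < d / t" using t by simp
      have qexp: "q (\<gamma> \<xi>) = Re (G \<xi>) + \<mu> / 2 * (1 - (norm (g 0))\<^sup>2) + k * (norm (p y))\<^sup>2
            - \<mu> / 2 * (norm (g \<xi> - g 0))\<^sup>2 + k * (\<Sum>i\<in>UNIV. (norm (pr i \<xi> - pr i 0))\<^sup>2)" for \<xi>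
      proof -
        have 1: "(norm (g \<xi>))\<^sup>2 = (norm (g 0))\<^sup>2 + 2 * Re (cnj (g 0) * (g \<xi> - g 0)) + (norm (g \<xi> - g 0))\<^sup>2"
          by (rule norm_sq_expand)
        have "(norm (p (\<gamma> \<xi>)))\<^sup>2 = (\<Sum>i\<in>UNIV. (norm (pr i \<xi>))\<^sup>2)" unfolding norm_vec_sq pr_def ..
        also have "\<dots> = (\<Sum>i\<in>UNIV. (norm (pr i 0))\<^sup>2 + 2 * Re (cnj (pr i 0) * (pr i \<xi> - pr i 0)) + (norm (pr i \<xi> - pr i 0))\<^sup>2)"
          by (intro sum.cong refl norm_sq_expand)
        also have "\<dots> = (\<Sum>i\<in>UNIV. (norm (pr i 0))\<^sup>2) + 2 * Re (\<Sum>i\<in>UNIV. cnj (pr i 0) * (pr i \<xi> - pr i 0)) + (\<Sum>i\<in>UNIV. (norm (pr i \<xi> - pr i 0))\<^sup>2)"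
          by (simp only: sum.distrib sum_distrib_left Re_sum)
        also have "(\<Sum>i\<in>UNIV. (norm (pr i 0))\<^sup>2) = (norm (p y))\<^sup>2" unfolding norm_vec_sq pr_def \<gamma>0 ..
        finally have 2: "(norm (p (\<gamma> \<xi>)))\<^sup>2 = (norm (p y))\<^sup>2 + 2 * Re (\<Sum>i\<in>UNIV. cnj (pr i 0) * (pr i \<xi> - pr i 0)) + (\<Sum>i\<in>UNIV. (norm (pr i \<xi> - pr i 0))\<^sup>2)" .
        have 3: "Re (G \<xi>) = Re (H (g \<xi>)) - \<mu> * Re (cnj (g 0) * (g \<xi> - g 0))
           + 2 * k * Re (\<Sum>i\<in>UNIV. cnj (pr i 0) * (pr i \<xi> - pr i 0))" unfolding G_def by simp
        show ?thesis unfolding q_def c_def g_def[symmetric, THEN fun_cong, simplified] 2 3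
          using 1 by (simp only: ) (simp add: field_simps g_def)
      qed
      have G0: "Re (G 0) + (\<mu> / 2 * (1 - (norm (g 0))\<^sup>2) + k * (norm (p y))\<^sup>2) = q y"
        using qexp[of 0] by (simp add: \<gamma>0)
      have "h (\<gamma> (of_real t * 0)) \<le> ereal (Re (H' 0) + t\<^sup>2 * (Q y + e) / 2)"
      proof (rule disc_subD[OF sub[OF t(1,2)]])
        show "continuous_on (cball 0 1) H'"
          using holomorphic_on_imp_continuous_on[OF holH'] by (rule continuous_on_subset) (use d1 in auto)
        show "H' holomorphic_on ball 0 1" using holH' by (rule holomorphic_on_subset) (use d1 in auto)
        fix u :: complex assume z: "norm u = 1"
        define \<xi> where "\<xi> = of_real t * u"
        have n\<xi>: "norm \<xi> = t" using z t by (simp add: \<xi>_def norm_mult)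
        then have \<xi>: "\<xi> \<noteq> 0" "norm \<xi> < d0" using t unfolding d_def by auto
        have a: "(1 - \<tau>) * t\<^sup>2 \<le> (norm (g \<xi> - g 0))\<^sup>2"
        proof -
          have "1 - \<tau> < (norm (g \<xi> - g 0))\<^sup>2 / t\<^sup>2"
            using d0(2)[OF \<xi>] n\<xi> by (simp add: norm_divide power_divide)
          then show ?thesis using t by (simp add: field_simps)
        qed
        have b: "(\<Sum>i\<in>UNIV. (norm (pr i \<xi> - pr i 0))\<^sup>2) \<le> \<tau> * t\<^sup>2"
        proof -
          have "(\<Sum>i\<in>UNIV. (norm (pr i \<xi> - pr i 0))\<^sup>2 / t\<^sup>2) < \<tau>"
            using d0(2)[OF \<xi>] n\<xi> by (simp add: norm_divide power_divide)
          then show ?thesis using t by (simp add: sum_divide_distrib[symmetric] field_simps)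
        qed
        have "h (\<gamma> \<xi>) \<le> ereal (hy + (q (\<gamma> \<xi>) - q y))" using n\<xi> t by (intro touch inN) auto
        also have "hy + (q (\<gamma> \<xi>) - q y) \<le> Re (H' u)"
        proof -
          have "\<mu> / 2 * ((1 - \<tau>) * t\<^sup>2) \<le> \<mu> / 2 * (norm (g \<xi> - g 0))\<^sup>2" using a \<mu> by (intro mult_left_mono) auto
          moreover have "k * (\<Sum>i\<in>UNIV. (norm (pr i \<xi> - pr i 0))\<^sup>2) \<le> k * (\<tau> * t\<^sup>2)" using b k by (intro mult_left_mono) auto
          moreover have "Re (H' u) = Re (G \<xi>) + K" unfolding H'_def \<xi>_def by simp
          moreover have "K = hy - q y + \<mu> / 2 * (1 - (norm (g 0))\<^sup>2) + k * (norm (p y))\<^sup>2 - \<mu> / 2 * ((1 - \<tau>) * t\<^sup>2) + k * (\<tau> * t\<^sup>2)"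
            unfolding K_def by (simp only: mult.assoc)
          ultimately show ?thesis unfolding qexp by linarith
        qed
        finally show "h (\<gamma> (of_real t * u)) \<le> ereal (Re (H' u))" unfolding \<xi>_def by simp
      qed
      then have "hy \<le> Re (G 0) + K + t\<^sup>2 * (Q y + e) / 2" by (simp add: \<gamma>0 hy H'_def)
      also have "\<dots> = hy - \<mu> / 2 * (1 - \<tau>) * t\<^sup>2 + k * \<tau> * t\<^sup>2 + t\<^sup>2 * (Q y + e) / 2"
        unfolding K_def using G0 by simp
      finally have "0 \<le> t\<^sup>2 * (\<tau> * (\<mu> / 2 + k) - \<mu> / 2 + (Q y + e) / 2)" by (simp add: algebra_simps)
      \<comment> \<open>The budget: the gain \<open>- \<mu> / 2\<close> is
        \<open>- m / 2 - 2 * e\<close>, the allowed defect is below \<open>m / 2 + e\<close> and the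
        errors are below \<open>e\<close>, which is contradictory.\<close>
      then have "0 \<le> \<tau> * (\<mu> / 2 + k) - \<mu> / 2 + (Q y + e) / 2" using t by (simp add: zero_le_mult_iff)
      moreover define T where "T = \<tau> * (\<mu> / 2 + k)"
      ultimately have "0 \<le> T - \<mu> / 2 + (Q y + e) / 2" by simp
      moreover have "\<mu> / 2 = m / 2 + 2 * e" unfolding \<mu>_def by simp
      moreover have "T < e" using \<tau>(2) unfolding T_def .
      ultimately show False using Qy by argo
    qed
  qed
qed

abbreviation dir_deriv :: "complex^'n \<Rightarrow> (complex^'n \<Rightarrow> real) \<Rightarrow> complex^'n \<Rightarrow> real" where
  "dir_deriv v f \<equiv> (\<lambda>x. frechet_derivative f (at x) v)"

section \<open>Second derivatives along complex lines\<close>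

text \<open>The Laplacian at \<open>\<zeta> = 0\<close> of the function \<open>\<zeta>\<close>
  \<mapsto> \<open>f (x + \<zeta> *s w)\<close> of one complex variable.\<close>

definition lap :: "complex^'n \<Rightarrow> (complex^'n \<Rightarrow> real) \<Rightarrow> complex^'n \<Rightarrow> real" where
  "lap w f x = dir_deriv w (dir_deriv w f) x + dir_deriv (\<i> *s w) (dir_deriv (\<i> *s w) f) x"

lemma smooth_on_differentiable: "smooth_on f S \<Longrightarrow> x \<in> S \<Longrightarrow> f differentiable (at x)"
  unfolding smooth_on_def using times_continuously_differentiable_on.simps(2) by blast

lemma smooth_on_dir_deriv:
  assumes "smooth_on f S" shows "smooth_on (\<lambda>x. frechet_derivative f (at x) v) S"
  using assms times_continuously_differentiable_on.simps(2) unfolding smooth_on_def by blast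

lemma smooth_on_continuous: "smooth_on f S \<Longrightarrow> continuous_on S f"
  unfolding smooth_on_def using times_continuously_differentiable_on.simps(1) by blast

lemma has_derivative_smooth:
  "smooth_on f S \<Longrightarrow> x \<in> S \<Longrightarrow> (f has_derivative (\<lambda>v. frechet_derivative f (at x) v)) (at x)"
  using smooth_on_differentiable frechet_derivative_works by (metis eta_contract_eq)

lemma line_derivative:
  fixes f :: "complex^'n \<Rightarrow> real"
  assumes "smooth_on f UNIV"
  shows "((\<lambda>t. f (y + t *\<^sub>R v)) has_real_derivative dir_deriv v f (y + t *\<^sub>R v)) (at t)"
proof -
  have "(f has_derivative (\<lambda>u. dir_deriv u f (y + t *\<^sub>R v))) (at (y + t *\<^sub>R v))"
    using has_derivative_smooth[OF assms] by auto
  moreover have "((\<lambda>t. y + t *\<^sub>R v) has_derivative (\<lambda>s. s *\<^sub>R v)) (at t)"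
    by (auto intro!: derivative_eq_intros)
  ultimately have "((\<lambda>t. f (y + t *\<^sub>R v)) has_derivative (\<lambda>s. dir_deriv (s *\<^sub>R v) f (y + t *\<^sub>R v))) (at t)"
    using has_derivative_compose[of "\<lambda>t. y + t *\<^sub>R v" "\<lambda>s. s *\<^sub>R v" t UNIV f] by auto
  moreover have "dir_deriv (s *\<^sub>R v) f x = dir_deriv v f x * s" for s x
    using linear_scale[OF linear_frechet_derivative[OF smooth_on_differentiable[OF assms, of x]]] by (simp add: mult.commute)
  ultimately show ?thesis unfolding has_field_derivative_def by simp
qed

lemma dir_deriv_lincomb:
  fixes f :: "complex^'n \<Rightarrow> real"
  assumes "smooth_on f UNIV"
  shows "dir_deriv (a *\<^sub>R u + b *\<^sub>R v) f x = a * dir_deriv u f x + b * dir_deriv v f x"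
proof -
  have "linear (frechet_derivative f (at x))"
    by (rule linear_frechet_derivative[OF smooth_on_differentiable[OF assms]]) simp
  then show ?thesis by (simp add: linear_add linear_scale)
qed

lemma dir_deriv_sum:
  fixes f :: "complex^'n \<Rightarrow> real"
  assumes "smooth_on f UNIV"
  shows "dir_deriv (\<Sum>i\<in>I. a i *\<^sub>R u i) f x = (\<Sum>i\<in>I. a i * dir_deriv (u i) f x)"
proof -
  have "linear (frechet_derivative f (at x))"
    by (rule linear_frechet_derivative[OF smooth_on_differentiable[OF assms]]) simp
  then show ?thesis by (simp add: linear_sum linear_scale)
qed

lemma dir_deriv_of_sum:
  fixes f :: "'i \<Rightarrow> complex^'n \<Rightarrow> real"
  assumes "\<And>i. smooth_on (f i) UNIV" "finite I"
  shows "dir_deriv v (\<lambda>x. \<Sum>i\<in>I. a i * f i x) x = (\<Sum>i\<in>I. a i * dir_deriv v (f i) x)"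
proof -
  have "((\<lambda>x. \<Sum>i\<in>I. a i * f i x) has_derivative (\<lambda>v. \<Sum>i\<in>I. a i * dir_deriv v (f i) x)) (at x)"
    by (intro has_derivative_sum has_derivative_mult_right has_derivative_smooth[OF assms(1)]) simp
  from fun_cong[OF frechet_derivative_at[OF this], of v] show ?thesis by simp
qed

lemma dir_deriv2_sum:
  fixes f :: "complex^'n \<Rightarrow> real"
  assumes f: "smooth_on f UNIV" and "finite I" "finite J"
  shows "dir_deriv (\<Sum>i\<in>I. a i *\<^sub>R u i) (dir_deriv (\<Sum>j\<in>J. b j *\<^sub>R v j) f) x
     = (\<Sum>i\<in>I. \<Sum>j\<in>J. a i * b j * dir_deriv (u i) (dir_deriv (v j) f) x)"
proof -
  have "dir_deriv (\<Sum>i\<in>I. a i *\<^sub>R u i) (dir_deriv (\<Sum>j\<in>J. b j *\<^sub>R v j) f) x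
     = (\<Sum>i\<in>I. a i * dir_deriv (u i) (dir_deriv (\<Sum>j\<in>J. b j *\<^sub>R v j) f) x)"
    by (intro dir_deriv_sum smooth_on_dir_deriv f)
  also have "\<dots> = (\<Sum>i\<in>I. a i * dir_deriv (u i) (\<lambda>y. \<Sum>j\<in>J. b j * dir_deriv (v j) f y) x)"
    by (simp only: dir_deriv_sum[OF f])
  also have "\<dots> = (\<Sum>i\<in>I. a i * (\<Sum>j\<in>J. b j * dir_deriv (u i) (dir_deriv (v j) f) x))"
    using dir_deriv_of_sum[OF smooth_on_dir_deriv[OF f] assms(3)] by simp
  finally show ?thesis by (simp add: sum_distrib_left mult.assoc)
qed

text \<open>The mean value theorem twice: in direction \<open>u\<close> for the difference of two
  translates, and in direction \<open>v\<close> for the derivative so obtained.\<close>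

lemma second_difference_MVT:
  fixes f :: "complex^'n \<Rightarrow> real"
  assumes f: "smooth_on f UNIV" and s: "0 < s"
  obtains \<sigma> \<tau> where "0 < \<sigma>" "\<sigma> < s" "0 < \<tau>" "\<tau> < s"
    "f (x + s *\<^sub>R u + s *\<^sub>R v) - f (x + s *\<^sub>R u) - f (x + s *\<^sub>R v) + f x
      = s * s * dir_deriv v (dir_deriv u f) (x + \<sigma> *\<^sub>R u + \<tau> *\<^sub>R v)"
proof -
  define g where "g = (\<lambda>t. f ((x + s *\<^sub>R v) + t *\<^sub>R u) - f (x + t *\<^sub>R u))"
  have "DERIV g t :> dir_deriv u f ((x + s *\<^sub>R v) + t *\<^sub>R u) - dir_deriv u f (x + t *\<^sub>R u)" for t
    unfolding g_def by (intro DERIV_diff line_derivative f)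
  then obtain \<sigma> where \<sigma>: "0 < \<sigma>" "\<sigma> < s" "g s - g 0 = (s - 0) * (dir_deriv u f ((x + s *\<^sub>R v) + \<sigma> *\<^sub>R u) - dir_deriv u f (x + \<sigma> *\<^sub>R u))"
    using MVT2[OF s, of g "\<lambda>t. dir_deriv u f ((x + s *\<^sub>R v) + t *\<^sub>R u) - dir_deriv u f (x + t *\<^sub>R u)"] by auto
  define k where "k = (\<lambda>t. dir_deriv u f ((x + \<sigma> *\<^sub>R u) + t *\<^sub>R v))"
  have "DERIV k t :> dir_deriv v (dir_deriv u f) ((x + \<sigma> *\<^sub>R u) + t *\<^sub>R v)" for t
    unfolding k_def by (intro line_derivative smooth_on_dir_deriv f)
  then obtain \<tau> where \<tau>: "0 < \<tau>" "\<tau> < s" "k s - k 0 = (s - 0) * dir_deriv v (dir_deriv u f) ((x + \<sigma> *\<^sub>R u) + \<tau> *\<^sub>R v)"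
    using MVT2[OF s, of k "\<lambda>t. dir_deriv v (dir_deriv u f) ((x + \<sigma> *\<^sub>R u) + t *\<^sub>R v)"] by auto
  have eq: "(x + s *\<^sub>R v) + \<sigma> *\<^sub>R u = (x + \<sigma> *\<^sub>R u) + s *\<^sub>R v" by (simp add: algebra_simps)
  have "g s - g 0 = s * (k s - k 0)" using \<sigma>(3) unfolding k_def eq by simp
  also have "\<dots> = s * s * dir_deriv v (dir_deriv u f) (x + \<sigma> *\<^sub>R u + \<tau> *\<^sub>R v)" using \<tau>(3) by simp
  finally have 1: "g s - g 0 = s * s * dir_deriv v (dir_deriv u f) (x + \<sigma> *\<^sub>R u + \<tau> *\<^sub>R v)" .
  have eq': "x + s *\<^sub>R v + s *\<^sub>R u = x + s *\<^sub>R u + s *\<^sub>R v" by (simp add: algebra_simps)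
  have "g s - g 0 = f (x + s *\<^sub>R u + s *\<^sub>R v) - f (x + s *\<^sub>R u) - f (x + s *\<^sub>R v) + f x"
    unfolding g_def by simp (rule arg_cong[OF eq'])
  with 1 that \<sigma>(1,2) \<tau>(1,2) show thesis by metis
qed

text \<open>The second difference is symmetric in \<open>u\<close> and \<open>v\<close>, so both
  mixed derivatives agree at points arbitrarily close to \<open>x\<close>; continuity does the
  rest.\<close>

lemma dir_deriv_commute:
  fixes f :: "complex^'n \<Rightarrow> real"
  assumes f: "smooth_on f UNIV"
  shows "dir_deriv v (dir_deriv u f) x = dir_deriv u (dir_deriv v f) x"
proof (rule ccontr)
  let ?A = "dir_deriv v (dir_deriv u f)" and ?B = "dir_deriv u (dir_deriv v f)"
  assume ne: "?A x \<noteq> ?B x"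
  define e where "e = \<bar>?A x - ?B x\<bar> / 2"
  have e: "0 < e" using ne by (simp add: e_def)
  have cA: "isCont ?A x" "isCont ?B x"
    using smooth_on_continuous[OF smooth_on_dir_deriv[OF smooth_on_dir_deriv[OF f]]]
    by (auto simp: continuous_on_eq_continuous_at)
  obtain d1 where d1: "d1 > 0" "\<And>y. dist y x < d1 \<Longrightarrow> dist (?A y) (?A x) < e"
    using cA(1) e unfolding continuous_at_eps_delta by blast
  obtain d2 where d2: "d2 > 0" "\<And>y. dist y x < d2 \<Longrightarrow> dist (?B y) (?B x) < e"
    using cA(2) e unfolding continuous_at_eps_delta by blast
  define s where "s = min d1 d2 / (2 * (norm u + norm v + 1))"
  have s: "0 < s" using d1 d2 by (simp add: s_def add_nonneg_pos)
  have small: "dist (x + \<sigma> *\<^sub>R u + \<tau> *\<^sub>R v) x < min d1 d2" if "0 < \<sigma>" "\<sigma> < s" "0 < \<tau>" "\<tau> < s" for \<sigma> \<tau>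
  proof -
    have "dist (x + \<sigma> *\<^sub>R u + \<tau> *\<^sub>R v) x \<le> \<sigma> * norm u + \<tau> * norm v"
      using norm_triangle_ineq[of "\<sigma> *\<^sub>R u" "\<tau> *\<^sub>R v"] that by (simp add: dist_norm)
    also have "\<dots> \<le> s * norm u + s * norm v" using that by (intro add_mono mult_right_mono) auto
    also have "\<dots> = s * (norm u + norm v)" by (simp add: distrib_left)
    also have "\<dots> < s * (2 * (norm u + norm v + 1))"
    proof -
      have "norm u + norm v < 2 * (norm u + norm v + 1)" using norm_ge_zero[of u] norm_ge_zero[of v] by argo
      then show ?thesis using s by (rule mult_strict_left_mono)
    qed
    also have "\<dots> = min d1 d2" unfolding s_def by (simp add: add_nonneg_eq_0_iff)
    finally show ?thesis .
  qed
  obtain \<sigma> \<tau> where 1: "0 < \<sigma>" "\<sigma> < s" "0 < \<tau>" "\<tau> < s"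
    "f (x + s *\<^sub>R u + s *\<^sub>R v) - f (x + s *\<^sub>R u) - f (x + s *\<^sub>R v) + f x = s * s * ?A (x + \<sigma> *\<^sub>R u + \<tau> *\<^sub>R v)"
    by (rule second_difference_MVT[OF f s])
  obtain \<sigma>' \<tau>' where 2: "0 < \<sigma>'" "\<sigma>' < s" "0 < \<tau>'" "\<tau>' < s"
    "f (x + s *\<^sub>R v + s *\<^sub>R u) - f (x + s *\<^sub>R v) - f (x + s *\<^sub>R u) + f x = s * s * ?B (x + \<sigma>' *\<^sub>R v + \<tau>' *\<^sub>R u)"
    by (rule second_difference_MVT[OF f s])
  have "x + s *\<^sub>R v + s *\<^sub>R u = x + s *\<^sub>R u + s *\<^sub>R v" by (simp add: algebra_simps)
  from arg_cong[OF this, of f] have "s * s * ?A (x + \<sigma> *\<^sub>R u + \<tau> *\<^sub>R v) = s * s * ?B (x + \<sigma>' *\<^sub>R v + \<tau>' *\<^sub>R u)"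
    using 1(5) 2(5) by linarith
  then have eq: "?A (x + \<sigma> *\<^sub>R u + \<tau> *\<^sub>R v) = ?B (x + \<tau>' *\<^sub>R u + \<sigma>' *\<^sub>R v)" using s by (simp add: algebra_simps)
  have "dist (?A (x + \<sigma> *\<^sub>R u + \<tau> *\<^sub>R v)) (?A x) < e" "dist (?B (x + \<tau>' *\<^sub>R u + \<sigma>' *\<^sub>R v)) (?B x) < e"
    using d1(2) d2(2) small[OF 1(1-4)] small[OF 2(3,4) 2(1,2)] by auto
  then show False unfolding eq dist_real_def e_def by argo
qed

lemma cis_smult_decomp: "cis t *s w = cos t *\<^sub>R w + sin t *\<^sub>R (\<i> *s (w::complex^'n))"
  by (simp add: vec_eq_iff complex_eq_iff)

lemma dir_deriv_zero_outside:
  fixes f :: "complex^'n \<Rightarrow> real"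
  assumes C: "closed C" "\<And>z. z \<notin> C \<Longrightarrow> f z = 0" and z: "z \<notin> C"
  shows "dir_deriv v f z = 0"
proof -
  have "((\<lambda>_. 0) has_derivative (\<lambda>_. 0)) (at z)" by simp
  then have "(f has_derivative (\<lambda>_. 0)) (at z)"
    by (rule has_derivative_transform_within_open[of _ _ _ "UNIV" "- C"]) (use C z in auto)
  from fun_cong[OF frechet_derivative_at[OF this], of v] show ?thesis by simp
qed

text \<open>Pairs with a point in \<open>C\<close> are treated by a Lebesgue number argument, all
  others have two zero values. It makes the Taylor remainders below uniform in the base
  point.\<close>

lemma compact_support_uniformly_continuous:
  fixes f :: "'a::metric_space \<Rightarrow> real"
  assumes f: "continuous_on UNIV f" and C: "compact C" "\<And>z. z \<notin> C \<Longrightarrow> f z = 0" and e: "0 < e"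
  obtains d where "0 < d" "\<And>x y. dist x y < d \<Longrightarrow> \<bar>f x - f y\<bar> < e"
proof -
  obtain d where d: "0 < d" "\<And>x y. x \<in> C \<Longrightarrow> dist y x < d \<Longrightarrow> \<bar>f y - f x\<bar> < e"
  proof -
    have "\<exists>r>0. \<forall>y z. dist y x < 2 * r \<and> dist z x < 2 * r \<longrightarrow> \<bar>f y - f z\<bar> < e" for x
    proof -
      have "isCont f x" using f by (simp add: continuous_on_eq_continuous_at)
      then obtain r where r: "r > 0" "\<And>y. dist y x < r \<Longrightarrow> dist (f y) (f x) < e / 2"
        unfolding continuous_at_eps_delta using e half_gt_zero by blast
      have "\<bar>f y - f z\<bar> < e" if "dist y x < r" "dist z x < r" for y z
        using r(2)[OF that(1)] r(2)[OF that(2)] unfolding dist_real_def by linarith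
      then show ?thesis using r(1) by (intro exI[of _ "r/2"]) auto
    qed
    then obtain r where r: "\<And>x. r x > 0" "\<And>x y z. dist y x < 2 * r x \<Longrightarrow> dist z x < 2 * r x \<Longrightarrow> \<bar>f y - f z\<bar> < e" by metis
    have "C \<subseteq> (\<Union>x\<in>C. ball x (r x))" using r(1) by auto
    from compactE_image[OF C(1) _ this] obtain F where F: "F \<subseteq> C" "finite F" "C \<subseteq> (\<Union>x\<in>F. ball x (r x))" by auto
    define d where "d = Min (insert 1 (r ` F))"
    have d0: "0 < d" unfolding d_def using F(2) r(1) by (subst Min_gr_iff) auto
    have "\<bar>f y - f x\<bar> < e" if x: "x \<in> C" "dist y x < d" for x y
    proof -
      obtain a where a: "a \<in> F" "dist a x < r a" using F(3) x(1) by auto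
      have "d \<le> r a" unfolding d_def using F(2) a(1) by auto
      have "dist y a < 2 * r a" using dist_triangle[of y a x] a x \<open>d \<le> r a\<close> by (simp add: dist_commute)
      moreover have "dist x a < 2 * r a" using a r(1)[of a] by (simp add: dist_commute)
      ultimately show ?thesis by (rule r(2))
    qed
    with d0 that show thesis by blast
  qed
  show thesis
  proof (rule that[OF d(1)])
    fix x y :: 'a assume xy: "dist x y < d"
    show "\<bar>f x - f y\<bar> < e"
    proof (cases "x \<in> C")
      case True then show ?thesis using d(2)[OF True, of y] xy by (simp add: dist_commute abs_minus_commute)
    next
      case False
      then show ?thesis using d(2)[of y x] xy C(2) e by (cases "y \<in> C") auto
    qed
  qed
qed

text \<open>The second order Taylor polynomial along a circle is the real part of a polynomial in
  \<open>cis \<theta>\<close>, so its mean is the value of this polynomial at 0.\<close>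

lemma taylor_on_circle:
  fixes f :: "complex^'n \<Rightarrow> real"
  assumes f: "smooth_on f UNIV" and C: "compact C" "\<And>z. z \<notin> C \<Longrightarrow> f z = 0" and e: "0 < e"
  obtains h0 where "0 < h0" "\<And>h y \<theta>. 0 < h \<Longrightarrow> h < h0 \<Longrightarrow>
     \<bar>f (y + (of_real h * cis \<theta>) *s w) - Re (of_real (f y + h\<^sup>2 / 4 * lap w f y)
        + of_real h * Complex (dir_deriv w f y) (- dir_deriv (\<i> *s w) f y) * cis \<theta>
        + of_real (h\<^sup>2 / 4) * Complex (dir_deriv w (dir_deriv w f) y - dir_deriv (\<i> *s w) (dir_deriv (\<i> *s w) f) y)
           (- 2 * dir_deriv w (dir_deriv (\<i> *s w) f) y) * (cis \<theta>)\<^sup>2)\<bar> \<le> h\<^sup>2 * e"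
proof -
  define v where "v = \<i> *s w"
  define W where "W = dir_deriv w (dir_deriv w f)"
  define X where "X = dir_deriv w (dir_deriv v f)"
  define V where "V = dir_deriv v (dir_deriv v f)"
  have "\<exists>d>0. \<forall>x y. dist x y < d \<longrightarrow> \<bar>dir_deriv a (dir_deriv b f) x - dir_deriv a (dir_deriv b f) y\<bar> < e / 4" for a b
  proof (rule compact_support_uniformly_continuous[of "dir_deriv a (dir_deriv b f)" C "e/4"])
    show "continuous_on UNIV (dir_deriv a (dir_deriv b f))"
      by (intro smooth_on_continuous smooth_on_dir_deriv f)
    show "dir_deriv a (dir_deriv b f) z = 0" if "z \<notin> C" for z
      by (intro dir_deriv_zero_outside[of C] compact_imp_closed C(1) that) (use C in \<open>auto intro: dir_deriv_zero_outside compact_imp_closed\<close>)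
  qed (use C e in auto)
  then obtain d1 d2 d3 where d: "d1 > 0" "d2 > 0" "d3 > 0"
    "\<And>x y. dist x y < d1 \<Longrightarrow> \<bar>W x - W y\<bar> < e/4" "\<And>x y. dist x y < d2 \<Longrightarrow> \<bar>X x - X y\<bar> < e/4" "\<And>x y. dist x y < d3 \<Longrightarrow> \<bar>V x - V y\<bar> < e/4"
    unfolding W_def X_def V_def by metis
  define h0 where "h0 = min d1 (min d2 d3) / (norm w + 1)"
  have h0: "0 < h0" using d by (simp add: h0_def add_nonneg_pos)
  show thesis
  proof (rule that[OF h0])
    fix h y \<theta> assume h: "0 < h" "h < h0"
    define c s u where "c = cos \<theta>" and "s = sin \<theta>" and "u = c *\<^sub>R w + s *\<^sub>R v"
    \<comment> \<open>Rotation of \<open>w\<close> is a real combination of \<open>w\<close> and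
      \<open>\<i> *s w\<close>, so all second derivatives along the circle reduce to
      \<open>W\<close>, \<open>X\<close> and \<open>V\<close>.\<close>
    have u: "(of_real h * cis \<theta>) *s w = h *\<^sub>R u"
      unfolding u_def c_def s_def v_def by (simp add: vec_eq_iff complex_eq_iff algebra_simps)
    have nu: "norm u = norm w" unfolding u_def c_def s_def v_def cis_smult_decomp[symmetric] norm_smult by simp
    have Du: "dir_deriv u f x = c * dir_deriv w f x + s * dir_deriv v f x" for x
      unfolding u_def by (rule dir_deriv_lincomb[OF f])
    have DDu: "dir_deriv u (dir_deriv u f) x = c\<^sup>2 * W x + 2 * (c * s) * X x + s\<^sup>2 * V x" for x
    proof -
      have "dir_deriv u (dir_deriv u f) x = c * dir_deriv u (dir_deriv w f) x + s * dir_deriv u (dir_deriv v f) x"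
      proof -
        have "dir_deriv u (dir_deriv u f) x = dir_deriv u (\<lambda>x. \<Sum>i\<in>(UNIV::bool set). (if i then c else s) * (if i then dir_deriv w f x else dir_deriv v f x)) x"
          unfolding Du by (simp add: UNIV_bool add.commute)
        also have "\<dots> = (\<Sum>i\<in>(UNIV::bool set). (if i then c else s) * dir_deriv u (if i then dir_deriv w f else dir_deriv v f) x)"
          using dir_deriv_of_sum[where f = "\<lambda>i. if i then dir_deriv w f else dir_deriv v f" and I = "UNIV::bool set" and v = u and a = "\<lambda>i. if i then c else s" and x = x]
            smooth_on_dir_deriv[OF f] by (simp add: if_distribR)
        also have "\<dots> = c * dir_deriv u (dir_deriv w f) x + s * dir_deriv u (dir_deriv v f) x" by (simp add: UNIV_bool)
        finally show ?thesis .
      qed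
      also have "dir_deriv u (dir_deriv w f) x = c * W x + s * X x"
        using dir_deriv_lincomb[OF smooth_on_dir_deriv[OF f, of w], where a=c and u=w and b=s and v=v and x=x] dir_deriv_commute[OF f, where v=v and u=w and x=x]
        unfolding u_def W_def X_def by simp
      also have "dir_deriv u (dir_deriv v f) x = c * X x + s * V x"
        unfolding u_def V_def X_def by (rule dir_deriv_lincomb[OF smooth_on_dir_deriv[OF f]])
      finally show ?thesis by (simp add: algebra_simps power2_eq_square)
    qed
    define diff where "diff = (\<lambda>n::nat. if n = 0 then (\<lambda>t. f (y + t *\<^sub>R u)) else if n = 1 then (\<lambda>t. dir_deriv u f (y + t *\<^sub>R u)) else (\<lambda>t. dir_deriv u (dir_deriv u f) (y + t *\<^sub>R u)) :: real \<Rightarrow> real)"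
    have "\<exists>t. 0 < t \<and> t \<le> h \<and> f (y + h *\<^sub>R u) = (\<Sum>m<2. diff m 0 / fact m * h ^ m) + diff 2 t / fact 2 * h ^ 2"
    proof (rule Maclaurin2[OF h(1)])
      show "\<forall>m t. m < 2 \<and> 0 \<le> t \<and> t \<le> h \<longrightarrow> (diff m has_real_derivative diff (Suc m) t) (at t)"
      proof (intro allI impI)
        fix m :: nat and t :: real assume "m < 2 \<and> 0 \<le> t \<and> t \<le> h"
        then have "m = 0 \<or> m = 1" by auto
        then show "(diff m has_real_derivative diff (Suc m) t) (at t)"
          using line_derivative[OF f, where y=y and v=u and t=t] line_derivative[OF smooth_on_dir_deriv[OF f, of u], where y=y and v=u and t=t]
          unfolding diff_def by auto
      qed
    qed (simp add: diff_def)
    then obtain t where t: "0 < t" "t \<le> h"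
      "f (y + h *\<^sub>R u) = f y + dir_deriv u f y * h + dir_deriv u (dir_deriv u f) (y + t *\<^sub>R u) / 2 * h\<^sup>2"
      by (auto simp: diff_def numeral_2_eq_2)
    have close: "dist (y + t *\<^sub>R u) y < min d1 (min d2 d3)"
    proof -
      have "dist (y + t *\<^sub>R u) y \<le> h * (norm w + 1)" using t h nu by (simp add: dist_norm mult_mono)
      also have "\<dots> < min d1 (min d2 d3)" using h(2) unfolding h0_def by (simp add: pos_less_divide_eq add_nonneg_pos)
      finally show ?thesis .
    qed
    have c2: "c\<^sup>2 \<le> 1" "s\<^sup>2 \<le> 1" "\<bar>2 * (c * s)\<bar> \<le> 1"
      using sin_cos_squared_add[of \<theta>] sum_squares_ge_zero[of "c" "s"] unfolding c_def s_def
      by (auto simp: abs_square_le_1 simp flip: sin_double mult.assoc) (metis abs_sin_le_one mult.assoc mult.commute sin_double)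
    have "\<bar>dir_deriv u (dir_deriv u f) (y + t *\<^sub>R u) - dir_deriv u (dir_deriv u f) y\<bar> \<le> e"
    proof -
      have "\<bar>c\<^sup>2 * (W (y + t *\<^sub>R u) - W y)\<bar> \<le> 1 * (e/4)" unfolding abs_mult
        using c2(1) d(4)[of "y + t *\<^sub>R u" y] close by (intro mult_mono) auto
      moreover have "\<bar>2 * (c * s) * (X (y + t *\<^sub>R u) - X y)\<bar> \<le> 1 * (e/4)" unfolding abs_mult[of "2 * (c * s)"]
        using c2(3) d(5)[of "y + t *\<^sub>R u" y] close by (intro mult_mono) auto
      moreover have "\<bar>s\<^sup>2 * (V (y + t *\<^sub>R u) - V y)\<bar> \<le> 1 * (e/4)" unfolding abs_mult
        using c2(2) d(6)[of "y + t *\<^sub>R u" y] close by (intro mult_mono) auto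
      moreover have "\<bar>a + b + c'\<bar> \<le> e" if "\<bar>a\<bar> \<le> 1 * (e/4)" "\<bar>b\<bar> \<le> 1 * (e/4)" "\<bar>c'\<bar> \<le> 1 * (e/4)" for a b c' :: real
        using that e by linarith
      ultimately have "\<bar>c\<^sup>2 * (W (y + t *\<^sub>R u) - W y) + 2 * (c * s) * (X (y + t *\<^sub>R u) - X y) + s\<^sup>2 * (V (y + t *\<^sub>R u) - V y)\<bar> \<le> e"
        by blast
      then show ?thesis unfolding DDu by (simp only: algebra_simps)
    qed
    then have "\<bar>h\<^sup>2 * ((dir_deriv u (dir_deriv u f) (y + t *\<^sub>R u) - dir_deriv u (dir_deriv u f) y) / 2)\<bar> \<le> h\<^sup>2 * e"
      unfolding abs_mult by (intro mult_mono) auto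
    moreover have "f (y + h *\<^sub>R u) - (f y + dir_deriv u f y * h + dir_deriv u (dir_deriv u f) y / 2 * h\<^sup>2)
         = h\<^sup>2 * ((dir_deriv u (dir_deriv u f) (y + t *\<^sub>R u) - dir_deriv u (dir_deriv u f) y) / 2)"
      unfolding t(3) by (simp add: algebra_simps)
    ultimately have "\<bar>f (y + h *\<^sub>R u) - (f y + dir_deriv u f y * h + dir_deriv u (dir_deriv u f) y / 2 * h\<^sup>2)\<bar> \<le> h\<^sup>2 * e"
      by (simp only:)
    moreover have "f y + dir_deriv u f y * h + dir_deriv u (dir_deriv u f) y / 2 * h\<^sup>2 =
      Re (of_real (f y + h\<^sup>2 / 4 * lap w f y)
        + of_real h * Complex (dir_deriv w f y) (- dir_deriv (\<i> *s w) f y) * cis \<theta>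
        + of_real (h\<^sup>2 / 4) * Complex (dir_deriv w (dir_deriv w f) y - dir_deriv (\<i> *s w) (dir_deriv (\<i> *s w) f) y)
           (- 2 * dir_deriv w (dir_deriv (\<i> *s w) f) y) * (cis \<theta>)\<^sup>2)"
    proof -
      \<comment> \<open>Double angles: the part of \<open>c\<^sup>2 * W + s\<^sup>2 * V\<close> that
        is constant in \<open>\<theta>\<close> is half of the Laplacian; together with the factor
        \<open>h\<^sup>2 / 2\<close> this is \<open>h\<^sup>2 / 4 * lap w f y\<close>.\<close>
      have cs: "c\<^sup>2 = 1 - s\<^sup>2" unfolding c_def s_def by (rule cos_squared_eq)
      have "(cis \<theta>)\<^sup>2 = Complex (1 - 2 * s\<^sup>2) (2 * (c * s))"
        using cs by (simp add: c_def s_def complex_eq_iff power2_eq_square)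
      moreover have "cis \<theta> = Complex c s" by (simp add: c_def s_def complex_eq_iff)
      moreover have "lap w f y = W y + V y" unfolding lap_def W_def V_def v_def ..
      ultimately show ?thesis unfolding DDu[of y] Du[of y]
        unfolding v_def[symmetric] W_def[symmetric, THEN fun_cong] V_def[symmetric, THEN fun_cong] X_def[symmetric, THEN fun_cong] cs
        by (simp add: field_simps)
    qed
    ultimately show "\<bar>f (y + (of_real h * cis \<theta>) *s w) - Re (of_real (f y + h\<^sup>2 / 4 * lap w f y)
        + of_real h * Complex (dir_deriv w f y) (- dir_deriv (\<i> *s w) f y) * cis \<theta>
        + of_real (h\<^sup>2 / 4) * Complex (dir_deriv w (dir_deriv w f) y - dir_deriv (\<i> *s w) (dir_deriv (\<i> *s w) f) y)
           (- 2 * dir_deriv w (dir_deriv (\<i> *s w) f) y) * (cis \<theta>)\<^sup>2)\<bar> \<le> h\<^sup>2 * e"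
      unfolding u by simp
  qed
qed

lemma continuous_on_circle_smult:
  fixes f :: "complex^'n \<Rightarrow> 'b::topological_space"
  assumes "continuous_on UNIV f"
  shows "continuous_on S (\<lambda>z. f (y + (a * z) *s w))"
  by (rule continuous_on_compose2[OF assms]) (auto intro!: continuous_intros)

text \<open>The Taylor polynomial in \<open>cis \<theta>\<close> has its value at 0 as mean.
  Uniformity in \<open>y\<close> matters because the estimate is later integrated over
  \<open>y\<close>.\<close>

lemma circle_mean_taylor:
  fixes f :: "complex^'n \<Rightarrow> real"
  assumes f: "smooth_on f UNIV" and C: "compact C" "\<And>z. z \<notin> C \<Longrightarrow> f z = 0" and e: "0 < e"
  obtains t0 where "0 < t0" "\<And>t y. 0 < t \<Longrightarrow> t < t0 \<Longrightarrow>
     \<bar>1 / (2 * pi) * (LINT x:{0..2*pi}|lborel. f (y + (of_real t * cis x) *s w)) - (f y + t\<^sup>2 / 4 * lap w f y)\<bar> \<le> t\<^sup>2 * e"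
proof -
  define T where "T = (\<lambda>t y u. of_real (f y + t\<^sup>2 / 4 * lap w f y)
        + of_real t * Complex (dir_deriv w f y) (- dir_deriv (\<i> *s w) f y) * u
        + of_real (t\<^sup>2 / 4) * Complex (dir_deriv w (dir_deriv w f) y - dir_deriv (\<i> *s w) (dir_deriv (\<i> *s w) f) y)
           (- 2 * dir_deriv w (dir_deriv (\<i> *s w) f) y) * u\<^sup>2)"
  obtain t0 where t0: "0 < t0" and *: "\<And>t y x. 0 < t \<Longrightarrow> t < t0 \<Longrightarrow>
     \<bar>f (y + (of_real t * cis x) *s w) - Re (T t y (cis x))\<bar> \<le> t\<^sup>2 * e"
    using taylor_on_circle[OF f C e, of w] unfolding T_def by blast
  show thesis
  proof (rule that[OF t0])
    fix t y assume t: "0 < t" "t < t0"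
    let ?a = "\<lambda>x. f (y + (of_real t * cis x) *s w)" and ?b = "\<lambda>x. Re (T t y (cis x))"
    have ia: "set_integrable lborel {0..2*pi} ?a"
      by (rule set_integrable_cis[of "\<lambda>u. f (y + (of_real t * u) *s w)"])
         (intro continuous_on_circle_smult smooth_on_continuous f)
    have ib: "set_integrable lborel {0..2*pi} ?b"
      unfolding T_def by (rule set_integrable_cis) (intro continuous_intros)
    have ic: "set_integrable lborel {0..2*pi} (\<lambda>x. t\<^sup>2 * e)"
      by (intro borel_integrable_atLeastAtMost' continuous_intros)
    have b: "(LINT x:{0..2*pi}|lborel. ?b x) = 2 * pi * (f y + t\<^sup>2 / 4 * lap w f y)"
    proof -
      have "(LINT x:{0..2*pi}|lborel. ?b x) = 2 * pi * Re (T t y 0)"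
        unfolding T_def by (rule mean_Re_holomorphic) (auto intro!: continuous_intros holomorphic_intros)
      then show ?thesis unfolding T_def by simp
    qed
    have c: "(LINT x:{0..2*pi}|lborel. t\<^sup>2 * e) = 2 * pi * (t\<^sup>2 * e)" by (simp add: set_integral_const)
    have "(LINT x:{0..2*pi}|lborel. ?a x) \<le> (LINT x:{0..2*pi}|lborel. ?b x + t\<^sup>2 * e)"
      by (rule set_integral_mono[OF ia set_integral_add(1)[OF ib ic]]) (use *[OF t] in \<open>auto simp: abs_le_iff algebra_simps\<close>)
    also have "\<dots> = 2 * pi * (f y + t\<^sup>2 / 4 * lap w f y) + 2 * pi * (t\<^sup>2 * e)"
      using set_integral_add(2)[OF ib ic] b c by simp
    finally have 1: "1 / (2 * pi) * (LINT x:{0..2*pi}|lborel. ?a x) \<le> (f y + t\<^sup>2 / 4 * lap w f y) + t\<^sup>2 * e"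
      by (simp add: pos_divide_le_eq) (simp add: algebra_simps)
    have "(LINT x:{0..2*pi}|lborel. ?b x - t\<^sup>2 * e) \<le> (LINT x:{0..2*pi}|lborel. ?a x)"
      by (rule set_integral_mono[OF set_integral_diff(1)[OF ib ic] ia]) (use *[OF t] in \<open>auto simp: abs_le_iff algebra_simps\<close>)
    moreover have "(LINT x:{0..2*pi}|lborel. ?b x - t\<^sup>2 * e) = 2 * pi * (f y + t\<^sup>2 / 4 * lap w f y) - 2 * pi * (t\<^sup>2 * e)"
      using set_integral_diff(2)[OF ib ic] b c by simp
    ultimately have 2: "(f y + t\<^sup>2 / 4 * lap w f y) - t\<^sup>2 * e \<le> 1 / (2 * pi) * (LINT x:{0..2*pi}|lborel. ?a x)"
      by (simp add: pos_le_divide_eq) (simp add: algebra_simps)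
    show "\<bar>1 / (2 * pi) * (LINT x:{0..2*pi}|lborel. ?a x) - (f y + t\<^sup>2 / 4 * lap w f y)\<bar> \<le> t\<^sup>2 * e"
      using 1 2 by (simp only: abs_le_iff) linarith
  qed
qed

section \<open>A family of smooth bump functions\<close>

text \<open>The negative powers of \<open>t\<close> are there to make the linear span of the family
  closed under differentiation; \<open>k = 0\<close> is the usual flat function.\<close>

definition bump :: "nat \<Rightarrow> real \<Rightarrow> real" where
  "bump k t = (if 0 < t then exp (- (1 / t)) / t ^ k else 0)"

text \<open>The substitution of the inverse of \<open>t\<close> reduces this to the decay of a power
  divided by the exponential.\<close>

lemma bump_tendsto_0: "(bump k \<longlongrightarrow> 0) (at 0)"
proof -
  have r: "(bump k \<longlongrightarrow> 0) (at_right 0)"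
  proof -
    have "((\<lambda>x::real. x ^ k / exp x) \<longlongrightarrow> 0) at_top" by (rule tendsto_power_div_exp_0)
    then have "((\<lambda>t::real. (inverse t) ^ k / exp (inverse t)) \<longlongrightarrow> 0) (at_right 0)"
      by (rule filterlim_compose[OF _ filterlim_inverse_at_top_right])
    then show ?thesis
      by (rule Lim_transform_eventually)
         (auto simp: eventually_at_filter bump_def exp_minus field_simps intro!: always_eventually)
  qed
  have l: "(bump k \<longlongrightarrow> 0) (at_left 0)"
    by (rule Lim_transform_eventually[OF tendsto_const])
       (auto simp: eventually_at_filter bump_def intro!: always_eventually)
  from l r show ?thesis by (simp add: filterlim_split_at)
qed

lemma bump_deriv: "(bump k has_real_derivative (bump (k + 2) t - of_nat k * bump (k + 1) t)) (at t)"
proof -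
  consider "t > 0" | "t < 0" | "t = 0" by linarith
  then show ?thesis
  proof cases
    case 1
    have "((\<lambda>t. exp (- (1 / t)) / t ^ k) has_real_derivative (bump (k + 2) t - of_nat k * bump (k + 1) t)) (at t)"
    proof (cases k)
      case (Suc n)
      have *: "((\<lambda>t::real. t ^ Suc n) has_real_derivative (1 + real n) * t ^ n) (at t)"
        using DERIV_pow[of "Suc n" t] by simp
      have "((\<lambda>t. exp (- (1 / t))) has_real_derivative exp (- (1 / t)) * (1 / t\<^sup>2)) (at t)"
        using 1 by (auto intro!: derivative_eq_intros simp: power2_eq_square)
      from DERIV_divide[OF this *] show ?thesis unfolding Suc
        by (rule DERIV_cong) (use 1 in \<open>auto simp: bump_def field_simps power2_eq_square\<close>)
    qed (use 1 in \<open>auto intro!: derivative_eq_intros simp: bump_def field_simps power2_eq_square\<close>)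
    then show ?thesis
      by (rule has_field_derivative_transform_within_open[of _ _ _ "{0<..}"]) (use 1 in \<open>auto simp: bump_def\<close>)
  next
    case 2
    have "((\<lambda>t. 0) has_real_derivative (bump (k + 2) t - of_nat k * bump (k + 1) t)) (at t)"
      using 2 by (simp add: bump_def)
    then show ?thesis
      by (rule has_field_derivative_transform_within_open[of _ _ _ "{..<0}"]) (use 2 in \<open>auto simp: bump_def\<close>)
  next
    case 3
    have "((\<lambda>h. (bump k h - bump k 0) / (h - 0)) \<longlongrightarrow> 0) (at 0)"
      by (rule Lim_transform_eventually[OF bump_tendsto_0[of "Suc k"]])
         (auto simp: eventually_at_filter bump_def intro!: always_eventually)
    then show ?thesis using 3 unfolding has_field_derivative_iff by (simp add: bump_def)
  qed
qed

text \<open>A class of functions closed under directional derivatives: membership alone yields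
  smoothness, without formulas for higher derivatives. It contains the mollifiers and the
  polynomials in the real coordinates.\<close>

inductive_set bump_class :: "complex^'n \<Rightarrow> real \<Rightarrow> (complex^'n \<Rightarrow> real) set" for z e where
  one: "(\<lambda>y. 1) \<in> bump_class z e"
| bump: "(\<lambda>y. bump k (e - (norm (y - z))\<^sup>2)) \<in> bump_class z e"
| inner: "f \<in> bump_class z e \<Longrightarrow> (\<lambda>y. (y \<bullet> v) * f y) \<in> bump_class z e"
| scale: "f \<in> bump_class z e \<Longrightarrow> (\<lambda>y. c * f y) \<in> bump_class z e"
| add: "f \<in> bump_class z e \<Longrightarrow> g \<in> bump_class z e \<Longrightarrow> (\<lambda>y. f y + g y) \<in> bump_class z e"

lemma bump_class_deriv:
  assumes "f \<in> bump_class z e"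
  shows "\<exists>f'. (\<forall>y. (f has_derivative f' y) (at y)) \<and> (\<forall>v. (\<lambda>y. f' y v) \<in> bump_class z e)"
  using assms
proof induction
  case one
  have "(\<lambda>y. 0 * 1) \<in> bump_class z e" by (intro bump_class.intros)
  then show ?case by (intro exI[of _ "\<lambda>_ _. 0"]) auto
next
  case (bump k)
  define b' where "b' = (\<lambda>t. bump (k + 2) t - of_nat k * bump (k + 1) t)"
  have "((\<lambda>y. bump k (e - (norm (y - z))\<^sup>2)) has_derivative (\<lambda>v. b' (e - (norm (y - z))\<^sup>2) * (- 2 * ((y - z) \<bullet> v)))) (at y)" for y
  proof -
    have "((\<lambda>y. e - (norm (y - z))\<^sup>2) has_derivative (\<lambda>v. - 2 * ((y - z) \<bullet> v))) (at y)"
      unfolding power2_norm_eq_inner by (auto intro!: derivative_eq_intros simp: inner_commute)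
    from has_derivative_compose[OF this bump_deriv[of k, unfolded has_field_derivative_def]]
    show ?thesis unfolding b'_def .
  qed
  moreover have "(\<lambda>y. b' (e - (norm (y - z))\<^sup>2) * (- 2 * ((y - z) \<bullet> v))) \<in> bump_class z e" for v
  proof -
    have "(\<lambda>y. bump (k + 2) (e - (norm (y - z))\<^sup>2) + (- of_nat k) * bump (k + 1) (e - (norm (y - z))\<^sup>2)) \<in> bump_class z e"
      by (intro bump_class.intros)
    then have b: "(\<lambda>y. b' (e - (norm (y - z))\<^sup>2)) \<in> bump_class z e" unfolding b'_def by simp
    have "(\<lambda>y. (-2) * ((y \<bullet> v) * b' (e - (norm (y - z))\<^sup>2)) + (2 * (z \<bullet> v)) * b' (e - (norm (y - z))\<^sup>2)) \<in> bump_class z e"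
      by (intro bump_class.intros b)
    then show ?thesis by (simp add: inner_diff_left algebra_simps)
  qed
  ultimately show ?case by (intro exI[of _ "\<lambda>y v. b' (e - (norm (y - z))\<^sup>2) * (- 2 * ((y - z) \<bullet> v))"]) auto
next
  case (inner f v)
  then obtain f' where f': "\<And>y. (f has_derivative f' y) (at y)" "\<And>u. (\<lambda>y. f' y u) \<in> bump_class z e" by blast
  have "((\<lambda>y. (y \<bullet> v) * f y) has_derivative (\<lambda>u. (y \<bullet> v) * f' y u + (u \<bullet> v) * f y)) (at y)" for y
    by (intro has_derivative_mult f' has_derivative_inner_left has_derivative_ident)
  moreover have "(\<lambda>y. (y \<bullet> v) * f' y u + (u \<bullet> v) * f y) \<in> bump_class z e" for u
    by (intro bump_class.intros f' inner.hyps)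
  ultimately show ?case by (intro exI[of _ "\<lambda>y u. (y \<bullet> v) * f' y u + (u \<bullet> v) * f y"]) auto
next
  case (scale f c)
  then obtain f' where f': "\<And>y. (f has_derivative f' y) (at y)" "\<And>u. (\<lambda>y. f' y u) \<in> bump_class z e" by blast
  then show ?case by (intro exI[of _ "\<lambda>y u. c * f' y u"]) (auto intro!: bump_class.intros has_derivative_mult_right)
next
  case (add f g)
  then obtain f' g' where f': "\<And>y. (f has_derivative f' y) (at y)" "\<And>u. (\<lambda>y. f' y u) \<in> bump_class z e"
    and g': "\<And>y. (g has_derivative g' y) (at y)" "\<And>u. (\<lambda>y. g' y u) \<in> bump_class z e" by metis
  then show ?case by (intro exI[of _ "\<lambda>y u. f' y u + g' y u"]) (auto intro!: bump_class.intros has_derivative_add)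
qed

lemma bump_class_smooth:
  assumes "f \<in> bump_class z e" shows "smooth_on f S"
  unfolding smooth_on_def
proof
  fix k show "times_continuously_differentiable_on k f S" using assms
  proof (induction k arbitrary: f)
    case 0
    then obtain f' where "\<And>y. (f has_derivative f' y) (at y)" using bump_class_deriv by blast
    then have "continuous_on S f" by (meson continuous_at_imp_continuous_on has_derivative_continuous)
    then show ?case by simp
  next
    case (Suc k)
    then obtain f' where f': "\<And>y. (f has_derivative f' y) (at y)" "\<And>u. (\<lambda>y. f' y u) \<in> bump_class z e"
      using bump_class_deriv by blast
    have "frechet_derivative f (at y) = f' y" for y using frechet_derivative_at[OF f'(1)] by simp
    then show ?case using Suc.IH[OF f'(2)] f'(1) by (auto simp: differentiable_def)
  qed
qed

section \<open>Wirtinger derivatives of test functions\<close>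

lemma has_derivative_of_real_smooth:
  fixes f :: "complex^'n \<Rightarrow> real"
  assumes "smooth_on f UNIV"
  shows "frechet_derivative (\<lambda>w. complex_of_real (f w)) (at z) v = of_real (dir_deriv v f z)"
proof -
  have "((\<lambda>w. complex_of_real (f w)) has_derivative (\<lambda>v. of_real (dir_deriv v f z))) (at z)"
    by (intro has_derivative_of_real has_derivative_smooth[OF assms]) auto
  from fun_cong[OF frechet_derivative_at[OF this], of v] show ?thesis by simp
qed

lemma partial_z_of_Complex:
  fixes a b :: "complex^'n \<Rightarrow> real"
  assumes "smooth_on a UNIV" "smooth_on b UNIV"
  shows "partial_z j (\<lambda>z. (of_real (a z) + \<i> * of_real (b z)) / 2) z =
     ((of_real (dir_deriv (axis j 1) a z) + \<i> * of_real (dir_deriv (axis j 1) b z))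
       - \<i> * (of_real (dir_deriv (axis j \<i>) a z) + \<i> * of_real (dir_deriv (axis j \<i>) b z))) / 4"
proof -
  have "((\<lambda>z. (of_real (a z) + \<i> * of_real (b z)) / 2) has_derivative
     (\<lambda>v. (of_real (dir_deriv v a z) + \<i> * of_real (dir_deriv v b z)) / 2)) (at z)"
    by (intro bounded_linear.has_derivative[OF bounded_linear_divide] has_derivative_add has_derivative_mult_right has_derivative_of_real
        has_derivative_smooth[OF assms(1) UNIV_I] has_derivative_smooth[OF assms(2) UNIV_I])
  from fun_cong[OF frechet_derivative_at[OF this]]
  have "frechet_derivative (\<lambda>z. (of_real (a z) + \<i> * of_real (b z)) / 2) (at z) v
     = (of_real (dir_deriv v a z) + \<i> * of_real (dir_deriv v b z)) / 2" for v by simp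
  note d = this
  show ?thesis unfolding partial_z_def d by (simp add: field_simps)
qed

lemma partial_z_partial_zbar_real:
  fixes f :: "complex^'n \<Rightarrow> real"
  assumes f: "smooth_on f UNIV"
  shows "partial_z j (partial_zbar k (\<lambda>w. of_real (f w))) z =
    Complex (dir_deriv (axis j 1) (dir_deriv (axis k 1) f) z + dir_deriv (axis j \<i>) (dir_deriv (axis k \<i>) f) z)
      (dir_deriv (axis j 1) (dir_deriv (axis k \<i>) f) z - dir_deriv (axis j \<i>) (dir_deriv (axis k 1) f) z) / 4"
proof -
  have eq: "partial_zbar k (\<lambda>w. complex_of_real (f w)) = (\<lambda>z. (of_real (dir_deriv (axis k 1) f z) + \<i> * of_real (dir_deriv (axis k \<i>) f z)) / 2)"
    unfolding partial_zbar_def has_derivative_of_real_smooth[OF f] ..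
  show ?thesis unfolding eq
    by (subst partial_z_of_Complex[OF smooth_on_dir_deriv[OF f] smooth_on_dir_deriv[OF f]])
       (simp add: complex_eq_iff)
qed

lemma vec_real_decomp: "u = (\<Sum>j\<in>UNIV. Re (u $ j) *\<^sub>R axis j 1 + Im (u $ j) *\<^sub>R axis j \<i>)" for u :: "complex^'n"
  by (simp add: vec_eq_iff axis_def complex_eq_iff if_distrib[of "\<lambda>x. _ *\<^sub>R x"] if_distrib[of Re] if_distrib[of Im] sum.If_cases cong: if_cong)

text \<open>The Levi form in direction \<open>u\<close> is a quarter of the Laplacian along the line
  spanned by \<open>u\<close>. The factor 2 is the one of dd^c = 2i del delbar.\<close>

lemma levi_sum:
  fixes f :: "complex^'n \<Rightarrow> real"
  assumes f: "smooth_on f UNIV"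
  shows "(\<Sum>j\<in>UNIV. \<Sum>k\<in>UNIV. u $ j * cnj (u $ k) * (2 * partial_z j (partial_zbar k (\<lambda>w. of_real (f w))) z))
     = of_real (lap u f z / 2)"
proof -
  define a where "a = (\<lambda>j. Re (u $ j))"
  define b where "b = (\<lambda>j. Im (u $ j))"
  define A where "A = (\<lambda>j k. dir_deriv (axis j 1) (dir_deriv (axis k 1) f) z)"
  define B where "B = (\<lambda>j k. dir_deriv (axis j 1) (dir_deriv (axis k \<i>) f) z)"
  define C where "C = (\<lambda>j k. dir_deriv (axis j \<i>) (dir_deriv (axis k 1) f) z)"
  define D where "D = (\<lambda>j k. dir_deriv (axis j \<i>) (dir_deriv (axis k \<i>) f) z)"
  have symA: "A j k = A k j" and symD: "D j k = D k j" and symB: "B j k = C k j" for j k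
    unfolding A_def B_def C_def D_def by (rule dir_deriv_commute[OF f])+
  let ?I = "UNIV :: ('n \<times> bool) set"
  \<comment> \<open>The real basis of the space, indexed so that \<open>True\<close> marks real and
    \<open>False\<close> imaginary directions.\<close>
  define e where "e = (\<lambda>(j, t). axis j (if t then 1 else \<i>) :: complex^'n)"
  have sumI: "(\<Sum>i\<in>?I. g i) = (\<Sum>j\<in>UNIV. g (j, True) + g (j, False))" for g :: "'n \<times> bool \<Rightarrow> 'x::comm_monoid_add"
  proof -
    have "(\<Sum>i\<in>?I. g i) = (\<Sum>j\<in>UNIV. \<Sum>t\<in>UNIV. g (j, t))" unfolding sum.cartesian_product by simp
    then show ?thesis by (simp add: UNIV_bool add.commute)
  qed
  have x: "u = (\<Sum>i\<in>?I. (case i of (j, t) \<Rightarrow> if t then a j else b j) *\<^sub>R e i)"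
    unfolding sumI using vec_real_decomp[of u] by (simp add: e_def a_def b_def)
  have ix: "\<i> *s u = (\<Sum>i\<in>?I. (case i of (j, t) \<Rightarrow> if t then - b j else a j) *\<^sub>R e i)"
    unfolding sumI using vec_real_decomp[of "\<i> *s u"] by (simp add: e_def a_def b_def)
  have 1: "dir_deriv u (dir_deriv u f) z = (\<Sum>j\<in>UNIV. \<Sum>k\<in>UNIV. a j * a k * A j k + a j * b k * B j k + b j * a k * C j k + b j * b k * D j k)"
    by (subst (1 2) x, subst dir_deriv2_sum[OF f]) (simp_all add: sumI e_def A_def B_def C_def D_def sum.distrib sum_subtractf sum_negf algebra_simps)
  have 2: "dir_deriv (\<i> *s u) (dir_deriv (\<i> *s u) f) z = (\<Sum>j\<in>UNIV. \<Sum>k\<in>UNIV. b j * b k * A j k - b j * a k * B j k - a j * b k * C j k + a j * a k * D j k)"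
    by (subst (1 2) ix, subst dir_deriv2_sum[OF f]) (simp_all add: sumI e_def A_def B_def C_def D_def sum.distrib sum_subtractf sum_negf algebra_simps)
  define S where "S = (\<Sum>j\<in>UNIV. \<Sum>k\<in>UNIV. u $ j * cnj (u $ k) * (2 * partial_z j (partial_zbar k (\<lambda>w. of_real (f w))) z))"
  have S: "S = (\<Sum>j\<in>UNIV. \<Sum>k\<in>UNIV. Complex (a j) (b j) * cnj (Complex (a k) (b k)) * (Complex (A j k + D j k) (B j k - C j k) / 2))"
    unfolding S_def partial_z_partial_zbar_real[OF f] a_def b_def A_def B_def C_def D_def
    by (intro sum.cong refl) simp
  have re: "Re S = (dir_deriv u (dir_deriv u f) z + dir_deriv (\<i> *s u) (dir_deriv (\<i> *s u) f) z) / 2"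
    unfolding S 1 2 Re_sum sum.distrib[symmetric] sum_divide_distrib
    by (intro sum.cong refl) (simp add: field_simps)
  \<comment> \<open>The terms of the imaginary part are antisymmetric in \<open>j\<close> and
    \<open>k\<close>, by symmetry of second derivatives, so that they cancel in the sum.\<close>
  define X where "X = (\<lambda>j k. ((b j * a k - a j * b k) * (A j k + D j k) + (a j * a k + b j * b k) * (B j k - C j k)) / 2)"
  have im: "Im S = (\<Sum>j\<in>UNIV. \<Sum>k\<in>UNIV. X j k)"
    unfolding S X_def Im_sum by (intro sum.cong refl) (simp add: field_simps)
  have X: "X k j = - X j k" for j k
    unfolding X_def symA[of k j] symD[of k j] symB[of k j] symB[of j k, symmetric] by (simp add: field_simps)
  have "(\<Sum>j\<in>UNIV. \<Sum>k\<in>UNIV. X j k) = (\<Sum>j\<in>UNIV. \<Sum>k\<in>UNIV. X k j)" by (rule sum.swap)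
  also have "\<dots> = (\<Sum>j\<in>UNIV. \<Sum>k\<in>UNIV. - X j k)" by (intro sum.cong refl X)
  also have "\<dots> = - (\<Sum>j\<in>UNIV. \<Sum>k\<in>UNIV. X j k)" by (simp only: sum_negf)
  finally have "(\<Sum>j\<in>UNIV. \<Sum>k\<in>UNIV. X j k) = - (\<Sum>j\<in>UNIV. \<Sum>k\<in>UNIV. X j k)" .
  then have "Im S = 0" unfolding im by simp
  then show ?thesis unfolding S_def[symmetric] complex_eq_iff re lap_def by simp
qed

section \<open>Averages of plurisubharmonic functions\<close>

lemma nn_integral_lborel_translate:
  fixes f :: "'a::euclidean_space \<Rightarrow> ennreal"
  assumes [measurable]: "f \<in> borel_measurable borel"
  shows "(\<integral>\<^sup>+x. f (c + x) \<partial>lborel) = (\<integral>\<^sup>+x. f x \<partial>lborel)"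
proof -
  have "(\<integral>\<^sup>+x. f x \<partial>lborel) = (\<integral>\<^sup>+x. f x \<partial>distr lborel borel ((+) c))" by (simp add: lborel_distr_plus)
  also have "\<dots> = (\<integral>\<^sup>+x. f (c + x) \<partial>lborel)" by (subst nn_integral_distr) auto
  finally show ?thesis by simp
qed

lemma nn_integral_lborel_reflect:
  fixes f :: "'a::euclidean_space \<Rightarrow> ennreal"
  assumes [measurable]: "f \<in> borel_measurable borel"
  shows "(\<integral>\<^sup>+x. f (c - x) \<partial>lborel) = (\<integral>\<^sup>+x. f x \<partial>lborel)"
proof -
  have "lborel = density (distr lborel borel (\<lambda>x::'a. c + (-1) *\<^sub>R x)) (\<lambda>_. ennreal (\<bar>-1\<bar> ^ DIM('a)))"
    by (rule lborel_affine) simp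
  then have "lborel = distr lborel borel (\<lambda>x::'a. c - x)" by (simp add: density_1)
  then have "(\<integral>\<^sup>+x. f x \<partial>lborel) = (\<integral>\<^sup>+x. f x \<partial>distr lborel borel (\<lambda>x::'a. c - x))" by simp
  also have "\<dots> = (\<integral>\<^sup>+x. f (c - x) \<partial>lborel)" by (subst nn_integral_distr) auto
  finally show ?thesis by simp
qed

lemma borel_measurable_cis [measurable]:
  "f \<in> borel_measurable M \<Longrightarrow> (\<lambda>x. cis (f x)) \<in> borel_measurable M"
  by (rule borel_measurable_continuous_on[of cis]) (intro continuous_intros)

lemma borel_measurable_smult [measurable]:
  fixes g :: "'a \<Rightarrow> complex^'n"
  assumes "f \<in> borel_measurable M" "g \<in> borel_measurable M"
  shows "(\<lambda>x. f x *s g x) \<in> borel_measurable M"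
  by (rule borel_measurable_continuous_Pair[OF assms]) (intro continuous_intros)

text \<open>Both sides of this identity are translation invariant integrals, hence proportional, and they
  agree on the indicator function of the unit ball.\<close>

lemma nn_integral_lborel_rotate:
  fixes f :: "complex^'n \<Rightarrow> ennreal"
  assumes [measurable]: "g \<in> borel_measurable borel"
  shows "(\<integral>\<^sup>+x. g (cis t *s x) \<partial>lborel) = (\<integral>\<^sup>+x. g (x::complex^'n) \<partial>lborel)"
proof -
  let ?T = "\<lambda>x::complex^'n. cis t *s x"
  let ?B = "ball 0 1 :: (complex^'n) set"
  have [measurable]: "?B \<in> sets borel" by simp
  define \<beta> where "\<beta> = emeasure lborel ?B"
  have \<beta>: "\<beta> \<noteq> 0" "\<beta> \<noteq> \<infinity>"
  proof -
    have "\<beta> < \<infinity>" unfolding \<beta>_def by (rule emeasure_bounded_finite) auto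
    then show "\<beta> \<noteq> \<infinity>" by simp
    show "\<beta> \<noteq> 0" unfolding \<beta>_def using open_not_negligible[of ?B] by (auto simp: negligible_iff_null_sets null_sets_def)
  qed
  have inv: "(\<integral>\<^sup>+x. F (a + ?T x) \<partial>lborel) = (\<integral>\<^sup>+x. F (?T x) \<partial>lborel)" if [measurable]: "F \<in> borel_measurable borel" for F :: "complex^'n \<Rightarrow> ennreal" and a
  proof -
    have "a + ?T x = ?T (cis (-t) *s a + x)" for x
      by (simp add: vector_add_ldistrib vector_smult_assoc cis_mult)
    then show ?thesis using nn_integral_lborel_translate[of "\<lambda>x. F (?T x)" "cis (-t) *s a"] by simp
  qed
  \<comment> \<open>One double integral is evaluated in two orders: \<open>\<beta>\<close> appears
    once as volume of the rotated ball, which is the ball itself, and once as volume of a reflected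
    and translated ball.\<close>
  have "\<beta> * (\<integral>\<^sup>+x. g x \<partial>lborel) = (\<integral>\<^sup>+x. indicator ?B (?T x) * (\<integral>\<^sup>+y. g (?T x + y) \<partial>lborel) \<partial>lborel)"
  proof -
    have "(\<integral>\<^sup>+x. indicator ?B (?T x) * (\<integral>\<^sup>+y. g (?T x + y) \<partial>lborel) \<partial>lborel) = (\<integral>\<^sup>+x. indicator ?B x * (\<integral>\<^sup>+y. g y \<partial>lborel) \<partial>lborel)"
      by (simp add: nn_integral_lborel_translate indicator_def norm_smult)
    also have "\<dots> = (\<integral>\<^sup>+x. indicator ?B x \<partial>(lborel :: (complex^'n) measure)) * (\<integral>\<^sup>+y. g y \<partial>lborel)"
      by (rule nn_integral_multc, rule borel_measurable_indicator) simp
    finally show ?thesis by (simp add: \<beta>_def)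
  qed
  also have "\<dots> = (\<integral>\<^sup>+x. (\<integral>\<^sup>+y. indicator ?B (?T x) * g (?T x + y) \<partial>lborel) \<partial>lborel)"
    by (simp add: nn_integral_cmult)
  also have "\<dots> = (\<integral>\<^sup>+y. (\<integral>\<^sup>+x. indicator ?B (?T x) * g (?T x + y) \<partial>lborel) \<partial>lborel)"
    by (rule lborel_pair.Fubini') measurable
  also have "\<dots> = (\<integral>\<^sup>+y. (\<integral>\<^sup>+x. indicator ?B (?T x - y) * g (?T x) \<partial>lborel) \<partial>lborel)"
    using inv[of "\<lambda>x. indicator ?B (x - y) * g x" y for y] by (simp add: add.commute)
  also have "\<dots> = (\<integral>\<^sup>+x. (\<integral>\<^sup>+y. indicator ?B (?T x - y) * g (?T x) \<partial>lborel) \<partial>lborel)"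
    by (rule lborel_pair.Fubini') measurable
  also have "\<dots> = (\<integral>\<^sup>+x. \<beta> * g (?T x) \<partial>lborel)"
    using nn_integral_lborel_reflect[of "indicator ?B" "?T x" for x] by (simp add: nn_integral_multc \<beta>_def)
  also have "\<dots> = \<beta> * (\<integral>\<^sup>+x. g (?T x) \<partial>lborel)" by (simp add: nn_integral_cmult)
  finally show ?thesis using \<beta> by (simp add: ennreal_mult_cancel_left)
qed

text \<open>With the value \<open>\<infinity>\<close> outside of an open \<open>X\<close> the
  sublevel sets stay open, so that the extension is Borel on the whole space.\<close>

definition top_ext :: "'a set \<Rightarrow> ('a \<Rightarrow> ereal) \<Rightarrow> 'a \<Rightarrow> ereal" where
  "top_ext X u x = (if x \<in> X then u x else \<infinity>)"

lemma borel_measurable_top_ext: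
  assumes "open X" "usc_on u X"
  shows "top_ext X u \<in> borel_measurable borel"
proof (rule borel_measurableI_less)
  fix t
  have "{x \<in> space borel. top_ext X u x < t} = {x \<in> X. u x < t}" by (auto simp: top_ext_def)
  moreover have "open {x \<in> X. u x < t}" using assms usc_on_open_iff by blast
  ultimately show "{x \<in> space borel. top_ext X u x < t} \<in> sets borel" by simp
qed

text \<open>Lets the difference of integrals in \<open>circle_mean\<close> be replaced by one
  integral of the nonnegative function \<open>C - u\<close>.\<close>

lemma e2ennreal_diff_cases:
  assumes "0 \<le> C" "x \<le> ereal C"
  shows "e2ennreal (ereal C - x) + e2ennreal x = ennreal C + e2ennreal (- x)"
proof (cases x)
  case (real r)
  show ?thesis
  proof (cases "0 \<le> r")
    case True
    then show ?thesis using assms real by (simp add: e2ennreal_ereal ennreal_plus[symmetric] e2ennreal_neg ennreal_neg)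
  next
    case False
    then show ?thesis using assms real by (simp add: e2ennreal_ereal ennreal_plus[symmetric] e2ennreal_neg ennreal_neg)
  qed
qed (use assms in \<open>auto simp: e2ennreal_neg\<close>)

text \<open>For \<open>C - u\<close> the sub-mean value inequality involves a single integral with
  values in [0, \<infinity>], to which Tonelli's theorem applies even if \<open>u\<close> takes the
  value \<open>-\<infinity>\<close>.\<close>

lemma psh_super_mean:
  assumes X: "open X" and psh: "psh_on u X" and disc: "\<And>x. norm x \<le> 1 \<Longrightarrow> z + x *s w \<in> X"
    and C: "0 \<le> C" "\<And>t. u (z + cis t *s w) \<le> ereal C"
  shows "(\<integral>\<^sup>+t\<in>{0..2*pi}. e2ennreal (ereal C - top_ext X u (z + cis t *s w)) \<partial>lborel) \<le> ennreal (2 * pi) * e2ennreal (ereal C - u z)"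
proof -
  have usc: "usc_on u X" using psh unfolding psh_on_def by blast
  note [measurable] = borel_measurable_top_ext[OF X usc]
  define f where "f = (\<lambda>t. top_ext X u (z + cis t *s w))"
  have fm[measurable]: "f \<in> borel_measurable borel" unfolding f_def by measurable
  have fu: "f t = u (z + cis t *s w)" for t unfolding f_def top_ext_def using disc[of "cis t"] by simp
  have fC: "f t \<le> ereal C" for t using C(2) fu by simp
  define P N I where "P = (\<integral>\<^sup>+t\<in>{0..2*pi}. e2ennreal (f t) \<partial>lborel)"
    and "N = (\<integral>\<^sup>+t\<in>{0..2*pi}. e2ennreal (- f t) \<partial>lborel)"
    and "I = (\<integral>\<^sup>+t\<in>{0..2*pi}. e2ennreal (ereal C - f t) \<partial>lborel)"
  have const: "(\<integral>\<^sup>+t\<in>{0..2*pi}. ennreal C \<partial>lborel) = ennreal (2 * pi * C)"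
    using C(1) by (simp add: nn_integral_cmult_indicator ennreal_mult[symmetric] mult.commute)
  have "I + P = (\<integral>\<^sup>+t\<in>{0..2*pi}. (e2ennreal (ereal C - f t) + e2ennreal (f t)) \<partial>lborel)"
    unfolding I_def P_def distrib_right by (rule nn_integral_add[symmetric]) measurable
  also have "\<dots> = (\<integral>\<^sup>+t\<in>{0..2*pi}. (ennreal C + e2ennreal (- f t)) \<partial>lborel)"
    using e2ennreal_diff_cases[OF C(1) fC] by simp
  also have "\<dots> = ennreal (2 * pi * C) + N"
    unfolding N_def distrib_right const[symmetric] by (rule nn_integral_add) measurable
  finally have eq: "I + P = ennreal (2 * pi * C) + N" .
  have "P \<le> (\<integral>\<^sup>+t\<in>{0..2*pi}. ennreal C \<partial>lborel)" unfolding P_def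
    using fC by (intro nn_integral_mono mult_right_mono) (auto simp flip: e2ennreal_ereal intro: e2ennreal_mono)
  then have Pfin: "P < \<infinity>" unfolding const using le_less_trans by fastforce
  then obtain p where p: "P = ennreal p" "0 \<le> p" by (metis ennreal_cases infinity_ennreal_def less_irrefl)
  have uz: "u z \<le> ereal (1 / (2 * pi)) * (enn2ereal P - enn2ereal N)"
    using psh disc unfolding psh_on_def circle_mean_def P_def N_def fu by auto
  have "I \<le> ennreal (2 * pi) * e2ennreal (ereal C - u z)"
  proof (cases "u z")
    case PInf
    then show ?thesis using psh disc[of 0] unfolding psh_on_def by auto
  next
    case MInf
    then show ?thesis by (simp add: ennreal_mult_top)
  next
    case (real r)
    have "N \<noteq> \<infinity>"
    proof
      assume "N = \<infinity>"
      then have "u z \<le> -\<infinity>" using uz p by simp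
      then show False using real by simp
    qed
    then obtain n where n: "N = ennreal n" "0 \<le> n" by (cases N) auto
    have "r \<le> (p - n) / (2 * pi)" using uz p n unfolding real by (simp add: enn2ereal_ennreal)
    then have r: "2 * pi * r \<le> p - n" by (simp add: pos_le_divide_eq algebra_simps)
    have "I \<noteq> \<infinity>" using eq n p by (metis ennreal_add_eq_top ennreal_neq_top infinity_ennreal_def)
    then obtain i where i: "I = ennreal i" "0 \<le> i" by (cases I) auto
    have "ennreal (i + p) = ennreal (2 * pi * C + n)" using eq i p n C(1) by (simp add: ennreal_plus)
    then have "i + p = 2 * pi * C + n" using i p n C(1) by (subst (asm) ennreal_inj) auto
    then have "i \<le> 2 * pi * (C - r)" using r by (simp add: algebra_simps)
    then have "ennreal i \<le> ennreal (2 * pi * (C - r))" by (rule ennreal_leI)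
    also have "\<dots> = ennreal (2 * pi) * ennreal (C - r)" by (rule ennreal_mult') simp
    finally show ?thesis unfolding i(1) real by (simp add: e2ennreal_ereal)
  qed
  then show ?thesis unfolding I_def f_def .
qed

text \<open>Rotation invariance allows averaging over the circles through \<open>x\<close> in
  complex lines; after exchanging the integrals the circle inequality applies for each
  \<open>x\<close>. It is used for indicators of balls and for mollifiers.\<close>

lemma psh_kernel_mean:
  fixes u :: "complex^'n \<Rightarrow> ereal"
  assumes X: "open X" and psh: "psh_on u X" and ball: "cball z e \<subseteq> X"
    and C: "0 \<le> C" "\<And>x. x \<in> cball z e \<Longrightarrow> u x \<le> ereal C"
    and [measurable]: "\<kappa> \<in> borel_measurable borel" and supp: "\<And>x. e < norm x \<Longrightarrow> \<kappa> x = 0"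
    and rot: "\<And>\<theta> x. \<kappa> (cis \<theta> *s x) = \<kappa> x"
  shows "(\<integral>\<^sup>+x. \<kappa> x * e2ennreal (ereal C - top_ext X u (z + x)) \<partial>lborel) \<le> e2ennreal (ereal C - u z) * (\<integral>\<^sup>+x. \<kappa> x \<partial>lborel)"
proof -
  have usc: "usc_on u X" using psh unfolding psh_on_def by blast
  note [measurable] = borel_measurable_top_ext[OF X usc]
  define N where "N = (\<lambda>x. e2ennreal (ereal C - top_ext X u x))"
  have [measurable]: "N \<in> borel_measurable borel" unfolding N_def by measurable
  have [measurable]: "{0..2*pi} \<in> sets borel" by simp
  let ?J = "\<integral>\<^sup>+x. \<kappa> x * N (z + x) \<partial>lborel"
  have J: "?J = (\<integral>\<^sup>+x. \<kappa> x * N (z + cis \<theta> *s x) \<partial>lborel)" for \<theta>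
    using nn_integral_lborel_rotate[of "\<lambda>x. \<kappa> x * N (z + x)" \<theta>] by (simp add: rot)
  have "ennreal (2 * pi) * ?J = (\<integral>\<^sup>+\<theta>\<in>{0..2*pi}. ?J \<partial>lborel)"
    by (subst nn_integral_cmult_indicator) (auto simp: mult.commute)
  also have "\<dots> = (\<integral>\<^sup>+\<theta>. (\<integral>\<^sup>+x. \<kappa> x * N (z + cis \<theta> *s x) * indicator {0..2*pi} \<theta> \<partial>lborel) \<partial>lborel)"
    by (intro nn_integral_cong) (subst J, subst nn_integral_multc[symmetric], measurable)
  also have "\<dots> = (\<integral>\<^sup>+x. (\<integral>\<^sup>+\<theta>. \<kappa> x * N (z + cis \<theta> *s x) * indicator {0..2*pi} \<theta> \<partial>lborel) \<partial>lborel)"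
    by (rule lborel_pair.Fubini') measurable
  also have "\<dots> \<le> (\<integral>\<^sup>+x. (ennreal (2 * pi) * e2ennreal (ereal C - u z)) * \<kappa> x \<partial>lborel)"
  proof (intro nn_integral_mono)
    fix x :: "complex^'n"
    have eq: "(\<integral>\<^sup>+\<theta>. \<kappa> x * N (z + cis \<theta> *s x) * indicator {0..2*pi} \<theta> \<partial>lborel) = \<kappa> x * (\<integral>\<^sup>+\<theta>\<in>{0..2*pi}. N (z + cis \<theta> *s x) \<partial>lborel)"
      by (subst nn_integral_cmult[symmetric]) (auto simp: mult.assoc)
    show "(\<integral>\<^sup>+\<theta>. \<kappa> x * N (z + cis \<theta> *s x) * indicator {0..2*pi} \<theta> \<partial>lborel) \<le> (ennreal (2 * pi) * e2ennreal (ereal C - u z)) * \<kappa> x"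
    proof (cases "norm x \<le> e")
      case True
      have sub: "z + t *s x \<in> cball z e" if "norm t \<le> 1" for t
      proof -
        have "norm t * norm x \<le> 1 * e" using True that by (intro mult_mono) auto
        then show ?thesis by (simp add: dist_norm norm_smult)
      qed
      have "(\<integral>\<^sup>+\<theta>\<in>{0..2*pi}. N (z + cis \<theta> *s x) \<partial>lborel) \<le> ennreal (2 * pi) * e2ennreal (ereal C - u z)"
        unfolding N_def by (rule psh_super_mean[OF X psh _ C(1)]) (use sub ball C(2) in auto)
      then show ?thesis unfolding eq by (subst mult.commute) (rule mult_right_mono, auto)
    next
      case False
      then show ?thesis using supp[of x] by simp
    qed
  qed
  also have "\<dots> = ennreal (2 * pi) * (e2ennreal (ereal C - u z) * (\<integral>\<^sup>+x. \<kappa> x \<partial>lborel))"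
    by (simp add: nn_integral_cmult mult.assoc)
  finally have "ennreal (2 * pi) * ?J \<le> ennreal (2 * pi) * (e2ennreal (ereal C - u z) * (\<integral>\<^sup>+x. \<kappa> x \<partial>lborel))" .
  then show ?thesis unfolding N_def by (subst (asm) ennreal_mult_le_mult_iff) auto
qed

lemma usc_bounded_above_cball:
  fixes u :: "'a::heine_borel \<Rightarrow> ereal"
  assumes "usc_on u X" "cball p r \<subseteq> X" "\<And>x. x \<in> X \<Longrightarrow> u x \<noteq> \<infinity>"
  obtains C where "0 \<le> C" "\<And>x. x \<in> cball p r \<Longrightarrow> u x \<le> ereal C"
proof (cases "cball p r = {}")
  case True
  then show ?thesis using that[of 0] by auto
next
  case False
  obtain y where y: "y \<in> cball p r" "\<And>x. x \<in> cball p r \<Longrightarrow> u x \<le> u y"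
    using usc_attains_max[OF compact_cball False usc_on_subset[OF assms(1,2)]] by auto
  have "u y \<noteq> \<infinity>" using assms y by auto
  then have "u y \<le> ereal (max 0 (real_of_ereal (u y)))" by (cases "u y") auto
  then show ?thesis using that[of "max 0 (real_of_ereal (u y))"] y(2) order_trans by fastforce
qed

text \<open>The ball of radius \<open>2 * r\<close> around \<open>z0\<close> covers
  \<open>ball p r\<close> and stays within \<open>4 * r\<close> of \<open>p\<close>, where
  \<open>u\<close> is at most \<open>C\<close>. The kernel inequality with its indicator bounds the
  integral by the finite number \<open>C - u z0\<close> times a volume.\<close>

lemma psh_integrable_if_finite_point:
  fixes u :: "complex^'n \<Rightarrow> ereal"
  assumes X: "open X" and psh: "psh_on u X" and r: "0 < r" "cball p (4 * r) \<subseteq> X"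
    and C: "0 \<le> C" "\<And>x. x \<in> cball p (4 * r) \<Longrightarrow> u x \<le> ereal C" and z0: "z0 \<in> ball p r" "u z0 \<noteq> -\<infinity>"
  shows "(\<integral>\<^sup>+x\<in>ball p r. e2ennreal (ereal C - top_ext X u x) \<partial>lborel) < \<infinity>"
proof -
  have usc: "usc_on u X" using psh unfolding psh_on_def by blast
  note [measurable] = borel_measurable_top_ext[OF X usc]
  define N where "N = (\<lambda>x. e2ennreal (ereal C - top_ext X u x))"
  have [measurable]: "N \<in> borel_measurable borel" unfolding N_def by measurable
  have ms[measurable]: "ball 0 (2 * r) \<in> sets (borel :: (complex^'n) measure)" by simp
  have sub: "cball z0 (2 * r) \<subseteq> cball p (4 * r)"
  proof
    fix x assume "x \<in> cball z0 (2 * r)"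
    then show "x \<in> cball p (4 * r)" using dist_triangle[of p x z0] z0(1) r(1) by auto
  qed
  have "(\<integral>\<^sup>+x\<in>ball p r. N x \<partial>lborel) \<le> (\<integral>\<^sup>+x. indicator (ball 0 (2 * r)) (x - z0) * N x \<partial>lborel)"
  proof (intro nn_integral_mono)
    fix x show "N x * indicator (ball p r) x \<le> indicator (ball 0 (2 * r)) (x - z0) * N x"
      using dist_triangle[of x z0 p] z0(1) r(1) by (auto simp: indicator_def dist_norm norm_minus_commute)
  qed
  also have "\<dots> = (\<integral>\<^sup>+x. indicator (ball 0 (2 * r)) x * N (z0 + x) \<partial>lborel)"
    using nn_integral_lborel_translate[of "\<lambda>x. indicator (ball 0 (2 * r)) (x - z0) * N x" z0] by simp
  also have "\<dots> \<le> e2ennreal (ereal C - u z0) * (\<integral>\<^sup>+x. indicator (ball 0 (2 * r)) (x::complex^'n) \<partial>lborel)"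
    unfolding N_def
    by (rule psh_kernel_mean[OF X psh _ C(1)]) (use sub r(2) C(2) ms in \<open>auto simp: norm_smult indicator_def\<close>)
  also have "\<dots> < \<infinity>"
  proof -
    have "emeasure lborel (ball 0 (2 * r) :: (complex^'n) set) < \<infinity>" by (rule emeasure_bounded_finite) auto
    moreover have "u z0 \<noteq> \<infinity>" using psh z0(1) r unfolding psh_on_def by (auto simp: subset_eq)
    then have "e2ennreal (ereal C - u z0) < \<infinity>" using z0(2) by (cases "u z0") (auto simp: e2ennreal_ereal)
    ultimately show ?thesis by (simp add: ennreal_mult_less_top)
  qed
  finally show ?thesis unfolding N_def .
qed

text \<open>The set near which u is identically \<open>-\<infinity>\<close> is open and closed in the domain, since u is
  integrable near all other points.\<close>

lemma psh_locally_integrable: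
  fixes u :: "complex^'n \<Rightarrow> ereal"
  assumes X: "open X" and psh: "psh_on u X" and p: "p \<in> X"
  obtains R C where "0 < R" "cball p R \<subseteq> X" "0 \<le> C" "\<And>x. x \<in> cball p R \<Longrightarrow> u x \<le> ereal C"
    "(\<integral>\<^sup>+x\<in>ball p R. e2ennreal (ereal C - top_ext X u x) \<partial>lborel) < \<infinity>"
proof -
  have usc: "usc_on u X" and fin: "\<And>x. x \<in> X \<Longrightarrow> u x \<noteq> \<infinity>" using psh unfolding psh_on_def by blast+
  note [measurable] = borel_measurable_top_ext[OF X usc]
  have ex: "\<exists>r C. 0 < r \<and> cball q (4 * r) \<subseteq> X \<and> 0 \<le> C \<and> (\<forall>x\<in>cball q (4 * r). u x \<le> ereal C)" if "q \<in> X" for q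
  proof -
    obtain e where e: "e > 0" "cball q e \<subseteq> X" using X \<open>q \<in> X\<close> open_contains_cball by blast
    obtain C where "0 \<le> C" "\<And>x. x \<in> cball q e \<Longrightarrow> u x \<le> ereal C" using usc_bounded_above_cball[OF usc e(2) fin] by blast
    then show ?thesis using e by (intro exI[of _ "e/4"] exI[of _ C]) auto
  qed
  define A where "A = {q \<in> X. \<exists>d>0. \<forall>x\<in>ball q d. x \<in> X \<and> u x = -\<infinity>}"
  have "open A" unfolding open_contains_ball
  proof
    fix q assume "q \<in> A"
    then obtain d where d: "d > 0" "\<forall>x\<in>ball q d. x \<in> X \<and> u x = -\<infinity>" unfolding A_def by auto
    have "ball q (d/2) \<subseteq> A"
    proof
      fix x assume x: "x \<in> ball q (d/2)"
      have "\<forall>y\<in>ball x (d/2). y \<in> X \<and> u y = -\<infinity>"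
      proof
        fix y assume "y \<in> ball x (d/2)"
        then have "y \<in> ball q d" using x dist_triangle[of q y x] by auto
        then show "y \<in> X \<and> u y = -\<infinity>" using d(2) by blast
      qed
      then show "x \<in> A" unfolding A_def using d x by (auto intro!: exI[of _ "d/2"])
    qed
    then show "\<exists>e>0. ball q e \<subseteq> A" using d(1) by (intro exI[of _ "d/2"]) auto
  qed
  have good: "\<exists>z0\<in>ball q r. u z0 \<noteq> -\<infinity>" if "q \<in> X - A" "0 < r" "cball q (4 * r) \<subseteq> X" for q r
  proof (rule ccontr)
    assume *: "\<not> (\<exists>z0\<in>ball q r. u z0 \<noteq> -\<infinity>)"
    have "ball q r \<subseteq> X" using that(2,3) by (auto simp: subset_eq)
    then show False using that * unfolding A_def by blast
  qed
  have "open (X - A)" unfolding open_contains_ball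
  proof
    fix q assume q: "q \<in> X - A"
    then obtain r C where r: "0 < r" "cball q (4 * r) \<subseteq> X" "0 \<le> C" "\<forall>x\<in>cball q (4 * r). u x \<le> ereal C" using ex by blast
    obtain z0 where z0: "z0 \<in> ball q r" "u z0 \<noteq> -\<infinity>" using good[OF q r(1,2)] by blast
    have I: "(\<integral>\<^sup>+x\<in>ball q r. e2ennreal (ereal C - top_ext X u x) \<partial>lborel) < \<infinity>"
      using psh_integrable_if_finite_point[OF X psh r(1-3) _ z0] r(4) by blast
    have "x \<in> X - A" if x: "x \<in> ball q r" for x
    proof (rule ccontr)
      assume "x \<notin> X - A"
      moreover have "x \<in> X" using x r(1,2) by (auto simp: subset_eq)
      ultimately obtain d where d: "d > 0" "\<forall>y\<in>ball x d. y \<in> X \<and> u y = -\<infinity>" unfolding A_def by auto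
      define E where "E = ball x d \<inter> ball q r"
      have E: "open E" "x \<in> E" unfolding E_def using x d by auto
      have [measurable]: "E \<in> sets borel" using E by simp
      \<comment> \<open>An open nonempty set on which \<open>u\<close> is
        \<open>-\<infinity>\<close> makes the integral of \<open>C - u\<close> infinite.\<close>
      have "emeasure lborel E \<noteq> 0" using E open_not_negligible[of E] by (auto simp: negligible_iff_null_sets null_sets_def)
      then have "\<infinity> = (\<integral>\<^sup>+y. \<infinity> * indicator E y \<partial>lborel)" by (subst nn_integral_cmult_indicator) (auto simp: ennreal_top_mult)
      also have "\<dots> \<le> (\<integral>\<^sup>+y\<in>ball q r. e2ennreal (ereal C - top_ext X u y) \<partial>lborel)"
        by (intro nn_integral_mono) (use d(2) in \<open>auto simp: E_def indicator_def top_ext_def\<close>)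
      finally show False using I by simp
    qed
    then show "\<exists>e>0. ball q e \<subseteq> X - A" using r(1) by blast
  qed
  have "p \<notin> A"
  proof
    assume pA: "p \<in> A"
    \<comment> \<open>The convention on components in \<open>psh_on\<close> enters here: the
      component of \<open>p\<close> contains a point outside of \<open>A\<close>, and
      \<open>A\<close> would disconnect it.\<close>
    define K where "K = connected_component_set X p"
    have "K \<in> components X" unfolding K_def components_def using p by auto
    then obtain z where z: "z \<in> K" "u z \<noteq> -\<infinity>" using psh unfolding psh_on_def by blast
    have "z \<in> X" using z(1) unfolding K_def using connected_component_subset by blast
    moreover have "z \<notin> A" using z(2) unfolding A_def by (auto dest: bspec[of _ _ z])
    moreover have "K \<subseteq> A \<union> (X - A)" unfolding K_def using connected_component_subset[of X p] by auto
    moreover have "p \<in> K" unfolding K_def using p by simp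
    moreover have "connected K" unfolding K_def by (rule connected_connected_component)
    ultimately show False using connectedD[of K A "X - A"] \<open>open A\<close> \<open>open (X - A)\<close> pA z(1) by blast
  qed
  then have pA: "p \<in> X - A" using p by simp
  obtain r C where r: "0 < r" "cball p (4 * r) \<subseteq> X" "0 \<le> C" "\<forall>x\<in>cball p (4 * r). u x \<le> ereal C" using ex[OF p] by blast
  obtain z0 where z0: "z0 \<in> ball p r" "u z0 \<noteq> -\<infinity>" using good[OF pA r(1,2)] by blast
  have "(\<integral>\<^sup>+x\<in>ball p r. e2ennreal (ereal C - top_ext X u x) \<partial>lborel) < \<infinity>"
    using psh_integrable_if_finite_point[OF X psh r(1-3) _ z0] r(4) by blast
  moreover have "cball p r \<subseteq> cball p (4 * r)" using r(1) by auto
  ultimately show thesis using that[of r C] r by blast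
qed

definition lform :: "complex^'n^'n \<Rightarrow> complex^'n \<Rightarrow> real" where
  "lform H w = Re (\<Sum>j\<in>UNIV. \<Sum>k\<in>UNIV. H $ j $ k * w $ j * cnj (w $ k))"

lemma lform_smult: "lform H (c *s w) = (norm c)\<^sup>2 * lform H w"
proof -
  have "(\<Sum>j\<in>UNIV. \<Sum>k\<in>UNIV. H $ j $ k * (c *s w) $ j * cnj ((c *s w) $ k))
      = (c * cnj c) * (\<Sum>j\<in>UNIV. \<Sum>k\<in>UNIV. H $ j $ k * w $ j * cnj (w $ k))"
    unfolding sum_distrib_left by (intro sum.cong refl) (simp add: algebra_simps)
  also have "c * cnj c = of_real ((norm c)\<^sup>2)" by (simp add: complex_norm_square[symmetric])
  finally show ?thesis unfolding lform_def by simp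
qed

text \<open>The mean is monotone, and for the real part of a holomorphic majorant it is the central
  value.\<close>

lemma disc_sub_of_mean:
  fixes F :: "complex \<Rightarrow> real"
  assumes int: "set_integrable lborel {0..2*pi} (\<lambda>t. F (cis t))"
    and le: "F 0 \<le> 1 / (2 * pi) * (LINT t:{0..2*pi}|lborel. F (cis t)) + m"
  shows "disc_sub (\<lambda>z. ereal (F z)) m"
  unfolding disc_sub_def
proof (intro allI impI)
  fix H assume H: "continuous_on (cball 0 1) H \<and> H holomorphic_on ball 0 1 \<and> (\<forall>z\<in>sphere 0 1. ereal (F z) \<le> ereal (Re (H z)))"
  have "(LINT t:{0..2*pi}|lborel. F (cis t)) \<le> (LINT t:{0..2*pi}|lborel. Re (H (cis t)))"
  proof (rule set_integral_mono[OF int])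
    show "set_integrable lborel {0..2*pi} (\<lambda>t. Re (H (cis t)))"
      using H by (intro set_integrable_cis continuous_intros) (auto elim: continuous_on_subset)
  qed (use H in auto)
  also have "\<dots> = 2 * pi * Re (H 0)" using H by (intro mean_Re_holomorphic) auto
  finally have "1 / (2 * pi) * (LINT t:{0..2*pi}|lborel. F (cis t)) \<le> Re (H 0)"
    by (simp add: pos_divide_le_eq mult.commute)
  then show "ereal (F 0) \<le> ereal (Re (H 0) + m)" using le by simp
qed

text \<open>Moving a translation from a function onto the kernel reverses its direction, and the
  Laplacian must not notice.\<close>

lemma lap_minus:
  fixes f :: "complex^'n \<Rightarrow> real"
  assumes f: "smooth_on f UNIV"
  shows "lap (- w) f x = lap w f x"
proof -
  have "dir_deriv (- w) (dir_deriv (- w) f) x = dir_deriv w (dir_deriv w f) x" for w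
    using dir_deriv2_sum[OF f, where I="{0::nat}" and J="{0::nat}" and a="\<lambda>_. -1" and u="\<lambda>_. w" and b="\<lambda>_. -1" and v="\<lambda>_. w" and x=x] by simp
  from this[of w] this[of "\<i> *s w"] show ?thesis unfolding lap_def by (simp add: vector_smult_rneg)
qed

section \<open>Mollification\<close>

definition mollifier :: "real \<Rightarrow> complex^'n \<Rightarrow> complex^'n \<Rightarrow> real" where
  "mollifier \<epsilon> z y = bump 0 (\<epsilon>\<^sup>2 - (norm (y - z))\<^sup>2)"

lemma smooth_mollifier: "smooth_on (mollifier e z) S"
  unfolding mollifier_def by (rule bump_class_smooth, rule bump_class.bump)

lemma mollifier_nonneg: "0 \<le> mollifier e z y"
  and mollifier_le_1: "mollifier e z y \<le> 1"
  and mollifier_shift: "mollifier e (z + a) y = mollifier e z (y - a)"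
  unfolding mollifier_def bump_def by (auto simp: diff_diff_eq add.commute)

lemma mollifier_eq_0: "0 < e \<Longrightarrow> y \<notin> ball z e \<Longrightarrow> mollifier e z y = 0"
proof -
  assume "0 < e" "y \<notin> ball z e"
  then have "e\<^sup>2 \<le> (norm (y - z))\<^sup>2" by (intro power_mono) (auto simp: dist_norm norm_minus_commute)
  then show ?thesis unfolding mollifier_def bump_def by simp
qed

lemma mollifier_pos: "0 < e \<Longrightarrow> y \<in> ball z e \<Longrightarrow> 0 < mollifier e z y"
proof -
  assume "0 < e" "y \<in> ball z e"
  then have "(norm (y - z))\<^sup>2 < e\<^sup>2" by (intro power_strict_mono) (auto simp: dist_norm norm_minus_commute)
  then show ?thesis unfolding mollifier_def bump_def by simp
qed

lemma continuous_mollifier: "continuous_on UNIV (mollifier e z)"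
  by (rule smooth_on_continuous[OF smooth_mollifier])

lemma borel_measurable_mollifier [measurable]: "mollifier e z \<in> borel_measurable borel"
  by (rule borel_measurable_continuous_onI[OF continuous_mollifier])

lemma integrable_cont_compact_support:
  fixes f :: "'a::euclidean_space \<Rightarrow> real"
  assumes "compact C" "continuous_on C f" "\<And>z. z \<notin> C \<Longrightarrow> f z = 0"
  shows "integrable lborel f"
proof -
  have "integrable lborel (\<lambda>x. indicator C x *\<^sub>R f x)" by (rule borel_integrable_compact[OF assms(1,2)])
  moreover have "(\<lambda>x. indicator C x *\<^sub>R f x) = f" using assms(3) by (auto simp: indicator_def fun_eq_iff)
  ultimately show ?thesis by simp
qed

lemma integrable_mollifier: "0 < e \<Longrightarrow> integrable lborel (mollifier e z)"
  by (rule integrable_cont_compact_support[of "cball z e"])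
     (auto intro: continuous_on_subset[OF continuous_mollifier] mollifier_eq_0)

text \<open>The type argument carries the dimension, which no other argument shows.\<close>

definition mollifier_mass :: "real \<Rightarrow> 'n::finite itself \<Rightarrow> real" where
  "mollifier_mass \<epsilon> _ = (LINT y|lborel. mollifier \<epsilon> (0::complex^'n) y)"

lemma mollifier_mass: "(LINT y|lborel. mollifier e (z::complex^'n) y) = mollifier_mass e TYPE('n)"
proof -
  have "(LINT y|lborel. mollifier e (0::complex^'n) y) = (LINT y|distr lborel borel ((+) (-z)). mollifier e 0 y)"
    by (simp add: lborel_distr_plus)
  also have "\<dots> = (LINT y|lborel. mollifier e 0 (-z + y))" by (rule integral_distr) auto
  also have "\<dots> = (LINT y|lborel. mollifier e z y)" unfolding mollifier_def by (simp add: algebra_simps)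
  finally show ?thesis unfolding mollifier_mass_def by simp
qed

lemma mollifier_mass_pos: "0 < d \<Longrightarrow> 0 < mollifier_mass d TYPE('n::finite)"
proof -
  assume e: "0 < d"
  have nn: "0 \<le> mollifier_mass d TYPE('n)" unfolding mollifier_mass_def by (simp add: mollifier_nonneg)
  moreover have "mollifier_mass d TYPE('n) \<noteq> 0"
  proof
    assume "mollifier_mass d TYPE('n) = 0"
    then have "AE y in lborel. mollifier d (0::complex^'n) y = 0"
      unfolding mollifier_mass_def
      using integral_nonneg_eq_0_iff_AE[OF integrable_mollifier[OF e, of "0::complex^'n"]] mollifier_nonneg by auto
    then have "AE y in lborel. y \<notin> ball (0::complex^'n) d"
    proof eventually_elim
      case (elim y)
      then show ?case using mollifier_pos[OF e, of y 0] by auto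
    qed
    then have "ball (0::complex^'n) d \<in> null_sets lborel" using AE_iff_null_sets[of "ball (0::complex^'n) d" lborel] by simp
    then have "emeasure lborel (ball (0::complex^'n) d) = 0" by (rule null_setsD1)
    moreover have "emeasure lborel (ball (0::complex^'n) d) \<noteq> 0"
      using open_not_negligible[of "ball (0::complex^'n) d"] e by (auto simp: negligible_iff_null_sets null_sets_def)
    ultimately show False by simp
  qed
  ultimately show ?thesis by simp
qed

definition conv :: "real \<Rightarrow> (complex^'n \<Rightarrow> real) \<Rightarrow> complex^'n \<Rightarrow> real" where
  "conv \<epsilon> h z = (LINT y|lborel. h y * mollifier \<epsilon> z y) / mollifier_mass \<epsilon> TYPE('n)"

lemma integrable_mult_bounded:
  fixes f g :: "'a \<Rightarrow> real"
  assumes f: "integrable M f" and [measurable]: "g \<in> borel_measurable M" and B: "\<And>x. \<bar>g x\<bar> \<le> B"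
  shows "integrable M (\<lambda>x. f x * g x)"
proof (rule Bochner_Integration.integrable_bound[of _ "\<lambda>x. B * f x"])
  show "(\<lambda>x. f x * g x) \<in> borel_measurable M" using borel_measurable_integrable[OF f] by measurable
  have "0 \<le> B" using B[of undefined] by linarith
  then show "AE x in M. norm (f x * g x) \<le> norm (B * f x)"
  proof (intro AE_I2)
    fix x
    have "\<bar>f x\<bar> * \<bar>g x\<bar> \<le> \<bar>f x\<bar> * B" using B by (intro mult_left_mono) auto
    then show "norm (f x * g x) \<le> norm (B * f x)" using \<open>0 \<le> B\<close> by (simp add: abs_mult mult.commute)
  qed
qed (use f in simp)

lemma continuous_conv:
  fixes h :: "complex^'n \<Rightarrow> real"
  assumes h: "integrable lborel h"
  shows "continuous_on UNIV (conv e h)"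
proof -
  have "continuous_on UNIV (\<lambda>z. LINT y|lborel. h y * mollifier e z y)"
  proof (rule continuous_on_sequentiallyI)
    fix X :: "nat \<Rightarrow> complex^'n" and a assume X: "X \<longlonglongrightarrow> a"
    note [measurable] = borel_measurable_integrable[OF h]
    show "(\<lambda>n. LINT y|lborel. h y * mollifier e (X n) y) \<longlonglongrightarrow> (LINT y|lborel. h y * mollifier e a y)"
    proof (rule integral_dominated_convergence[where w = "\<lambda>y. \<bar>h y\<bar>"])
      show "AE y in lborel. (\<lambda>n. h y * mollifier e (X n) y) \<longlonglongrightarrow> h y * mollifier e a y"
      proof (intro AE_I2 tendsto_intros)
        fix y :: "complex^'n"
        have "mollifier e z y = mollifier e y z" for z :: "complex^'n" unfolding mollifier_def by (simp add: norm_minus_commute)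
        moreover have "(\<lambda>n. mollifier e y (X n)) \<longlonglongrightarrow> mollifier e y a"
          using continuous_mollifier[of e y] X by (auto simp: continuous_on_eq_continuous_at intro: isCont_tendsto_compose)
        ultimately show "(\<lambda>n. mollifier e (X n) y) \<longlonglongrightarrow> mollifier e a y" by simp
      qed
      show "AE y in lborel. norm (h y * mollifier e (X n) y) \<le> \<bar>h y\<bar>" for n
        using mollifier_nonneg[of e "X n"] mollifier_le_1[of e "X n"]
        by (intro AE_I2) (simp add: abs_mult mult_left_le)
      show "(\<lambda>y. h y * mollifier e a y) \<in> borel_measurable lborel" "(\<lambda>y. h y * mollifier e (X n) y) \<in> borel_measurable lborel" for n
        by measurable
    qed (use h in simp)
  qed
  then show ?thesis unfolding conv_def divide_inverse by (rule continuous_on_mult_right)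
qed

lemma lap_mollifier:
  assumes e: "0 < d"
  shows "continuous_on UNIV (lap w (mollifier d z))"
    and "y \<notin> cball z d \<Longrightarrow> lap w (mollifier d z) y = 0"
    and "\<exists>B. \<forall>y. \<bar>lap w (mollifier d z) y\<bar> \<le> B"
proof -
  show c: "continuous_on UNIV (lap w (mollifier d z))"
    unfolding lap_def[abs_def] by (intro continuous_on_add smooth_on_continuous smooth_on_dir_deriv smooth_mollifier)
  have z: "dir_deriv a (dir_deriv b (mollifier d z)) y = 0" if "y \<notin> cball z d" for a b y
    using that by (intro dir_deriv_zero_outside[of "cball z d"]) (use e in \<open>auto intro!: mollifier_eq_0\<close>)
  show 0: "lap w (mollifier d z) y = 0" if "y \<notin> cball z d" for y
    unfolding lap_def using z[OF that] by simp
  have "compact (lap w (mollifier d z) ` cball z d)"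
    by (intro compact_continuous_image continuous_on_subset[OF c]) auto
  then obtain B where B: "\<forall>x\<in>lap w (mollifier d z) ` cball z d. norm x \<le> B" using compact_imp_bounded bounded_iff by metis
  have "\<bar>lap w (mollifier d z) y\<bar> \<le> max B 0" for y
    using B 0[of y] by (cases "y \<in> cball z d") (auto simp: le_max_iff_disj)
  then show "\<exists>B. \<forall>y. \<bar>lap w (mollifier d z) y\<bar> \<le> B" by blast
qed

text \<open>Fubini moves the circle mean onto the kernel, where \<open>circle_mean_taylor\<close>
  applies uniformly. All derivatives fall on the kernel, so that integrability of \<open>h\<close>
  suffices.\<close>

lemma conv_circle_mean:
  fixes h :: "complex^'n \<Rightarrow> real"
  assumes h: "integrable lborel h" and e: "0 < d" "0 < e"
  obtains t1 where "0 < t1" "\<And>t. 0 < t \<Longrightarrow> t < t1 \<Longrightarrow>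
     conv d h z + t\<^sup>2 / 4 * ((LINT y|lborel. h y * lap w (mollifier d z) y) / mollifier_mass d TYPE('n)) - t\<^sup>2 * e
       \<le> 1 / (2 * pi) * (LINT x:{0..2*pi}|lborel. conv d h (z + (of_real t * cis x) *s w))"
proof -
  note [measurable] = borel_measurable_integrable[OF h, simplified]
  define c where "c = mollifier_mass d TYPE('n)"
  have c: "0 < c" unfolding c_def by (rule mollifier_mass_pos[OF e(1)])
  define B where "B = (LINT y|lborel. \<bar>h y\<bar>)"
  have B: "0 \<le> B" unfolding B_def by simp
  \<comment> \<open>The Taylor error gets multiplied by the integral \<open>B\<close> of the modulus
    of \<open>h\<close> and divided by the mass \<open>c\<close>.\<close>
  define e' where "e' = e * c / (B + 1)"
  have e': "0 < e'" using e c B unfolding e'_def by (simp add: add_nonneg_pos)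
  let ?q = "mollifier d z"
  have C0: "mollifier d z y = 0" if "y \<notin> cball z d" for y
    using that by (intro mollifier_eq_0 e) auto
  obtain t1 where t1: "0 < t1" and tay: "\<And>t y. 0 < t \<Longrightarrow> t < t1 \<Longrightarrow>
     \<bar>1 / (2 * pi) * (LINT x:{0..2*pi}|lborel. ?q (y + (of_real t * cis x) *s (- w))) - (?q y + t\<^sup>2 / 4 * lap (- w) ?q y)\<bar> \<le> t\<^sup>2 * e'"
    using circle_mean_taylor[where f = ?q and w = "- w", OF smooth_mollifier compact_cball C0 e'] by blast
  show thesis
  proof (rule that[OF t1])
    fix t assume t: "0 < t" "t < t1"
    define M where "M = (\<lambda>y. 1 / (2 * pi) * (LINT x:{0..2*pi}|lborel. ?q (y + (of_real t * cis x) *s (- w))))"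
    define f where "f = (\<lambda>x y. indicator {0..2*pi} x * (h y * ?q (y + (of_real t * cis x) *s (- w))))"
    have [measurable]: "{0..2*pi} \<in> sets borel" by simp
    have fm: "(\<lambda>(x, y). f x y) \<in> borel_measurable (lborel \<Otimes>\<^sub>M lborel)"
      unfolding f_def by measurable
    have dom: "integrable (lborel \<Otimes>\<^sub>M lborel) (\<lambda>(x, y). indicator {0..2*pi} x * \<bar>h y\<bar> :: real)"
    proof (rule lborel_pair.Fubini_integrable)
      show "(\<lambda>(x, y). indicator {0..2*pi} x * \<bar>h y\<bar> :: real) \<in> borel_measurable (lborel \<Otimes>\<^sub>M lborel)" by measurable
      have "integrable lborel (\<lambda>x. indicator {0..2*pi} x * B :: real)"
        using borel_integrable_atLeastAtMost'[of 0 "2*pi" "\<lambda>_. B"] unfolding set_integrable_def by simp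
      then show "integrable lborel (\<lambda>x. LINT y|lborel. norm ((\<lambda>(x, y). indicator {0..2*pi} x * \<bar>h y\<bar> :: real) (x, y)))"
        by (simp add: abs_mult B_def)
    qed (use h in auto)
    have fint: "integrable (lborel \<Otimes>\<^sub>M lborel) (\<lambda>(x, y). f x y)"
      by (rule Bochner_Integration.integrable_bound[OF dom fm])
         (use mollifier_nonneg[of d z] mollifier_le_1[of d z] in \<open>auto intro!: AE_I2 simp: f_def abs_mult mult_left_le indicator_def\<close>)
    have Fub: "(LINT y|lborel. LINT x|lborel. f x y) = (LINT x|lborel. LINT y|lborel. f x y)"
      by (rule lborel_pair.Fubini_integral[OF fint])
    have inner: "(LINT x|lborel. f x y) = 2 * pi * (h y * M y)" for y
      unfolding f_def M_def set_lebesgue_integral_def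
      by (simp add: mult.left_commute[of "indicator _ _"])
    have outer: "(LINT y|lborel. f x y) = indicator {0..2*pi} x * (c * conv d h (z + (of_real t * cis x) *s w))" for x
      using c unfolding f_def conv_def c_def[symmetric] mollifier_shift by (simp add: vector_smult_rneg)
    have "integrable lborel (\<lambda>y. LINT x|lborel. f x y)" using lborel_pair.integrable_snd[OF fint] .
    then have hM: "integrable lborel (\<lambda>y. h y * M y)" unfolding inner by simp
    have mean: "1 / (2 * pi) * (LINT x:{0..2*pi}|lborel. conv d h (z + (of_real t * cis x) *s w)) = (LINT y|lborel. h y * M y) / c"
    proof -
      have "2 * pi * (LINT y|lborel. h y * M y) = c * (LINT x:{0..2*pi}|lborel. conv d h (z + (of_real t * cis x) *s w))"
        using Fub unfolding inner outer set_lebesgue_integral_def by (simp add: mult.left_commute[of "indicator _ _"])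
      then show ?thesis using c by (simp add: field_simps)
    qed
    obtain LB where LB: "\<And>y. \<bar>lap w ?q y\<bar> \<le> LB" using lap_mollifier(3)[OF e(1)] by blast
    have [measurable]: "lap w ?q \<in> borel_measurable borel"
      by (rule borel_measurable_continuous_onI[OF lap_mollifier(1)[OF e(1)]])
    have i1: "integrable lborel (\<lambda>y. h y * ?q y)"
      by (rule integrable_mult_bounded[OF h, of _ 1]) (use mollifier_nonneg[of d z] mollifier_le_1[of d z] in auto)
    have i2: "integrable lborel (\<lambda>y. h y * lap w ?q y)"
      by (rule integrable_mult_bounded[OF h _ LB]) measurable
    have "(LINT y|lborel. h y * ?q y + t\<^sup>2 / 4 * (h y * lap w ?q y) - t\<^sup>2 * e' * \<bar>h y\<bar>) \<le> (LINT y|lborel. h y * M y)"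
    proof (rule integral_mono[OF _ hM])
      show "integrable lborel (\<lambda>y. h y * ?q y + t\<^sup>2 / 4 * (h y * lap w ?q y) - t\<^sup>2 * e' * \<bar>h y\<bar>)" using i1 i2 h by simp
      fix y
      have "\<bar>h y * (M y - (?q y + t\<^sup>2 / 4 * lap w ?q y))\<bar> \<le> \<bar>h y\<bar> * (t\<^sup>2 * e')"
        unfolding abs_mult using tay[OF t, of y] by (intro mult_left_mono) (auto simp: M_def lap_minus[OF smooth_mollifier])
      then show "h y * ?q y + t\<^sup>2 / 4 * (h y * lap w ?q y) - t\<^sup>2 * e' * \<bar>h y\<bar> \<le> h y * M y"
        by (simp add: abs_le_iff algebra_simps)
    qed
    also have "(LINT y|lborel. h y * ?q y + t\<^sup>2 / 4 * (h y * lap w ?q y) - t\<^sup>2 * e' * \<bar>h y\<bar>)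
       = (LINT y|lborel. h y * ?q y) + t\<^sup>2 / 4 * (LINT y|lborel. h y * lap w ?q y) - t\<^sup>2 * e' * B"
      using i1 i2 h by (simp add: B_def)
    finally have "((LINT y|lborel. h y * ?q y) + t\<^sup>2 / 4 * (LINT y|lborel. h y * lap w ?q y) - t\<^sup>2 * e' * B) / c \<le> (LINT y|lborel. h y * M y) / c"
      using c by (intro divide_right_mono) auto
    moreover have "t\<^sup>2 * e' * B / c \<le> t\<^sup>2 * e"
    proof -
      have "e' * B / c = e * (B / (B + 1))" using c unfolding e'_def by simp
      also have "\<dots> \<le> e" using e B by (intro mult_left_le) auto
      finally show ?thesis using mult_left_mono[of "e' * B / c" e "t\<^sup>2"] by (simp add: mult.assoc)
    qed
    ultimately show "conv d h z + t\<^sup>2 / 4 * ((LINT y|lborel. h y * lap w ?q y) / mollifier_mass d TYPE('n)) - t\<^sup>2 * e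
       \<le> 1 / (2 * pi) * (LINT x:{0..2*pi}|lborel. conv d h (z + (of_real t * cis x) *s w))"
      unfolding mean unfolding conv_def c_def[symmetric] by (simp add: add_divide_distrib diff_divide_distrib)
  qed
qed

lemma conv_mono_AE:
  fixes f :: "complex^'n \<Rightarrow> real"
  assumes f: "integrable lborel f" and e: "0 < d" and le: "AE y in lborel. y \<in> ball z d \<longrightarrow> f y \<le> b"
  shows "conv d f z \<le> b"
proof -
  have "(LINT y|lborel. f y * mollifier d z y) \<le> (LINT y|lborel. b * mollifier d z y)"
  proof (rule integral_mono_AE)
    show "integrable lborel (\<lambda>y. f y * mollifier d z y)"
      by (rule integrable_mult_bounded[OF f, of _ 1]) (use mollifier_nonneg[of d z] mollifier_le_1[of d z] in auto)
    show "AE y in lborel. f y * mollifier d z y \<le> b * mollifier d z y" using le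
    proof eventually_elim
      case (elim y)
      then show ?case using mollifier_eq_0[OF e, of y z] mollifier_nonneg[of d z y]
        by (cases "y \<in> ball z d") (auto intro: mult_right_mono)
    qed
  qed (use integrable_mollifier[OF e, of z] in simp)
  also have "\<dots> = b * mollifier_mass d TYPE('n)" by (simp add: mollifier_mass)
  finally show ?thesis unfolding conv_def using mollifier_mass_pos[OF e, where 'n='n] by (simp add: pos_divide_le_eq)
qed

text \<open>\<open>psh_kernel_mean\<close> with the mollifier as kernel. Finiteness of
  \<open>u\<close> almost everywhere permits the return from \<open>C - u\<close> in
  [0, \<infinity>] to a real integral.\<close>

lemma psh_le_conv:
  fixes u :: "complex^'n \<Rightarrow> ereal"
  assumes X: "open X" and psh: "psh_on u X" and R: "cball p R \<subseteq> X" and C: "0 \<le> C" "\<And>x. x \<in> cball p R \<Longrightarrow> u x \<le> ereal C"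
    and e: "0 < d" "d < R" and int: "integrable lborel (\<lambda>y. indicator (ball p R) y * real_of_ereal (u y))"
    and AEu: "AE y in lborel. y \<in> ball p R \<longrightarrow> u y \<noteq> -\<infinity>"
  shows "u p \<le> ereal (conv d (\<lambda>y. indicator (ball p R) y * real_of_ereal (u y)) p)"
proof -
  have usc: "usc_on u X" and fin: "\<And>x. x \<in> X \<Longrightarrow> u x \<noteq> \<infinity>" using psh unfolding psh_on_def by blast+
  note [measurable] = borel_measurable_top_ext[OF X usc]
  define c where "c = mollifier_mass d TYPE('n)"
  have c: "0 < c" unfolding c_def by (rule mollifier_mass_pos[OF e(1)])
  define U where "U = (\<lambda>y. indicator (ball p R) y * real_of_ereal (u y))"
  have U: "integrable lborel U" using int unfolding U_def .
  have p: "p \<in> cball p R" using e by auto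
  have up: "u p \<noteq> \<infinity>" using fin R p by blast
  show ?thesis
  proof (cases "u p")
    case (real r)
    have "(\<integral>\<^sup>+x. ennreal (mollifier d 0 x) * e2ennreal (ereal C - top_ext X u (p + x)) \<partial>lborel) \<le> e2ennreal (ereal C - u p) * (\<integral>\<^sup>+x. ennreal (mollifier d (0::complex^'n) x) \<partial>lborel)"
    proof (rule psh_kernel_mean[OF X psh _ C(1)])
      show "cball p d \<subseteq> X" "\<And>x. x \<in> cball p d \<Longrightarrow> u x \<le> ereal C" using R C(2) e by (auto simp: subset_eq)
      show "ennreal (mollifier d 0 x) = 0" if "d < norm x" for x using that e mollifier_eq_0[of d x 0] by simp
      show "ennreal (mollifier d 0 (cis \<theta> *s x)) = ennreal (mollifier d 0 x)" for \<theta> x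
        unfolding mollifier_def by (simp add: norm_smult)
    qed measurable
    also have "(\<integral>\<^sup>+x. ennreal (mollifier d (0::complex^'n) x) \<partial>lborel) = ennreal c"
      unfolding c_def mollifier_mass_def by (rule nn_integral_eq_integral[OF integrable_mollifier[OF e(1)]]) (simp add: mollifier_nonneg)
    also have "(\<integral>\<^sup>+x. ennreal (mollifier d 0 x) * e2ennreal (ereal C - top_ext X u (p + x)) \<partial>lborel)
       = (\<integral>\<^sup>+x. ennreal (mollifier d p x) * e2ennreal (ereal C - top_ext X u x) \<partial>lborel)"
      using nn_integral_lborel_translate[of "\<lambda>x. ennreal (mollifier d p x) * e2ennreal (ereal C - top_ext X u x)" p]
        mollifier_shift[of d 0 p] by simp
    also have "\<dots> = (\<integral>\<^sup>+x. ennreal ((C - U x) * mollifier d p x) \<partial>lborel)"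
    proof (rule nn_integral_cong_AE, use AEu in eventually_elim)
      case (elim y)
      show ?case
      proof (cases "y \<in> ball p d")
        case True
        then have yR: "y \<in> ball p R" "y \<in> cball p R" "y \<in> X" using e R by (auto simp: subset_eq)
        obtain t where t: "u y = ereal t" using elim yR fin by (cases "u y") auto
        have "t \<le> C" using C(2)[OF yR(2)] t by simp
        then show ?thesis using yR t mollifier_nonneg[of d p y]
          by (simp add: top_ext_def U_def e2ennreal_ereal ennreal_mult[symmetric] mult.commute)
      next
        case False
        then show ?thesis using mollifier_eq_0[OF e(1), of y p] by simp
      qed
    qed
    also have "\<dots> = ennreal (LINT x|lborel. (C - U x) * mollifier d p x)"
    proof (rule nn_integral_eq_integral)
      have "integrable lborel (\<lambda>x. C * mollifier d p x - U x * mollifier d p x)"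
        using integrable_mollifier[OF e(1), of p] integrable_mult_bounded[OF U, of "mollifier d p" 1] mollifier_nonneg[of d p] mollifier_le_1[of d p] by simp
      then show "integrable lborel (\<lambda>x. (C - U x) * mollifier d p x)" by (simp add: left_diff_distrib)
      show "AE x in lborel. 0 \<le> (C - U x) * mollifier d p x" using AEu
      proof eventually_elim
        case (elim y)
        have "U y \<le> C"
        proof (cases "y \<in> ball p R")
          case True
          then have "u y \<le> ereal C" "u y \<noteq> -\<infinity>" using C(2)[of y] elim by auto
          then show ?thesis using True unfolding U_def by (cases "u y") auto
        qed (simp add: U_def C)
        then show ?case using mollifier_nonneg[of d p y] by (intro mult_nonneg_nonneg) auto
      qed
    qed
    finally have le: "ennreal (LINT x|lborel. (C - U x) * mollifier d p x) \<le> e2ennreal (ereal C - u p) * ennreal c" .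
    have "r \<le> C" using C(2)[OF p] real by simp
    then have "e2ennreal (ereal C - u p) * ennreal c = ennreal ((C - r) * c)"
      unfolding real using c by (simp add: e2ennreal_ereal ennreal_mult)
    then have "(LINT x|lborel. (C - U x) * mollifier d p x) \<le> (C - r) * c"
      using le \<open>r \<le> C\<close> c by (simp add: ennreal_le_iff)
    moreover have "(LINT x|lborel. (C - U x) * mollifier d p x) = C * c - (LINT x|lborel. U x * mollifier d p x)"
    proof -
      have "(LINT x|lborel. (C - U x) * mollifier d p x) = (LINT x|lborel. C * mollifier d p x - U x * mollifier d p x)" by (simp add: left_diff_distrib)
      also have "\<dots> = C * c - (LINT x|lborel. U x * mollifier d p x)"
        using integrable_mollifier[OF e(1), of p] integrable_mult_bounded[OF U, of "mollifier d p" 1] mollifier_nonneg[of d p] mollifier_le_1[of d p]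
        by (simp add: mollifier_mass c_def)
      finally show ?thesis .
    qed
    ultimately have "r * c \<le> (LINT x|lborel. U x * mollifier d p x)" by (simp add: algebra_simps)
    then show ?thesis using c unfolding real conv_def U_def[symmetric] c_def[symmetric] by (simp add: pos_le_divide_eq)
  qed (use up in auto)
qed

text \<open>Prepares mollification near \<open>p\<close>: integrability of \<open>C - u\<close>
  gives finiteness almost everywhere, and the modulus of \<open>u\<close> is at most
  \<open>C + (C - u)\<close>.\<close>

lemma psh_local_data:
  fixes u :: "complex^'n \<Rightarrow> ereal"
  assumes X: "open X" and psh: "psh_on u X" and p: "p \<in> X" "0 < R0"
  obtains R C where "0 < R" "R \<le> R0" "cball p R \<subseteq> X" "0 \<le> C" "\<And>x. x \<in> cball p R \<Longrightarrow> u x \<le> ereal C"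
    "integrable lborel (\<lambda>y. indicator (ball p R) y * real_of_ereal (u y))"
    "AE y in lborel. y \<in> ball p R \<longrightarrow> u y \<noteq> -\<infinity>"
proof -
  have usc: "usc_on u X" and fin: "\<And>x. x \<in> X \<Longrightarrow> u x \<noteq> \<infinity>" using psh unfolding psh_on_def by blast+
  note [measurable] = borel_measurable_top_ext[OF X usc]
  obtain R1 C where R1: "0 < R1" "cball p R1 \<subseteq> X" and C: "0 \<le> C" "\<And>x. x \<in> cball p R1 \<Longrightarrow> u x \<le> ereal C"
    and I1: "(\<integral>\<^sup>+x\<in>ball p R1. e2ennreal (ereal C - top_ext X u x) \<partial>lborel) < \<infinity>"
    by (rule psh_locally_integrable[OF X psh p(1)]) (rule that, assumption+)
  define R where "R = min R0 R1"
  have R: "0 < R" "R \<le> R0" "R \<le> R1" using p(2) R1(1) by (auto simp: R_def)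
  have sub: "cball p R \<subseteq> cball p R1" "ball p R \<subseteq> ball p R1" using R(3) by auto
  have [measurable]: "ball p R \<in> sets borel" by simp
  have "(\<integral>\<^sup>+x\<in>ball p R. e2ennreal (ereal C - top_ext X u x) \<partial>lborel) \<le> (\<integral>\<^sup>+x\<in>ball p R1. e2ennreal (ereal C - top_ext X u x) \<partial>lborel)"
    using sub(2) by (intro nn_integral_mono) (auto simp: indicator_def)
  then have I: "(\<integral>\<^sup>+x\<in>ball p R. e2ennreal (ereal C - top_ext X u x) \<partial>lborel) < \<infinity>" using I1 by (rule le_less_trans)
  have inX: "y \<in> X" "u y \<le> ereal C" if "y \<in> ball p R" for y using that sub R1 C(2) by (auto simp: subset_eq)
  have AEu: "AE y in lborel. y \<in> ball p R \<longrightarrow> u y \<noteq> -\<infinity>"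
  proof -
    have "AE y in lborel. e2ennreal (ereal C - top_ext X u y) * indicator (ball p R) y \<noteq> \<infinity>"
      using I by (intro nn_integral_PInf_AE) auto
    then show ?thesis by eventually_elim (auto simp: inX top_ext_def)
  qed
  have eqU: "indicator (ball p R) y * real_of_ereal (u y) = indicator (ball p R) y * real_of_ereal (top_ext X u y)" for y :: "complex^'n"
    using inX(1)[of y] by (auto simp: top_ext_def indicator_def)
  have "integrable lborel (\<lambda>y. indicator (ball p R) y * real_of_ereal (top_ext X u y))"
  proof (rule integrableI_bounded)
    have "(\<integral>\<^sup>+y. ennreal (norm (indicator (ball p R) y * real_of_ereal (top_ext X u y))) \<partial>lborel)
       \<le> (\<integral>\<^sup>+y. ennreal C * indicator (ball p R) y + e2ennreal (ereal C - top_ext X u y) * indicator (ball p R) y \<partial>lborel)"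
    proof (rule nn_integral_mono)
      fix y
      show "ennreal (norm (indicator (ball p R) y * real_of_ereal (top_ext X u y))) \<le> ennreal C * indicator (ball p R) y + e2ennreal (ereal C - top_ext X u y) * indicator (ball p R) y"
      proof (cases "y \<in> ball p R")
        case True
        show ?thesis
        proof (cases "u y")
          case (real t)
          have "t \<le> C" using inX(2)[OF True] real by simp
          then have "ennreal \<bar>t\<bar> \<le> ennreal (C + (C - t))" using C(1) by (intro ennreal_leI) auto
          also have "\<dots> = ennreal C + ennreal (C - t)" using C(1) \<open>t \<le> C\<close> by (intro ennreal_plus) auto
          finally show ?thesis using True real inX(1)[OF True] by (simp add: top_ext_def e2ennreal_ereal)
        qed (use True inX[OF True] in \<open>auto simp: top_ext_def\<close>)
      qed simp
    qed
    also have "\<dots> = ennreal C * emeasure lborel (ball p R) + (\<integral>\<^sup>+x\<in>ball p R. e2ennreal (ereal C - top_ext X u x) \<partial>lborel)"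
      by (subst nn_integral_add) (auto simp: nn_integral_cmult_indicator)
    also have "\<dots> < \<infinity>"
    proof -
      have "emeasure lborel (ball p R) < \<infinity>" by (rule emeasure_bounded_finite) auto
      then show ?thesis using I by (simp add: ennreal_mult_less_top)
    qed
    finally show "(\<integral>\<^sup>+y. ennreal (norm (indicator (ball p R) y * real_of_ereal (top_ext X u y))) \<partial>lborel) < \<infinity>" .
  qed measurable
  then have "integrable lborel (\<lambda>y. indicator (ball p R) y * real_of_ereal (u y))" unfolding eqU .
  then show thesis using that[of R C] R sub R1 C AEu by (auto simp: subset_eq)
qed

text \<open>A quasi-psh function whose Levi current in direction \<open>w\<close> is bounded from below by \<open>-Q\<close> has
  the corresponding sub-mean value property: this holds for its mollifications, which lie above the
  function up to a small error and below any majorant that is continuous near the circle.\<close>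

lemma current_imp_disc_sub:
  fixes u :: "complex^'n \<Rightarrow> ereal" and s Q :: "complex^'n \<Rightarrow> real"
  assumes X: "open X" and psh: "psh_on u X" and s: "continuous_on X s" and Q: "continuous_on X Q" "\<And>z. z \<in> X \<Longrightarrow> 0 \<le> Q z"
    and cur: "\<And>f. smooth_on f UNIV \<Longrightarrow> (\<exists>C. compact C \<and> C \<subseteq> X \<and> (\<forall>z. z \<notin> C \<longrightarrow> f z = 0)) \<Longrightarrow> (\<And>z. 0 \<le> f z) \<Longrightarrow>
       0 \<le> (LINT z:X|lborel. Q z * f z) + (LINT z:X|lborel. real_of_ereal (ereal (s z) + u z) * (lap w f z / 2))"
    and p: "p \<in> X" and \<eta>: "0 < \<eta>"
  shows "\<exists>k0>0. \<forall>k. 0 < k \<and> k < k0 \<longrightarrow>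
     disc_sub (\<lambda>\<zeta>. ereal (s (p + (of_real k * \<zeta>) *s w)) + u (p + (of_real k * \<zeta>) *s w)) (k\<^sup>2 * (Q p + \<eta>) / 2)"
proof -
  have usc: "usc_on u X" and fin: "\<And>x. x \<in> X \<Longrightarrow> u x \<noteq> \<infinity>" using psh unfolding psh_on_def by blast+
  note [measurable] = borel_measurable_top_ext[OF X usc]
  define h where "h = (\<lambda>z. ereal (s z) + u z)"
  define q where "q = Q p + \<eta>"
  have q: "0 < q" using Q(2)[OF p] \<eta> by (simp add: q_def)
  obtain R0 where R0: "0 < R0" "\<And>y. y \<in> X \<Longrightarrow> dist y p < 2 * R0 \<Longrightarrow> Q y < q"
  proof -
    obtain d where "d > 0" "\<forall>y\<in>X. dist y p < d \<longrightarrow> dist (Q y) (Q p) < \<eta>"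
      using Q(1) p \<eta> unfolding continuous_on_iff by metis
    then show thesis by (intro that[of "d/2"]) (auto simp: q_def dist_real_def abs_less_iff)
  qed
  obtain R C where R: "0 < R" "R \<le> R0" "cball p R \<subseteq> X" and C: "0 \<le> C" "\<And>x. x \<in> cball p R \<Longrightarrow> u x \<le> ereal C"
    and uint: "integrable lborel (\<lambda>y. indicator (ball p R) y * real_of_ereal (u y))"
    and AEu: "AE y in lborel. y \<in> ball p R \<longrightarrow> u y \<noteq> -\<infinity>"
    by (rule psh_local_data[OF X psh p R0(1)]) (rule that, assumption+)
  have Qq: "Q y \<le> q" if "y \<in> cball p R" for y
    using R0(2)[of y] that R by (force simp: dist_commute)
  \<comment> \<open>Centres within \<open>2 * r\<close> of \<open>p\<close> and mollification radii
    below \<open>r\<close> keep all kernels inside \<open>ball p R\<close>.\<close>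
  define r where "r = R / 4"
  have r: "0 < r" "4 * r = R" using R by (auto simp: r_def)
  define U where "U = (\<lambda>y. indicator (ball p R) y * real_of_ereal (u y))"
  define S where "S = (\<lambda>y. indicator (ball p R) y * s y)"
  define ht where "ht = (\<lambda>y. S y + U y)"
  have Uint: "integrable lborel U" using uint unfolding U_def .
  have scont: "continuous_on (cball p R) s" using s R(3) by (rule continuous_on_subset)
  have [measurable]: "ball p R \<in> sets borel" by simp
  have Sint: "integrable lborel S"
  proof -
    have "integrable lborel (\<lambda>x. indicator (cball p R) x *\<^sub>R s x)" by (rule borel_integrable_compact[OF compact_cball scont])
    then have "integrable lborel (\<lambda>x. indicator (ball p R) x *\<^sub>R (indicator (cball p R) x *\<^sub>R s x))"
      by (rule integrable_mult_indicator[rotated]) simp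
    moreover have "(\<lambda>x. indicator (ball p R) x *\<^sub>R (indicator (cball p R) x *\<^sub>R s x)) = S"
      unfolding S_def by (auto simp: indicator_def fun_eq_iff)
    ultimately show ?thesis by simp
  qed
  have hint: "integrable lborel ht" unfolding ht_def using Sint Uint by simp
  note [measurable] = borel_measurable_integrable[OF hint, simplified] borel_measurable_integrable[OF Sint, simplified]
  have ht_h: "AE y in lborel. y \<in> ball p R \<longrightarrow> ereal (ht y) = h y" using AEu
  proof eventually_elim
    case (elim y)
    show ?case
    proof
      assume y: "y \<in> ball p R"
      then have "u y \<noteq> \<infinity>" using fin R(3) by (auto simp: subset_eq)
      then show "ereal (ht y) = h y" using elim y unfolding ht_def h_def S_def U_def by (cases "u y") auto
    qed
  qed
  \<comment> \<open>At a fixed \<open>\<epsilon>\<close> the mollification satisfies the inequality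
    on small circles; how small depends on \<open>\<epsilon>\<close>.\<close>
  have loc: "\<exists>k1>0. \<forall>k. 0 < k \<and> k < k1 \<longrightarrow>
       disc_sub (\<lambda>\<zeta>. ereal (conv \<epsilon> ht (z + (of_real k * \<zeta>) *s w))) (k\<^sup>2 * (q + e) / 2)"
    if e: "0 < \<epsilon>" "\<epsilon> < r" "0 < e" and z: "z \<in> ball p (2 * r)" for \<epsilon> e z
  proof -
    define c where "c = mollifier_mass \<epsilon> TYPE('n)"
    have c: "0 < c" unfolding c_def by (rule mollifier_mass_pos[OF e(1)])
    let ?f = "mollifier \<epsilon> z"
    have zR: "cball z \<epsilon> \<subseteq> ball p R"
    proof
      fix y assume "y \<in> cball z \<epsilon>"
      then show "y \<in> ball p R" using dist_triangle[of p y z] z e r by auto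
    qed
    have zX: "cball z \<epsilon> \<subseteq> X" using zR R(3) by (meson ball_subset_cball order_trans)
    have "0 \<le> (LINT z:X|lborel. Q z * ?f z) + (LINT z:X|lborel. real_of_ereal (ereal (s z) + u z) * (lap w ?f z / 2))"
      by (rule cur[OF smooth_mollifier _ mollifier_nonneg]) (use zX e in \<open>auto intro!: exI[of _ "cball z \<epsilon>"] mollifier_eq_0\<close>)
    also have "(LINT z:X|lborel. Q z * ?f z) \<le> q * c"
    proof -
      have eq: "(\<lambda>y. indicator X y *\<^sub>R (Q y * ?f y)) = (\<lambda>y. if y \<in> cball z \<epsilon> then Q y * ?f y else 0)"
        using zX mollifier_eq_0[OF e(1), of _ z] by (auto simp: indicator_def fun_eq_iff)
      have "integrable lborel (\<lambda>y. if y \<in> cball z \<epsilon> then Q y * ?f y else 0)"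
      proof (rule integrable_cont_compact_support[of "cball z \<epsilon>"])
        have "continuous_on (cball z \<epsilon>) (\<lambda>y. Q y * ?f y)"
          using continuous_on_subset[OF Q(1) zX] continuous_on_subset[OF continuous_mollifier] by (intro continuous_on_mult) auto
        then show "continuous_on (cball z \<epsilon>) (\<lambda>y. if y \<in> cball z \<epsilon> then Q y * ?f y else 0)"
          by (rule continuous_on_eq) auto
      qed auto
      then have "(LINT y|lborel. (if y \<in> cball z \<epsilon> then Q y * ?f y else 0)) \<le> (LINT y|lborel. q * ?f y)"
      proof (rule integral_mono)
        show "(if y \<in> cball z \<epsilon> then Q y * ?f y else 0) \<le> q * ?f y" for y
          using Qq[of y] subsetD[OF zR, of y] mollifier_nonneg[of \<epsilon> z y] q by (auto intro!: mult_right_mono)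
      qed (use integrable_mollifier[OF e(1), of z] in simp)
      then show ?thesis unfolding set_lebesgue_integral_def eq by (simp add: mollifier_mass c_def)
    qed
    also have "(LINT z:X|lborel. real_of_ereal (ereal (s z) + u z) * (lap w ?f z / 2)) = (LINT y|lborel. ht y * lap w ?f y) / 2"
    proof -
      have "(LINT z:X|lborel. real_of_ereal (ereal (s z) + u z) * (lap w ?f z / 2)) = (LINT y|lborel. ht y * lap w ?f y / 2)"
        unfolding set_lebesgue_integral_def
      proof (rule integral_cong_AE)
        have [measurable]: "lap w ?f \<in> borel_measurable borel"
          by (rule borel_measurable_continuous_onI[OF lap_mollifier(1)[OF e(1)]])
        show "(\<lambda>y. ht y * lap w ?f y / 2) \<in> borel_measurable lborel" by measurable
        have "(\<lambda>z. indicator X z *\<^sub>R (real_of_ereal (ereal (s z) + u z) * (lap w ?f z / 2))) =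
              (\<lambda>z. indicator (ball p R) z * (real_of_ereal (ereal (S z) + top_ext X u z) * (lap w ?f z / 2)))"
        proof
          fix x
          show "indicator X x *\<^sub>R (real_of_ereal (ereal (s x) + u x) * (lap w ?f x / 2)) =
              indicator (ball p R) x * (real_of_ereal (ereal (S x) + top_ext X u x) * (lap w ?f x / 2))"
          proof (cases "x \<in> ball p R")
            case True
            then have "x \<in> X" using R(3) by (auto simp: subset_eq)
            then show ?thesis using True by (simp add: S_def top_ext_def)
          next
            case False
            then have "lap w ?f x = 0" using lap_mollifier(2)[OF e(1), of x z w] subsetD[OF zR, of x] by auto
            then show ?thesis by simp
          qed
        qed
        then show "(\<lambda>z. indicator X z *\<^sub>R (real_of_ereal (ereal (s z) + u z) * (lap w ?f z / 2))) \<in> borel_measurable lborel"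
          by simp
        show "AE y in lborel. indicator X y *\<^sub>R (real_of_ereal (ereal (s y) + u y) * (lap w ?f y / 2)) = ht y * lap w ?f y / 2"
          using ht_h
        proof eventually_elim
          case (elim y)
          show ?case
          proof (cases "y \<in> ball p R")
            case True
            then have "y \<in> X" using R(3) by (auto simp: subset_eq)
            moreover have "ereal (s y) + u y = ereal (ht y)" using elim True unfolding h_def by simp
            ultimately show ?thesis by simp
          next
            case False
            then have "lap w ?f y = 0" using lap_mollifier(2)[OF e(1), of y z w] subsetD[OF zR, of y] by auto
            then show ?thesis by simp
          qed
        qed
      qed
      then show ?thesis by simp
    qed
    \<comment> \<open>The current tested on the mollifier: the Laplacian of the mollification along
      \<open>w\<close> is at least \<open>- 2 * q\<close>.\<close>
    finally have D: "- (2 * q) \<le> (LINT y|lborel. ht y * lap w ?f y) / c" using c by (simp add: pos_le_divide_eq)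
    obtain k1 where k1: "0 < k1" "\<And>k. 0 < k \<Longrightarrow> k < k1 \<Longrightarrow>
       conv \<epsilon> ht z + k\<^sup>2 / 4 * ((LINT y|lborel. ht y * lap w ?f y) / c) - k\<^sup>2 * (e / 2)
         \<le> 1 / (2 * pi) * (LINT \<theta>:{0..2*pi}|lborel. conv \<epsilon> ht (z + (of_real k * cis \<theta>) *s w))"
    proof -
      have "0 < e / 2" using e by simp
      then show thesis by (rule conv_circle_mean[OF hint e(1), of "e/2" z w, folded c_def]) (rule that, assumption+)
    qed
    show ?thesis
    proof (intro exI[of _ k1] conjI allI impI k1(1))
      fix k assume k: "0 < k \<and> k < k1"
      show "disc_sub (\<lambda>\<zeta>. ereal (conv \<epsilon> ht (z + (of_real k * \<zeta>) *s w))) (k\<^sup>2 * (q + e) / 2)"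
      proof (rule disc_sub_of_mean)
        show "set_integrable lborel {0..2*pi} (\<lambda>\<theta>. conv \<epsilon> ht (z + (of_real k * cis \<theta>) *s w))"
          by (rule set_integrable_cis[of "\<lambda>\<zeta>. conv \<epsilon> ht (z + (of_real k * \<zeta>) *s w)"])
             (intro continuous_on_circle_smult continuous_conv hint)
        have "k\<^sup>2 / 4 * (- (2 * q)) \<le> k\<^sup>2 / 4 * ((LINT y|lborel. ht y * lap w ?f y) / c)" by (intro mult_left_mono D) auto
        then show "conv \<epsilon> ht (z + (of_real k * 0) *s w) \<le> 1 / (2 * pi) * (LINT \<theta>:{0..2*pi}|lborel. conv \<epsilon> ht (z + (of_real k * cis \<theta>) *s w)) + k\<^sup>2 * (q + e) / 2"
        proof -
          assume A: "k\<^sup>2 / 4 * (- (2 * q)) \<le> k\<^sup>2 / 4 * ((LINT y|lborel. ht y * lap w ?f y) / c)"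
          have arith: "a \<le> x + b / 2 + d / 2" if "a + y - d / 2 \<le> x" "- (b / 2) \<le> y" for a b d x y :: real
            using that by linarith
          have "conv \<epsilon> ht z \<le> 1 / (2 * pi) * (LINT \<theta>:{0..2*pi}|lborel. conv \<epsilon> ht (z + (of_real k * cis \<theta>) *s w)) + k\<^sup>2 * q / 2 + k\<^sup>2 * e / 2"
            by (rule arith[OF k1(2)[of k, simplified times_divide_eq_right[of "k\<^sup>2" e 2]]]) (use k A in \<open>auto simp: mult.commute\<close>)
          then show ?thesis by (simp add: distrib_left add_divide_distrib)
        qed
      qed
    qed
  qed
  \<comment> \<open>\<open>disc_sub_of_local\<close> removes the dependence of the radius on
    \<open>\<epsilon>\<close>: the inequality now holds on the disc of a fixed radius
    \<open>k\<close>, so that \<open>\<epsilon>\<close> may tend to 0.\<close>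
  have conv_sub: "disc_sub (\<lambda>\<zeta>. ereal (conv \<epsilon> ht (p + \<zeta> *s (of_real k *s w)))) (k\<^sup>2 * q / 2)"
    if e: "0 < \<epsilon>" "\<epsilon> < r" and k: "0 < k" "k * norm w < r" for \<epsilon> k
  proof (rule disc_sub_of_local[where X = "ball p (2 * r)" and Q = "\<lambda>_. k\<^sup>2 * q"])
    show "usc_on (\<lambda>z. ereal (conv \<epsilon> ht z)) (ball p (2 * r))"
      unfolding usc_on_open_iff[OF open_ball]
    proof
      fix t :: ereal
      have "continuous_on (ball p (2 * r)) (\<lambda>z. ereal (conv \<epsilon> ht z))"
        by (intro continuous_on_ereal continuous_on_subset[OF continuous_conv[OF hint]]) auto
      then have "open (ball p (2 * r) \<inter> (\<lambda>z. ereal (conv \<epsilon> ht z)) -` {..<t})" by (intro continuous_open_preimage) auto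
      then show "open {x \<in> ball p (2 * r). ereal (conv \<epsilon> ht x) < t}" by (simp add: Int_def vimage_def)
    qed
    show "p + \<zeta> *s (of_real k *s w) \<in> ball p (2 * r)" if "norm \<zeta> \<le> 1" for \<zeta>
    proof -
      have "norm \<zeta> * (k * norm w) \<le> 1 * (k * norm w)" using that k by (intro mult_right_mono) auto
      moreover have "norm (\<zeta> *s (complex_of_real k *s w)) = norm \<zeta> * (k * norm w)" using k by (simp only: norm_smult norm_of_real abs_of_pos)
      moreover have "dist p (p + \<zeta> *s (complex_of_real k *s w)) = norm (\<zeta> *s (complex_of_real k *s w))" by (simp add: dist_norm)
      ultimately have "dist p (p + \<zeta> *s (complex_of_real k *s w)) \<le> k * norm w" by (simp only: mult_1)
      also have "\<dots> < 2 * r" using k r by linarith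
      finally have "dist p (p + \<zeta> *s (complex_of_real k *s w)) < 2 * r" .
      then show ?thesis unfolding mem_ball .
    qed
    fix y :: "complex^'n" and e :: real assume y: "y \<in> ball p (2 * r)" and e': "0 < e"
    \<comment> \<open>A disc of radius \<open>t\<close> in direction \<open>k w\<close> is one of
      radius \<open>t * k\<close> in direction \<open>w\<close>, which multiplies errors by
      \<open>k\<^sup>2\<close>.\<close>
    have "0 < e / k\<^sup>2" using e' k by simp
    obtain k1 where k1: "0 < k1" "\<And>t. 0 < t \<Longrightarrow> t < k1 \<Longrightarrow>
       disc_sub (\<lambda>\<zeta>. ereal (conv \<epsilon> ht (y + (of_real t * \<zeta>) *s w))) (t\<^sup>2 * (q + e / k\<^sup>2) / 2)"
      using loc[OF e \<open>0 < e / k\<^sup>2\<close> y] by blast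
    show "\<exists>\<gamma> R. 0 < R \<and> (\<forall>i. (\<lambda>\<xi>. \<gamma> \<xi> $ i) holomorphic_on ball 0 R) \<and> \<gamma> 0 = y \<and>
          (\<forall>i. ((\<lambda>\<xi>. \<gamma> \<xi> $ i) has_field_derivative (of_real k *s w) $ i) (at 0)) \<and>
          (\<exists>k0>0. \<forall>t. 0 < t \<and> t < k0 \<longrightarrow>
              disc_sub (\<lambda>\<zeta>. ereal (conv \<epsilon> ht (\<gamma> (of_real t * \<zeta>)))) (t\<^sup>2 * (k\<^sup>2 * q + e) / 2))"
    proof (rule exI[of _ "\<lambda>\<xi>. y + \<xi> *s (of_real k *s w)"], rule exI[of _ 1], intro conjI allI exI[of _ "k1 / k"] impI)
      fix t assume t: "0 < t \<and> t < k1 / k"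
      have "disc_sub (\<lambda>\<zeta>. ereal (conv \<epsilon> ht (y + (of_real (t * k) * \<zeta>) *s w))) ((t * k)\<^sup>2 * (q + e / k\<^sup>2) / 2)"
        using t k by (intro k1(2)) (auto simp: field_simps)
      moreover have "(t * k)\<^sup>2 * (q + e / k\<^sup>2) / 2 = t\<^sup>2 * (k\<^sup>2 * q + e) / 2" using k by (simp add: field_simps power_mult_distrib)
      moreover have "(of_real (t * k) * \<zeta>) *s w = (of_real t * \<zeta>) *s (of_real k *s w)" for \<zeta>
        by (simp add: vec_eq_iff algebra_simps)
      ultimately show "disc_sub (\<lambda>\<zeta>. ereal (conv \<epsilon> ht (y + (of_real t * \<zeta>) *s (of_real k *s w)))) (t\<^sup>2 * (k\<^sup>2 * q + e) / 2)" by (simp only:)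
    qed (use k k1 in \<open>auto intro!: holomorphic_intros derivative_eq_intros\<close>)
  qed (use q in auto)
  define k0 where "k0 = r / (norm w + 1)"
  have "0 < k0" using r by (simp add: k0_def add_nonneg_pos)
  moreover have "disc_sub (\<lambda>\<zeta>. h (p + (of_real k * \<zeta>) *s w)) (k\<^sup>2 * (Q p + \<eta>) / 2)" if k: "0 < k" "k < k0" for k
  proof (rule disc_subI_strict)
    have kw: "k * norm w < r"
    proof -
      have "k * norm w \<le> k * (norm w + 1)" using k by (intro mult_left_mono) auto
      also have "\<dots> < r" using k(2) unfolding k0_def by (simp add: pos_less_divide_eq add_nonneg_pos)
      finally show ?thesis .
    qed
    fix R' :: real and H assume R': "1 < R'" and H: "H holomorphic_on ball 0 R'" and
      maj: "\<And>\<zeta>. norm \<zeta> = 1 \<Longrightarrow> h (p + (of_real k * \<zeta>) *s w) < ereal (Re (H \<zeta>))"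
    have "h p \<le> ereal (Re (H 0) + k\<^sup>2 * q / 2) + ereal e" if e: "0 < e" for e
    proof -
      define e1 where "e1 = e / 2"
      have e1: "0 < e1" using e by (simp add: e1_def)
      \<comment> \<open>The pairs \<open>(\<zeta>, y)\<close> at which the function at
        \<open>y\<close> is below the majorant at \<open>\<zeta>\<close> plus \<open>e1\<close>,
        written with a separating level to be visibly open. Compactness of the circle gives one
        \<open>\<epsilon>1\<close> for all \<open>\<zeta>\<close>.\<close>
      define O1 where "O1 = (\<Union>t::real. (ball 0 R' \<inter> (\<lambda>\<zeta>. Re (H \<zeta>) + e1) -` {t<..}) \<times> {y \<in> X. u y < ereal (t - s y)})"
      have "open O1" unfolding O1_def
      proof (intro open_UN ballI open_Times)
        show "open (ball 0 R' \<inter> (\<lambda>\<zeta>. Re (H \<zeta>) + e1) -` {t<..})" for t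
          using holomorphic_on_imp_continuous_on[OF H] by (intro continuous_open_preimage continuous_intros) auto
        show "open {y \<in> X. u y < ereal (t - s y)}" for t
          using usc_on_less_continuous[OF usc, of "\<lambda>y. t - s y"] s X by (simp add: openin_open_eq continuous_on_diff)
      qed
      define \<Delta> where "\<Delta> = (\<lambda>\<zeta>. (\<zeta>, p + (of_real k * \<zeta>) *s w)) ` sphere (0::complex) 1"
      have "compact \<Delta>" unfolding \<Delta>_def by (intro compact_continuous_image continuous_intros compact_sphere)
      have circ: "p + (of_real k * \<zeta>) *s w \<in> ball p r" if "norm \<zeta> = 1" for \<zeta>
        using kw k that by (simp add: dist_norm norm_smult norm_mult)
      have circX: "p + (of_real k * \<zeta>) *s w \<in> X" if "norm \<zeta> = 1" for \<zeta>
        using circ[OF that] R(3) r by (auto simp: subset_eq)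
      have "\<Delta> \<subseteq> O1"
      proof
        fix x assume "x \<in> \<Delta>"
        then obtain \<zeta> where x: "x = (\<zeta>, p + (of_real k * \<zeta>) *s w)" "norm \<zeta> = 1" unfolding \<Delta>_def by auto
        let ?y = "p + (of_real k * \<zeta>) *s w"
        have "u ?y < ereal (Re (H \<zeta>) - s ?y)" using maj[OF x(2)] fin[OF circX[OF x(2)]] unfolding h_def by (cases "u ?y") auto
        then show "x \<in> O1" unfolding O1_def x(1) using e1 x(2) R' circX[OF x(2)] by (auto intro!: exI[of _ "Re (H \<zeta>)"])
      qed
      then obtain \<epsilon>1 where \<epsilon>1: "\<epsilon>1 > 0" "(\<Union>x\<in>\<Delta>. cball x \<epsilon>1) \<subseteq> O1"
        using compact_subset_open_imp_cball_epsilon_subset[OF \<open>compact \<Delta>\<close> \<open>open O1\<close>] by metis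
      obtain d where d: "d > 0" "\<And>y. y \<in> X \<Longrightarrow> dist y p < d \<Longrightarrow> \<bar>s y - s p\<bar> < e1"
        using s p e1 unfolding continuous_on_iff dist_real_def by metis
      define \<epsilon> where "\<epsilon> = Min {\<epsilon>1, d, r} / 2"
      have \<epsilon>: "0 < \<epsilon>" "\<epsilon> < r" "\<epsilon> < d" "\<epsilon> < \<epsilon>1" using \<epsilon>1(1) d(1) r(1) unfolding \<epsilon>_def by (auto simp: min_def)
      have "ereal (conv \<epsilon> ht (p + 0 *s (of_real k *s w))) \<le> ereal (Re (H 0 + of_real e1) + k\<^sup>2 * q / 2)"
      proof (rule disc_subD[OF conv_sub[OF \<epsilon>(1,2) k(1) kw]])
        have "H holomorphic_on cball 0 1" by (rule holomorphic_on_subset[OF H]) (use R' in auto)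
        then show "continuous_on (cball 0 1) (\<lambda>\<zeta>. H \<zeta> + of_real e1)" by (intro continuous_intros holomorphic_on_imp_continuous_on)
        show "(\<lambda>\<zeta>. H \<zeta> + of_real e1) holomorphic_on ball 0 1" by (intro holomorphic_intros holomorphic_on_subset[OF H]) (use R' in auto)
        fix \<zeta> :: complex assume z: "norm \<zeta> = 1"
        let ?z = "p + (of_real k * \<zeta>) *s w"
        have "conv \<epsilon> ht ?z \<le> Re (H \<zeta>) + e1"
        proof (rule conv_mono_AE[OF hint \<epsilon>(1)], use ht_h in eventually_elim)
          case (elim y)
          show ?case
          proof
            assume y: "y \<in> ball ?z \<epsilon>"
            have "dist (\<zeta>, ?z) (\<zeta>, y) \<le> \<epsilon>1" using y \<epsilon>(4) by (simp add: dist_Pair_Pair)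
            then have "(\<zeta>, y) \<in> O1" using \<epsilon>1(2) z unfolding \<Delta>_def by (auto simp: subset_eq)
            then obtain t where t: "u y < ereal (t - s y)" "t < Re (H \<zeta>) + e1" "y \<in> X" unfolding O1_def by auto
            have "y \<in> ball p R" using y circ[OF z] dist_triangle[of p y ?z] \<epsilon> r by auto
            then have "ereal (ht y) = h y" using elim by simp
            also have "\<dots> \<le> ereal t" using t(1) unfolding h_def by (cases "u y") auto
            finally show "ht y \<le> Re (H \<zeta>) + e1" using t(2) by simp
          qed
        qed
        then show "ereal (conv \<epsilon> ht (p + \<zeta> *s (of_real k *s w))) \<le> ereal (Re (H \<zeta> + of_real e1))"
          by (simp add: vector_smult_assoc mult.commute)
      qed
      then have conv_le: "conv \<epsilon> ht p \<le> Re (H 0) + e1 + k\<^sup>2 * q / 2" by simp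
      \<comment> \<open>At the centre \<open>u\<close> lies below its mollification, while the
        continuous summand \<open>s\<close> costs a second \<open>e1\<close>.\<close>
      have "u p \<le> ereal (conv \<epsilon> U p)" unfolding U_def
        by (rule psh_le_conv[OF X psh R(3) C \<epsilon>(1) _ uint AEu]) (use \<epsilon> r in auto)
      moreover have "conv \<epsilon> (\<lambda>y. (- 1) * S y) p \<le> - s p + e1"
      proof (rule conv_mono_AE)
        show "AE y in lborel. y \<in> ball p \<epsilon> \<longrightarrow> (- 1) * S y \<le> - s p + e1"
        proof (intro AE_I2 impI)
          fix y assume y: "y \<in> ball p \<epsilon>"
          then have "y \<in> ball p R" "y \<in> X" using \<epsilon> r R(3) by (auto simp: subset_eq)
          then show "(- 1) * S y \<le> - s p + e1" using d(2)[of y] y \<epsilon> unfolding S_def by (auto simp: dist_commute abs_less_iff)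
        qed
      qed (use Sint \<epsilon> in auto)
      moreover have "conv \<epsilon> ht p = conv \<epsilon> U p - conv \<epsilon> (\<lambda>y. (- 1) * S y) p"
      proof -
        have "integrable lborel (\<lambda>y. S y * mollifier \<epsilon> p y)" "integrable lborel (\<lambda>y. U y * mollifier \<epsilon> p y)"
          using mollifier_nonneg[of \<epsilon> p] mollifier_le_1[of \<epsilon> p] by (auto intro!: integrable_mult_bounded[of _ _ _ 1] Sint Uint)
        then show ?thesis unfolding conv_def ht_def by (simp add: distrib_right add_divide_distrib)
      qed
      ultimately have "u p \<le> ereal (Re (H 0) + k\<^sup>2 * q / 2 + e - s p)"
        using conv_le by (elim order_trans) (simp add: e1_def)
      then show ?thesis unfolding h_def by (cases "u p") auto
    qed
    then have "h p \<le> ereal (Re (H 0) + k\<^sup>2 * q / 2)" by (rule ereal_le_epsilon2[rule_format])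
    then show "h (p + (of_real k * 0) *s w) \<le> ereal (Re (H 0) + k\<^sup>2 * (Q p + \<eta>) / 2)" unfolding q_def by simp
  qed
  ultimately show ?thesis unfolding h_def by blast
qed

section \<open>The sub-mean value property on manifolds\<close>

lemma disc_sub_cong:
  assumes "\<And>z. norm z \<le> 1 \<Longrightarrow> h z = h' z"
  shows "disc_sub h m \<longleftrightarrow> disc_sub h' m"
  unfolding disc_sub_def using assms by (auto simp: dist_norm)

lemma disc_sub_mono: "disc_sub h m \<Longrightarrow> m \<le> m' \<Longrightarrow> disc_sub h m'"
  unfolding disc_sub_def by (meson add_left_mono ereal_less_eq(3) order_trans)

text \<open>A majorant of the larger function on the circle is one of the smaller, and the central
  values agree.\<close>

lemma disc_sub_touching:
  assumes "disc_sub h m" "h 0 = h' 0" "\<And>z. norm z = 1 \<Longrightarrow> h z \<le> h' z"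
  shows "disc_sub h' m"
  unfolding disc_sub_def
proof (intro allI impI)
  fix H assume "continuous_on (cball 0 1) H \<and> H holomorphic_on ball 0 1 \<and> (\<forall>z\<in>sphere 0 1. h' z \<le> ereal (Re (H z)))"
  then have "h 0 \<le> ereal (Re (H 0) + m)" by (intro disc_subD[OF assms(1)]) (auto intro: order_trans[OF assms(3)])
  then show "h' 0 \<le> ereal (Re (H 0) + m)" using assms(2) by simp
qed

lemma norm_add_smult_sq:
  "(norm (a + z *s (w :: complex^'n)))\<^sup>2 = (norm a)\<^sup>2 + 2 * Re (z * clin a w) + (norm z)\<^sup>2 * (norm w)\<^sup>2"
proof -
  have "(norm ((a + z *s w) $ i))\<^sup>2 = (norm (a $ i))\<^sup>2 + 2 * Re (z * (cnj (a $ i) * w $ i)) + (norm z)\<^sup>2 * (norm (w $ i))\<^sup>2" for i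
    unfolding norm_sq_expand[of "(a + z *s w) $ i" "a $ i"] by (simp add: norm_mult power_mult_distrib algebra_simps)
  then show ?thesis unfolding norm_vec_sq clin_def
    by (simp add: sum.distrib sum_distrib_left del: times_complex.simps)
qed

text \<open>On the unit circle the squared distance is the real part of an affine function of
  \<open>u\<close> whose central value is too large by \<open>(norm w)\<^sup>2\<close>. The sign of
  \<open>a\<close> is free: the quadratic term either repairs a defect or spends some
  positivity.\<close>

lemma disc_sub_add_quadratic:
  fixes w z p :: "complex^'n"
  assumes "disc_sub h m"
  shows "disc_sub (\<lambda>u. h u + ereal (a * (norm (z + u *s w - p))\<^sup>2)) (m - a * (norm w)\<^sup>2)"
  unfolding disc_sub_def
proof (intro allI impI)
  fix H assume H: "continuous_on (cball 0 1) H \<and> H holomorphic_on ball 0 1 \<and>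
     (\<forall>u\<in>sphere 0 1. h u + ereal (a * (norm (z + u *s w - p))\<^sup>2) \<le> ereal (Re (H u)))"
  define G where "G = (\<lambda>u. H u - of_real (a * ((norm (z - p))\<^sup>2 + (norm w)\<^sup>2)) - of_real (2 * a) * (u * clin (z - p) w))"
  have "h 0 \<le> ereal (Re (G 0) + m)"
  proof (rule disc_subD[OF assms])
    fix u :: complex assume z: "norm u = 1"
    have "z + u *s w - p = (z - p) + u *s w" by simp
    then have "(norm (z + u *s w - p))\<^sup>2 = (norm (z - p))\<^sup>2 + 2 * Re (u * clin (z - p) w) + (norm w)\<^sup>2"
      using norm_add_smult_sq[of "z - p" u w] z by (simp only: power_one mult_1)
    then have "a * (norm (z + u *s w - p))\<^sup>2 = a * ((norm (z - p))\<^sup>2 + (norm w)\<^sup>2) + 2 * a * Re (u * clin (z - p) w)"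
      by (simp only: distrib_left mult_ac add_ac)
    moreover have "h u + ereal (a * (norm (z + u *s w - p))\<^sup>2) \<le> ereal (Re (H u))" using H z by simp
    moreover have "Re (G u) = Re (H u) - a * ((norm (z - p))\<^sup>2 + (norm w)\<^sup>2) - 2 * a * Re (u * clin (z - p) w)"
    proof -
      have "Re (of_real t * X) = t * Re X" for t X by simp
      then show ?thesis unfolding G_def by (simp only: minus_complex.simps Re_complex_of_real)
    qed
    ultimately show "h u \<le> ereal (Re (G u))" by (cases "h u") auto
  qed (use H in \<open>auto simp: G_def intro!: continuous_intros holomorphic_intros\<close>)
  then have "h 0 \<le> ereal (Re (H 0) + m - a * ((norm (z - p))\<^sup>2 + (norm w)\<^sup>2))" by (simp add: G_def algebra_simps)
  then show "h 0 + ereal (a * (norm (z + 0 *s w - p))\<^sup>2) \<le> ereal (Re (H 0) + (m - a * (norm w)\<^sup>2))"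
    by (cases "h 0") (auto simp: algebra_simps)
qed

lemma disc_sub_scale:
  assumes "disc_sub h m" "0 < a"
  shows "disc_sub (\<lambda>z. ereal a * h z + ereal b) (a * m)"
  unfolding disc_sub_def
proof (intro allI impI)
  fix H assume H: "continuous_on (cball 0 1) H \<and> H holomorphic_on ball 0 1 \<and>
     (\<forall>z\<in>sphere 0 1. ereal a * h z + ereal b \<le> ereal (Re (H z)))"
  have iff: "ereal a * x + ereal b \<le> ereal t \<longleftrightarrow> x \<le> ereal ((t - b) / a)" for x t
    using assms(2) by (cases x) (auto simp: field_simps)
  have "h 0 \<le> ereal (Re ((H 0 - of_real b) / of_real a) + m)"
    by (rule disc_subD[OF assms(1), of "\<lambda>z. (H z - of_real b) / of_real a"])
       (use H assms(2) iff in \<open>auto intro!: continuous_intros holomorphic_intros\<close>)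
  also have "Re ((H 0 - of_real b) / of_real a) + m = (Re (H 0) + a * m - b) / a" using assms(2) by (simp add: field_simps)
  finally show "ereal a * h 0 + ereal b \<le> ereal (Re (H 0) + a * m)" unfolding iff by simp
qed

text \<open>Finitely many balls of local integrability cover \<open>C\<close>, and the sum over them
  dominates.\<close>

lemma psh_integrable_compact:
  fixes u :: "complex^'n \<Rightarrow> ereal"
  assumes X: "open X" and psh: "psh_on u X" and s: "continuous_on X s" and C: "compact C" "C \<subseteq> X"
  shows "integrable lborel (\<lambda>y. indicator C y * real_of_ereal (ereal (s y) + u y))"
proof -
  have usc: "usc_on u X" and fin: "\<And>x. x \<in> X \<Longrightarrow> u x \<noteq> \<infinity>" using psh unfolding psh_on_def by blast+
  note [measurable] = borel_measurable_top_ext[OF X usc]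
  have [measurable]: "C \<in> sets borel" using C(1) by (simp add: borel_compact)
  have "\<exists>R. 0 < R \<and> integrable lborel (\<lambda>y. indicator (ball p R) y * real_of_ereal (u y))" if "p \<in> C" for p
    using psh_local_data[OF X psh subsetD[OF C(2) that] zero_less_one] by metis
  then obtain R where R: "\<And>p. p \<in> C \<Longrightarrow> 0 < R p" "\<And>p. p \<in> C \<Longrightarrow> integrable lborel (\<lambda>y. indicator (ball p (R p)) y * real_of_ereal (u y))"
    by metis
  have "C \<subseteq> (\<Union>p\<in>C. ball p (R p))" using R(1) by auto
  from compactE_image[OF C(1) _ this] obtain F where F: "F \<subseteq> C" "finite F" "C \<subseteq> (\<Union>p\<in>F. ball p (R p))" by auto
  have sC: "integrable lborel (\<lambda>x. indicator C x *\<^sub>R s x)" by (rule borel_integrable_compact[OF C(1) continuous_on_subset[OF s C(2)]])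
  note [measurable] = borel_measurable_integrable[OF sC, simplified]
  show ?thesis
  proof (rule Bochner_Integration.integrable_bound)
    show "integrable lborel (\<lambda>y. \<bar>indicator C y * s y\<bar> + (\<Sum>p\<in>F. \<bar>indicator (ball p (R p)) y * real_of_ereal (u y)\<bar>))"
      using sC R(2) F(1) by (intro Bochner_Integration.integrable_add Bochner_Integration.integrable_sum integrable_abs) auto
    have eq: "(\<lambda>y. indicator C y * real_of_ereal (ereal (s y) + u y)) = (\<lambda>y. indicator C y * real_of_ereal (ereal (indicator C y * s y) + top_ext X u y))"
      using C(2) by (auto simp: fun_eq_iff indicator_def top_ext_def)
    show "(\<lambda>y. indicator C y * real_of_ereal (ereal (s y) + u y)) \<in> borel_measurable lborel" unfolding eq by measurable
    show "AE y in lborel. norm (indicator C y * real_of_ereal (ereal (s y) + u y)) \<le> norm (\<bar>indicator C y * s y\<bar> + (\<Sum>p\<in>F. \<bar>indicator (ball p (R p)) y * real_of_ereal (u y)\<bar>))"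
    proof (intro AE_I2)
      fix y
      have nn: "0 \<le> (\<Sum>p\<in>F. \<bar>indicator (ball p (R p)) y * real_of_ereal (u y)\<bar>)" by (intro sum_nonneg) auto
      show "norm (indicator C y * real_of_ereal (ereal (s y) + u y)) \<le> norm (\<bar>indicator C y * s y\<bar> + (\<Sum>p\<in>F. \<bar>indicator (ball p (R p)) y * real_of_ereal (u y)\<bar>))"
      proof (cases "y \<in> C")
        case True
        then obtain p where p: "p \<in> F" "y \<in> ball p (R p)" using F(3) by auto
        have "\<bar>indicator (ball p (R p)) y * real_of_ereal (u y)\<bar> \<le> (\<Sum>p\<in>F. \<bar>indicator (ball p (R p)) y * real_of_ereal (u y)\<bar>)"
          using p(1) F(2) by (intro member_le_sum) auto
        then have "\<bar>real_of_ereal (u y)\<bar> \<le> (\<Sum>p\<in>F. \<bar>indicator (ball p (R p)) y * real_of_ereal (u y)\<bar>)" using p by simp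
        moreover have "\<bar>real_of_ereal (ereal (s y) + u y)\<bar> \<le> \<bar>s y\<bar> + \<bar>real_of_ereal (u y)\<bar>" by (cases "u y") auto
        ultimately show ?thesis using True nn by simp
      qed (use nn in simp)
    qed
  qed
qed

section \<open>Charts and the metric form\<close>

locale hermitian_mfd =
  fixes A :: "('a::t2_space, 'n::finite) chart set" and g :: "('a, 'n) metric_coeffs"
  assumes mfd: "compact_hermitian_manifold A g"
begin

abbreviation "charts \<equiv> holomorphic_charts A"

definition Q :: "('a, 'n) chart \<Rightarrow> complex^'n \<Rightarrow> complex^'n \<Rightarrow> real" where
  "Q c z w = lform (g c z) w"

lemma metric_chart:
  assumes "c \<in> charts"
  shows "z \<in> chart_image c \<Longrightarrow> hermitian_pos_def (g c z)" "smooth_on (\<lambda>z. g c z $ j $ k) (chart_image c)"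
proof -
  have "\<forall>c\<in>charts. (\<forall>z\<in>chart_image c. hermitian_pos_def (g c z)) \<and> (\<forall>j k. smooth_on (\<lambda>z. g c z $ j $ k) (chart_image c))"
    using mfd unfolding compact_hermitian_manifold_def hermitian_metric_def by (elim conjE)
  from bspec[OF this assms] show "z \<in> chart_image c \<Longrightarrow> hermitian_pos_def (g c z)" "smooth_on (\<lambda>z. g c z $ j $ k) (chart_image c)"
    by auto
qed

lemma metric_transition:
  assumes "c \<in> charts" "c' \<in> charts" "z \<in> snd c ` (fst c \<inter> fst c')"
  shows "g c z $ j $ k = (\<Sum>l\<in>UNIV. \<Sum>m\<in>UNIV. g c' (transition c c' z) $ l $ m
               * partial_z j (\<lambda>w. transition c c' w $ l) z
               * cnj (partial_z k (\<lambda>w. transition c c' w $ m) z))"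
proof -
  have "\<forall>c\<in>charts. \<forall>c'\<in>charts. \<forall>z\<in>snd c ` (fst c \<inter> fst c'). \<forall>j k. g c z $ j $ k = (\<Sum>l\<in>UNIV. \<Sum>m\<in>UNIV. g c' (transition c c' z) $ l $ m
               * partial_z j (\<lambda>w. transition c c' w $ l) z
               * cnj (partial_z k (\<lambda>w. transition c c' w $ m) z))"
    using mfd unfolding compact_hermitian_manifold_def hermitian_metric_def by (elim conjE)
  from bspec[OF bspec[OF bspec[OF this assms(1)] assms(2)] assms(3)] show ?thesis by blast
qed

lemma compact_UNIV: "compact (UNIV :: 'a set)"
  using mfd unfolding compact_hermitian_manifold_def by blast

lemma chart_topological:
  assumes "c \<in> charts"
  shows "open (fst c)" "open (chart_image c)" "continuous_on (fst c) (snd c)" "continuous_on (chart_image c) (chart_inv c)"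
  using assms unfolding holomorphic_charts_def topological_chart_def homeomorphism_def by auto

lemma chart_inv_left [simp]: "c \<in> charts \<Longrightarrow> x \<in> fst c \<Longrightarrow> chart_inv c (snd c x) = x"
  unfolding holomorphic_charts_def topological_chart_def homeomorphism_def by auto

lemma chart_inv_right [simp]: "z \<in> chart_image c \<Longrightarrow> snd c (chart_inv c z) = z"
  by (rule f_inv_into_f)

lemma chart_inv_in: "z \<in> chart_image c \<Longrightarrow> chart_inv c z \<in> fst c"
  by (rule inv_into_into)

lemma inj_chart: "c \<in> charts \<Longrightarrow> inj_on (snd c) (fst c)"
  by (metis chart_inv_left inj_onI)

lemma atlas_subset: "A \<subseteq> charts"
  using mfd unfolding compact_hermitian_manifold_def holomorphic_atlas_def holomorphic_charts_def by auto

lemma atlas_cover: obtains c where "c \<in> A" "x \<in> fst c"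
proof -
  have "(\<Union>c\<in>A. fst c) = UNIV"
    using mfd unfolding compact_hermitian_manifold_def holomorphic_atlas_def by (elim conjE)
  then have "x \<in> (\<Union>c\<in>A. fst c)" by simp
  then show thesis using that by (elim UN_E)
qed

lemma open_chart_image_subset:
  assumes c: "c \<in> charts" and W: "open W" "W \<subseteq> fst c" shows "open (snd c ` W)"
proof -
  have "snd c ` W = {z \<in> chart_image c. chart_inv c z \<in> W}"
    using W(2) c by (auto simp: image_iff)
  moreover have "open (chart_image c \<inter> chart_inv c -` W)"
    by (rule continuous_open_preimage[OF chart_topological(4)[OF c] chart_topological(2)[OF c] W(1)])
  ultimately show ?thesis by (simp add: Int_def vimage_def)
qed

lemma open_chart_preimage:
  assumes c: "c \<in> charts" and W: "open W" shows "open {x \<in> fst c. snd c x \<in> W}"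
  using continuous_open_preimage[OF chart_topological(3)[OF c] chart_topological(1)[OF c] W] by (simp add: Int_def vimage_def)

lemma holomorphic_map_on_cong:
  assumes "holomorphic_map_on F S" "open T" "T \<subseteq> S" "\<And>z. z \<in> T \<Longrightarrow> F z = G z"
  shows "holomorphic_map_on G T"
  unfolding holomorphic_map_on_def
proof
  fix z assume z: "z \<in> T"
  then obtain L where L: "(F has_derivative L) (at z)" "\<forall>c v. L (c *s v) = c *s L v"
    using assms(1,3) unfolding holomorphic_map_on_def by blast
  have "(G has_derivative L) (at z)"
    by (rule has_derivative_transform_within_open[OF L(1) assms(2) z assms(4)])
  then show "\<exists>L. (G has_derivative L) (at z) \<and> (\<forall>c v. L (c *s v) = c *s L v)" using L(2) by blast
qed

text \<open>\<open>quasi_psh\<close> asks for a decomposition on the whole domain of a chart, hence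
  domains have to be shrunk to coordinate balls.\<close>

lemma chart_restrict:
  assumes c: "c \<in> charts" and W: "open W" "W \<subseteq> fst c"
  shows "(W, snd c) \<in> charts"
proof -
  have inv: "chart_inv (W, snd c) z = chart_inv c z" if "z \<in> snd c ` W" for z
    using that W(2) inj_chart[OF c] by (auto simp: inv_into_f_f inj_on_subset subset_iff)
  have op: "open (snd c ` W)" by (rule open_chart_image_subset[OF c W])
  have "homeomorphism W (snd c ` W) (snd c) (chart_inv (W, snd c))"
  proof (rule homeomorphismI)
    show "continuous_on W (snd c)" using chart_topological(3)[OF c] W(2) by (rule continuous_on_subset)
    have "continuous_on (snd c ` W) (chart_inv c)" by (rule continuous_on_subset[OF chart_topological(4)[OF c]]) (use W(2) in auto)
    then show "continuous_on (snd c ` W) (chart_inv (W, snd c))" by (rule continuous_on_eq) (use inv in auto)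
  qed (use W(2) c inv in \<open>auto simp: subset_iff\<close>)
  then have top: "topological_chart (W, snd c)" unfolding topological_chart_def using W op by simp
  have "holomorphically_compatible (W, snd c) c'" if c': "c' \<in> A" for c'
  proof -
    have comp: "holomorphically_compatible c c'" using c c' unfolding holomorphic_charts_def by blast
    have c'c: "c' \<in> charts" using atlas_subset c' by blast
    have oW: "open (W \<inter> fst c')" using W(1) chart_topological(1)[OF c'c] by auto
    have "holomorphic_map_on (transition (W, snd c) c') (snd c ` (W \<inter> fst c'))"
      by (rule holomorphic_map_on_cong[of "transition c c'" "snd c ` (fst c \<inter> fst c')"])
         (use comp inv W(2) open_chart_image_subset[OF c oW] in \<open>auto simp: holomorphically_compatible_def transition_def\<close>)
    moreover have "holomorphic_map_on (transition c' (W, snd c)) (snd c' ` (W \<inter> fst c'))"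
      by (rule holomorphic_map_on_cong[of "transition c' c" "snd c' ` (fst c \<inter> fst c')"])
         (use comp W(2) open_chart_image_subset[OF c'c oW] in \<open>auto simp: holomorphically_compatible_def transition_def\<close>)
    ultimately show ?thesis unfolding holomorphically_compatible_def by simp
  qed
  then show ?thesis unfolding holomorphic_charts_def using top by blast
qed

text \<open>By definition the charts of the maximal atlas are compatible with those of
  \<open>A\<close> only; near \<open>x\<close> the transition factors through a chart of
  \<open>A\<close>.\<close>

lemma transition_holomorphic:
  assumes c: "c \<in> charts" and c': "c' \<in> charts" and x: "x \<in> fst c" "x \<in> fst c'"
  obtains L where "(transition c c' has_derivative L) (at (snd c x))" "\<And>a v. L (a *s v) = a *s L v"
proof -
  obtain b where b: "b \<in> A" "x \<in> fst b" by (rule atlas_cover)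
  have bc: "b \<in> charts" using b atlas_subset by blast
  have "holomorphic_map_on (transition c b) (snd c ` (fst c \<inter> fst b))"
    using c b unfolding holomorphic_charts_def holomorphically_compatible_def by blast
  then obtain L1 where L1: "(transition c b has_derivative L1) (at (snd c x))" "\<And>a v. L1 (a *s v) = a *s L1 v"
    using x b unfolding holomorphic_map_on_def by blast
  have "holomorphic_map_on (transition b c') (snd b ` (fst c' \<inter> fst b))"
    using c' b unfolding holomorphic_charts_def holomorphically_compatible_def by blast
  then obtain L2 where L2: "(transition b c' has_derivative L2) (at (snd b x))" "\<And>a v. L2 (a *s v) = a *s L2 v"
    using x b unfolding holomorphic_map_on_def by blast
  have tx: "transition c b (snd c x) = snd b x" unfolding transition_def using c x by simp
  have "((\<lambda>z. transition b c' (transition c b z)) has_derivative (\<lambda>v. L2 (L1 v))) (at (snd c x))"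
    by (rule has_derivative_compose[OF L1(1)]) (use L2(1) tx in simp)
  then have "(transition c c' has_derivative (\<lambda>v. L2 (L1 v))) (at (snd c x))"
  proof (rule has_derivative_transform_within_open)
    show "open (snd c ` (fst c \<inter> fst b))" by (rule open_chart_image_subset[OF c]) (use chart_topological(1)[OF c] chart_topological(1)[OF bc] in auto)
    show "snd c x \<in> snd c ` (fst c \<inter> fst b)" using x b by auto
    show "transition b c' (transition c b z) = transition c c' z" if "z \<in> snd c ` (fst c \<inter> fst b)" for z
      using that c bc unfolding transition_def by auto
  qed
  then show thesis using that L1(2) L2(2) by simp
qed

lemma partial_z_complex_linear:
  assumes "(F has_derivative L) (at z)" "\<And>a v. L (a *s v) = a *s L v"
  shows "partial_z j (\<lambda>w. F w $ l) z = L (axis j 1) $ l"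
proof -
  have "((\<lambda>w. F w $ l) has_derivative (\<lambda>v. L v $ l)) (at z)"
    by (rule bounded_linear.has_derivative[OF bounded_linear_vec_nth assms(1)])
  then have "frechet_derivative (\<lambda>w. F w $ l) (at z) = (\<lambda>v. L v $ l)" by (rule frechet_derivative_at[symmetric])
  moreover have "axis j \<i> = \<i> *s axis j 1" by (simp add: vec_eq_iff axis_def)
  ultimately show ?thesis unfolding partial_z_def using assms(2)[of \<i> "axis j 1"] by simp
qed

text \<open>The transformation rule of the coefficients is the pullback by \<open>L\<close>, whose
  matrix entries are the Wirtinger derivatives of the transition. So \<open>Q\<close> is a function
  of the tangent vector alone.\<close>

lemma Q_transition:
  assumes c: "c \<in> charts" and c': "c' \<in> charts" and x: "x \<in> fst c" "x \<in> fst c'"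
    and L: "(transition c c' has_derivative L) (at (snd c x))" "\<And>a v. L (a *s v) = a *s L v"
  shows "Q c (snd c x) w = Q c' (snd c' x) (L w)"
proof -
  have lin: "linear L" using L(1) by (rule has_derivative_linear)
  have Lw: "L w $ l = (\<Sum>j\<in>UNIV. w $ j * L (axis j 1) $ l)" for l
  proof -
    have "w = (\<Sum>j\<in>UNIV. w $ j *s axis j 1)" by (simp add: basis_expansion)
    then have "L w = L (\<Sum>j\<in>UNIV. w $ j *s axis j 1)" by simp
    also have "\<dots> = (\<Sum>j\<in>UNIV. w $ j *s L (axis j 1))" using linear_sum[OF lin, of "\<lambda>j. w $ j *s axis j 1" UNIV] L(2) by simp
    finally have "L w = (\<Sum>j\<in>UNIV. w $ j *s L (axis j 1))" .
    then show ?thesis by simp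
  qed
  have "g c (snd c x) $ j $ k = (\<Sum>l\<in>UNIV. \<Sum>m\<in>UNIV. g c' (transition c c' (snd c x)) $ l $ m
               * partial_z j (\<lambda>w. transition c c' w $ l) (snd c x)
               * cnj (partial_z k (\<lambda>w. transition c c' w $ m) (snd c x)))" for j k
    using metric_transition[OF c c'] x by auto
  moreover have "transition c c' (snd c x) = snd c' x" unfolding transition_def using c x by simp
  ultimately have gjk: "g c (snd c x) $ j $ k = (\<Sum>l\<in>UNIV. \<Sum>m\<in>UNIV. g c' (snd c' x) $ l $ m * L (axis j 1) $ l * cnj (L (axis k 1) $ m))" for j k
    by (simp add: partial_z_complex_linear[OF L])
  let ?G = "g c' (snd c' x)"
  have "(\<Sum>j\<in>UNIV. \<Sum>k\<in>UNIV. g c (snd c x) $ j $ k * w $ j * cnj (w $ k))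
      = (\<Sum>j\<in>UNIV. \<Sum>k\<in>UNIV. \<Sum>l\<in>UNIV. \<Sum>m\<in>UNIV. ?G $ l $ m * (w $ j * L (axis j 1) $ l) * cnj (w $ k * L (axis k 1) $ m))"
    unfolding gjk sum_distrib_right by (intro sum.cong refl) (simp add: algebra_simps)
  also have "\<dots> = (\<Sum>l\<in>UNIV. \<Sum>m\<in>UNIV. \<Sum>j\<in>UNIV. \<Sum>k\<in>UNIV. ?G $ l $ m * (w $ j * L (axis j 1) $ l) * cnj (w $ k * L (axis k 1) $ m))"
    by (subst (2) sum.swap, subst (3) sum.swap, subst sum.swap, subst (2) sum.swap) (rule refl)
  also have "\<dots> = (\<Sum>l\<in>UNIV. \<Sum>m\<in>UNIV. ?G $ l $ m * L w $ l * cnj (L w $ m))"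
  proof (intro sum.cong refl)
    fix l m
    show "(\<Sum>j\<in>UNIV. \<Sum>k\<in>UNIV. ?G $ l $ m * (w $ j * L (axis j 1) $ l) * cnj (w $ k * L (axis k 1) $ m)) = ?G $ l $ m * L w $ l * cnj (L w $ m)"
      unfolding Lw by (simp only: sum_distrib_left sum_distrib_right cnj_sum mult.assoc, subst sum.swap, rule refl)
  qed
  finally show ?thesis unfolding Q_def lform_def by simp
qed

text \<open>The derivative of the inverse transition is a right inverse of \<open>L\<close>.\<close>

lemma transition_derivative_onto:
  assumes c: "c \<in> charts" and c': "c' \<in> charts" and x: "x \<in> fst c" "x \<in> fst c'"
    and L: "(transition c c' has_derivative L) (at (snd c x))"
  obtains w' where "L w' = w"
proof -
  obtain M where M: "(transition c' c has_derivative M) (at (snd c' x))"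
    by (rule transition_holomorphic[OF c' c x(2,1)]) (rule that, assumption)
  have tx: "transition c' c (snd c' x) = snd c x" unfolding transition_def using c' x by simp
  have "((\<lambda>z. transition c c' (transition c' c z)) has_derivative (\<lambda>v. L (M v))) (at (snd c' x))"
    by (rule has_derivative_compose[OF M]) (use L tx in simp)
  then have "((\<lambda>z. z) has_derivative (\<lambda>v. L (M v))) (at (snd c' x))"
  proof (rule has_derivative_transform_within_open)
    show "open (snd c' ` (fst c' \<inter> fst c))" by (rule open_chart_image_subset[OF c']) (use chart_topological(1)[OF c] chart_topological(1)[OF c'] in auto)
    show "snd c' x \<in> snd c' ` (fst c' \<inter> fst c)" using x by auto
    show "transition c c' (transition c' c z) = z" if "z \<in> snd c' ` (fst c' \<inter> fst c)" for z
      using that c c' unfolding transition_def by auto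
  qed
  then have "(\<lambda>v. L (M v)) = (\<lambda>v. v)" by (rule has_derivative_unique[OF _ has_derivative_ident])
  then show thesis using that[of "M w"] by meson
qed

lemma g_entry_continuous: "c \<in> charts \<Longrightarrow> continuous_on (chart_image c) (\<lambda>z. g c z $ j $ k)"
  using metric_chart(2) by (rule smooth_on_continuous)

lemma Q_continuous:
  assumes c: "c \<in> charts" shows "continuous_on (chart_image c \<times> UNIV) (\<lambda>(z, w). Q c z w)"
proof -
  have *: "continuous_on (chart_image c \<times> UNIV) (\<lambda>x. g c (fst x) $ j $ k)" for j k
    by (rule continuous_on_compose2[OF g_entry_continuous[OF c] continuous_on_fst[OF continuous_on_id]]) auto
  show ?thesis unfolding Q_def lform_def case_prod_unfold by (intro continuous_intros *)
qed

lemma Q_continuous1: "c \<in> charts \<Longrightarrow> continuous_on (chart_image c) (\<lambda>z. Q c z w)"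
  by (rule continuous_on_compose2[OF Q_continuous, of c "chart_image c" "\<lambda>z. (z, w)", simplified]) (auto intro!: continuous_intros)

lemma Q_pos: "c \<in> charts \<Longrightarrow> z \<in> chart_image c \<Longrightarrow> w \<noteq> 0 \<Longrightarrow> 0 < Q c z w"
proof -
  assume "c \<in> charts" "z \<in> chart_image c" "w \<noteq> 0"
  then have "\<forall>x. x \<noteq> 0 \<longrightarrow> Re (\<Sum>j\<in>UNIV. \<Sum>k\<in>UNIV. g c z $ j $ k * x $ j * cnj (x $ k)) > 0"
    using conjunct2[OF metric_chart(1)[unfolded hermitian_pos_def_def]] by blast
  then show "0 < Q c z w" using \<open>w \<noteq> 0\<close> unfolding Q_def lform_def by blast
qed

lemma Q_zero [simp]: "Q c z 0 = 0" unfolding Q_def lform_def by simp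

lemma Q_nonneg: "c \<in> charts \<Longrightarrow> z \<in> chart_image c \<Longrightarrow> 0 \<le> Q c z w"
  using Q_pos[of c z w] by (cases "w = 0") auto

lemma Q_smult: "Q c z (a *s w) = (norm a)\<^sup>2 * Q c z w" unfolding Q_def by (rule lform_smult)

text \<open>The local sub-mean value property expressing \<open>\<kappa> \<omega> + dd\<^sup>c v \<ge> 0\<close> at a point.\<close>

definition wsub :: "real \<Rightarrow> ('a \<Rightarrow> ereal) \<Rightarrow> 'a \<Rightarrow> bool" where
  "wsub \<kappa> v x \<longleftrightarrow> (\<exists>c\<in>charts. x \<in> fst c \<and> (\<forall>w \<eta>. 0 < \<eta> \<longrightarrow> (\<exists>\<rho>0>0. \<forall>\<rho>. 0 < \<rho> \<and> \<rho> < \<rho>0 \<longrightarrow>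
     disc_sub (\<lambda>\<zeta>. v (chart_inv c (snd c x + (of_real \<rho> * \<zeta>) *s w))) (\<rho>\<^sup>2 * (\<kappa> * Q c (snd c x) w + \<eta>) / 2))))"

definition wsh :: "real \<Rightarrow> ('a \<Rightarrow> ereal) \<Rightarrow> bool" where
  "wsh \<kappa> v \<longleftrightarrow> usc_on v UNIV \<and> (\<forall>x. v x \<noteq> \<infinity>) \<and> (\<forall>x. wsub \<kappa> v x)"

lemma usc_chart:
  assumes "usc_on v UNIV" "c \<in> charts"
  shows "usc_on (\<lambda>z. v (chart_inv c z)) (chart_image c)"
  unfolding usc_on_open_iff[OF chart_topological(2)[OF assms(2)]]
proof
  fix t
  have "open {x. v x < t}" using assms(1) unfolding usc_on_def by (simp add: openin_open_eq)
  from continuous_open_preimage[OF chart_topological(4)[OF assms(2)] chart_topological(2)[OF assms(2)] this]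
  show "open {z \<in> chart_image c. v (chart_inv c z) < t}" by (simp add: Int_def vimage_def)
qed

lemma line_field_derivative:
  fixes F :: "complex^'c \<Rightarrow> complex^'d"
  assumes "(F has_derivative L) (at (z + x *s w))" "\<And>a v. L (a *s v) = a *s L v"
  shows "((\<lambda>x. F (z + x *s w) $ i) has_field_derivative L w $ i) (at x)"
proof -
  have bl: "bounded_linear (\<lambda>x. x *s (w::complex^'c))"
    by (rule linear_conv_bounded_linear[THEN iffD1], rule linearI) (simp_all add: vec_eq_iff distrib_right)
  then have "((\<lambda>x. z + x *s w) has_derivative (\<lambda>t. t *s w)) (at x)"
    using has_derivative_add[OF has_derivative_const bounded_linear.has_derivative[OF bl has_derivative_ident], of z] by simp
  from has_derivative_compose[OF this assms(1)]
  have "((\<lambda>x. F (z + x *s w)) has_derivative (\<lambda>t. t *s L w)) (at x)" using assms(2) by simp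
  from bounded_linear.has_derivative[OF bounded_linear_vec_nth this, of i]
  have "((\<lambda>x. F (z + x *s w) $ i) has_derivative (\<lambda>t. t * L w $ i)) (at x)" by simp
  then show ?thesis unfolding has_field_derivative_def
    by (rule has_derivative_eq_rhs) (simp add: fun_eq_iff mult.commute)
qed

text \<open>\<open>wsub\<close> speaks about some chart and about radii depending on the point.
  \<open>disc_sub_of_local\<close> accepts curved discs, so the property in any chart passes to all
  affine discs of a given chart, with a defect controlled by \<open>Q\<close> on the disc.\<close>

lemma wsh_disc_sub:
  assumes v: "wsh \<kappa> v" and \<kappa>: "0 \<le> \<kappa>" and c: "c \<in> charts" and disc: "\<And>u. norm u \<le> 1 \<Longrightarrow> z + u *s w \<in> chart_image c"
    and m: "\<And>u. norm u \<le> 1 \<Longrightarrow> \<kappa> * Q c (z + u *s w) w \<le> m"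
  shows "disc_sub (\<lambda>u. v (chart_inv c (z + u *s w))) (m / 2)"
proof (rule disc_sub_of_local[OF chart_topological(2)[OF c], where Q = "\<lambda>z. \<kappa> * Q c z w"])
  show "usc_on (\<lambda>z. v (chart_inv c z)) (chart_image c)" using v c unfolding wsh_def by (intro usc_chart) auto
  show "v (chart_inv c z) \<noteq> \<infinity>" for z using v unfolding wsh_def by auto
  show "continuous_on (chart_image c) (\<lambda>z. \<kappa> * Q c z w)" by (intro continuous_intros Q_continuous1 c)
  have "0 \<le> \<kappa> * Q c (z + 0 *s w) w" using Q_nonneg[OF c disc[of 0]] \<kappa> by simp
  then show "0 \<le> m" using m[of 0] by simp
  fix y e assume y: "y \<in> chart_image c" and e: "(0::real) < e"
  define x where "x = chart_inv c y"
  have x: "x \<in> fst c" "snd c x = y" unfolding x_def using y by (auto intro: chart_inv_in)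
  obtain c1 where c1: "c1 \<in> charts" "x \<in> fst c1" and l1: "\<And>w e. 0 < e \<Longrightarrow> \<exists>t0>0. \<forall>t. 0 < t \<and> t < t0 \<longrightarrow>
     disc_sub (\<lambda>u. v (chart_inv c1 (snd c1 x + (of_real t * u) *s w))) (t\<^sup>2 * (\<kappa> * Q c1 (snd c1 x) w + e) / 2)"
    using v unfolding wsh_def wsub_def by meson
  obtain L where L: "(transition c1 c has_derivative L) (at (snd c1 x))" "\<And>a v. L (a *s v) = a *s L v"
    by (rule transition_holomorphic[OF c1(1) c c1(2) x(1)]) (rule that, assumption+)
  obtain w1 where w1: "L w1 = w" by (rule transition_derivative_onto[OF c1(1) c c1(2) x(1) L(1)]) (rule that, assumption)
  have Qeq: "Q c1 (snd c1 x) w1 = Q c y w" using Q_transition[OF c1(1) c c1(2) x(1) L, of w1] w1 x by simp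
  obtain t0 where t0: "0 < t0" "\<And>t. 0 < t \<Longrightarrow> t < t0 \<Longrightarrow>
     disc_sub (\<lambda>u. v (chart_inv c1 (snd c1 x + (of_real t * u) *s w1))) (t\<^sup>2 * (\<kappa> * Q c y w + e) / 2)"
    using l1[OF e, of w1] unfolding Qeq by blast
  define D where "D = snd c1 ` (fst c1 \<inter> fst c)"
  have oD: "open D" unfolding D_def by (rule open_chart_image_subset[OF c1(1)]) (use chart_topological(1)[OF c] chart_topological(1)[OF c1(1)] in auto)
  have "open ((\<lambda>\<xi>. snd c1 x + \<xi> *s w1) -` D)" by (intro open_vimage oD continuous_intros)
  moreover have "0 \<in> (\<lambda>\<xi>. snd c1 x + \<xi> *s w1) -` D" using c1 x unfolding D_def by auto
  ultimately obtain R where R0: "0 < R" "ball 0 R \<subseteq> (\<lambda>\<xi>. snd c1 x + \<xi> *s w1) -` D" by (rule openE)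
  then have R: "0 < R" "\<And>\<xi>. norm \<xi> < R \<Longrightarrow> snd c1 x + \<xi> *s w1 \<in> D" by (auto simp: subset_eq)
  \<comment> \<open>The image of an affine disc of \<open>c1\<close> is a holomorphic curve in
    \<open>c\<close> through \<open>y\<close> with velocity \<open>L w1 = w\<close>.\<close>
  define h where "h = (\<lambda>\<xi>. transition c1 c (snd c1 x + \<xi> *s w1))"
  have "(\<lambda>\<xi>. h \<xi> $ i) holomorphic_on ball 0 R" for i
  proof (rule holomorphic_onI)
    fix \<xi> :: complex assume "\<xi> \<in> ball 0 R"
    then obtain x' where x': "x' \<in> fst c1" "x' \<in> fst c" "snd c1 x + \<xi> *s w1 = snd c1 x'" using R(2)[of \<xi>] unfolding D_def by auto
    obtain L' where L': "(transition c1 c has_derivative L') (at (snd c1 x'))" "\<And>a v. L' (a *s v) = a *s L' v"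
      by (rule transition_holomorphic[OF c1(1) c x'(1,2)]) (rule that, assumption+)
    have "((\<lambda>\<xi>. h \<xi> $ i) has_field_derivative L' w1 $ i) (at \<xi>)" unfolding h_def
      by (rule line_field_derivative) (use L' x' in auto)
    then show "(\<lambda>\<xi>. h \<xi> $ i) field_differentiable at \<xi> within ball 0 R"
      using field_differentiable_at_within field_differentiable_def by blast
  qed
  moreover have "h 0 = y" unfolding h_def transition_def using c1 x by simp
  moreover have "((\<lambda>\<xi>. h \<xi> $ i) has_field_derivative w $ i) (at 0)" for i
    using line_field_derivative[of "transition c1 c" L "snd c1 x" 0 w1 i] L unfolding h_def w1[symmetric] by simp
  moreover have "disc_sub (\<lambda>u. v (chart_inv c (h (of_real t * u)))) (t\<^sup>2 * (\<kappa> * Q c y w + e) / 2)"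
    if t: "0 < t" "t < min t0 R" for t
  proof (rule disc_sub_cong[THEN iffD1, OF _ t0(2)[of t]])
    fix u :: complex assume "norm u \<le> 1"
    then have "norm (of_real t * u) \<le> t" using t by (simp add: norm_mult mult_left_le)
    then have "snd c1 x + (of_real t * u) *s w1 \<in> D" using t by (intro R(2)) auto
    then show "v (chart_inv c1 (snd c1 x + (of_real t * u) *s w1)) = v (chart_inv c (h (of_real t * u)))"
      unfolding h_def transition_def D_def using c c1 by auto
  qed (use t in auto)
  ultimately show "\<exists>h R. 0 < R \<and> (\<forall>i. (\<lambda>\<xi>. h \<xi> $ i) holomorphic_on ball 0 R) \<and> h 0 = y \<and>
          (\<forall>i. ((\<lambda>\<xi>. h \<xi> $ i) has_field_derivative w $ i) (at 0)) \<and>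
          (\<exists>t0>0. \<forall>t. 0 < t \<and> t < t0 \<longrightarrow>
              disc_sub (\<lambda>u. v (chart_inv c (h (of_real t * u)))) (t\<^sup>2 * (\<kappa> * Q c y w + e) / 2))"
    using R(1) t0(1) by (intro exI[of _ h] exI[of _ R] conjI allI exI[of _ "min t0 R"]) auto
qed (use disc m in auto)

end

section \<open>From sub-mean values to nonnegative currents\<close>

lemma partial_z_zbar_bounded:
  fixes f :: "complex^'n \<Rightarrow> real" and j k :: 'n
  assumes f: "smooth_on f UNIV" and C: "compact C" "\<And>z. z \<notin> C \<Longrightarrow> f z = 0"
  defines "P \<equiv> \<lambda>z. partial_z j (partial_zbar k (\<lambda>w. of_real (f w))) z"
  shows "continuous_on UNIV P" "z \<notin> C \<Longrightarrow> P z = 0" "\<exists>B. \<forall>z. norm (P z) \<le> B"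
proof -
  have *: "P = (\<lambda>z. Complex (dir_deriv (axis j 1) (dir_deriv (axis k 1) f) z + dir_deriv (axis j \<i>) (dir_deriv (axis k \<i>) f) z)
      (dir_deriv (axis j 1) (dir_deriv (axis k \<i>) f) z - dir_deriv (axis j \<i>) (dir_deriv (axis k 1) f) z) / 4)"
    unfolding P_def partial_z_partial_zbar_real[OF f] ..
  have cd: "continuous_on UNIV (dir_deriv a (dir_deriv b f))" for a b
    by (intro smooth_on_continuous smooth_on_dir_deriv f)
  have Cx: "Complex x y = of_real x + \<i> * of_real y" for x y by (simp add: complex_eq_iff)
  show c: "continuous_on UNIV P" unfolding * Cx by (intro continuous_intros cd) auto
  have d0: "dir_deriv a (dir_deriv b f) z = 0" if "z \<notin> C" for a b z
    by (intro dir_deriv_zero_outside[of C] compact_imp_closed C(1) that) (use C in \<open>auto intro: dir_deriv_zero_outside compact_imp_closed\<close>)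
  show 0: "P z = 0" if "z \<notin> C" for z unfolding * using d0[OF that] by (simp add: Cx)
  have "compact (P ` C)" by (intro compact_continuous_image continuous_on_subset[OF c] C) auto
  then obtain B where B: "\<forall>x\<in>P ` C. norm x \<le> B" using compact_imp_bounded bounded_iff by metis
  have "norm (P z) \<le> max B 0" for z using B 0[of z] by (cases "z \<in> C") (auto simp: le_max_iff_disj)
  then show "\<exists>B. \<forall>z. norm (P z) \<le> B" by blast
qed

lemma lap_bounded:
  fixes f :: "complex^'n \<Rightarrow> real"
  assumes f: "smooth_on f UNIV" and C: "compact C" "\<And>z. z \<notin> C \<Longrightarrow> f z = 0"
  shows "continuous_on UNIV (lap w f)" "z \<notin> C \<Longrightarrow> lap w f z = 0" "\<exists>B. \<forall>z. \<bar>lap w f z\<bar> \<le> B"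
proof -
  show c: "continuous_on UNIV (lap w f)"
    unfolding lap_def[abs_def] by (intro continuous_on_add smooth_on_continuous smooth_on_dir_deriv f)
  have d0: "dir_deriv a (dir_deriv b f) z = 0" if "z \<notin> C" for a b z
    by (intro dir_deriv_zero_outside[of C] compact_imp_closed C(1) that) (use C in \<open>auto intro: dir_deriv_zero_outside compact_imp_closed\<close>)
  show 0: "lap w f z = 0" if "z \<notin> C" for z unfolding lap_def using d0[OF that] by simp
  have "compact (lap w f ` C)" by (intro compact_continuous_image continuous_on_subset[OF c] C) auto
  then obtain B where B: "\<forall>x\<in>lap w f ` C. norm x \<le> B" using compact_imp_bounded bounded_iff by metis
  have "\<bar>lap w f z\<bar> \<le> max B 0" for z using B 0[of z] by (cases "z \<in> C") (auto simp: le_max_iff_disj)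
  then show "\<exists>B. \<forall>z. \<bar>lap w f z\<bar> \<le> B" by blast
qed

lemma circle_mean_real:
  assumes int: "set_integrable lborel {0..2*pi} k" and u: "\<And>t. u (z + cis t *s w) = ereal (k t)"
  shows "circle_mean u z w = ereal (1 / (2 * pi) * (LINT t:{0..2*pi}|lborel. k t))"
proof -
  define f where "f = (\<lambda>t. indicator {0..2*pi} t *\<^sub>R k t)"
  have f: "integrable lborel f" using int unfolding set_integrable_def f_def .
  have 1: "(\<integral>\<^sup>+ t \<in> {0..2*pi}. e2ennreal (u (z + cis t *s w)) \<partial>lborel) = (\<integral>\<^sup>+ t. ennreal (f t) \<partial>lborel)"
    unfolding f_def u e2ennreal_ereal by (intro nn_integral_cong) (auto simp: indicator_def)
  have 2: "(\<integral>\<^sup>+ t \<in> {0..2*pi}. e2ennreal (- u (z + cis t *s w)) \<partial>lborel) = (\<integral>\<^sup>+ t. ennreal (- f t) \<partial>lborel)"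
    unfolding f_def u uminus_ereal.simps e2ennreal_ereal by (intro nn_integral_cong) (auto simp: indicator_def)
  have fin: "(\<integral>\<^sup>+ t. ennreal (f t) \<partial>lborel) \<noteq> \<infinity>" "(\<integral>\<^sup>+ t. ennreal (- f t) \<partial>lborel) \<noteq> \<infinity>"
    using f by (auto simp: real_integrable_def)
  have e: "enn2ereal x = ereal (enn2real x)" if "x \<noteq> \<infinity>" for x using that by (cases x) (auto simp: enn2ereal_ennreal)
  show ?thesis unfolding circle_mean_def 1 2 e[OF fin(1)] e[OF fin(2)]
    using real_lebesgue_integral_def[OF f] by (simp add: set_lebesgue_integral_def f_def)
qed

text \<open>Testing the sub-mean value inequality on small circles against \<open>\<psi>\<close> and moving the mean over
  to \<open>\<psi>\<close> gives the lower bound for the distributional Laplacian.\<close>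

lemma sub_mean_imp_current:
  fixes h :: "complex^'n \<Rightarrow> real"
  assumes \<psi>: "smooth_on \<psi> UNIV" and C: "compact C" "\<And>z. z \<notin> C \<Longrightarrow> \<psi> z = 0" "\<And>z. 0 \<le> \<psi> z"
    and C': "compact C'" "0 < d" "\<And>x y. x \<in> C \<Longrightarrow> dist x y \<le> d \<Longrightarrow> y \<in> C'"
    and h: "integrable lborel (\<lambda>y. indicator C' y * h y)" and bdd: "\<And>y. y \<in> C' \<Longrightarrow> \<bar>h y\<bar> \<le> M"
    and q: "continuous_on C q"
    and sub: "\<And>e. 0 < e \<Longrightarrow> \<exists>t0>0. \<forall>t z. 0 < t \<and> t < t0 \<and> z \<in> C \<longrightarrow>
        h z \<le> 1 / (2 * pi) * (LINT \<theta>:{0..2*pi}|lborel. h (z + (of_real t * cis \<theta>) *s w)) + t\<^sup>2 * (q z + e) / 2"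
  shows "0 \<le> (LINT z|lborel. indicator C z * q z * \<psi> z) + (LINT z|lborel. indicator C' z * h z * (lap w \<psi> z / 2))"
proof -
  \<comment> \<open>The cut-off is invisible on circles of radius at most \<open>d\<close> centred
    in \<open>C\<close>, hence wherever \<open>\<psi>\<close> does not vanish.\<close>
  define H where "H = (\<lambda>y. indicator C' y * h y)"
  have H: "integrable lborel H" using h unfolding H_def .
  note [measurable] = borel_measurable_integrable[OF H, simplified]
  have [measurable]: "\<psi> \<in> borel_measurable borel" by (rule borel_measurable_continuous_onI[OF smooth_on_continuous[OF \<psi>]])
  have M0: "\<bar>H y\<bar> \<le> max M 0" for y using bdd[of y] unfolding H_def by (auto simp: indicator_def le_max_iff_disj)
  have \<psi>int: "integrable lborel \<psi>"
    by (rule integrable_cont_compact_support[OF C(1) continuous_on_subset[OF smooth_on_continuous[OF \<psi>]] C(2)]) auto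
  obtain P where P: "\<And>y. \<bar>\<psi> y\<bar> \<le> P"
  proof -
    have "compact (\<psi> ` C)" by (intro compact_continuous_image continuous_on_subset[OF smooth_on_continuous[OF \<psi>]] C) auto
    then obtain B where B: "\<forall>x\<in>\<psi> ` C. norm x \<le> B" using compact_imp_bounded bounded_iff by metis
    have "\<bar>\<psi> z\<bar> \<le> max B 0" for z using B C(2)[of z] by (cases "z \<in> C") (auto simp: le_max_iff_disj)
    then show thesis using that by blast
  qed
  have [measurable]: "lap w \<psi> \<in> borel_measurable borel" by (rule borel_measurable_continuous_onI[OF lap_bounded(1)[OF \<psi> C(1,2)]])
  obtain LB where LB: "\<And>y. \<bar>lap w \<psi> y\<bar> \<le> LB" using lap_bounded(3)[OF \<psi> C(1,2)] by blast
  have qint: "integrable lborel (\<lambda>z. indicator C z * q z * \<psi> z)"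
  proof -
    have "integrable lborel (\<lambda>x. indicator C x *\<^sub>R q x)" by (rule borel_integrable_compact[OF C(1) q])
    from integrable_mult_bounded[OF this _ P] show ?thesis by simp
  qed
  have Hl: "integrable lborel (\<lambda>z. H z * lap w \<psi> z)" by (rule integrable_mult_bounded[OF H _ LB]) measurable
  have H\<psi>: "integrable lborel (\<lambda>z. H z * \<psi> z)" by (rule integrable_mult_bounded[OF H _ P]) measurable
  define B where "B = (LINT y|lborel. \<bar>H y\<bar>)"
  define I1 I2 I3 where "I1 = (LINT z|lborel. indicator C z * q z * \<psi> z)" and "I2 = (LINT z|lborel. H z * lap w \<psi> z)" and "I3 = (LINT z|lborel. \<psi> z)"
  have CC: "y \<in> C'" if "y \<in> C" for y using C'(3)[OF that, of y] C'(2) by simp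
  have main: "0 \<le> I1 + I2 / 2 + e * (I3 + 2 * B)" if e: "0 < e" for e
  proof -
    obtain t0 where t0: "0 < t0" "\<And>t z. 0 < t \<Longrightarrow> t < t0 \<Longrightarrow> z \<in> C \<Longrightarrow>
        h z \<le> 1 / (2 * pi) * (LINT \<theta>:{0..2*pi}|lborel. h (z + (of_real t * cis \<theta>) *s w)) + t\<^sup>2 * (q z + e) / 2"
      using sub[OF e] by blast
    obtain t1 where t1: "0 < t1" and tay: "\<And>t y. 0 < t \<Longrightarrow> t < t1 \<Longrightarrow>
     \<bar>1 / (2 * pi) * (LINT \<theta>:{0..2*pi}|lborel. \<psi> (y + (of_real t * cis \<theta>) *s (- w))) - (\<psi> y + t\<^sup>2 / 4 * lap (- w) \<psi> y)\<bar> \<le> t\<^sup>2 * e"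
      using circle_mean_taylor[where f = \<psi> and w = "- w", OF \<psi> C(1,2) e] by blast
    define d1 where "d1 = d / (norm w + 1)"
    define t where "t = min (min t0 t1) d1 / 2"
    have d0: "0 < d1" using C'(2) by (simp add: d1_def add_nonneg_pos)
    have t': "0 < t" "t < t0" "t < t1" "t < d1" using t0(1) t1 d0 unfolding t_def by (auto simp: min_def)
    note t = t'[unfolded d1_def]
    have tw: "t * norm w \<le> d"
    proof -
      have "t * norm w \<le> t * (norm w + 1)" using t by (intro mult_left_mono) auto
      also have "\<dots> \<le> d" using t(4) by (simp add: pos_less_divide_eq add_nonneg_pos)
      finally show ?thesis .
    qed
    define a where "a = (\<lambda>\<theta>. (of_real t * cis \<theta>) *s w)"
    have na: "norm (a \<theta>) \<le> d" for \<theta> unfolding a_def norm_smult norm_mult using t tw by simp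
    define Mh where "Mh = (\<lambda>z. 1 / (2 * pi) * (LINT \<theta>:{0..2*pi}|lborel. H (z + a \<theta>)))"
    define N where "N = (\<lambda>y. 1 / (2 * pi) * (LINT \<theta>:{0..2*pi}|lborel. \<psi> (y + (of_real t * cis \<theta>) *s (- w))))"
    have [measurable]: "{0..2*pi} \<in> sets borel" by simp
    define f where "f = (\<lambda>\<theta> z. indicator {0..2*pi} \<theta> * (\<psi> z * H (z + a \<theta>)))"
    have fm: "(\<lambda>(\<theta>, y). f \<theta> y) \<in> borel_measurable (lborel \<Otimes>\<^sub>M lborel)"
      unfolding f_def a_def by measurable
    have dom: "integrable (lborel \<Otimes>\<^sub>M lborel) (\<lambda>(\<theta>, y). indicator {0..2*pi} \<theta> * (max M 0 * \<psi> y) :: real)"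
    proof (rule lborel_pair.Fubini_integrable)
      show "(\<lambda>(\<theta>, y). indicator {0..2*pi} \<theta> * (max M 0 * \<psi> y) :: real) \<in> borel_measurable (lborel \<Otimes>\<^sub>M lborel)" by measurable
      have "integrable lborel (\<lambda>\<theta>. indicator {0..2*pi} \<theta> * (\<bar>max M 0\<bar> * I3) :: real)"
        using borel_integrable_atLeastAtMost'[of 0 "2*pi" "\<lambda>_. \<bar>max M 0\<bar> * I3"] unfolding set_integrable_def by simp
      then show "integrable lborel (\<lambda>\<theta>. LINT y|lborel. norm ((\<lambda>(\<theta>, y). indicator {0..2*pi} \<theta> * (max M 0 * \<psi> y) :: real) (\<theta>, y)))"
        using C(3) by (simp add: abs_mult I3_def)
    qed (use \<psi>int in auto)
    have fint: "integrable (lborel \<Otimes>\<^sub>M lborel) (\<lambda>(\<theta>, y). f \<theta> y)"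
    proof (rule Bochner_Integration.integrable_bound[OF dom fm], intro AE_I2)
      fix x :: "real \<times> (complex^'n)"
      have "\<bar>\<psi> (snd x)\<bar> * \<bar>H (snd x + a (fst x))\<bar> \<le> \<bar>\<psi> (snd x)\<bar> * max M 0" by (intro mult_left_mono M0) auto
      then show "norm ((\<lambda>(\<theta>, y). f \<theta> y) x) \<le> norm ((\<lambda>(\<theta>, y). indicator {0..2*pi} \<theta> * (max M 0 * \<psi> y) :: real) x)"
        unfolding case_prod_unfold f_def by (auto simp: abs_mult indicator_def mult.commute)
    qed
    have Fub: "(LINT z|lborel. LINT \<theta>|lborel. f \<theta> z) = (LINT \<theta>|lborel. LINT z|lborel. f \<theta> z)"
      by (rule lborel_pair.Fubini_integral[OF fint])
    have inner: "(LINT \<theta>|lborel. f \<theta> z) = 2 * pi * (\<psi> z * Mh z)" for z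
      unfolding f_def Mh_def set_lebesgue_integral_def by (simp add: mult.left_commute[of "indicator _ _"])
    define f2 where "f2 = (\<lambda>\<theta> y. indicator {0..2*pi} \<theta> * (H y * \<psi> (y + (of_real t * cis \<theta>) *s (- w))))"
    have f2m: "(\<lambda>(\<theta>, y). f2 \<theta> y) \<in> borel_measurable (lborel \<Otimes>\<^sub>M lborel)" unfolding f2_def by measurable
    have dom2: "integrable (lborel \<Otimes>\<^sub>M lborel) (\<lambda>(\<theta>, y). indicator {0..2*pi} \<theta> * (P * \<bar>H y\<bar>) :: real)"
    proof (rule lborel_pair.Fubini_integrable)
      show "(\<lambda>(\<theta>, y). indicator {0..2*pi} \<theta> * (P * \<bar>H y\<bar>) :: real) \<in> borel_measurable (lborel \<Otimes>\<^sub>M lborel)" by measurable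
      have "integrable lborel (\<lambda>\<theta>. indicator {0..2*pi} \<theta> * (\<bar>P\<bar> * B) :: real)"
        using borel_integrable_atLeastAtMost'[of 0 "2*pi" "\<lambda>_. \<bar>P\<bar> * B"] unfolding set_integrable_def by simp
      then show "integrable lborel (\<lambda>\<theta>. LINT y|lborel. norm ((\<lambda>(\<theta>, y). indicator {0..2*pi} \<theta> * (P * \<bar>H y\<bar>) :: real) (\<theta>, y)))"
        by (simp add: abs_mult B_def)
    qed (use H in auto)
    have f2int: "integrable (lborel \<Otimes>\<^sub>M lborel) (\<lambda>(\<theta>, y). f2 \<theta> y)"
    proof (rule Bochner_Integration.integrable_bound[OF dom2 f2m], intro AE_I2)
      fix x :: "real \<times> (complex^'n)"
      have P0: "0 \<le> P" using P[of 0] by linarith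
      have "\<bar>H (snd x)\<bar> * \<bar>\<psi> (snd x + (of_real t * cis (fst x)) *s (- w))\<bar> \<le> \<bar>H (snd x)\<bar> * P" by (intro mult_left_mono P) auto
      then show "norm ((\<lambda>(\<theta>, y). f2 \<theta> y) x) \<le> norm ((\<lambda>(\<theta>, y). indicator {0..2*pi} \<theta> * (P * \<bar>H y\<bar>) :: real) x)"
        unfolding case_prod_unfold f2_def using P0 by (auto simp: abs_mult indicator_def mult.commute)
    qed
    have Fub2: "(LINT z|lborel. LINT \<theta>|lborel. f2 \<theta> z) = (LINT \<theta>|lborel. LINT z|lborel. f2 \<theta> z)"
      by (rule lborel_pair.Fubini_integral[OF f2int])
    have inner2: "(LINT \<theta>|lborel. f2 \<theta> z) = 2 * pi * (H z * N z)" for z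
      unfolding f2_def N_def set_lebesgue_integral_def by (simp add: mult.left_commute[of "indicator _ _"])
    \<comment> \<open>Translation by \<open>a \<theta>\<close> carries the circle from
      \<open>h\<close> over to \<open>\<psi>\<close> and reverses its direction.\<close>
    have shift: "(LINT z|lborel. f \<theta> z) = (LINT z|lborel. f2 \<theta> z)" for \<theta>
    proof -
      have "(LINT z|lborel. f2 \<theta> z) = (LINT z|distr lborel borel ((+) (a \<theta>)). f2 \<theta> z)" by (simp add: lborel_distr_plus)
      also have "\<dots> = (LINT z|lborel. f2 \<theta> (a \<theta> + z))" unfolding f2_def by (rule integral_distr) measurable
      also have "\<dots> = (LINT z|lborel. f \<theta> z)" unfolding f2_def f_def a_def by (simp add: vector_smult_rneg algebra_simps)
      finally show ?thesis by simp
    qed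
    have swap: "(LINT z|lborel. \<psi> z * Mh z) = (LINT y|lborel. H y * N y)"
    proof -
      have "2 * pi * (LINT z|lborel. \<psi> z * Mh z) = 2 * pi * (LINT y|lborel. H y * N y)"
        using Fub Fub2 unfolding inner inner2 shift integral_mult_right_zero by simp
      then show ?thesis by simp
    qed
    have i1: "integrable lborel (\<lambda>z. \<psi> z * Mh z)" using lborel_pair.integrable_snd[OF fint] unfolding inner by simp
    have i2: "integrable lborel (\<lambda>z. H z * N z)" using lborel_pair.integrable_snd[OF f2int] unfolding inner2 by simp
    have "(LINT z|lborel. H z * \<psi> z) \<le> (LINT z|lborel. \<psi> z * Mh z + t\<^sup>2 / 2 * (indicator C z * q z * \<psi> z) + t\<^sup>2 / 2 * e * \<psi> z)"
    proof (rule integral_mono[OF H\<psi>])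
      show "integrable lborel (\<lambda>z. \<psi> z * Mh z + t\<^sup>2 / 2 * (indicator C z * q z * \<psi> z) + t\<^sup>2 / 2 * e * \<psi> z)" using i1 qint \<psi>int by simp
      fix z
      show "H z * \<psi> z \<le> \<psi> z * Mh z + t\<^sup>2 / 2 * (indicator C z * q z * \<psi> z) + t\<^sup>2 / 2 * e * \<psi> z"
      proof (cases "z \<in> C")
        case True
        have "H (z + a \<theta>) = h (z + a \<theta>)" for \<theta> using C'(3)[OF True, of "z + a \<theta>"] na[of \<theta>] unfolding H_def by (simp add: dist_norm)
        then have "h z \<le> Mh z + t\<^sup>2 * (q z + e) / 2" using t0(2)[OF t(1,2) True] unfolding Mh_def a_def by simp
        then have "\<psi> z * h z \<le> \<psi> z * (Mh z + t\<^sup>2 * (q z + e) / 2)" using C(3) by (intro mult_left_mono) auto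
        moreover have "H z = h z" using CC[OF True] unfolding H_def by simp
        ultimately show ?thesis using True by (simp add: field_simps)
      qed (use C(2) in simp)
    qed
    also have "\<dots> = (LINT y|lborel. H y * N y) + t\<^sup>2 / 2 * I1 + t\<^sup>2 / 2 * e * I3"
      unfolding I1_def I3_def swap[symmetric] using i1 qint \<psi>int by simp
    also have "(LINT y|lborel. H y * N y) \<le> (LINT y|lborel. H y * \<psi> y + t\<^sup>2 / 4 * (H y * lap w \<psi> y) + t\<^sup>2 * e * \<bar>H y\<bar>)"
    proof (rule integral_mono[OF i2])
      show "integrable lborel (\<lambda>y. H y * \<psi> y + t\<^sup>2 / 4 * (H y * lap w \<psi> y) + t\<^sup>2 * e * \<bar>H y\<bar>)" using H\<psi> Hl H by simp
      fix y
      have "\<bar>H y * (N y - (\<psi> y + t\<^sup>2 / 4 * lap w \<psi> y))\<bar> \<le> \<bar>H y\<bar> * (t\<^sup>2 * e)"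
        unfolding abs_mult using tay[OF t(1,3), of y] by (intro mult_left_mono) (auto simp: N_def lap_minus[OF \<psi>])
      then show "H y * N y \<le> H y * \<psi> y + t\<^sup>2 / 4 * (H y * lap w \<psi> y) + t\<^sup>2 * e * \<bar>H y\<bar>" by (simp add: abs_le_iff algebra_simps)
    qed
    also have "\<dots> = (LINT y|lborel. H y * \<psi> y) + t\<^sup>2 / 4 * I2 + t\<^sup>2 * e * B"
      unfolding I2_def B_def using H\<psi> Hl H by simp
    \<comment> \<open>The terms of order 0 cancel, since both sides contain the integral of
      \<open>H * \<psi>\<close>; what remains is divisible by \<open>t\<^sup>2\<close>.\<close>
    finally have "0 \<le> t\<^sup>2 / 2 * (I1 + I2 / 2 + e * (I3 + 2 * B))" by (simp add: algebra_simps)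
    then show ?thesis using t(1) by (simp add: zero_le_mult_iff)
  qed
  define K where "K = I3 + 2 * B"
  have K: "0 \<le> K" unfolding K_def I3_def B_def using C(3) by (intro add_nonneg_nonneg) auto
  have "0 \<le> I1 + I2 / 2"
  proof (rule field_le_epsilon)
    fix e :: real assume e: "0 < e"
    have "0 < e / (K + 1)" using e K by simp
    from main[OF this] have "0 \<le> I1 + I2 / 2 + e / (K + 1) * K" unfolding K_def .
    also have "e / (K + 1) * K \<le> e" using e K by (simp add: field_simps)
    finally show "0 \<le> I1 + I2 / 2 + e" by simp
  qed
  then show ?thesis unfolding I1_def I2_def H_def by simp
qed

context hermitian_mfd
begin

text \<open>Hermitian symmetry makes the sum equal to its own conjugate.\<close>

lemma levi_metric_sum:
  assumes c: "c \<in> charts" and z: "z \<in> chart_image c"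
  shows "(\<Sum>j\<in>UNIV. \<Sum>k\<in>UNIV. w $ j * cnj (w $ k) * g c z $ j $ k) = of_real (Q c z w)"
proof -
  define S where "S = (\<Sum>j\<in>UNIV. \<Sum>k\<in>UNIV. w $ j * cnj (w $ k) * g c z $ j $ k)"
  have herm: "g c z $ k $ j = cnj (g c z $ j $ k)" for j k
    using conjunct1[OF metric_chart(1)[OF c z, unfolded hermitian_pos_def_def]] by blast
  have "cnj S = (\<Sum>j\<in>UNIV. \<Sum>k\<in>UNIV. cnj (w $ j) * w $ k * cnj (g c z $ j $ k))" unfolding S_def by simp
  also have "\<dots> = (\<Sum>j\<in>UNIV. \<Sum>k\<in>UNIV. cnj (w $ j) * w $ k * g c z $ k $ j)"
    by (intro sum.cong refl arg_cong2[where f="(*)"] herm[symmetric])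
  also have "\<dots> = (\<Sum>k\<in>UNIV. \<Sum>j\<in>UNIV. cnj (w $ j) * w $ k * g c z $ k $ j)" by (rule sum.swap)
  also have "\<dots> = S" unfolding S_def by (intro sum.cong refl) (simp only: mult_ac)
  finally have "cnj S = S" .
  then have im: "Im S = 0" by (simp add: complex_eq_iff)
  have "Re S = Q c z w" unfolding S_def Q_def lform_def by (intro arg_cong[where f=Re] sum.cong refl) (simp only: mult_ac)
  with im show ?thesis unfolding S_def[symmetric] by (simp add: complex_eq_iff)
qed

text \<open>Translates \<open>current11_nonneg\<close> into real integrals: the form contributes
  \<open>Q\<close>, and \<open>levi_sum\<close> collects the second derivatives of the test function
  into half a Laplacian.\<close>

lemma current_sum:
  fixes q :: "complex^'n \<Rightarrow> real"
  assumes c: "c \<in> charts" and q: "smooth_on q UNIV" and C: "compact C" "C \<subseteq> chart_image c" "\<And>z. z \<notin> C \<Longrightarrow> q z = 0"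
    and h: "integrable lborel (\<lambda>y. indicator C y * real_of_ereal (u y))"
  shows "(\<Sum>j\<in>UNIV. \<Sum>k\<in>UNIV. w $ j * cnj (w $ k) * (form_current (chart_image c) (g c) j k q + ddc_current (chart_image c) u j k q))
    = of_real ((LINT z|lborel. indicator C z * Q c z w * q z) + (LINT z|lborel. indicator C z * real_of_ereal (u z) * (lap w q z / 2)))"
proof -
  let ?X = "chart_image c"
  define P where "P = (\<lambda>j k z. partial_z j (partial_zbar k (\<lambda>w. of_real (q w))) z)"
  define f where "f = (\<lambda>j k z. indicator C z *\<^sub>R (g c z $ j $ k * of_real (q z)))"
  define r where "r = (\<lambda>y. indicator C y * real_of_ereal (u y))"
  define k' where "k' = (\<lambda>j k z. of_real (r z) * P j k z)"
  have qc: "continuous_on S q" for S using continuous_on_subset[OF smooth_on_continuous[OF q]] by auto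
  have fint: "integrable lborel (f j k)" for j k unfolding f_def
    by (intro borel_integrable_compact C continuous_intros qc continuous_on_subset[OF g_entry_continuous[OF c]])
  have kint: "integrable lborel (k' j k)" for j k
  proof -
    obtain B where B: "\<And>z. norm (P j k z) \<le> B" using partial_z_zbar_bounded(3)[OF q C(1) C(3)] unfolding P_def by blast
    have [measurable]: "P j k \<in> borel_measurable borel" unfolding P_def
      by (rule borel_measurable_continuous_onI[OF partial_z_zbar_bounded(1)[OF q C(1) C(3)]])
    have [measurable]: "r \<in> borel_measurable borel" using borel_measurable_integrable[OF h] unfolding r_def by simp
    show ?thesis
    proof (rule Bochner_Integration.integrable_bound[of _ "\<lambda>z. B * r z"])
      show "integrable lborel (\<lambda>z. B * r z)" using h unfolding r_def by simp
      show "k' j k \<in> borel_measurable lborel" unfolding k'_def by measurable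
      have B0: "0 \<le> B" using order_trans[OF norm_ge_zero B] .
      have "\<bar>r z\<bar> * norm (P j k z) \<le> \<bar>r z\<bar> * B" for z by (intro mult_left_mono B) auto
      then show "AE z in lborel. norm (k' j k z) \<le> norm (B * r z)" using B0
        by (intro AE_I2) (simp add: k'_def norm_mult abs_mult mult.commute)
    qed
  qed
  have form: "form_current ?X (g c) j k q = (LINT z|lborel. f j k z)" for j k
    unfolding form_current_def set_lebesgue_integral_def f_def using C by (intro Bochner_Integration.integral_cong refl) (auto simp: indicator_def)
  have ddc: "ddc_current ?X u j k q = 2 * (LINT z|lborel. k' j k z)" for j k
    unfolding ddc_current_def set_lebesgue_integral_def k'_def r_def P_def
    using C partial_z_zbar_bounded(2)[OF q C(1) C(3), of _ j k]
    by (intro arg_cong[where f="\<lambda>x. 2 * x"] Bochner_Integration.integral_cong refl) (auto simp: indicator_def)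
  have "(\<Sum>j\<in>UNIV. \<Sum>k\<in>UNIV. w $ j * cnj (w $ k) * (form_current ?X (g c) j k q + ddc_current ?X u j k q))
     = (\<Sum>j\<in>UNIV. \<Sum>k\<in>UNIV. (LINT z|lborel. w $ j * cnj (w $ k) * (f j k z + 2 * k' j k z)))"
    unfolding form ddc using fint kint by (intro sum.cong refl) simp
  also have "\<dots> = (LINT z|lborel. (\<Sum>j\<in>UNIV. \<Sum>k\<in>UNIV. w $ j * cnj (w $ k) * (f j k z + 2 * k' j k z)))"
    using fint kint by (simp add: Bochner_Integration.integral_sum)
  also have "\<dots> = (LINT z|lborel. of_real (indicator C z * Q c z w * q z + indicator C z * real_of_ereal (u z) * (lap w q z / 2)))"
  proof (intro Bochner_Integration.integral_cong refl)
    fix z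
    have "(\<Sum>j\<in>UNIV. \<Sum>k\<in>UNIV. w $ j * cnj (w $ k) * (f j k z + 2 * k' j k z))
      = of_real (indicator C z * q z) * (\<Sum>j\<in>UNIV. \<Sum>k\<in>UNIV. w $ j * cnj (w $ k) * g c z $ j $ k)
       + of_real (r z) * (\<Sum>j\<in>UNIV. \<Sum>k\<in>UNIV. w $ j * cnj (w $ k) * (2 * P j k z))"
      unfolding f_def k'_def scaleR_conv_of_real sum_distrib_left sum.distrib[symmetric]
      by (intro sum.cong refl) (simp add: algebra_simps)
    also have "(\<Sum>j\<in>UNIV. \<Sum>k\<in>UNIV. w $ j * cnj (w $ k) * (2 * P j k z)) = of_real (lap w q z / 2)"
      unfolding P_def by (rule levi_sum[OF q])
    also have "of_real (indicator C z * q z) * (\<Sum>j\<in>UNIV. \<Sum>k\<in>UNIV. w $ j * cnj (w $ k) * g c z $ j $ k) = of_real (indicator C z * Q c z w * q z)"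
    proof (cases "z \<in> C")
      case True
      then have "z \<in> ?X" using C(2) by blast
      from levi_metric_sum[OF c this] True show ?thesis by (simp add: mult.commute)
    qed simp
    finally show "(\<Sum>j\<in>UNIV. \<Sum>k\<in>UNIV. w $ j * cnj (w $ k) * (f j k z + 2 * k' j k z)) = of_real (indicator C z * Q c z w * q z + indicator C z * real_of_ereal (u z) * (lap w q z / 2))"
      unfolding r_def by simp
  qed
  also have "\<dots> = of_real (LINT z|lborel. indicator C z * Q c z w * q z + indicator C z * real_of_ereal (u z) * (lap w q z / 2))"
    by (rule integral_complex_of_real)
  also have "(LINT z|lborel. indicator C z * Q c z w * q z + indicator C z * real_of_ereal (u z) * (lap w q z / 2))
     = (LINT z|lborel. indicator C z * Q c z w * q z) + (LINT z|lborel. indicator C z * real_of_ereal (u z) * (lap w q z / 2))"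
  proof (rule Bochner_Integration.integral_add)
    have "integrable lborel (\<lambda>x. indicator C x *\<^sub>R (Q c x w * q x))"
      by (intro borel_integrable_compact C continuous_intros qc continuous_on_subset[OF Q_continuous1[OF c]])
    then show "integrable lborel (\<lambda>z. indicator C z * Q c z w * q z)" by (simp add: mult.assoc)
    obtain B where B: "\<And>z. \<bar>lap w q z\<bar> \<le> B" using lap_bounded(3)[OF q C(1) C(3)] by blast
    have [measurable]: "lap w q \<in> borel_measurable borel" by (rule borel_measurable_continuous_onI[OF lap_bounded(1)[OF q C(1,3)]])
    have "integrable lborel (\<lambda>z. indicator C z * real_of_ereal (u z) * lap w q z)" by (rule integrable_mult_bounded[OF h _ B]) measurable
    then show "integrable lborel (\<lambda>z. indicator C z * real_of_ereal (u z) * (lap w q z / 2))" by simp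
  qed
  finally show ?thesis .
qed

lemma LINT_indicator_support:
  fixes f :: "complex^'n \<Rightarrow> real"
  assumes "C \<subseteq> X" "\<And>z. z \<notin> C \<Longrightarrow> f z = 0"
  shows "(LINT z:X|lborel. f z) = (LINT z|lborel. indicator C z * f z)"
  unfolding set_lebesgue_integral_def using assms by (intro Bochner_Integration.integral_cong refl) (auto simp: indicator_def)

lemma chart_ball:
  assumes c: "c \<in> charts" and x: "x \<in> fst c"
  obtains R where "0 < R" "cball (snd c x) R \<subseteq> chart_image c"
  using open_contains_cball[THEN iffD1, OF chart_topological(2)[OF c]] x by (metis imageI)

lemma chart_at: obtains c where "c \<in> charts" "x \<in> fst c"
  using atlas_cover atlas_subset by (metis subsetD)

text \<open>In a chart where \<open>v = s + u\<close> with \<open>s\<close> smooth and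
  \<open>u\<close> psh, the current inequality is precisely what \<open>current_imp_disc_sub\<close>
  requires.\<close>

lemma PSH_imp_wsh:
  assumes v: "v \<in> PSH A g" shows "wsh 1 v"
proof -
  have q: "quasi_psh A v" using v unfolding PSH_def by blast
  have fin: "v x \<noteq> \<infinity>" for x using conjunct1[OF q[unfolded quasi_psh_def]] by blast
  have ch: "\<exists>c\<in>charts. x \<in> fst c \<and> (\<exists>s u. smooth_on s (chart_image c) \<and> psh_on u (chart_image c) \<and> (\<forall>y\<in>fst c. v y = ereal (s (snd c y)) + u (snd c y)))" for x
  proof -
    have "\<forall>x. \<exists>(U, f)\<in>charts. x \<in> U \<and> (\<exists>(s :: complex^'n \<Rightarrow> real) u. smooth_on s (f ` U) \<and> psh_on u (f ` U) \<and>
           (\<forall>y\<in>U. v y = ereal (s (f y)) + u (f y)))"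
      using q unfolding quasi_psh_def by (elim conjE)
    from spec[OF this, of x] show ?thesis by (simp only: case_prod_unfold)
  qed
  have "open {x. v x < t}" for t
  proof (subst open_subopen, intro ballI)
    fix x assume x: "x \<in> {x. v x < t}"
    obtain c s u where c: "c \<in> charts" "x \<in> fst c" and s: "smooth_on s (chart_image c)" and u: "psh_on u (chart_image c)"
      and eq: "\<And>y. y \<in> fst c \<Longrightarrow> v y = ereal (s (snd c y)) + u (snd c y)" using ch[of x] by blast
    have "usc_on u (chart_image c)" using u unfolding psh_on_def by blast
    from usc_on_minus_continuous[OF this, of "\<lambda>z. - s z"] smooth_on_continuous[OF s]
    have "open {z \<in> chart_image c. u z - ereal (- s z) < t}"
      unfolding usc_on_open_iff[OF chart_topological(2)[OF c(1)]] by (simp add: continuous_on_minus)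
    from open_chart_preimage[OF c(1) this]
    have "open {y \<in> fst c. snd c y \<in> {z \<in> chart_image c. u z - ereal (- s z) < t}}" .
    moreover have "{y \<in> fst c. snd c y \<in> {z \<in> chart_image c. u z - ereal (- s z) < t}} = {y \<in> fst c. v y < t}"
      using eq by (auto simp: add.commute minus_ereal_def)
    ultimately have "open {y \<in> fst c. v y < t}" by simp
    then show "\<exists>T. open T \<and> x \<in> T \<and> T \<subseteq> {x. v x < t}" using x c(2) by (intro exI[of _ "{y \<in> fst c. v y < t}"]) auto
  qed
  then have usc: "usc_on v UNIV" unfolding usc_on_def by (simp add: openin_open_eq)
  have "wsub 1 v x" for x
  proof -
    obtain c s u where c: "c \<in> charts" "x \<in> fst c" and s: "smooth_on s (chart_image c)" and u: "psh_on u (chart_image c)"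
      and eq: "\<And>y. y \<in> fst c \<Longrightarrow> v y = ereal (s (snd c y)) + u (snd c y)" using ch[of x] by blast
    have eqz: "v (chart_inv c z) = ereal (s z) + u z" if "z \<in> chart_image c" for z
      using eq[OF chart_inv_in[OF that]] that by simp
    \<comment> \<open>Integrability on the support of \<open>\<psi>\<close> makes the real integrals
      meaningful, so that nonnegativity of the complex sum can be read off from them.\<close>
    have cur: "0 \<le> (LINT z:chart_image c|lborel. Q c z w * \<psi> z) + (LINT z:chart_image c|lborel. real_of_ereal (ereal (s z) + u z) * (lap w \<psi> z / 2))"
      if \<psi>: "smooth_on \<psi> UNIV" "\<exists>C. compact C \<and> C \<subseteq> chart_image c \<and> (\<forall>z. z \<notin> C \<longrightarrow> \<psi> z = 0)" "\<And>z. 0 \<le> \<psi> z" for w \<psi>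
    proof -
      obtain C where C: "compact C" "C \<subseteq> chart_image c" "\<And>z. z \<notin> C \<Longrightarrow> \<psi> z = 0" using \<psi>(2) by blast
      have h: "integrable lborel (\<lambda>y. indicator C y * real_of_ereal (ereal (s y) + u y))"
        by (rule psh_integrable_compact[OF chart_topological(2)[OF c(1)] u smooth_on_continuous[OF s] C(1,2)])
      have heq: "(\<lambda>y. indicator C y * real_of_ereal ((v \<circ> chart_inv c) y)) = (\<lambda>y. indicator C y * real_of_ereal (ereal (s y) + u y))"
        using eqz C(2) by (auto simp: fun_eq_iff indicator_def)
      have h': "integrable lborel (\<lambda>y. indicator C y * real_of_ereal ((v \<circ> chart_inv c) y))" unfolding heq by (rule h)
      have heq': "indicator C y * real_of_ereal ((v \<circ> chart_inv c) y) = indicator C y * real_of_ereal (ereal (s y) + u y)" for y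
        using fun_cong[OF heq, of y] .
      have "test_function (chart_image c) \<psi>" unfolding test_function_def using \<psi> by blast
      then have "(\<Sum>j\<in>UNIV. \<Sum>k\<in>UNIV. w $ j * cnj (w $ k) * (form_current (chart_image c) (g c) j k \<psi> + ddc_current (chart_image c) (v \<circ> chart_inv c) j k \<psi>)) \<in> \<real>\<^sub>\<ge>\<^sub>0"
        using v c(1) \<psi>(3) unfolding PSH_def current11_nonneg_def by blast
      moreover have "(\<Sum>j\<in>UNIV. \<Sum>k\<in>UNIV. w $ j * cnj (w $ k) * (form_current (chart_image c) (g c) j k \<psi> + ddc_current (chart_image c) (v \<circ> chart_inv c) j k \<psi>))
          = of_real ((LINT z|lborel. indicator C z * Q c z w * \<psi> z) + (LINT z|lborel. indicator C z * real_of_ereal ((v \<circ> chart_inv c) z) * (lap w \<psi> z / 2)))"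
        by (rule current_sum[OF c(1) \<psi>(1) C h'])
      moreover have nn: "S \<in> \<real>\<^sub>\<ge>\<^sub>0 \<Longrightarrow> S = of_real t \<Longrightarrow> 0 \<le> t" for S :: complex and t by simp
      ultimately have "0 \<le> (LINT z|lborel. indicator C z * Q c z w * \<psi> z) + (LINT z|lborel. indicator C z * real_of_ereal ((v \<circ> chart_inv c) z) * (lap w \<psi> z / 2))"
        by (intro nn)
      then show ?thesis unfolding heq'
        using LINT_indicator_support[OF C(2), of "\<lambda>z. Q c z w * \<psi> z"] C(3)
          LINT_indicator_support[OF C(2), of "\<lambda>z. real_of_ereal (ereal (s z) + u z) * (lap w \<psi> z / 2)"] lap_bounded(2)[OF \<psi>(1) C(1,3)]
        by (simp add: mult.assoc)
    qed
    obtain R where R: "0 < R" "cball (snd c x) R \<subseteq> chart_image c" by (rule chart_ball[OF c]) (rule that, assumption+)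
    have "\<exists>\<rho>0>0. \<forall>\<rho>. 0 < \<rho> \<and> \<rho> < \<rho>0 \<longrightarrow>
       disc_sub (\<lambda>\<zeta>. v (chart_inv c (snd c x + (of_real \<rho> * \<zeta>) *s w))) (\<rho>\<^sup>2 * (1 * Q c (snd c x) w + e) / 2)" if e: "0 < e" for w e
    proof -
      have "\<exists>\<rho>0>0. \<forall>\<rho>. 0 < \<rho> \<and> \<rho> < \<rho>0 \<longrightarrow>
         disc_sub (\<lambda>\<zeta>. ereal (s (snd c x + (of_real \<rho> * \<zeta>) *s w)) + u (snd c x + (of_real \<rho> * \<zeta>) *s w)) (\<rho>\<^sup>2 * (Q c (snd c x) w + e) / 2)"
        by (rule current_imp_disc_sub[OF chart_topological(2)[OF c(1)] u smooth_on_continuous[OF s] Q_continuous1[OF c(1)] Q_nonneg[OF c(1)] cur _ e])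
           (use c in auto)
      then obtain \<rho>0 where \<rho>0: "0 < \<rho>0" "\<And>\<rho>. 0 < \<rho> \<Longrightarrow> \<rho> < \<rho>0 \<Longrightarrow>
         disc_sub (\<lambda>\<zeta>. ereal (s (snd c x + (of_real \<rho> * \<zeta>) *s w)) + u (snd c x + (of_real \<rho> * \<zeta>) *s w)) (\<rho>\<^sup>2 * (Q c (snd c x) w + e) / 2)"
        by blast
      define d1 where "d1 = R / (norm w + 1)"
      have d1: "0 < d1" using R(1) by (simp add: d1_def add_nonneg_pos)
      show ?thesis
      proof (intro exI[of _ "min \<rho>0 d1"] conjI allI impI)
        fix \<rho> assume \<rho>: "0 < \<rho> \<and> \<rho> < min \<rho>0 d1"
        have "\<rho> * norm w \<le> \<rho> * (norm w + 1)" using \<rho> by (intro mult_left_mono) auto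
        also have "\<dots> \<le> R" using \<rho> by (simp add: d1_def pos_less_divide_eq add_nonneg_pos)
        finally have \<rho>w: "\<rho> * norm w \<le> R" .
        have "disc_sub (\<lambda>\<zeta>. v (chart_inv c (snd c x + (of_real \<rho> * \<zeta>) *s w))) (\<rho>\<^sup>2 * (Q c (snd c x) w + e) / 2)"
        proof (rule disc_sub_cong[THEN iffD2, OF _ \<rho>0(2)])
          fix \<zeta> :: complex assume z: "norm \<zeta> \<le> 1"
          have "norm ((of_real \<rho> * \<zeta>) *s w) = norm \<zeta> * (\<rho> * norm w)" using \<rho> by (simp add: norm_smult norm_mult)
          also have "\<dots> \<le> 1 * R" using z \<rho>w \<rho> by (intro mult_mono) auto
          finally have "snd c x + (of_real \<rho> * \<zeta>) *s w \<in> cball (snd c x) R" by (simp add: dist_norm)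
          then show "v (chart_inv c (snd c x + (of_real \<rho> * \<zeta>) *s w)) = ereal (s (snd c x + (of_real \<rho> * \<zeta>) *s w)) + u (snd c x + (of_real \<rho> * \<zeta>) *s w)"
            using R(2) by (intro eqz) blast
        qed (use \<rho> in auto)
        then show "disc_sub (\<lambda>\<zeta>. v (chart_inv c (snd c x + (of_real \<rho> * \<zeta>) *s w))) (\<rho>\<^sup>2 * (1 * Q c (snd c x) w + e) / 2)" by simp
      qed (use \<rho>0 d1 in simp)
    qed
    then show ?thesis unfolding wsub_def using c by blast
  qed
  then show ?thesis unfolding wsh_def using usc fin by blast
qed

end

section \<open>Bounded functions with the sub-mean value property are competitors\<close>

lemma usc_on_compose:
  assumes u: "usc_on u T" and f: "continuous_on S f" "\<And>x. x \<in> S \<Longrightarrow> f x \<in> T"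
  shows "usc_on (\<lambda>x. u (f x)) S"
  unfolding usc_on_def
proof
  fix t
  obtain W where W: "open W" "{y \<in> T. u y < t} = T \<inter> W" using u unfolding usc_on_def openin_open by metis
  have "{x \<in> S. u (f x) < t} = S \<inter> f -` W" using W(2) f(2) by auto
  then show "openin (top_of_set S) {x \<in> S. u (f x) < t}" using continuous_openin_preimage_gen[OF f(1) W(1)] by simp
qed

lemma bump_class_sum: "finite I \<Longrightarrow> (\<And>i. i \<in> I \<Longrightarrow> f i \<in> bump_class z e) \<Longrightarrow> (\<lambda>y. \<Sum>i\<in>I. f i y) \<in> bump_class z e"
proof (induction I rule: finite_induct)
  case empty
  have "(\<lambda>y. 0 * 1) \<in> bump_class z e" by (intro bump_class.intros)
  then show ?case by simp
next
  case (insert i I)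
  then show ?case by (simp add: bump_class.add)
qed

lemma smooth_on_norm_sq: "smooth_on (\<lambda>z::complex^'n. a * (norm (z - p))\<^sup>2) S"
proof -
  have 1: "(\<lambda>z::complex^'n. \<Sum>b\<in>Basis. (z \<bullet> b) * ((z \<bullet> b) * 1)) \<in> bump_class 0 0"
    by (intro bump_class_sum bump_class.intros) simp
  have "(\<lambda>z. a * ((\<Sum>b\<in>Basis. (z \<bullet> b) * ((z \<bullet> b) * 1)) + ((- 2) * ((z \<bullet> p) * 1) + (p \<bullet> p) * 1))) \<in> bump_class (0::complex^'n) 0"
    by (intro bump_class.intros 1)
  moreover have "a * ((\<Sum>b\<in>Basis. (z \<bullet> b) * ((z \<bullet> b) * 1)) + ((- 2) * ((z \<bullet> p) * 1) + (p \<bullet> p) * 1)) = a * (norm (z - p))\<^sup>2" for z :: "complex^'n"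
  proof -
    have "(\<Sum>b\<in>Basis. (z \<bullet> b) * ((z \<bullet> b) * 1)) = z \<bullet> z" by (simp add: euclidean_inner[of z z])
    moreover have "(norm (z - p))\<^sup>2 = z \<bullet> z - 2 * (z \<bullet> p) + p \<bullet> p"
      unfolding power2_norm_eq_inner by (simp add: inner_diff_left inner_diff_right inner_commute)
    ultimately show ?thesis by simp
  qed
  ultimately have "(\<lambda>z. a * (norm (z - p))\<^sup>2) \<in> bump_class (0::complex^'n) 0" by (simp only:)
  then show ?thesis by (rule bump_class_smooth)
qed

context hermitian_mfd
begin

text \<open>Extrema of a continuous positive function on the compact product with the unit sphere,
  extended by homogeneity.\<close>

lemma Q_bounds:
  assumes c: "c \<in> charts" and K: "compact K" "K \<subseteq> chart_image c"
  obtains l N where "0 < l" "0 \<le> N" "\<And>z w. z \<in> K \<Longrightarrow> l * (norm w)\<^sup>2 \<le> Q c z w" "\<And>z w. z \<in> K \<Longrightarrow> Q c z w \<le> N * (norm w)\<^sup>2"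
proof (cases "K = {}")
  case True
  then show thesis using that[of 1 0] by auto
next
  case False
  let ?S = "K \<times> sphere (0::complex^'n) 1"
  have cS: "compact ?S" by (intro compact_Times K compact_sphere)
  obtain e :: "complex^'n" where "norm e = 1" using vector_choose_size[of 1] by auto
  then have ne: "?S \<noteq> {}" using False by (metis Times_empty empty_iff mem_sphere_0)
  have cont: "continuous_on ?S (\<lambda>(z, w). Q c z w)" by (rule continuous_on_subset[OF Q_continuous[OF c]]) (use K in auto)
  obtain a where a: "a \<in> ?S" "\<And>x. x \<in> ?S \<Longrightarrow> (case a of (z, w) \<Rightarrow> Q c z w) \<le> (case x of (z, w) \<Rightarrow> Q c z w)"
    using continuous_attains_inf[OF cS ne cont] by blast
  obtain b where b: "b \<in> ?S" "\<And>x. x \<in> ?S \<Longrightarrow> (case x of (z, w) \<Rightarrow> Q c z w) \<le> (case b of (z, w) \<Rightarrow> Q c z w)"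
    using continuous_attains_sup[OF cS ne cont] by blast
  define l where "l = (case a of (z, w) \<Rightarrow> Q c z w)"
  define N where "N = (case b of (z, w) \<Rightarrow> Q c z w)"
  have l: "0 < l" unfolding l_def using a(1) K(2) by (cases a) (auto simp: subset_eq intro!: Q_pos[OF c])
  have N: "0 \<le> N" unfolding N_def using b(1) Q_nonneg[OF c, of "fst b" "snd b"] K(2) by (cases b) (auto simp: subset_eq)
  have both: "l * (norm w)\<^sup>2 \<le> Q c z w \<and> Q c z w \<le> N * (norm w)\<^sup>2" if z: "z \<in> K" for z w
  proof (cases "w = 0")
    case False
    define v where "v = of_real (1 / norm w) *s w"
    have "norm v = 1" using False unfolding v_def norm_smult norm_of_real by simp
    then have "(z, v) \<in> ?S" using z by simp
    then have "l \<le> Q c z v" "Q c z v \<le> N" using a(2)[of "(z, v)"] b(2)[of "(z, v)"] unfolding l_def N_def by auto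
    moreover have "w = of_real (norm w) *s v" using False by (simp add: v_def vector_smult_assoc)
    then have "Q c z w = (norm w)\<^sup>2 * Q c z v" using Q_smult[of c z "of_real (norm w)" v] by simp
    ultimately show ?thesis by (simp add: mult.commute[of _ "(norm w)\<^sup>2"] mult_left_mono)
  qed simp
  then show thesis using that l N by blast
qed

lemma usc_bounded_above:
  fixes v :: "'a \<Rightarrow> ereal"
  assumes "usc_on v UNIV" "\<And>x. v x \<noteq> \<infinity>"
  obtains M where "0 \<le> M" "\<And>x. v x \<le> ereal M"
proof -
  obtain y where y: "\<And>x. v x \<le> v y" using usc_attains_max[OF compact_UNIV _ assms(1)] by auto
  have "v y \<le> ereal (max 0 (real_of_ereal (v y)))" using assms(2)[of y] by (cases "v y") auto
  from order_trans[OF y this] show thesis by (intro that[of "max 0 (real_of_ereal (v y))"]) auto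
qed

lemma wsh_circle_mean:
  assumes v: "wsh \<kappa> v" and \<kappa>: "0 \<le> \<kappa>" and vr: "\<And>x. v x = ereal (vr x)" "\<And>x. \<bar>vr x\<bar> \<le> M" and c: "c \<in> charts"
    and disc: "\<And>u. norm u \<le> 1 \<Longrightarrow> z + u *s w \<in> chart_image c"
    and m: "\<And>u. norm u \<le> 1 \<Longrightarrow> \<kappa> * Q c (z + u *s w) w \<le> m"
  shows "set_integrable lborel {0..2*pi} (\<lambda>t. vr (chart_inv c (z + cis t *s w)))"
    and "vr (chart_inv c z) \<le> 1 / (2 * pi) * (LINT t:{0..2*pi}|lborel. vr (chart_inv c (z + cis t *s w))) + m / 2"
proof -
  have sub: "disc_sub (\<lambda>u. ereal (vr (chart_inv c (z + u *s w)))) (m / 2)"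
    using wsh_disc_sub[OF v \<kappa> c disc m] unfolding vr(1) by simp
  have "usc_on (\<lambda>z. v (chart_inv c z)) (chart_image c)" using v c unfolding wsh_def by (intro usc_chart) auto
  then have usc: "usc_on (\<lambda>u. ereal (vr (chart_inv c (z + u *s w)))) (sphere 0 1)"
    unfolding vr(1) by (rule usc_on_compose) (use disc in \<open>auto intro!: continuous_intros\<close>)
  show "set_integrable lborel {0..2*pi} (\<lambda>t. vr (chart_inv c (z + cis t *s w)))"
    using mean_le_of_bounded_usc(1)[OF sub vr(2) usc] .
  show "vr (chart_inv c z) \<le> 1 / (2 * pi) * (LINT t:{0..2*pi}|lborel. vr (chart_inv c (z + cis t *s w))) + m / 2"
    using mean_le_of_bounded_usc(2)[OF sub vr(2) usc] by simp
qed

text \<open>Adding \<open>N * (norm (z - p))\<^sup>2\<close>, with \<open>N\<close> half of an upper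
  bound for \<open>Q\<close>, cancels the defect and yields a psh function; the smooth part of
  \<open>v\<close> is the negative of this quadratic.\<close>

lemma wsh_quasi_psh:
  assumes v: "wsh 1 v" and vr: "\<And>x. v x = ereal (vr x)" "\<And>x. \<bar>vr x\<bar> \<le> M"
  shows "quasi_psh A v"
proof -
  have "\<exists>(U, f)\<in>charts. x \<in> U \<and> (\<exists>(s :: complex^'n \<Rightarrow> real) u. smooth_on s (f ` U) \<and> psh_on u (f ` U) \<and>
           (\<forall>y\<in>U. v y = ereal (s (f y)) + u (f y)))" for x
  proof -
    obtain c where c: "c \<in> charts" "x \<in> fst c" by (rule chart_at)
    obtain R where R: "0 < R" "cball (snd c x) R \<subseteq> chart_image c" by (rule chart_ball[OF c]) (rule that, assumption+)
    define p where "p = snd c x"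
    obtain l N0 where N0: "0 \<le> N0" "\<And>z w. z \<in> cball p R \<Longrightarrow> Q c z w \<le> N0 * (norm w)\<^sup>2"
      using Q_bounds[OF c(1) compact_cball R(2)] unfolding p_def by metis
    define N where "N = N0 / 2"
    have Rim: "ball p R \<subseteq> chart_image c" using R(2) ball_subset_cball unfolding p_def by blast
    define U where "U = {y \<in> fst c. snd c y \<in> ball p R}"
    have "open U" unfolding U_def by (rule open_chart_preimage[OF c(1) open_ball])
    then have U: "(U, snd c) \<in> charts" by (rule chart_restrict[OF c(1)]) (auto simp: U_def)
    have im: "snd c ` U = ball p R"
    proof
      show "ball p R \<subseteq> snd c ` U"
      proof
        fix z assume z: "z \<in> ball p R"
        then have zi: "z \<in> chart_image c" using Rim by blast
        then have "chart_inv c z \<in> U" "snd c (chart_inv c z) = z" using z chart_inv_in[OF zi] chart_inv_right[OF zi] unfolding U_def by auto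
        then show "z \<in> snd c ` U" by (metis imageI)
      qed
    qed (auto simp: U_def)
    define u where "u = (\<lambda>z. v (chart_inv c z) + ereal (N * (norm (z - p))\<^sup>2))"
    have uscv: "usc_on (\<lambda>z. v (chart_inv c z)) (ball p R)"
      by (rule usc_on_subset[OF usc_chart[OF _ c(1)] Rim]) (use v in \<open>simp add: wsh_def\<close>)
    have "psh_on u (ball p R)" unfolding psh_on_def
    proof (intro conjI ballI allI impI)
      show "u z \<noteq> \<infinity>" for z unfolding u_def vr by simp
      fix C assume "C \<in> components (ball p R)"
      then have "C \<noteq> {}" by (rule in_components_nonempty)
      then show "\<exists>z\<in>C. u z \<noteq> - \<infinity>" unfolding u_def vr by auto
    next
      have "u = (\<lambda>z. v (chart_inv c z) - ereal (- (N * (norm (z - p))\<^sup>2)))" unfolding u_def by (simp add: minus_ereal_def)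
      then show "usc_on u (ball p R)" using usc_on_minus_continuous[OF uscv, of "\<lambda>z. - (N * (norm (z - p))\<^sup>2)"] by (simp add: continuous_intros)
    next
      fix z w assume disc: "\<forall>t\<in>cball 0 1. z + t *s w \<in> ball p R"
      have d1: "z + t *s w \<in> ball p R" if "norm t \<le> 1" for t using disc that by auto
      have sub: "disc_sub (\<lambda>t. v (chart_inv c (z + t *s w))) (N0 * (norm w)\<^sup>2 / 2)"
      proof (rule wsh_disc_sub[OF v _ c(1)])
        fix t :: complex assume t: "norm t \<le> 1"
        show "z + t *s w \<in> chart_image c" by (rule subsetD[OF Rim d1[OF t]])
        show "1 * Q c (z + t *s w) w \<le> N0 * (norm w)\<^sup>2" using d1[OF t] N0(2)[of "z + t *s w" w] by simp
      qed simp
      have sub2: "disc_sub (\<lambda>t. ereal (vr (chart_inv c (z + t *s w)) + N * (norm (z + t *s w - p))\<^sup>2)) 0"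
        using disc_sub_add_quadratic[OF sub, of N z w p] unfolding vr by (simp add: N_def)
      have nle: "N * (norm (z + t *s w - p))\<^sup>2 \<le> N * R\<^sup>2" if "norm t \<le> 1" for t
        using d1[OF that] N0(1) by (intro mult_left_mono power_mono) (auto simp: N_def dist_norm norm_minus_commute)
      have bd: "\<bar>vr (chart_inv c (z + t *s w)) + N * (norm (z + t *s w - p))\<^sup>2\<bar> \<le> M + N * R\<^sup>2" if "t \<in> sphere 0 1" for t
      proof -
        have "0 \<le> N * (norm (z + t *s w - p))\<^sup>2" using N0(1) by (simp add: N_def)
        then show ?thesis using vr(2)[of "chart_inv c (z + t *s w)"] nle[of t] that by (simp add: abs_le_iff)
      qed
      have "usc_on (\<lambda>t. v (chart_inv c (z + t *s w)) - ereal (- (N * (norm (z + t *s w - p))\<^sup>2))) (sphere 0 1)"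
        by (rule usc_on_minus_continuous, rule usc_on_compose[OF uscv]) (use d1 in \<open>auto intro!: continuous_intros\<close>)
      then have usc2: "usc_on (\<lambda>t. ereal (vr (chart_inv c (z + t *s w)) + N * (norm (z + t *s w - p))\<^sup>2)) (sphere 0 1)"
        unfolding vr by simp
      note mean = mean_le_of_bounded_usc[OF sub2 bd usc2]
      have "circle_mean u z w = ereal (1 / (2 * pi) * (LINT \<theta>:{0..2*pi}|lborel. vr (chart_inv c (z + cis \<theta> *s w)) + N * (norm (z + cis \<theta> *s w - p))\<^sup>2))"
      proof (rule circle_mean_real[OF mean(1)])
        fix \<theta> :: real
        show "u (z + cis \<theta> *s w) = ereal (vr (chart_inv c (z + cis \<theta> *s w)) + N * (norm (z + cis \<theta> *s w - p))\<^sup>2)"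
          unfolding u_def using vr(1)[of "chart_inv c (z + cis \<theta> *s w)"] by simp
      qed
      then show "u z \<le> circle_mean u z w" using mean(2) unfolding u_def vr by simp
    qed
    moreover have "smooth_on (\<lambda>z. (- N) * (norm (z - p))\<^sup>2) (ball p R)" by (rule smooth_on_norm_sq)
    moreover have "v y = ereal ((- N) * (norm (snd c y - p))\<^sup>2) + u (snd c y)" if "y \<in> U" for y
      using that c(1) unfolding u_def vr U_def by simp
    moreover have "x \<in> U" using c(2) R(1) unfolding U_def p_def by simp
    ultimately show ?thesis using U unfolding im[symmetric] by blast
  qed
  then show ?thesis unfolding quasi_psh_def vr by auto
qed

text \<open>The lower bound makes \<open>v\<close> real and bounded, so circle means are ordinary
  integrals and \<open>sub_mean_imp_current\<close> applies to each test function.\<close>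

lemma wsh_imp_PSH:
  assumes v: "wsh 1 v" and bdd: "\<And>x. ereal b \<le> v x"
  shows "v \<in> PSH A g"
proof -
  have usc: "usc_on v UNIV" and fin: "\<And>x. v x \<noteq> \<infinity>" using v unfolding wsh_def by auto
  obtain M0 where M0: "0 \<le> M0" "\<And>x. v x \<le> ereal M0" by (rule usc_bounded_above[OF usc fin]) (rule that, assumption+)
  define M where "M = max M0 \<bar>b\<bar>"
  define vr where "vr = (\<lambda>x. real_of_ereal (v x))"
  have vr1: "v x = ereal (vr x)" for x using fin[of x] bdd[of x] unfolding vr_def by (cases "v x") auto
  have vr2: "\<bar>vr x\<bar> \<le> M" for x using M0(2)[of x] bdd[of x] unfolding M_def vr1[of x] by auto
  have M: "0 \<le> M" using M0(1) by (simp add: M_def)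
  have "current11_nonneg (chart_image c) (\<lambda>j k f. form_current (chart_image c) (g c) j k f + ddc_current (chart_image c) (v \<circ> chart_inv c) j k f)"
    if c: "c \<in> charts" for c
    unfolding current11_nonneg_def
  proof (intro allI impI)
    fix w :: "complex^'n" and f assume f': "test_function (chart_image c) f \<and> (\<forall>z. 0 \<le> f z)"
    let ?X = "chart_image c"
    have f: "smooth_on f UNIV" and f0: "\<And>z. 0 \<le> f z" using f' unfolding test_function_def by auto
    obtain C where C: "compact C" "C \<subseteq> ?X" "\<And>z. z \<notin> C \<Longrightarrow> f z = 0" using f' unfolding test_function_def by auto
    obtain \<delta> where \<delta>: "0 < \<delta>" "(\<Union>x\<in>C. cball x \<delta>) \<subseteq> ?X"
      using compact_subset_open_imp_cball_epsilon_subset[OF C(1) chart_topological(2)[OF c] C(2)] by metis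
    \<comment> \<open>The closed \<open>\<delta>\<close>-neighbourhood of the support, still inside
      the chart; it contains all circles that are used.\<close>
    define C' where "C' = {x + y | x y. x \<in> C \<and> y \<in> cball 0 \<delta>}"
    have C'c: "compact C'" unfolding C'_def by (intro compact_sums C compact_cball)
    have near: "y \<in> C'" if "x \<in> C" "dist x y \<le> \<delta>" for x y
      using that unfolding C'_def by (intro CollectI exI[of _ x] exI[of _ "y - x"]) (auto simp: dist_norm norm_minus_commute)
    have C'X: "C' \<subseteq> ?X" using \<delta>(2) unfolding C'_def by (force simp: dist_norm)
    have CC': "C \<subseteq> C'" using near \<delta>(1) by auto
    have uscz: "usc_on (\<lambda>z. v (chart_inv c z)) ?X" by (rule usc_chart[OF usc c])
    note [measurable] = borel_measurable_top_ext[OF chart_topological(2)[OF c] uscz]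
    have [measurable]: "C' \<in> sets borel" "C \<in> sets borel" using C'c C(1) by (auto simp: borel_compact)
    define h where "h = (\<lambda>y. real_of_ereal ((v \<circ> chart_inv c) y))"
    have h: "h y = vr (chart_inv c y)" for y unfolding h_def vr_def by simp
    have hint: "integrable lborel (\<lambda>y. indicator D y * h y)" if D: "compact D" "D \<subseteq> ?X" for D
    proof -
      have "integrable lborel (\<lambda>y. indicator D y * real_of_ereal (top_ext ?X (\<lambda>z. v (chart_inv c z)) y))"
      proof (rule integrable_mult_bounded)
        have "emeasure lborel D < \<infinity>" by (rule emeasure_bounded_finite[OF compact_imp_bounded[OF D(1)]])
        moreover have "D \<in> sets lborel" using D(1) by (simp add: borel_compact)
        ultimately show "integrable lborel (indicator D :: _ \<Rightarrow> real)" by (intro integrable_real_indicator) auto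
        show "\<bar>real_of_ereal (top_ext ?X (\<lambda>z. v (chart_inv c z)) x)\<bar> \<le> M" for x
          using vr2 M unfolding top_ext_def vr1 by auto
      qed measurable
      moreover have "(\<lambda>y. indicator D y * real_of_ereal (top_ext ?X (\<lambda>z. v (chart_inv c z)) y)) = (\<lambda>y. indicator D y * h y)"
        using D(2) by (auto simp: fun_eq_iff indicator_def top_ext_def h_def)
      ultimately show ?thesis by simp
    qed
    have "0 \<le> (LINT z|lborel. indicator C z * Q c z w * f z) + (LINT z|lborel. indicator C' z * h z * (lap w f z / 2))"
    proof (rule sub_mean_imp_current[OF f C(1,3) f0 C'c \<delta>(1) near hint[OF C'c C'X], where M = M])
      show "\<bar>h y\<bar> \<le> M" for y unfolding h by (rule vr2)
      show "continuous_on C (\<lambda>z. Q c z w)" by (rule continuous_on_subset[OF Q_continuous1[OF c] C(2)])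
      fix e :: real assume e: "0 < e"
      \<comment> \<open>Radii must not depend on the centre. \<open>wsh_disc_sub\<close> works for
        every disc in the chart, so uniform continuity of \<open>Q\<close> is all that is left to
        ensure.\<close>
      have "uniformly_continuous_on C' (\<lambda>z. Q c z w)"
        by (intro compact_uniformly_continuous C'c continuous_on_subset[OF Q_continuous1[OF c] C'X])
      then obtain d where d: "d > 0" "\<And>x y. x \<in> C' \<Longrightarrow> y \<in> C' \<Longrightarrow> dist y x < d \<Longrightarrow> dist (Q c y w) (Q c x w) < e"
        using e unfolding uniformly_continuous_on_def by metis
      define \<rho>0 where "\<rho>0 = min \<delta> d / (norm w + 1)"
      have "0 < \<rho>0" using d(1) \<delta>(1) by (simp add: \<rho>0_def add_nonneg_pos)
      moreover have "h z \<le> 1 / (2 * pi) * (LINT \<theta>:{0..2*pi}|lborel. h (z + (of_real \<rho> * cis \<theta>) *s w)) + \<rho>\<^sup>2 * (Q c z w + e) / 2"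
        if \<rho>: "0 < \<rho>" "\<rho> < \<rho>0" and z: "z \<in> C" for \<rho> z
      proof -
        have "\<rho> * norm w \<le> \<rho> * (norm w + 1)" using \<rho> by (intro mult_left_mono) auto
        also have "\<dots> < min \<delta> d" using \<rho> unfolding \<rho>0_def by (subst (asm) pos_less_divide_eq) (auto simp: add_nonneg_pos)
        finally have \<rho>w: "\<rho> * norm w < min \<delta> d" .
        have dz: "dist z (z + u *s (of_real \<rho> *s w)) < min \<delta> d" if "norm u \<le> 1" for u
        proof -
          have "dist z (z + u *s (of_real \<rho> *s w)) = norm (u *s (complex_of_real \<rho> *s w))" by (simp add: dist_norm)
          also have "\<dots> = norm u * (\<rho> * norm w)" using \<rho> by (simp only: norm_smult norm_of_real abs_of_pos)
          also have "\<dots> \<le> 1 * (\<rho> * norm w)" using that \<rho> by (intro mult_right_mono) auto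
          finally show ?thesis using \<rho>w by simp
        qed
        have inC': "z + u *s (of_real \<rho> *s w) \<in> C'" if "norm u \<le> 1" for u
          using dz[OF that] by (intro near[OF z]) simp
        have "h z \<le> 1 / (2 * pi) * (LINT \<theta>:{0..2*pi}|lborel. vr (chart_inv c (z + cis \<theta> *s (of_real \<rho> *s w)))) + \<rho>\<^sup>2 * (Q c z w + e) / 2"
          unfolding h
        proof (rule wsh_circle_mean(2)[OF v _ vr1 vr2 c])
          fix u :: complex assume u: "norm u \<le> 1"
          show "z + u *s (of_real \<rho> *s w) \<in> ?X" using inC'[OF u] C'X by blast
          have "dist (Q c (z + u *s (of_real \<rho> *s w)) w) (Q c z w) < e"
            using dz[OF u] CC' z inC'[OF u] by (intro d(2)) (auto simp: dist_commute)
          then have "Q c (z + u *s (of_real \<rho> *s w)) w \<le> Q c z w + e" by (simp add: dist_real_def abs_less_iff)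
          then have "\<rho>\<^sup>2 * Q c (z + u *s (of_real \<rho> *s w)) w \<le> \<rho>\<^sup>2 * (Q c z w + e)" by (intro mult_left_mono) auto
          then show "1 * Q c (z + u *s (of_real \<rho> *s w)) (of_real \<rho> *s w) \<le> \<rho>\<^sup>2 * (Q c z w + e)" unfolding Q_smult by simp
        qed simp
        also have "(\<lambda>\<theta>. vr (chart_inv c (z + cis \<theta> *s (of_real \<rho> *s w)))) = (\<lambda>\<theta>. h (z + (of_real \<rho> * cis \<theta>) *s w))"
          unfolding h by (simp add: vector_smult_assoc mult.commute)
        finally show ?thesis .
      qed
      ultimately show "\<exists>\<rho>0>0. \<forall>\<rho> z. 0 < \<rho> \<and> \<rho> < \<rho>0 \<and> z \<in> C \<longrightarrow>
        h z \<le> 1 / (2 * pi) * (LINT \<theta>:{0..2*pi}|lborel. h (z + (of_real \<rho> * cis \<theta>) *s w)) + \<rho>\<^sup>2 * (Q c z w + e) / 2" by blast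
    qed
    also have "(LINT z|lborel. indicator C' z * h z * (lap w f z / 2)) = (LINT z|lborel. indicator C z * real_of_ereal ((v \<circ> chart_inv c) z) * (lap w f z / 2))"
      using lap_bounded(2)[OF f C(1,3), of _ w] CC' unfolding h_def by (intro Bochner_Integration.integral_cong refl) (auto simp: indicator_def)
    finally have "0 \<le> (LINT z|lborel. indicator C z * Q c z w * f z) + (LINT z|lborel. indicator C z * real_of_ereal ((v \<circ> chart_inv c) z) * (lap w f z / 2))" .
    moreover have "(\<Sum>j\<in>UNIV. \<Sum>k\<in>UNIV. w $ j * cnj (w $ k) * (form_current ?X (g c) j k f + ddc_current ?X (v \<circ> chart_inv c) j k f))
        = of_real ((LINT z|lborel. indicator C z * Q c z w * f z) + (LINT z|lborel. indicator C z * real_of_ereal ((v \<circ> chart_inv c) z) * (lap w f z / 2)))"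
      by (rule current_sum[OF c f C hint[OF C(1,2), unfolded h_def]])
    moreover have nn: "0 \<le> t \<Longrightarrow> S = of_real t \<Longrightarrow> S \<in> \<real>\<^sub>\<ge>\<^sub>0" for S :: complex and t by simp
    ultimately show "(\<Sum>j\<in>UNIV. \<Sum>k\<in>UNIV. w $ j * cnj (w $ k) * (form_current ?X (g c) j k f + ddc_current ?X (v \<circ> chart_inv c) j k f)) \<in> \<real>\<^sub>\<ge>\<^sub>0"
      by (intro nn)
  qed
  then show ?thesis unfolding PSH_def using wsh_quasi_psh[OF v vr1 vr2] by blast
qed

end

section \<open>Operations that preserve sub-mean values\<close>

lemma scaled_defect: "a \<noteq> 0 \<Longrightarrow> (a::real) * (r * (k * q + e / a) / 2) = r * (a * k * q + e) / 2"
  by (simp add: field_simps)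

context hermitian_mfd
begin

text \<open>The tool behind maxima and gluing: at each point one member of the construction has to
  agree with the result and stay below it nearby. Different points may use different
  members.\<close>

lemma wsub_cong_near:
  assumes sub: "wsub \<kappa> v x" and W: "open W" "x \<in> W" and eq: "v x = u x" and le: "\<And>y. y \<in> W \<Longrightarrow> v y \<le> u y"
  shows "wsub \<kappa> u x"
proof -
  obtain c where c: "c \<in> charts" "x \<in> fst c" and l: "\<And>w e. 0 < e \<Longrightarrow> \<exists>h0>0. \<forall>h. 0 < h \<and> h < h0 \<longrightarrow>
     disc_sub (\<lambda>t. v (chart_inv c (snd c x + (of_real h * t) *s w))) (h\<^sup>2 * (\<kappa> * Q c (snd c x) w + e) / 2)"
    using sub unfolding wsub_def by meson
  have "open (snd c ` (fst c \<inter> W))" by (rule open_chart_image_subset[OF c(1)]) (use chart_topological(1)[OF c(1)] W in auto)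
  moreover have "snd c x \<in> snd c ` (fst c \<inter> W)" using c W by auto
  ultimately obtain R where R: "0 < R" "cball (snd c x) R \<subseteq> snd c ` (fst c \<inter> W)" using open_contains_cball by blast
  have inW: "chart_inv c z \<in> W" if "z \<in> cball (snd c x) R" for z using R(2) that c(1) by auto
  have "\<exists>h0>0. \<forall>h. 0 < h \<and> h < h0 \<longrightarrow>
     disc_sub (\<lambda>t. u (chart_inv c (snd c x + (of_real h * t) *s w))) (h\<^sup>2 * (\<kappa> * Q c (snd c x) w + e) / 2)" if e: "0 < e" for w e
  proof -
    obtain h0 where h0: "0 < h0" "\<And>h. 0 < h \<Longrightarrow> h < h0 \<Longrightarrow>
     disc_sub (\<lambda>t. v (chart_inv c (snd c x + (of_real h * t) *s w))) (h\<^sup>2 * (\<kappa> * Q c (snd c x) w + e) / 2)" using l[OF e] by blast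
    define d1 where "d1 = R / (norm w + 1)"
    have d1: "0 < d1" using R(1) by (simp add: d1_def add_nonneg_pos)
    show ?thesis
    proof (intro exI[of _ "min h0 d1"] conjI allI impI)
      fix h assume h: "0 < h \<and> h < min h0 d1"
      have "h * norm w \<le> h * (norm w + 1)" using h by (intro mult_left_mono) auto
      also have "\<dots> \<le> R" using h by (simp add: d1_def pos_less_divide_eq add_nonneg_pos)
      finally have hw: "h * norm w \<le> R" .
      show "disc_sub (\<lambda>t. u (chart_inv c (snd c x + (of_real h * t) *s w))) (h\<^sup>2 * (\<kappa> * Q c (snd c x) w + e) / 2)"
      proof (rule disc_sub_touching[OF h0(2)])
        fix t :: complex assume z: "norm t = 1"
        have "norm ((of_real h * t) *s w) = h * norm w" using h z by (simp add: norm_smult norm_mult)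
        then have "snd c x + (of_real h * t) *s w \<in> cball (snd c x) R" using hw by (simp add: dist_norm)
        then show "v (chart_inv c (snd c x + (of_real h * t) *s w)) \<le> u (chart_inv c (snd c x + (of_real h * t) *s w))"
          by (intro le inW)
      qed (use h c eq in auto)
    qed (use h0 d1 in simp)
  qed
  then show ?thesis unfolding wsub_def using c by blast
qed

lemma wsub_const: "0 \<le> \<kappa> \<Longrightarrow> wsub \<kappa> (\<lambda>_. ereal b) x"
proof -
  assume \<kappa>: "0 \<le> \<kappa>"
  obtain c where c: "c \<in> charts" "x \<in> fst c" by (rule chart_at)
  have "disc_sub (\<lambda>z. ereal b) (s\<^sup>2 * (\<kappa> * Q c (snd c x) w + e) / 2)" if "0 < e" for w e s
    using Q_nonneg[OF c(1), of "snd c x" w] c(2) that \<kappa> by (intro disc_sub_degenerate) auto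
  then show ?thesis unfolding wsub_def using c by (intro bexI[of _ c] conjI allI impI exI[of _ 1]) auto
qed

lemma usc_on_const: "usc_on (\<lambda>_. a) S"
  unfolding usc_on_def
proof
  fix t
  show "openin (top_of_set S) {x \<in> S. a < t}" by (cases "a < t") simp_all
qed

lemma wsh_const: "0 \<le> \<kappa> \<Longrightarrow> wsh \<kappa> (\<lambda>_. ereal b)"
  unfolding wsh_def using wsub_const usc_on_const by auto

text \<open>At every point the larger of the two functions touches the maximum from below.\<close>

lemma wsh_max_const:
  assumes v: "wsh \<kappa> v" and \<kappa>: "0 \<le> \<kappa>" shows "wsh \<kappa> (\<lambda>x. max (v x) (ereal b))"
proof -
  have usc: "openin (top_of_set UNIV) {x \<in> UNIV. v x < t}" for t
    using v unfolding wsh_def usc_on_def by (elim conjE) (rule spec)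
  have "usc_on (\<lambda>x. max (v x) (ereal b)) UNIV" unfolding usc_on_def
  proof
    fix t
    have eq: "{x \<in> UNIV. max (v x) (ereal b) < t} = (if ereal b < t then {x \<in> UNIV. v x < t} else {})"
      by (auto simp only: max_less_iff_conj split: if_splits)
    show "openin (top_of_set UNIV) {x \<in> UNIV. max (v x) (ereal b) < t}"
      unfolding eq by (cases "ereal b < t") (simp_all only: if_True if_False usc openin_empty)
  qed
  moreover have "wsub \<kappa> (\<lambda>x. max (v x) (ereal b)) x" for x
  proof (cases "v x \<le> ereal b")
    case True
    show ?thesis by (rule wsub_cong_near[OF wsub_const[OF \<kappa>, of b] open_UNIV]) (use True in \<open>auto simp: max_def\<close>)
  next
    case False
    have "wsub \<kappa> v x" using v unfolding wsh_def by blast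
    then show ?thesis by (rule wsub_cong_near[OF _ open_UNIV]) (use False in \<open>auto simp: max_def\<close>)
  qed
  moreover have "max (v x) (ereal b) \<noteq> \<infinity>" for x
  proof -
    have "v x \<noteq> \<infinity>" using v unfolding wsh_def by blast
    then show ?thesis by (simp add: max_def)
  qed
  ultimately show ?thesis unfolding wsh_def by blast
qed

lemma wsub_affine:
  assumes v: "wsub \<kappa> v x" and a: "0 < a"
  shows "wsub (a * \<kappa>) (\<lambda>y. ereal a * v y + ereal b) x"
proof -
  obtain c where c: "c \<in> charts" "x \<in> fst c" and l: "\<And>w e. 0 < e \<Longrightarrow> \<exists>t0>0. \<forall>t. 0 < t \<and> t < t0 \<longrightarrow>
     disc_sub (\<lambda>z. v (chart_inv c (snd c x + (of_real t * z) *s w))) (t\<^sup>2 * (\<kappa> * Q c (snd c x) w + e) / 2)"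
    using v unfolding wsub_def by meson
  have "\<exists>t0>0. \<forall>t. 0 < t \<and> t < t0 \<longrightarrow>
     disc_sub (\<lambda>z. ereal a * v (chart_inv c (snd c x + (of_real t * z) *s w)) + ereal b) (t\<^sup>2 * (a * \<kappa> * Q c (snd c x) w + e) / 2)" if "0 < e" for w e
  proof -
    have "0 < e / a" using that a by simp
    from l[OF this, of w] obtain t0 where t0: "0 < t0" "\<And>t. 0 < t \<Longrightarrow> t < t0 \<Longrightarrow>
     disc_sub (\<lambda>z. v (chart_inv c (snd c x + (of_real t * z) *s w))) (t\<^sup>2 * (\<kappa> * Q c (snd c x) w + e / a) / 2)" by blast
    have eq: "a * (t\<^sup>2 * (\<kappa> * Q c (snd c x) w + e / a) / 2) = t\<^sup>2 * (a * \<kappa> * Q c (snd c x) w + e) / 2" for t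
      by (rule scaled_defect) (use a in simp)
    show ?thesis
    proof (intro exI[of _ t0] conjI allI impI t0(1))
      fix t assume "0 < t \<and> t < t0"
      then have "disc_sub (\<lambda>z. v (chart_inv c (snd c x + (of_real t * z) *s w))) (t\<^sup>2 * (\<kappa> * Q c (snd c x) w + e / a) / 2)" by (intro t0(2)) auto
      from disc_sub_scale[OF this a, of b] show "disc_sub (\<lambda>z. ereal a * v (chart_inv c (snd c x + (of_real t * z) *s w)) + ereal b) (t\<^sup>2 * (a * \<kappa> * Q c (snd c x) w + e) / 2)"
        unfolding eq .
    qed
  qed
  then show ?thesis unfolding wsub_def using c by blast
qed

text \<open>Scaling by the reciprocal of \<open>\<kappa>\<close> undoes an excess of positivity
  spent in a construction; the lower bound permits the return to \<open>PSH\<close>.\<close>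

lemma wsh_bounded_PSH_affine:
  assumes v: "wsh \<kappa> v" and a: "0 < a" "a * \<kappa> = 1" and b: "\<And>x. ereal m \<le> v x"
  shows "(\<lambda>y. ereal a * v y + ereal b) \<in> PSH A g"
proof (rule wsh_imp_PSH[of _ "a * m + b"])
  have usc: "usc_on v UNIV" and fin: "\<And>x. v x \<noteq> \<infinity>" using v unfolding wsh_def by auto
  have "usc_on (\<lambda>y. ereal a * v y + ereal b) UNIV" unfolding usc_on_def
  proof
    fix t :: ereal
    have "ereal a * x + ereal b < t \<longleftrightarrow> x < (t - ereal b) / ereal a" if "x \<noteq> \<infinity>" for x
      using that a(1) by (cases x; cases t) (auto simp: field_simps)
    then have "{x \<in> UNIV. ereal a * v x + ereal b < t} = {x \<in> UNIV. v x < (t - ereal b) / ereal a}" using fin by auto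
    then show "openin (top_of_set UNIV) {x \<in> UNIV. ereal a * v x + ereal b < t}" using usc unfolding usc_on_def by (simp only:)
  qed
  moreover have "ereal a * v x + ereal b \<noteq> \<infinity>" for x using fin[of x] a(1) by (cases "v x") auto
  moreover have "wsub 1 (\<lambda>y. ereal a * v y + ereal b) x" for x
    using wsub_affine[of \<kappa> v x a b] v a unfolding wsh_def by simp
  ultimately show "wsh 1 (\<lambda>y. ereal a * v y + ereal b)" unfolding wsh_def by blast
  show "ereal (a * m + b) \<le> ereal a * v x + ereal b" for x
    using b[of x] fin[of x] a(1) by (cases "v x") auto
qed

text \<open>Truncation supplies the lower bound that \<open>wsh_imp_PSH\<close> asks for; the shift
  is for normalizing on the compact set.\<close>

lemma PSH_shift_trunc:
  assumes v: "v \<in> PSH A g"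
  shows "(\<lambda>y. max (v y) (ereal m) + ereal b) \<in> PSH A g"
  using wsh_bounded_PSH_affine[OF wsh_max_const[OF PSH_imp_wsh[OF v], of m], of 1 m b] by (simp add: one_ereal_def[symmetric])

lemma const_PSH: "(\<lambda>_. ereal b) \<in> PSH A g"
  by (rule wsh_imp_PSH[OF wsh_const]) auto

text \<open>Scaling by \<open>a < 1\<close> leaves over some positivity, which pays for \<open>- b |z - p|\<^sup>2\<close>.\<close>

lemma wsub_minus_quadratic:
  assumes v: "wsub \<kappa> v x" "wsh \<kappa> v" "0 \<le> \<kappa>" and c: "c \<in> charts" "x \<in> fst c" and a: "0 < a" "0 \<le> b"
    and pos: "\<And>w. 2 * b * (norm w)\<^sup>2 \<le> (\<kappa>' - a * \<kappa>) * Q c (snd c x) w"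
  shows "wsub \<kappa>' (\<lambda>y. ereal a * v y - ereal (b * (norm (snd c y - p))\<^sup>2)) x"
proof -
  obtain R where R: "0 < R" "cball (snd c x) R \<subseteq> chart_image c" by (rule chart_ball[OF c]) (rule that, assumption+)
  have "\<exists>t0>0. \<forall>t. 0 < t \<and> t < t0 \<longrightarrow>
     disc_sub (\<lambda>u. ereal a * v (chart_inv c (snd c x + (of_real t * u) *s w)) - ereal (b * (norm (snd c (chart_inv c (snd c x + (of_real t * u) *s w)) - p))\<^sup>2)) (t\<^sup>2 * (\<kappa>' * Q c (snd c x) w + e) / 2)" if e: "0 < e" for w e
  proof -
    \<comment> \<open>\<open>\<kappa> + 1\<close> is never 0. Multiplied by \<open>\<kappa>\<close>
      the variation of \<open>Q\<close> is at most \<open>e / a\<close>, and scaled by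
      \<open>a\<close> at most \<open>e\<close>.\<close>
    have "0 < e / (a * (\<kappa> + 1))" using e a v(3) by simp
    moreover have "isCont (\<lambda>z. Q c z w) (snd c x)"
      using Q_continuous1[OF c(1)] chart_topological(2)[OF c(1)] c(2) by (simp add: continuous_on_eq_continuous_at)
    ultimately obtain d where d: "d > 0" "\<And>z. dist z (snd c x) < d \<Longrightarrow> dist (Q c z w) (Q c (snd c x) w) < e / (a * (\<kappa> + 1))"
      unfolding continuous_at_eps_delta by metis
    define d1 where "d1 = min R d / (norm w + 1)"
    have d1: "0 < d1" using R(1) d(1) by (simp add: d1_def add_nonneg_pos)
    show ?thesis
    proof (intro exI[of _ d1] conjI allI impI d1)
      fix t assume t: "0 < t \<and> t < d1"
      have "t * norm w \<le> t * (norm w + 1)" using t by (intro mult_left_mono) auto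
      also have "\<dots> < min R d" using t unfolding d1_def by (subst (asm) pos_less_divide_eq) (auto simp: add_nonneg_pos)
      finally have tw: "t * norm w < min R d" .
      let ?z = "\<lambda>u. snd c x + u *s (of_real t *s w)"
      have dz: "dist (?z u) (snd c x) < min R d" if "norm u \<le> 1" for u
      proof -
        have "dist (?z u) (snd c x) = norm (u *s (complex_of_real t *s w))" by (simp add: dist_norm)
        also have "\<dots> = norm u * (t * norm w)" using t by (simp only: norm_smult norm_of_real abs_of_pos)
        also have "\<dots> \<le> 1 * (t * norm w)" using that t by (intro mult_right_mono) auto
        finally show ?thesis using tw by simp
      qed
      have inI: "?z u \<in> chart_image c" if "norm u \<le> 1" for u
        using dz[OF that] R(2) by (auto simp: subset_eq dist_commute)
      define q where "q = Q c (snd c x) w"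
      have sub: "disc_sub (\<lambda>u. v (chart_inv c (?z u))) (t\<^sup>2 * (\<kappa> * q + e / a) / 2)"
      proof (rule wsh_disc_sub[OF v(2,3) c(1) inI])
        fix u :: complex assume u: "norm u \<le> 1"
        have "Q c (?z u) w \<le> q + e / (a * (\<kappa> + 1))" using d(2)[of "?z u"] dz[OF u] by (simp add: q_def dist_real_def abs_less_iff)
        then have "\<kappa> * Q c (?z u) w \<le> \<kappa> * (q + e / (a * (\<kappa> + 1)))" by (rule mult_left_mono[OF _ v(3)])
        also have "\<kappa> * (q + e / (a * (\<kappa> + 1))) = \<kappa> * q + (\<kappa> / (\<kappa> + 1)) * (e / a)" using a v(3) by (simp add: field_simps)
        also have "(\<kappa> / (\<kappa> + 1)) * (e / a) \<le> e / a" using a v(3) e by (intro mult_left_le_one_le) auto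
        finally have "t\<^sup>2 * (\<kappa> * Q c (?z u) w) \<le> t\<^sup>2 * (\<kappa> * q + e / a)" by (intro mult_left_mono) auto
        then show "\<kappa> * Q c (?z u) (of_real t *s w) \<le> t\<^sup>2 * (\<kappa> * q + e / a)" unfolding Q_smult by (simp add: mult.left_commute)
      qed
      from disc_sub_add_quadratic[OF disc_sub_scale[OF sub a(1), of 0], of "- b" "snd c x" "of_real t *s w" p]
      have "disc_sub (\<lambda>u. ereal a * v (chart_inv c (?z u)) + ereal (- b * (norm (?z u - p))\<^sup>2)) (a * (t\<^sup>2 * (\<kappa> * q + e / a) / 2) + b * (t\<^sup>2 * (norm w)\<^sup>2))"
        by (simp add: norm_smult power_mult_distrib zero_ereal_def[symmetric])
      moreover have "a * (t\<^sup>2 * (\<kappa> * q + e / a) / 2) + b * (t\<^sup>2 * (norm w)\<^sup>2) \<le> t\<^sup>2 * (\<kappa>' * q + e) / 2"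
      proof -
        have "t\<^sup>2 * (2 * b * (norm w)\<^sup>2) \<le> t\<^sup>2 * ((\<kappa>' - a * \<kappa>) * q)" using pos[of w] by (intro mult_left_mono) (auto simp: q_def)
        then have "2 * (b * (t\<^sup>2 * (norm w)\<^sup>2)) \<le> t\<^sup>2 * (\<kappa>' * q + e) - t\<^sup>2 * (a * \<kappa> * q + e)" by (simp add: algebra_simps)
        moreover have "a * (t\<^sup>2 * (\<kappa> * q + e / a) / 2) = t\<^sup>2 * (a * \<kappa> * q + e) / 2" by (rule scaled_defect) (use a in simp)
        ultimately show ?thesis by linarith
      qed
      ultimately have "disc_sub (\<lambda>u. ereal a * v (chart_inv c (?z u)) + ereal (- b * (norm (?z u - p))\<^sup>2)) (t\<^sup>2 * (\<kappa>' * q + e) / 2)"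
        by (rule disc_sub_mono)
      moreover have zeq: "?z u = snd c x + (of_real t * u) *s w" for u by (simp add: vector_smult_assoc mult.commute)
      ultimately have "disc_sub (\<lambda>u. ereal a * v (chart_inv c (snd c x + (of_real t * u) *s w)) + ereal (- b * (norm (snd c x + (of_real t * u) *s w - p))\<^sup>2)) (t\<^sup>2 * (\<kappa>' * q + e) / 2)"
        by (simp only:)
      then show "disc_sub (\<lambda>u. ereal a * v (chart_inv c (snd c x + (of_real t * u) *s w)) - ereal (b * (norm (snd c (chart_inv c (snd c x + (of_real t * u) *s w)) - p))\<^sup>2)) (t\<^sup>2 * (\<kappa>' * Q c (snd c x) w + e) / 2)"
        unfolding q_def
      proof (rule disc_sub_cong[THEN iffD1, rotated])
        fix u :: complex assume u: "norm u \<le> 1"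
        have "snd c (chart_inv c (snd c x + (of_real t * u) *s w)) = snd c x + (of_real t * u) *s w"
          using chart_inv_right[OF inI[OF u]] unfolding zeq .
        then show "ereal a * v (chart_inv c (snd c x + (of_real t * u) *s w)) + ereal (- b * (norm (snd c x + (of_real t * u) *s w - p))\<^sup>2) =
           ereal a * v (chart_inv c (snd c x + (of_real t * u) *s w)) - ereal (b * (norm (snd c (chart_inv c (snd c x + (of_real t * u) *s w)) - p))\<^sup>2)"
          by (simp add: minus_ereal_def)
      qed
    qed
  qed
  then show ?thesis unfolding wsub_def using c by blast
qed

end

section \<open>Harnack inequality and localization\<close>

text \<open>A polynomial substitute for harmonic measure of an arc around 1: the negative of a tent
  function has negative mean, and a polynomial squeezed slightly above it is still negative at
  0.\<close>

lemma circle_bump_poly: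
  assumes t: "0 < (t::real)"
  obtains p \<kappa> where "0 < \<kappa>" "\<And>z. norm z = 1 \<Longrightarrow> - max 0 (1 - norm (z - 1) * t) \<le> Re (poly p z)" "Re (poly p 0) \<le> - \<kappa>"
proof -
  define f where "f = (\<lambda>z::complex. max 0 (1 - norm (z - 1) * t))"
  have cf: "continuous_on S f" for S unfolding f_def by (intro continuous_intros)
  have int: "set_integrable lborel {0..2*pi} (\<lambda>s. f (cis s))" by (rule set_integrable_cis[OF cf])
  define m where "m = (LINT s:{0..2*pi}|lborel. f (cis s))"
  have mi: "((\<lambda>s. f (cis s)) has_integral m) {0..2*pi}"
    using set_borel_integral_eq_integral[OF int] unfolding m_def by (metis has_integral_integral)
  have "0 \<le> m" by (rule has_integral_nonneg[OF mi]) (simp add: f_def)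
  moreover have "m \<noteq> 0"
  proof
    assume "m = 0"
    then have "((\<lambda>s. f (cis s)) has_integral 0) (cbox 0 (2*pi))" using mi by simp
    have pn: "pi \<le> 0 \<longleftrightarrow> False" by (simp only: not_le pi_gt_zero simp_thms)
    from \<open>((\<lambda>s. f (cis s)) has_integral 0) (cbox 0 (2*pi))\<close> have "f (cis 0) = 0"
    proof (rule has_integral_0_cbox_imp_0[rotated 2])
      show "continuous_on (cbox 0 (2*pi)) (\<lambda>s. f (cis s))" by (rule continuous_on_cis_circle[OF cf])
    qed (auto simp: f_def box_real pn)
    then show False by (simp add: f_def)
  qed
  ultimately have m: "0 < m" by simp
  \<comment> \<open>Half of the mean of \<open>f\<close>, so that \<open>e - f\<close> has mean
    \<open>- e\<close>.\<close>
  define e where "e = m / (4 * pi)"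
  have e: "0 < e" using m by (simp add: e_def)
  have "continuous_on (sphere 0 1) (\<lambda>z. e / 2 - f z)" by (intro continuous_intros cf)
  then obtain p where p: "\<And>z. z \<in> sphere 0 1 \<Longrightarrow> \<bar>(e / 2 - f z) - Re (poly p z)\<bar> < e / 2"
    using continuous_circle_approx[of "\<lambda>z. e / 2 - f z" "e / 2"] e by (metis half_gt_zero)
  have lo: "- f z \<le> Re (poly p z)" and up: "Re (poly p z) \<le> e - f z" if "norm z = 1" for z
    using abs_less_iff[THEN iffD1, OF p[of z]] that by auto
  have ei: "set_integrable lborel {0..2*pi} (\<lambda>s. e)" by (intro borel_integrable_atLeastAtMost' continuous_intros)
  have "2 * pi * Re (poly p 0) = (LINT s:{0..2*pi}|lborel. Re (poly p (cis s)))"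
    by (rule mean_Re_holomorphic[symmetric]) (auto intro!: continuous_intros holomorphic_intros)
  also have "\<dots> \<le> (LINT s:{0..2*pi}|lborel. e - f (cis s))"
  proof (rule set_integral_mono)
    show "set_integrable lborel {0..2*pi} (\<lambda>s. Re (poly p (cis s)))" by (rule set_integrable_cis) (intro continuous_intros)
    show "set_integrable lborel {0..2*pi} (\<lambda>s. e - f (cis s))" by (rule set_integral_diff(1)[OF ei int])
  qed (use up in simp)
  also have "\<dots> = 2 * pi * e - m" using set_integral_diff(2)[OF ei int] by (simp add: m_def set_integral_const)
  also have "\<dots> = 2 * pi * (- e)" using pi_gt_zero by (simp add: e_def field_simps)
  finally have "Re (poly p 0) \<le> - e" by (rule mult_left_le_imp_le) simp
  then show thesis using that[OF e, of p] lo unfolding f_def by blast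
qed

context hermitian_mfd
begin

section \<open>Connected components and the Harnack inequality\<close>

text \<open>Upper bounds propagate along chains of coordinate balls, hence only within a component.
  Charts make components open, therefore closed and compact as well.\<close>

abbreviation comp :: "'a \<Rightarrow> 'a set" where "comp a \<equiv> connected_component_set UNIV a"

lemma chart_inv_ball_connected:
  assumes c: "c \<in> charts" and R: "ball p R \<subseteq> chart_image c"
  shows "connected (chart_inv c ` ball p R)"
  by (rule connected_continuous_image[OF continuous_on_subset[OF chart_topological(4)[OF c] R]]) (simp add: connected_ball)

lemma chart_preimage_eq:
  assumes c: "c \<in> charts" and S: "S \<subseteq> chart_image c"
  shows "{x \<in> fst c. snd c x \<in> S} = chart_inv c ` S"
proof
  show "{x \<in> fst c. snd c x \<in> S} \<subseteq> chart_inv c ` S" using c by (force simp: image_iff)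
  show "chart_inv c ` S \<subseteq> {x \<in> fst c. snd c x \<in> S}"
  proof
    fix x assume "x \<in> chart_inv c ` S"
    then obtain z where z: "z \<in> S" "x = chart_inv c z" by auto
    have "z \<in> chart_image c" using z S by blast
    then show "x \<in> {x \<in> fst c. snd c x \<in> S}" using z chart_inv_in[of z c] chart_inv_right[of z c] by simp
  qed
qed

lemma chart_ball_in_comp:
  assumes c: "c \<in> charts" and R: "ball p R \<subseteq> chart_image c" and x: "x \<in> comp a" "x \<in> chart_inv c ` ball p R"
  shows "chart_inv c ` ball p R \<subseteq> comp a"
  using connected_component_maximal[OF x(2) chart_inv_ball_connected[OF c R], of UNIV] connected_component_eq[OF x(1)] by auto

lemma comp_open: "open (comp a)"
proof (subst open_subopen, intro ballI)
  fix x assume x: "x \<in> comp a"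
  obtain c where c: "c \<in> charts" "x \<in> fst c" by (rule chart_at)
  obtain R where R: "0 < R" "cball (snd c x) R \<subseteq> chart_image c" by (rule chart_ball[OF c]) (rule that, assumption+)
  have R2: "ball (snd c x) R \<subseteq> chart_image c" using R(2) ball_subset_cball by blast
  let ?B = "{y \<in> fst c. snd c y \<in> ball (snd c x) R}"
  have xin: "x \<in> ?B" using c R by simp
  then have "x \<in> chart_inv c ` ball (snd c x) R" unfolding chart_preimage_eq[OF c(1) R2] .
  from chart_ball_in_comp[OF c(1) R2 x this] have "?B \<subseteq> comp a" unfolding chart_preimage_eq[OF c(1) R2] .
  then show "\<exists>T. open T \<and> x \<in> T \<and> T \<subseteq> comp a"
    using open_chart_preimage[OF c(1) open_ball, of "snd c x" R] xin by blast
qed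

lemma comp_closed: "closed (comp a)"
proof -
  have "- comp a = (\<Union>y\<in>- comp a. comp y)"
  proof (intro equalityI subsetI)
    fix x assume "x \<in> (\<Union>y\<in>- comp a. comp y)"
    then obtain y where y: "y \<notin> comp a" "x \<in> comp y" by auto
    have "x \<notin> comp a"
    proof
      assume "x \<in> comp a"
      then have "comp y = comp a" using connected_component_eq[OF y(2)] connected_component_eq[of x UNIV a] by (simp only:)
      moreover have "y \<in> comp y" by simp
      ultimately show False using y(1) by (simp only:)
    qed
    then show "x \<in> - comp a" by simp
  next
    fix x assume "x \<in> - comp a"
    then show "x \<in> (\<Union>y\<in>- comp a. comp y)" by (rule UN_I) simp
  qed
  then have "open (- comp a)" using comp_open by (metis open_UN)
  then show ?thesis by (simp add: closed_def)
qed

lemma comp_compact: "compact (comp a)"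
  using compact_Int_closed[OF compact_UNIV comp_closed] by simp

lemma comp_self: "a \<in> comp a" by simp

text \<open>A function which is far below its upper bound on a small ball is so on a concentric family of
  circles through this ball, hence at their centers.\<close>

lemma harnack_local:
  assumes c: "c \<in> charts" and R: "0 < R" "cball p (4 * R) \<subseteq> chart_image c" and q: "q \<in> ball p R" and s: "0 < s"
  obtains \<kappa> C where "0 < \<kappa>" "0 \<le> C" "\<And>v M L z. wsh 1 v \<Longrightarrow> 0 \<le> L \<Longrightarrow> (\<And>z. z \<in> ball p (4 * R) \<Longrightarrow> v (chart_inv c z) \<le> ereal M) \<Longrightarrow>
     (\<And>z. z \<in> ball q s \<Longrightarrow> v (chart_inv c z) \<le> ereal (M - L)) \<Longrightarrow> z \<in> ball p R \<Longrightarrow> v (chart_inv c z) \<le> ereal (M - \<kappa> * L + C)"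
proof -
  obtain l N where N: "0 \<le> N" "\<And>z w. z \<in> cball p (4 * R) \<Longrightarrow> Q c z w \<le> N * (norm w)\<^sup>2"
    using Q_bounds[OF c compact_cball R(2)] by metis
  \<comment> \<open>The tent vanishes for \<open>norm (u - 1)\<close> at least
    \<open>s / (2 * R)\<close>. As \<open>norm w\<close> is at most \<open>2 * R\<close>, on its
    support the disc stays within \<open>s\<close> of \<open>q\<close>.\<close>
  have t0: "0 < 2 * R / s" using R s by simp
  obtain P \<kappa> where \<kappa>: "0 < \<kappa>" and P: "\<And>u. norm u = 1 \<Longrightarrow> - max 0 (1 - norm (u - 1) * (2 * R / s)) \<le> Re (poly P u)" and P0: "Re (poly P 0) \<le> - \<kappa>"
    by (rule circle_bump_poly[OF t0]) (rule that, assumption+)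
  show thesis
  proof (rule that[OF \<kappa>, of "N * (2 * R)\<^sup>2 / 2"])
    show "0 \<le> N * (2 * R)\<^sup>2 / 2" using N(1) by simp
    fix v M L z assume v: "wsh 1 v" and L: "0 \<le> L" and vM: "\<And>z. z \<in> ball p (4 * R) \<Longrightarrow> v (chart_inv c z) \<le> ereal M"
      and vL: "\<And>z. z \<in> ball q s \<Longrightarrow> v (chart_inv c z) \<le> ereal (M - L)" and z: "z \<in> ball p R"
    \<comment> \<open>The circle centred at \<open>z\<close> passes through \<open>q\<close> at the
      parameter 1, where the tent is concentrated.\<close>
    define w where "w = q - z"
    have nw: "norm w \<le> 2 * R" using dist_triangle[of q z p] z q unfolding w_def by (simp add: dist_norm[symmetric] dist_commute)
    have zin: "z + u *s w \<in> ball p (4 * R)" if "norm u \<le> 1" for u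
    proof -
      have "norm u * norm w \<le> 1 * (2 * R)" using that nw R by (intro mult_mono) auto
      then have "dist z (z + u *s w) \<le> 2 * R" by (simp add: dist_norm norm_smult)
      then show ?thesis using dist_triangle[of p "z + u *s w" z] z R by simp
    qed
    have "disc_sub (\<lambda>u. v (chart_inv c (z + u *s w))) (N * (2 * R)\<^sup>2 / 2)"
    proof (rule wsh_disc_sub[OF v _ c])
      fix u :: complex assume u: "norm u \<le> 1"
      have zc: "z + u *s w \<in> cball p (4 * R)" using zin[OF u] by auto
      then show "z + u *s w \<in> chart_image c" using R(2) by blast
      have "(norm w)\<^sup>2 \<le> (2 * R)\<^sup>2" using nw by (intro power_mono) auto
      then have "N * (norm w)\<^sup>2 \<le> N * (2 * R)\<^sup>2" using N(1) by (intro mult_left_mono) auto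
      then show "1 * Q c (z + u *s w) w \<le> N * (2 * R)\<^sup>2" using N(2)[OF zc, of w] by linarith
    qed simp
    then have "v (chart_inv c (z + 0 *s w)) \<le> ereal (Re (of_real M + of_real L * poly P 0) + N * (2 * R)\<^sup>2 / 2)"
    proof (rule disc_subD[where H = "\<lambda>u. of_real M + of_real L * poly P u"])
      fix u :: complex assume u: "norm u = 1"
      let ?f = "max 0 (1 - norm (u - 1) * (2 * R / s))"
      have "L * (- ?f) \<le> L * Re (poly P u)" using P[OF u] L by (intro mult_left_mono) auto
      then have H: "M - L * ?f \<le> Re (of_real M + of_real L * poly P u)" by simp
      have "v (chart_inv c (z + u *s w)) \<le> ereal (M - L * ?f)"
      proof (cases "norm (u - 1) * (2 * R / s) < 1")
        case True
        have "z + u *s w = q + (u - 1) *s w" unfolding w_def by (simp add: vec_eq_iff algebra_simps)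
        moreover have "norm ((u - 1) *s w) < s"
        proof -
          have "norm (u - 1) * norm w \<le> norm (u - 1) * (2 * R)" using nw by (intro mult_left_mono) auto
          also have "\<dots> < s" using True s by (simp add: field_simps)
          finally show ?thesis by (simp only: norm_smult)
        qed
        ultimately have "z + u *s w \<in> ball q s" by (simp add: dist_norm del: vector_ssub_ldistrib vector_sub_rdistrib)
        then have 1: "v (chart_inv c (z + u *s w)) \<le> ereal (M - L)" by (rule vL)
        have "?f \<le> 1" using R s by simp
        then have "L * ?f \<le> L" using L by (rule mult_left_le)
        then have "ereal (M - L) \<le> ereal (M - L * ?f)" by simp
        with 1 show ?thesis by (rule order_trans)
      next
        case False
        then have "?f = 0" by simp
        then show ?thesis using vM[OF zin] u by simp
      qed
      also have "ereal (M - L * ?f) \<le> ereal (Re (of_real M + of_real L * poly P u))" using H by simp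
      finally show "v (chart_inv c (z + u *s w)) \<le> ereal (Re (of_real M + of_real L * poly P u))" .
    qed (auto intro!: continuous_intros holomorphic_intros)
    moreover have "L * Re (poly P 0) \<le> L * (- \<kappa>)" using P0 L by (intro mult_left_mono) auto
    then have "Re (of_real M + of_real L * poly P 0) + N * (2 * R)\<^sup>2 / 2 \<le> M - \<kappa> * L + N * (2 * R)\<^sup>2 / 2" by (simp add: mult.commute)
    then have "ereal (Re (of_real M + of_real L * poly P 0) + N * (2 * R)\<^sup>2 / 2) \<le> ereal (M - \<kappa> * L + N * (2 * R)\<^sup>2 / 2)" by simp
    ultimately have "v (chart_inv c (z + 0 *s w)) \<le> ereal (M - \<kappa> * L + N * (2 * R)\<^sup>2 / 2)" by (rule order_trans)
    then show "v (chart_inv c z) \<le> ereal (M - \<kappa> * L + N * (2 * R)\<^sup>2 / 2)" by simp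
  qed
qed

text \<open>The points having a neighbourhood with some pair of constants form a set which is open,
  contains \<open>N0\<close> and, by \<open>harnack_local\<close>, is closed in the component.
  Compactness makes the constants uniform. They depend on \<open>N0\<close> but not on
  \<open>v\<close>, \<open>M\<close> and \<open>L\<close>, which is essential for bounding all
  competitors at once.\<close>

lemma harnack:
  assumes N0: "open N0" "N0 \<subseteq> comp a" "N0 \<noteq> {}"
  obtains \<kappa> C where "0 < \<kappa>" "0 \<le> C" "\<And>v M L x. wsh 1 v \<Longrightarrow> 0 \<le> L \<Longrightarrow> (\<And>x. x \<in> comp a \<Longrightarrow> v x \<le> ereal M) \<Longrightarrow>
     (\<And>x. x \<in> N0 \<Longrightarrow> v x \<le> ereal (M - L)) \<Longrightarrow> x \<in> comp a \<Longrightarrow> v x \<le> ereal (M - \<kappa> * L + C)"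
proof -
  define H where "H = (\<lambda>W \<kappa> C. \<forall>v M L. wsh 1 v \<longrightarrow> 0 \<le> L \<longrightarrow> (\<forall>x\<in>comp a. v x \<le> ereal M) \<longrightarrow>
     (\<forall>x\<in>N0. v x \<le> ereal (M - L)) \<longrightarrow> (\<forall>x\<in>W. v x \<le> ereal (M - \<kappa> * L + C)))"
  define Good where "Good = {x. \<exists>W \<kappa> C. open W \<and> x \<in> W \<and> (0::real) < \<kappa> \<and> (0::real) \<le> C \<and> H W \<kappa> C}"
  have "open Good"
  proof (subst open_subopen, intro ballI)
    fix x assume "x \<in> Good"
    then obtain W \<kappa> C where W: "open W" "x \<in> W" "(0::real) < \<kappa>" "(0::real) \<le> C" "H W \<kappa> C" unfolding Good_def by blast
    then have "W \<subseteq> Good" unfolding Good_def by blast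
    with W(1,2) show "\<exists>T. open T \<and> x \<in> T \<and> T \<subseteq> Good" by blast
  qed
  have step: "\<exists>W. open W \<and> x \<in> W \<and> W \<subseteq> comp a \<and> (W \<inter> Good \<noteq> {} \<longrightarrow> W \<subseteq> Good)" if x: "x \<in> comp a" for x
  proof -
    obtain c where c: "c \<in> charts" "x \<in> fst c" by (rule chart_at)
    define p where "p = snd c x"
    obtain R0 where R0: "0 < R0" "cball p R0 \<subseteq> chart_image c" by (rule chart_ball[OF c, folded p_def]) (rule that, assumption+)
    define R where "R = R0 / 4"
    have R: "0 < R" "cball p (4 * R) \<subseteq> chart_image c" using R0 by (auto simp: R_def)
    have b4: "ball p (4 * R) \<subseteq> chart_image c" and b1: "ball p R \<subseteq> chart_image c" using R by (auto simp: subset_eq)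
    define W where "W = {y \<in> fst c. snd c y \<in> ball p R}"
    have W: "open W" "x \<in> W" unfolding W_def using open_chart_preimage[OF c(1) open_ball] c(2) R by (auto simp: p_def)
    have xin: "x \<in> chart_inv c ` ball p (4 * R)" using chart_preimage_eq[OF c(1) b4] c(2) R by (auto simp: p_def)
    have in_comp: "chart_inv c z \<in> comp a" if "z \<in> ball p (4 * R)" for z
      using chart_ball_in_comp[OF c(1) b4 x xin] that by blast
    have Wcomp: "W \<subseteq> comp a" unfolding W_def chart_preimage_eq[OF c(1) b1] using in_comp R by auto
    moreover have "W \<subseteq> Good" if "W \<inter> Good \<noteq> {}"
    proof -
      obtain y where y: "y \<in> W" "y \<in> Good" using \<open>W \<inter> Good \<noteq> {}\<close> by auto
      obtain W1 \<kappa>1 C1 where W1: "open W1" "y \<in> W1" "0 < \<kappa>1" "0 \<le> C1" "H W1 \<kappa>1 C1" using y(2) unfolding Good_def by blast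
      define q where "q = snd c y"
      have q: "q \<in> ball p R" using y(1) unfolding W_def q_def by simp
      have yc: "y \<in> fst c" using y(1) unfolding W_def by simp
      have "open (snd c ` (fst c \<inter> W1) \<inter> ball p R)" by (intro open_Int open_ball open_chart_image_subset[OF c(1)]) (use chart_topological(1)[OF c(1)] W1 in auto)
      moreover have "q \<in> snd c ` (fst c \<inter> W1) \<inter> ball p R" using yc W1 q unfolding q_def by auto
      ultimately obtain s where s: "0 < s" "ball q s \<subseteq> snd c ` (fst c \<inter> W1) \<inter> ball p R" by (rule openE)
      obtain \<kappa> C where \<kappa>: "0 < \<kappa>" "0 \<le> C" and har: "\<And>v M L z. wsh 1 v \<Longrightarrow> 0 \<le> L \<Longrightarrow> (\<And>z. z \<in> ball p (4 * R) \<Longrightarrow> v (chart_inv c z) \<le> ereal M) \<Longrightarrow>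
         (\<And>z. z \<in> ball q s \<Longrightarrow> v (chart_inv c z) \<le> ereal (M - L)) \<Longrightarrow> z \<in> ball p R \<Longrightarrow> v (chart_inv c z) \<le> ereal (M - \<kappa> * L + C)"
      proof (rule harnack_local[OF c(1) R q s(1)], goal_cases)
        case (1 \<kappa> C)
        show thesis by (rule that) (fact 1)+
      qed
      have "H W (\<kappa> * \<kappa>1) (\<kappa> * C1 + C)" unfolding H_def
      proof (intro allI impI ballI)
        fix v M L x' assume v: "wsh 1 v" and L: "0 \<le> L" and vM: "\<forall>x\<in>comp a. v x \<le> ereal M" and vN: "\<forall>x\<in>N0. v x \<le> ereal (M - L)" and x': "x' \<in> W"
        \<comment> \<open>The gain already available near \<open>y\<close>. If the constant
          \<open>C1\<close> eats it up, the trivial bound \<open>M\<close> is used instead.\<close>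
        define L' where "L' = max 0 (\<kappa>1 * L - C1)"
        have vW1: "v y \<le> ereal (M - \<kappa>1 * L + C1)" if "y \<in> W1" for y using W1(5) v L vM vN that unfolding H_def by blast
        have "v (chart_inv c (snd c x')) \<le> ereal (M - \<kappa> * L' + C)"
        proof (rule har[OF v])
          show "0 \<le> L'" by (simp add: L'_def)
          show "v (chart_inv c z) \<le> ereal M" if "z \<in> ball p (4 * R)" for z using in_comp[OF that] vM by blast
          show "v (chart_inv c z) \<le> ereal (M - L')" if "z \<in> ball q s" for z
          proof -
            have zW1: "chart_inv c z \<in> W1" "chart_inv c z \<in> fst c" using s(2) that c(1) by auto
            show ?thesis
            proof (cases "0 \<le> \<kappa>1 * L - C1")
              case True
              have "v (chart_inv c z) \<le> ereal (M - \<kappa>1 * L + C1)" using vW1 zW1 by blast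
              also have "M - \<kappa>1 * L + C1 = M - L'" using True by (simp add: L'_def)
              finally show ?thesis .
            next
              case False
              have "z \<in> ball p (4 * R)" using s(2) that R by auto
              then show ?thesis using vM in_comp[of z] False by (simp add: L'_def)
            qed
          qed
          show "snd c x' \<in> ball p R" using x' unfolding W_def by simp
        qed
        moreover have "\<kappa> * (\<kappa>1 * L - C1) \<le> \<kappa> * L'" using \<kappa>(1) by (intro mult_left_mono) (auto simp: L'_def)
        then have "ereal (M - \<kappa> * L' + C) \<le> ereal (M - (\<kappa> * \<kappa>1) * L + (\<kappa> * C1 + C))" by (simp add: algebra_simps)
        moreover have "chart_inv c (snd c x') = x'" using x' c(1) unfolding W_def by simp
        ultimately show "v x' \<le> ereal (M - (\<kappa> * \<kappa>1) * L + (\<kappa> * C1 + C))" by (metis order_trans)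
      qed
      moreover have "0 < \<kappa> * \<kappa>1" "0 \<le> \<kappa> * C1 + C" using \<kappa> W1(3,4) by simp_all
      ultimately show "W \<subseteq> Good" unfolding Good_def using W(1) by blast
    qed
    ultimately show ?thesis using W by blast
  qed
  have "open (comp a - Good)"
  proof (subst open_subopen, intro ballI)
    fix x assume x: "x \<in> comp a - Good"
    then obtain W where "open W" "x \<in> W" "W \<subseteq> comp a" "W \<inter> Good \<noteq> {} \<longrightarrow> W \<subseteq> Good" using step by blast
    then show "\<exists>T. open T \<and> x \<in> T \<and> T \<subseteq> comp a - Good" using x by (intro exI[of _ W]) blast
  qed
  obtain n0 where n0: "n0 \<in> N0" using N0(3) by blast
  have "H N0 1 0" unfolding H_def by auto
  then have "n0 \<in> Good" unfolding Good_def using N0(1) n0 zero_less_one order_refl[of 0] by blast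
  have "comp a \<subseteq> Good"
  proof (rule ccontr)
    assume "\<not> comp a \<subseteq> Good"
    moreover have "connected (comp a)" by (rule connected_connected_component)
    ultimately show False using connectedD[of "comp a" Good "comp a - Good"] \<open>open Good\<close> \<open>open (comp a - Good)\<close> \<open>n0 \<in> Good\<close> n0 N0(2) by blast
  qed
  then have "\<forall>x\<in>comp a. \<exists>W \<kappa> C. open W \<and> x \<in> W \<and> (0::real) < \<kappa> \<and> (0::real) \<le> C \<and> H W \<kappa> C" unfolding Good_def by blast
  then obtain W \<kappa> C where W: "\<And>x. x \<in> comp a \<Longrightarrow> open (W x)" "\<And>x. x \<in> comp a \<Longrightarrow> x \<in> W x"
    "\<And>x. x \<in> comp a \<Longrightarrow> (0::real) < \<kappa> x" "\<And>x. x \<in> comp a \<Longrightarrow> (0::real) \<le> C x" "\<And>x. x \<in> comp a \<Longrightarrow> H (W x) (\<kappa> x) (C x)" by metis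
  obtain F where F: "F \<subseteq> comp a" "finite F" "comp a \<subseteq> (\<Union>x\<in>F. W x)"
    using compactE_image[OF comp_compact[of a], of "comp a" W] W(1,2) by blast
  define k where "k = Min (insert 1 (\<kappa> ` F))"
  define C' where "C' = Max (insert 0 (C ` F))"
  show thesis
  proof (rule that[of k C'])
    show "0 < k" unfolding k_def using F W(3) by (subst Min_gr_iff) auto
    show "0 \<le> C'" unfolding C'_def using F by (intro Max_ge) auto
    fix v M L x assume v: "wsh 1 v" "0 \<le> L" "\<And>x. x \<in> comp a \<Longrightarrow> v x \<le> ereal M" "\<And>x. x \<in> N0 \<Longrightarrow> v x \<le> ereal (M - L)" "x \<in> comp a"
    obtain f where f: "f \<in> F" "x \<in> W f" using F(3) v(5) by blast
    have "H (W f) (\<kappa> f) (C f)" using W(5) f F by blast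
    then have 1: "v x \<le> ereal (M - \<kappa> f * L + C f)" using v f unfolding H_def by blast
    have "k \<le> \<kappa> f" unfolding k_def using F f by auto
    then have "k * L \<le> \<kappa> f * L" using v(2) by (rule mult_right_mono)
    moreover have "C f \<le> C'" unfolding C'_def using F f by auto
    ultimately have "ereal (M - \<kappa> f * L + C f) \<le> ereal (M - k * L + C')" by simp
    with 1 show "v x \<le> ereal (M - k * L + C')" by (rule order_trans)
  qed
qed

end

lemma ereal_scaled_le:
  assumes "0 < d" "ereal d * x - ereal q \<le> ereal t" shows "x \<le> ereal ((t + q) / d)"
  using assms by (cases x) (auto simp: field_simps)

context hermitian_mfd
begin

lemma wsh_compE:
  assumes v: "wsh 1 v" obtains y where "y \<in> comp a" "\<And>z. z \<in> comp a \<Longrightarrow> v z \<le> v y"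
proof -
  have "usc_on v (comp a)" using v usc_on_subset[of v UNIV] unfolding wsh_def by blast
  from usc_attains_max[OF comp_compact _ this] comp_self[of a] that show thesis by blast
qed

text \<open>If \<open>M\<close> is the maximum over the component, Harnack gives
  \<open>M \<le> M - k * (M - C0) + C\<close>, hence an upper bound for \<open>M\<close>.\<close>

lemma comp_bound:
  assumes N0: "open N0" "N0 \<subseteq> comp a" "N0 \<noteq> {}"
  obtains B where "0 \<le> B" "\<And>v x. wsh 1 v \<Longrightarrow> (\<And>x. x \<in> N0 \<Longrightarrow> v x \<le> ereal C0) \<Longrightarrow> x \<in> comp a \<Longrightarrow> v x \<le> ereal B"
proof (rule harnack[OF N0], goal_cases)
  case (1 k C)
  show thesis
  proof (rule that[of "max 0 (C0 + C / k)"])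
    fix v x assume v: "wsh 1 v" and N: "\<And>x. x \<in> N0 \<Longrightarrow> v x \<le> ereal C0" and x: "x \<in> comp a"
    obtain y where y: "y \<in> comp a" "\<And>z. z \<in> comp a \<Longrightarrow> v z \<le> v y" by (rule wsh_compE[OF v]) (rule that)
    have "v y \<le> ereal (C0 + C / k)"
    proof (rule ccontr)
      assume n: "\<not> v y \<le> ereal (C0 + C / k)"
      moreover have "v y \<noteq> \<infinity>" using v unfolding wsh_def by blast
      ultimately obtain M where M: "v y = ereal M" by (cases "v y") auto
      have gt: "C / k < M - C0" using n M by simp
      have L: "0 \<le> M - C0" using gt divide_nonneg_pos[OF 1(3,2)] by linarith
      have "v y \<le> ereal (M - k * (M - C0) + C)"
      proof (rule 1(4)[OF v L _ _ y(1)])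
        show "v x \<le> ereal M" if "x \<in> comp a" for x using y(2)[OF that] M by simp
        show "v x \<le> ereal (M - (M - C0))" if "x \<in> N0" for x using N[OF that] by simp
      qed
      then have "k * (M - C0) \<le> C" unfolding M by simp
      then have "M - C0 \<le> C / k" using 1(2) by (simp add: pos_le_divide_eq mult.commute)
      then show False using gt by simp
    qed
    also have "ereal (C0 + C / k) \<le> ereal (max 0 (C0 + C / k))" by simp
    finally show "v x \<le> ereal (max 0 (C0 + C / k))" using y(2)[OF x] by (rule order_trans[rotated])
  qed simp
qed

lemma chart_cball_preimage:
  assumes c: "c \<in> charts" and r: "cball p r \<subseteq> chart_image c"
  shows "closed {x \<in> fst c. snd c x \<in> cball p r}" "connected {x \<in> fst c. snd c x \<in> cball p r}"
proof -
  have cont: "continuous_on (cball p r) (chart_inv c)" by (rule continuous_on_subset[OF chart_topological(4)[OF c] r])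
  show "closed {x \<in> fst c. snd c x \<in> cball p r}" unfolding chart_preimage_eq[OF c r]
    by (rule compact_imp_closed[OF compact_continuous_image[OF cont compact_cball]])
  show "connected {x \<in> fst c. snd c x \<in> cball p r}" unfolding chart_preimage_eq[OF c r]
    by (rule connected_continuous_image[OF cont connected_cball])
qed

text \<open>The bound on the sphere makes the inner function nonpositive there, so the extension by
  0 is usc. As \<open>d \<le> 1 / 2\<close>, at least half of \<open>\<omega>\<close> is left over,
  and \<open>4 * b * (norm w)\<^sup>2 \<le> Q c z w\<close> is what it takes to pay for the
  quadratic term.\<close>

lemma glue_PSH:
  assumes c: "c \<in> charts" and r: "cball p r \<subseteq> chart_image c" and v: "wsh 1 v"
    and l: "\<And>z w. z \<in> cball p r \<Longrightarrow> 4 * b * (norm w)\<^sup>2 \<le> Q c z w" and b: "0 \<le> b" and d: "0 < d" "d \<le> 1 / 2"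
    and bd: "\<And>x. x \<in> fst c \<Longrightarrow> snd c x \<in> sphere p r \<Longrightarrow> v x \<le> ereal (b * r\<^sup>2 / d)"
  shows "(\<lambda>x. if x \<in> fst c \<and> snd c x \<in> ball p r then max (ereal d * v x - ereal (b * (norm (snd c x - p))\<^sup>2)) 0 else 0) \<in> PSH A g"
    (is "?W \<in> _")
proof -
  let ?h = "\<lambda>x. ereal d * v x - ereal (b * (norm (snd c x - p))\<^sup>2)"
  define D where "D = {x \<in> fst c. snd c x \<in> cball p r}"
  have cD: "closed D" unfolding D_def by (rule chart_cball_preimage(1)[OF c r])
  have fin: "v x \<noteq> \<infinity>" for x using v unfolding wsh_def by blast
  have W0: "0 \<le> ?W x" for x by (auto simp: max_def)
  have hiff: "?h x < ereal t \<longleftrightarrow> v x < ereal ((t + b * (norm (snd c x - p))\<^sup>2) / d)" for x t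
    using d(1) fin[of x] by (cases "v x") (auto simp: field_simps)
  have finh: "?h x \<noteq> \<infinity>" for x using d(1) fin[of x] by (cases "v x") auto
  have ufst: "usc_on v (fst c)" using v usc_on_subset[of v UNIV] unfolding wsh_def by blast
  have oh: "open {x \<in> fst c. ?h x < ereal t}" for t
  proof -
    have "openin (top_of_set (fst c)) {x \<in> fst c. v x < ereal ((t + b * (norm (snd c x - p))\<^sup>2) / d)}"
      by (intro usc_on_less_continuous[OF ufst] continuous_intros chart_topological(3)[OF c]) (use d in auto)
    then show ?thesis unfolding hiff using openin_open_trans chart_topological(1)[OF c] by blast
  qed
  have usc: "usc_on ?W UNIV" unfolding usc_on_def
  proof
    fix t :: ereal
    have "open {x \<in> UNIV. ?W x < t}"
    proof (cases t)
      case (real s)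
      show ?thesis
      proof (cases "0 < s")
        case True
        \<comment> \<open>The sphere is the critical place: by the boundary condition it belongs to
          the open set on the right.\<close>
        have "{x \<in> UNIV. ?W x < t} = - D \<union> {x \<in> fst c. ?h x < ereal s}"
        proof (intro equalityI subsetI)
          fix x assume x: "x \<in> {x \<in> UNIV. ?W x < t}"
          show "x \<in> - D \<union> {x \<in> fst c. ?h x < ereal s}"
          proof (cases "x \<in> D")
            case xD: True
            then have xc: "x \<in> fst c" "snd c x \<in> cball p r" by (auto simp: D_def)
            have "?h x < ereal s"
            proof (cases "snd c x \<in> ball p r")
              case True
              then show ?thesis using x xc(1) real by simp
            next
              case False
              then have dr: "dist p (snd c x) = r" using xc(2) by simp
              then have sp: "snd c x \<in> sphere p r" by simp
              have nr: "norm (snd c x - p) = r" using dr by (simp add: dist_norm norm_minus_commute)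
              have "v x \<le> ereal (b * r\<^sup>2 / d)" by (rule bd[OF xc(1) sp])
              also have "\<dots> < ereal ((s + b * (norm (snd c x - p))\<^sup>2) / d)" unfolding nr using True d(1) by (simp add: divide_strict_right_mono)
              finally show ?thesis unfolding hiff .
            qed
            then show ?thesis using xc by blast
          qed blast
        next
          fix x assume x: "x \<in> - D \<union> {x \<in> fst c. ?h x < ereal s}"
          show "x \<in> {x \<in> UNIV. ?W x < t}"
          proof (cases "x \<in> fst c \<and> snd c x \<in> ball p r")
            case True
            then have "x \<in> D" by (auto simp: D_def)
            then have "?h x < t" using x real by blast
            moreover have "0 < t" using \<open>0 < s\<close> real by simp
            ultimately show ?thesis using True by simp
          next
            case False
            then have "?W x = 0" by (simp only: if_False)
            moreover have "0 < t" using \<open>0 < s\<close> real by simp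
            ultimately show ?thesis by simp
          qed
        qed
        then show ?thesis using oh cD by (simp only:) (intro open_Un open_Compl oh)
      next
        case False
        then have "t \<le> 0" using real by simp
        then have "\<not> ?W x < t" for x using W0[of x] by (meson leD order_trans)
        then have "{x \<in> UNIV. ?W x < t} = {}" by blast
        then show ?thesis by (simp only: open_empty)
      qed
    next
      case PInf
      have "?W x < t" for x using finh[of x] PInf by (auto simp: max_def)
      then have "{x \<in> UNIV. ?W x < t} = UNIV" by blast
      then show ?thesis by (simp only: open_UNIV)
    next
      case MInf
      then have "{x \<in> UNIV. ?W x < t} = {}" by simp
      then show ?thesis by (simp only: open_empty)
    qed
    then show "openin (top_of_set UNIV) {x \<in> UNIV. ?W x < t}" by (simp only: open_openin subtopology_UNIV)
  qed
  have "wsub 1 ?W x" for x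
  proof (cases "x \<in> fst c \<and> snd c x \<in> ball p r \<and> 0 \<le> ?h x")
    case True
    have hx: "wsub 1 ?h x"
    proof (rule wsub_minus_quadratic[where \<kappa> = 1])
      show "wsub 1 v x" using v unfolding wsh_def by blast
      fix w
      have "4 * b * (norm w)\<^sup>2 \<le> Q c (snd c x) w" using True by (intro l) auto
      moreover have "0 \<le> Q c (snd c x) w" using Q_nonneg[OF c] True by blast
      then have "(1 / 2) * Q c (snd c x) w \<le> (1 - d * 1) * Q c (snd c x) w" using d by (intro mult_right_mono) auto
      ultimately show "2 * b * (norm w)\<^sup>2 \<le> (1 - d * 1) * Q c (snd c x) w" by simp
    qed (use v c True d b in auto)
    show ?thesis
    proof (rule wsub_cong_near[OF hx open_chart_preimage[OF c open_ball, of p r]])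
      show "x \<in> {x \<in> fst c. snd c x \<in> ball p r}" using True by blast
      show "?h x = ?W x" using True by (simp add: max_absorb1)
      show "?h y \<le> ?W y" if "y \<in> {x \<in> fst c. snd c x \<in> ball p r}" for y using that by simp
    qed
  next
    case False
    \<comment> \<open>In the remaining cases the glued function is 0 at \<open>x\<close> and
      nonnegative everywhere.\<close>
    have "wsub 1 (\<lambda>_. ereal 0) x" by (rule wsub_const) simp
    then show ?thesis
    proof (rule wsub_cong_near[OF _ open_UNIV])
      show "ereal 0 = ?W x" using False by (auto simp: max_def zero_ereal_def)
      show "ereal 0 \<le> ?W y" for y using W0[of y] by (simp only: zero_ereal_def)
    qed simp
  qed
  moreover have "?W x \<noteq> \<infinity>" for x using finh[of x] by (auto simp: max_def)
  ultimately have "wsh 1 ?W" using usc unfolding wsh_def by blast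
  then show ?thesis by (rule wsh_imp_PSH[of _ 0]) (use W0 in \<open>simp only: zero_ereal_def\<close>)
qed

section \<open>Localization of the extremal function\<close>

lemma extremal_nonneg: "0 \<le> extremal_fun A g E x"
  unfolding extremal_fun_def using const_PSH[of 0] by (intro SUP_upper2[of "\<lambda>_. ereal 0"]) auto

lemma extremal_upper: "v \<in> PSH A g \<Longrightarrow> (\<And>y. y \<in> E \<Longrightarrow> v y \<le> 0) \<Longrightarrow> v x \<le> extremal_fun A g E x"
  unfolding extremal_fun_def by (rule SUP_upper) auto

text \<open>The extremal function is nonnegative, as 0 is a competitor, and vanishes at points of
  \<open>E\<close>; only upper semicontinuity at \<open>a\<close> is in question.\<close>

lemma extremal_isCont_iff:
  assumes a: "a \<in> E"
  shows "isCont (extremal_fun A g E) a \<longleftrightarrow> (\<forall>d>0. \<exists>W. open W \<and> a \<in> W \<and> (\<forall>x\<in>W. extremal_fun A g E x < ereal d))"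
proof -
  let ?V = "extremal_fun A g E"
  have "?V a \<le> 0" unfolding extremal_fun_def by (rule SUP_least) (use a in auto)
  then have V0: "?V a = 0" using extremal_nonneg[of E a] by (rule antisym)
  show ?thesis
  proof (intro iffI allI impI)
    fix d :: real assume c: "isCont ?V a" and "0 < d"
    then have "?V a \<in> {..<ereal d}" using V0 by simp
    then show "\<exists>W. open W \<and> a \<in> W \<and> (\<forall>x\<in>W. ?V x < ereal d)"
      using c[unfolded continuous_at_open, rule_format, of "{..<ereal d}"] by auto
  next
    assume H: "\<forall>d>0. \<exists>W. open W \<and> a \<in> W \<and> (\<forall>x\<in>W. ?V x < ereal d)"
    show "isCont ?V a" unfolding isCont_def
    proof (rule order_tendstoI)
      fix t assume t: "t < ?V a"
      have "t < ?V x" for x using t V0 extremal_nonneg[of E x] by (metis less_le_trans)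
      then show "\<forall>\<^sub>F x in at a. t < ?V x" by simp
    next
      fix t assume "?V a < t"
      then obtain e where e: "0 < e" "ereal e < t" using ereal_dense2[of 0 t] V0 by auto
      obtain W where "open W" "a \<in> W" "\<forall>x\<in>W. ?V x < ereal e" using H e(1) by blast
      then show "\<forall>\<^sub>F x in at a. ?V x < t" unfolding eventually_at_topological using e(2) by (intro exI[of _ W]) (auto intro: less_trans)
    qed
  qed
qed

text \<open>A competitor \<open>v\<close> for \<open>K \<inter> B\<close> becomes one for \<open>K\<close> after replacing it by
  \<open>max(d v - b |z - p|\<^sup>2, 0)\<close> inside and by 0 outside of the ball, provided that
  \<open>d v \<le> b r\<^sup>2\<close> on its boundary. If \<open>M = sup v\<close> is large then \<open>d = b r\<^sup>2 / M\<close> is admissible, so that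
  \<open>v \<le> M / 2\<close> near \<open>a\<close>, and the Harnack inequality bounds \<open>M\<close>.\<close>

lemma extremal_local:
  assumes a: "a \<in> K" and B: "closed_coordinate_ball A a r B"
  shows "isCont (extremal_fun A g K) a \<longleftrightarrow> isCont (extremal_fun A g (K \<inter> B)) a"
proof -
  obtain c where r: "0 < r" and c: "c \<in> charts" "a \<in> fst c" and rc: "cball (snd c a) r \<subseteq> chart_image c"
    and Beq: "B = {x \<in> fst c. snd c x \<in> cball (snd c a) r}"
    using B unfolding closed_coordinate_ball_def by auto
  define p where "p = snd c a"
  note rc = rc[folded p_def] and Beq = Beq[folded p_def]
  have aB: "a \<in> B" unfolding Beq p_def using c(2) r by simp
  have Bcomp: "B \<subseteq> comp a"
    using connected_component_maximal[OF aB _ subset_UNIV] chart_cball_preimage(2)[OF c(1) rc] unfolding Beq by blast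
  obtain l N where l: "0 < l" "\<And>z w. z \<in> cball p r \<Longrightarrow> l * (norm w)\<^sup>2 \<le> Q c z w"
    using Q_bounds[OF c(1) compact_cball rc] by metis
  define b where "b = l / 4"
  have b: "0 < b" using l(1) by (simp add: b_def)
  have bl: "4 * b * (norm w)\<^sup>2 \<le> Q c z w" if "z \<in> cball p r" for z w using l(2)[OF that, of w] by (simp add: b_def)
  have br: "0 < b * r\<^sup>2" using b r by simp
  \<comment> \<open>With \<open>d = b * r\<^sup>2 / M\<close> the bound \<open>M\<close> on the
    component is the boundary condition of \<open>glue_PSH\<close>, and
    \<open>2 * (b * r\<^sup>2) \<le> M\<close> is its requirement
    \<open>d \<le> 1 / 2\<close>.\<close>
  have key: "ereal d * v x - ereal (b * (norm (snd c x - p))\<^sup>2) \<le> extremal_fun A g K x"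
    if v: "v \<in> PSH A g" "\<And>y. y \<in> K \<inter> B \<Longrightarrow> v y \<le> 0" and M: "\<And>y. y \<in> comp a \<Longrightarrow> v y \<le> ereal M" "2 * (b * r\<^sup>2) \<le> M"
      and d: "d = b * r\<^sup>2 / M" and x: "x \<in> fst c" "snd c x \<in> ball p r" for v x M d
  proof -
    have M0: "0 < M" using M(2) br by linarith
    have d1: "0 < d" "d \<le> 1 / 2" unfolding d using br M0 M(2) by (simp_all add: field_simps)
    let ?W = "\<lambda>x. if x \<in> fst c \<and> snd c x \<in> ball p r then max (ereal d * v x - ereal (b * (norm (snd c x - p))\<^sup>2)) 0 else 0"
    have "?W \<in> PSH A g"
    proof (rule glue_PSH[OF c(1) rc PSH_imp_wsh[OF v(1)] bl _ d1])
      fix y assume y: "y \<in> fst c" "snd c y \<in> sphere p r"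
      then have "y \<in> B" unfolding Beq by simp
      then have "v y \<le> ereal M" using Bcomp M(1) by blast
      also have "M = b * r\<^sup>2 / d" unfolding d using br M0 b r by simp
      finally show "v y \<le> ereal (b * r\<^sup>2 / d)" .
    qed (use b in auto)
    moreover have "?W y \<le> 0" if "y \<in> K" for y
    proof (cases "y \<in> fst c \<and> snd c y \<in> ball p r")
      case True
      then have "v y \<le> 0" using that by (intro v(2)) (auto simp: Beq)
      then have "ereal d * v y \<le> 0" using d1(1) by (simp add: ereal_mult_le_0_iff)
      then have "ereal d * v y - ereal (b * (norm (snd c y - p))\<^sup>2) \<le> 0" using b
        by (cases "ereal d * v y") (auto simp: zero_ereal_def intro: order_trans)
      then show ?thesis by simp
    qed auto
    ultimately have "?W x \<le> extremal_fun A g K x" by (rule extremal_upper)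
    then show ?thesis using x by simp
  qed
  have oball: "open {x \<in> fst c. snd c x \<in> ball p s}" for s by (rule open_chart_preimage[OF c(1) open_ball])
  have "isCont (extremal_fun A g (K \<inter> B)) a" if cK: "isCont (extremal_fun A g K) a"
  proof -
    have near: "\<exists>W. open W \<and> a \<in> W \<and> (\<forall>x\<in>W. extremal_fun A g K x < ereal e)" if "0 < e" for e
      using cK[unfolded extremal_isCont_iff[OF a]] that by blast
    \<comment> \<open>Together with the radius \<open>r / 2\<close> in \<open>N0\<close> this gives
      \<open>d * v \<le> b * r\<^sup>2 / 2\<close> there, which is
      \<open>v \<le> M / 2\<close>.\<close>
    have "0 < b * r\<^sup>2 / 4" using br by simp
    from near[OF this] obtain O1 where O1: "open O1" "a \<in> O1" "\<And>x. x \<in> O1 \<Longrightarrow> extremal_fun A g K x < ereal (b * r\<^sup>2 / 4)" by blast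
    define N0 where "N0 = O1 \<inter> comp a \<inter> {x \<in> fst c. snd c x \<in> ball p (r / 2)}"
    have N0: "open N0" "N0 \<subseteq> comp a" unfolding N0_def using O1(1) comp_open oball by blast+
    have aN0: "a \<in> N0" unfolding N0_def using O1(2) c(2) r by (simp add: p_def)
    then have N0': "N0 \<noteq> {}" by blast
    have "\<exists>M0\<ge>2 * (b * r\<^sup>2). \<forall>v\<in>PSH A g. (\<forall>y\<in>K \<inter> B. v y \<le> 0) \<longrightarrow> (\<forall>x\<in>comp a. v x \<le> ereal M0)"
    proof (rule harnack[OF N0 N0'], goal_cases)
      case (1 k C)
      \<comment> \<open>A larger maximum \<open>M\<close> would admit \<open>key\<close>, and
        Harnack with the gain \<open>M / 2\<close> would give
        \<open>k * (M / 2) \<le> C\<close>.\<close>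
      define M0 where "M0 = max (2 * (b * r\<^sup>2)) (2 * C / k)"
      have "v x \<le> ereal M0" if v: "v \<in> PSH A g" "\<forall>y\<in>K \<inter> B. v y \<le> 0" and x: "x \<in> comp a" for v x
      proof -
        have w: "wsh 1 v" by (rule PSH_imp_wsh[OF v(1)])
        obtain y where y: "y \<in> comp a" "\<And>z. z \<in> comp a \<Longrightarrow> v z \<le> v y" by (rule wsh_compE[OF w]) (rule that)
        have "v y \<le> ereal M0"
        proof (rule ccontr)
          assume n: "\<not> v y \<le> ereal M0"
          moreover have "v y \<noteq> \<infinity>" using w unfolding wsh_def by blast
          ultimately obtain M where M: "v y = ereal M" by (cases "v y") auto
          have gt: "2 * (b * r\<^sup>2) \<le> M" "2 * C / k < M" using n unfolding M ereal_less_eq M0_def by linarith+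
          define d where "d = b * r\<^sup>2 / M"
          have Mp: "0 < M" using gt(1) br by linarith
          have d0: "0 < d" unfolding d_def using br Mp by simp
          have "v y \<le> ereal (M - k * (M / 2) + C)"
          proof (rule 1(3)[OF w _ _ _ y(1)])
            show "v x \<le> ereal M" if "x \<in> comp a" for x using y(2)[OF that] M by simp
            show "v x \<le> ereal (M - M / 2)" if xN: "x \<in> N0" for x
            proof -
              have xs: "x \<in> O1" "x \<in> fst c" "snd c x \<in> ball p (r / 2)" using xN unfolding N0_def by auto
              have nx: "norm (snd c x - p) \<le> r / 2" using xs(3) by (simp add: dist_norm norm_minus_commute)
              have "ereal d * v x - ereal (b * (norm (snd c x - p))\<^sup>2) \<le> extremal_fun A g K x"
              proof (rule key[OF v(1) _ _ gt(1) d_def xs(2)])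
                show "v y \<le> ereal M" if "y \<in> comp a" for y using y(2)[OF that] M by simp
                show "snd c x \<in> ball p r" using xs(3) r by simp
              qed (use v(2) in blast)
              also have "\<dots> \<le> ereal (b * r\<^sup>2 / 4)" using O1(3)[OF xs(1)] by simp
              finally have "v x \<le> ereal ((b * r\<^sup>2 / 4 + b * (norm (snd c x - p))\<^sup>2) / d)" by (rule ereal_scaled_le[OF d0])
              also have "\<dots> \<le> ereal (M - M / 2)"
              proof -
                have "b * (norm (snd c x - p))\<^sup>2 \<le> b * (r / 2)\<^sup>2" using b nx by (intro mult_left_mono power_mono) auto
                then have "(b * r\<^sup>2 / 4 + b * (norm (snd c x - p))\<^sup>2) / d \<le> (b * r\<^sup>2 / 2) / d"
                  using d0 by (intro divide_right_mono) (auto simp: power_divide)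
                also have "(b * r\<^sup>2 / 2) / d = M - M / 2" unfolding d_def using br Mp b r by simp
                finally show ?thesis by simp
              qed
              finally show ?thesis .
            qed
          qed (use Mp in simp)
          then have "k * (M / 2) \<le> C" unfolding M by simp
          then have "M \<le> 2 * C / k" using 1(1) by (simp add: pos_le_divide_eq mult.commute)
          then show False using gt(2) by simp
        qed
        then show ?thesis using y(2)[OF x] by (rule order_trans[rotated])
      qed
      then show ?case by (intro exI[of _ M0]) (auto simp: M0_def)
    qed
    then obtain M0 where M0: "2 * (b * r\<^sup>2) \<le> M0" "\<And>v x. v \<in> PSH A g \<Longrightarrow> (\<forall>y\<in>K \<inter> B. v y \<le> 0) \<Longrightarrow> x \<in> comp a \<Longrightarrow> v x \<le> ereal M0" by blast
    \<comment> \<open>The scaling factor is now the same for all competitors, so smallness of the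
      extremal function of \<open>K\<close> transfers to all of them on one neighbourhood.\<close>
    define d where "d = b * r\<^sup>2 / M0"
    have d0: "0 < d" unfolding d_def using br M0(1) by (intro divide_pos_pos) linarith+
    show ?thesis unfolding extremal_isCont_iff[OF IntI[OF a aB]]
    proof (intro allI impI)
      fix e :: real assume e: "0 < e"
      have e4: "0 < d * e / 4" using d0 e by simp
      from near[OF this] obtain O2 where O2: "open O2" "a \<in> O2" "\<And>x. x \<in> O2 \<Longrightarrow> extremal_fun A g K x < ereal (d * e / 4)" by blast
      \<comment> \<open>Within this radius the quadratic term is at most \<open>d * e / 4\<close>,
        as is the extremal function of \<open>K\<close>; so
        \<open>d * v \<le> d * e / 2\<close>.\<close>
      define s where "s = min r (sqrt (d * e / 4 / b))"
      have s: "0 < s" using r e4 b by (simp add: s_def)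
      have "extremal_fun A g (K \<inter> B) x < ereal e" if x: "x \<in> O2 \<inter> {x \<in> fst c. snd c x \<in> ball p s}" for x
      proof -
        have xs: "x \<in> O2" "x \<in> fst c" "snd c x \<in> ball p s" using x by auto
        have nx: "norm (snd c x - p) \<le> sqrt (d * e / 4 / b)" using xs(3) by (simp add: dist_norm norm_minus_commute s_def)
        have "(norm (snd c x - p))\<^sup>2 \<le> (sqrt (d * e / 4 / b))\<^sup>2" by (rule power_mono[OF nx]) simp
        also have "\<dots> = d * e / 4 / b" by (rule real_sqrt_pow2) (use e4 b in simp)
        finally have bn: "b * (norm (snd c x - p))\<^sup>2 \<le> d * e / 4" using b by (simp add: field_simps)
        have "v x \<le> ereal (e / 2)" if v: "v \<in> PSH A g" "\<forall>y\<in>K \<inter> B. v y \<le> 0" for v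
        proof -
          have "ereal d * v x - ereal (b * (norm (snd c x - p))\<^sup>2) \<le> extremal_fun A g K x"
          proof (rule key[OF v(1) _ M0(2)[OF v] M0(1) d_def xs(2)])
            show "snd c x \<in> ball p r" using xs(3) by (simp add: s_def)
          qed (use v(2) in blast)
          also have "\<dots> \<le> ereal (d * e / 4)" using O2(3)[OF xs(1)] by simp
          finally have "v x \<le> ereal ((d * e / 4 + b * (norm (snd c x - p))\<^sup>2) / d)" by (rule ereal_scaled_le[OF d0])
          also have "\<dots> \<le> ereal ((d * e / 2) / d)" unfolding ereal_less_eq using bn d0 by (intro divide_right_mono) auto
          also have "(d * e / 2) / d = e / 2" using d0 by simp
          finally show ?thesis .
        qed
        then have "extremal_fun A g (K \<inter> B) x \<le> ereal (e / 2)" unfolding extremal_fun_def by (intro SUP_least) blast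
        also have "\<dots> < ereal e" using e by simp
        finally show ?thesis .
      qed
      moreover have "open (O2 \<inter> {x \<in> fst c. snd c x \<in> ball p s})" by (rule open_Int[OF O2(1) oball])
      moreover have "a \<in> O2 \<inter> {x \<in> fst c. snd c x \<in> ball p s}" using O2(2) c(2) s by (simp add: p_def)
      ultimately show "\<exists>W. open W \<and> a \<in> W \<and> (\<forall>x\<in>W. extremal_fun A g (K \<inter> B) x < ereal e)" by blast
    qed
  qed
  moreover have "isCont (extremal_fun A g K) a" if cB: "isCont (extremal_fun A g (K \<inter> B)) a"
    unfolding extremal_isCont_iff[OF a]
  proof (intro allI impI)
    fix e :: real assume "0 < e"
    with cB[unfolded extremal_isCont_iff[OF IntI[OF a aB]]]
    have "\<exists>W. open W \<and> a \<in> W \<and> (\<forall>x\<in>W. extremal_fun A g (K \<inter> B) x < ereal e)" by (elim allE impE)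
    then obtain W where W: "open W" "a \<in> W" "\<And>x. x \<in> W \<Longrightarrow> extremal_fun A g (K \<inter> B) x < ereal e" by blast
    have "extremal_fun A g K x \<le> extremal_fun A g (K \<inter> B) x" for x
      unfolding extremal_fun_def by (rule SUP_subset_mono) auto
    from le_less_trans[OF this W(3)] show "\<exists>W. open W \<and> a \<in> W \<and> (\<forall>x\<in>W. extremal_fun A g K x < ereal e)"
      using W(1,2) by (intro exI[of _ W]) simp
  qed
  ultimately show ?thesis by blast
qed

end

section \<open>Regularization\<close>

context hermitian_mfd
begin

text \<open>Hadamard's three circles theorem, by the maximum principle for \<open>v + q |\<xi>|\<^sup>2 - k ln |\<xi>|\<close> on an
  annulus.\<close>

lemma three_circles:
  assumes c: "c \<in> charts" and v: "wsh 1 v" and vr: "\<And>x. v x = ereal (vr x)"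
    and d: "0 < d" "d < R" and R: "cball z R \<subseteq> chart_image c"
    and N: "0 \<le> N" "\<And>y w. y \<in> cball z R \<Longrightarrow> Q c y w \<le> N * (norm w)\<^sup>2"
    and M: "\<And>y. y \<in> cball z R \<Longrightarrow> vr (chart_inv c y) \<le> M" and m0: "\<And>y. y \<in> cball z d \<Longrightarrow> vr (chart_inv c y) \<le> m0" and AM: "m0 \<le> M"
    and y: "d \<le> dist z y" "dist z y \<le> R" and q: "q = (N + 1) / 2"
  shows "vr (chart_inv c y) \<le> m0 + q * d\<^sup>2 + (M - m0 + q * R\<^sup>2) / ln (R / d) * ln (dist z y / d)"
proof -
  define t where "t = dist z y"
  have t: "0 < t" "d \<le> t" "t \<le> R" using y d by (auto simp: t_def)
  have q0: "0 \<le> q" using N(1) q by simp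
  define w where "w = of_real (1 / t) *s (y - z)"
  have nw: "norm w = 1" using t(1) unfolding w_def norm_smult by (simp add: norm_divide t_def dist_norm norm_minus_commute)
  have tw: "z + of_real t *s w = y" unfolding w_def using t(1) by (simp add: vector_smult_assoc)
  have lnp: "0 < ln (R / d)" using d by simp
  \<comment> \<open>Chosen so that the value of the comparison function for the bound
    \<open>M\<close> on the outer circle is \<open>m0 - k * ln d\<close>, no larger than the bound
    on the inner circle.\<close>
  define k where "k = (M - m0 + q * R\<^sup>2) / ln (R / d)"
  have keq: "k * (ln R - ln d) = M - m0 + q * R\<^sup>2" unfolding k_def using lnp d by (simp add: ln_div)
  define S where "S = {\<xi>::complex. d \<le> norm \<xi> \<and> norm \<xi> \<le> R}"
  have "S = cball 0 R - ball 0 d" unfolding S_def by auto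
  then have cS: "compact S" by (simp only: compact_diff[OF compact_cball open_ball])
  have tS: "of_real t \<in> S" unfolding S_def using t by simp
  have dzw: "dist z (z + \<xi> *s w) = norm \<xi>" for \<xi> by (simp add: dist_norm norm_smult nw)
  have inR: "z + \<xi> *s w \<in> cball z R" if "norm \<xi> \<le> R" for \<xi> using that dzw[of \<xi>] by simp
  define e where "e = (\<lambda>\<xi>::complex. k * ln (norm \<xi>) - q * (norm \<xi>)\<^sup>2)"
  define F where "F = (\<lambda>\<xi>. vr (chart_inv c (z + \<xi> *s w)) - e \<xi>)"
  have "usc_on (\<lambda>\<xi>. v (chart_inv c (z + \<xi> *s w)) - ereal (e \<xi>)) S"
  proof (rule usc_on_minus_continuous)
    have "usc_on (\<lambda>z. v (chart_inv c z)) (chart_image c)" using v c unfolding wsh_def by (intro usc_chart) auto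
    then show "usc_on (\<lambda>\<xi>. v (chart_inv c (z + \<xi> *s w))) S"
    proof (rule usc_on_compose)
      show "z + \<xi> *s w \<in> chart_image c" if "\<xi> \<in> S" for \<xi> using inR[of \<xi>] R that unfolding S_def by blast
    qed (intro continuous_intros)
    show "continuous_on S e" unfolding e_def by (intro continuous_intros) (use d(1) in \<open>auto simp: S_def\<close>)
  qed
  from usc_attains_max[OF cS _ this] tS obtain \<xi>0 where \<xi>0: "\<xi>0 \<in> S" and
    max: "\<And>\<xi>. \<xi> \<in> S \<Longrightarrow> v (chart_inv c (z + \<xi> *s w)) - ereal (e \<xi>) \<le> v (chart_inv c (z + \<xi>0 *s w)) - ereal (e \<xi>0)" by blast
  have Fmax: "F \<xi> \<le> F \<xi>0" if "\<xi> \<in> S" for \<xi> using max[OF that] unfolding vr F_def by simp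
  have "F \<xi>0 \<le> m0 + q * d\<^sup>2 - k * ln d"
  proof -
    consider "norm \<xi>0 = d" | "norm \<xi>0 = R" | "d < norm \<xi>0" "norm \<xi>0 < R" using \<xi>0 unfolding S_def by fastforce
    then show ?thesis
    proof cases
      case 1
      then have "vr (chart_inv c (z + \<xi>0 *s w)) \<le> m0" by (intro m0) (simp add: dzw)
      then show ?thesis unfolding F_def e_def 1 by simp
    next
      case 2
      then have "vr (chart_inv c (z + \<xi>0 *s w)) \<le> M" by (intro M inR) simp
      then have "F \<xi>0 \<le> m0 - k * ln d" using keq unfolding F_def e_def 2 by (simp add: algebra_simps)
      moreover have "0 \<le> q * d\<^sup>2" using q0 by simp
      ultimately show ?thesis by linarith
    next
      case 3
      \<comment> \<open>The disc of this radius around \<open>\<xi>0\<close> stays in the annulus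
        and misses 0, so a branch of the logarithm exists on it.\<close>
      define h where "h = min (norm \<xi>0 - d) (R - norm \<xi>0)"
      have h: "0 < h" "h < norm \<xi>0" using 3 d(1) unfolding h_def by auto
      have \<xi>00: "\<xi>0 \<noteq> 0" using 3 d(1) by auto
      have ann: "\<xi>0 + of_real h * u \<in> S" if "norm u \<le> 1" for u
      proof -
        have "norm (of_real h * u) \<le> h" using that h by (simp add: norm_mult mult_left_le)
        then show ?thesis using norm_triangle_ineq[of \<xi>0 "of_real h * u"] norm_triangle_ineq2[of \<xi>0 "- (of_real h * u)"]
          unfolding S_def h_def by auto
      qed
      define w' where "w' = of_real h *s w"
      have nw': "norm w' = h" unfolding w'_def using h nw by (simp only: norm_smult norm_of_real abs_of_pos mult_1_right)
      have zeq: "(z + \<xi>0 *s w) + u *s w' = z + (\<xi>0 + of_real h * u) *s w" for u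
        unfolding w'_def by (simp add: vec_eq_iff algebra_simps)
      have "disc_sub (\<lambda>u. v (chart_inv c ((z + \<xi>0 *s w) + u *s w'))) (N * h\<^sup>2 / 2)"
      proof (rule wsh_disc_sub[OF v _ c])
        fix u :: complex assume "norm u \<le> 1"
        then have "(z + \<xi>0 *s w) + u *s w' \<in> cball z R" unfolding zeq using ann[of u] by (intro inR) (simp add: S_def)
        then show "(z + \<xi>0 *s w) + u *s w' \<in> chart_image c" "1 * Q c ((z + \<xi>0 *s w) + u *s w') w' \<le> N * h\<^sup>2"
          using R N(2)[of "(z + \<xi>0 *s w) + u *s w'" w'] unfolding nw' by auto
      qed simp
      have nz: "norm (z + a *s w - z) = norm a" for a by (simp add: norm_smult nw)
      from disc_sub_add_quadratic[OF \<open>disc_sub _ (N * h\<^sup>2 / 2)\<close>, of q "z + \<xi>0 *s w" w' z]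
      have sub: "disc_sub (\<lambda>u. ereal (vr (chart_inv c (z + (\<xi>0 + of_real h * u) *s w)) + q * (norm (\<xi>0 + of_real h * u))\<^sup>2)) (N * h\<^sup>2 / 2 - q * h\<^sup>2)"
        unfolding zeq nw' vr nz plus_ereal.simps .
      \<comment> \<open>By maximality the perturbed function is at most \<open>F \<xi>0\<close> plus
        \<open>k\<close> times the logarithm, which is the real part of \<open>H\<close>. The
        principal branch suffices, since the argument has positive real part.\<close>
      define H where "H = (\<lambda>u. of_real (F \<xi>0 + k * ln (norm \<xi>0)) + of_real k * Ln (1 + of_real h * u / \<xi>0))"
      have np: "1 + of_real h * u / \<xi>0 \<notin> \<real>\<^sub>\<le>\<^sub>0" "1 + of_real h * u / \<xi>0 \<noteq> 0" if "norm u \<le> 1" for u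
      proof -
        have "norm (of_real h * u / \<xi>0) = h * norm u / norm \<xi>0" using h(1) by (simp add: norm_mult norm_divide)
        also have "\<dots> \<le> h * 1 / norm \<xi>0" using h(1) that by (intro divide_right_mono mult_left_mono) auto
        also have "\<dots> < 1" using h by (simp add: divide_less_eq)
        finally have "- Re (of_real h * u / \<xi>0) < 1" using complex_Re_le_cmod[of "- (of_real h * u / \<xi>0)"] by (simp only: norm_minus_cancel uminus_complex.sel)
        then have "0 < Re (1 + of_real h * u / \<xi>0)" by (simp only: plus_complex.sel one_complex.sel)
        then show "1 + of_real h * u / \<xi>0 \<notin> \<real>\<^sub>\<le>\<^sub>0" "1 + of_real h * u / \<xi>0 \<noteq> 0"
          using complex_nonpos_Reals_iff by (force, force)
      qed
      have "ereal (vr (chart_inv c (z + (\<xi>0 + of_real h * 0) *s w)) + q * (norm (\<xi>0 + of_real h * 0))\<^sup>2) \<le> ereal (Re (H 0) + (N * h\<^sup>2 / 2 - q * h\<^sup>2))"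
      proof (rule disc_subD[OF sub])
        show "continuous_on (cball 0 1) H" unfolding H_def
          by (intro continuous_intros) (use np \<xi>00 in auto)
        show "H holomorphic_on ball 0 1" unfolding H_def
          by (intro holomorphic_intros) (use np \<xi>00 in auto)
        fix u :: complex assume u: "norm u = 1"
        have n1: "1 + of_real h * u / \<xi>0 = (\<xi>0 + of_real h * u) / \<xi>0" using \<xi>00 by (simp add: field_simps)
        have aS: "\<xi>0 + of_real h * u \<in> S" using ann[of u] u by simp
        then have pos: "0 < norm (\<xi>0 + of_real h * u)" using d(1) unfolding S_def by auto
        have "Re (Ln (1 + of_real h * u / \<xi>0)) = ln (norm (1 + of_real h * u / \<xi>0))" by (rule Re_Ln) (use np(2)[of u] u in simp)
        also have "\<dots> = ln (norm (\<xi>0 + of_real h * u)) - ln (norm \<xi>0)" unfolding n1 norm_divide using pos \<xi>00 by (simp add: ln_div)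
        finally have ReLn: "Re (Ln (1 + of_real h * u / \<xi>0)) = ln (norm (\<xi>0 + of_real h * u)) - ln (norm \<xi>0)" .
        have "Re (H u) = F \<xi>0 + k * ln (norm \<xi>0) + k * Re (Ln (1 + of_real h * u / \<xi>0))" unfolding H_def by simp
        then have "Re (H u) = F \<xi>0 + k * ln (norm (\<xi>0 + of_real h * u))" unfolding ReLn by (simp only: right_diff_distrib)
        then show "ereal (vr (chart_inv c (z + (\<xi>0 + of_real h * u) *s w)) + q * (norm (\<xi>0 + of_real h * u))\<^sup>2) \<le> ereal (Re (H u))"
          using Fmax[OF aS] unfolding F_def[of] e_def by simp
      qed
      then have "vr (chart_inv c (z + \<xi>0 *s w)) + q * (norm \<xi>0)\<^sup>2 \<le> F \<xi>0 + k * ln (norm \<xi>0) + (N * h\<^sup>2 / 2 - q * h\<^sup>2)"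
        unfolding H_def by simp
      \<comment> \<open>\<open>q\<close> exceeds half of the bound for \<open>Q\<close> by 1/2, so
        the inequality at the centre is violated by \<open>h\<^sup>2 / 2\<close>.\<close>
      moreover have "N * h\<^sup>2 / 2 - q * h\<^sup>2 = - (h\<^sup>2 / 2)" unfolding q by (simp add: field_simps)
      moreover have "0 < h\<^sup>2" using h(1) by simp
      ultimately have False unfolding F_def e_def by linarith
      then show ?thesis ..
    qed
  qed
  then have "F (of_real t) \<le> m0 + q * d\<^sup>2 - k * ln d" using Fmax[OF tS] by linarith
  moreover have "F (of_real t) = vr (chart_inv c y) - k * ln t + q * t\<^sup>2" unfolding F_def e_def tw using t(1) by simp
  moreover have "0 \<le> q * t\<^sup>2" using q0 by simp
  moreover have "k * ln (t / d) = k * ln t - k * ln d" using t(1) d(1) by (simp add: ln_div right_diff_distrib)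
  ultimately have "vr (chart_inv c y) \<le> m0 + q * d\<^sup>2 + k * ln (t / d)" by linarith
  then show ?thesis unfolding k_def t_def .
qed

text \<open>\<open>holomorphic_map_on\<close> provides derivatives pointwise, without any bound. The
  transition is bounded near the compact set, and Cauchy estimates along complex lines turn this
  into a bound for the derivatives.\<close>

lemma transition_Lipschitz:
  assumes c: "c \<in> charts" and c': "c' \<in> charts" and E: "compact E" "E \<subseteq> fst c \<inter> fst c'"
  obtains C d where "1 < C" "0 < d" "\<And>x y. x \<in> E \<Longrightarrow> dist (snd c x) y \<le> d \<Longrightarrow> y \<in> snd c ` (fst c \<inter> fst c')"
    "\<And>x y. x \<in> E \<Longrightarrow> dist (snd c x) y \<le> d \<Longrightarrow> dist (snd c' x) (transition c c' y) \<le> C * dist (snd c x) y"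
proof -
  define D where "D = snd c ` (fst c \<inter> fst c')"
  define T where "T = transition c c'"
  have oD: "open D" unfolding D_def by (rule open_chart_image_subset[OF c]) (use chart_topological(1)[OF c] chart_topological(1)[OF c'] in auto)
  have Tder: "\<exists>L. (T has_derivative L) (at y) \<and> (\<forall>a v. L (a *s v) = a *s L v)" if "y \<in> D" for y
  proof -
    obtain x where x: "x \<in> fst c" "x \<in> fst c'" "y = snd c x" using \<open>y \<in> D\<close> unfolding D_def by blast
    obtain L where L: "(transition c c' has_derivative L) (at (snd c x))" "\<And>a v. L (a *s v) = a *s L v"
      by (rule transition_holomorphic[OF c c' x(1,2)]) (rule that, assumption+)
    then show ?thesis unfolding T_def x(3) by blast
  qed
  have Tcont: "continuous_on D T" using Tder has_derivative_continuous continuous_at_imp_continuous_on by meson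
  have cK: "compact (snd c ` E)"
    by (rule compact_continuous_image[OF continuous_on_subset[OF chart_topological(3)[OF c]] E(1)]) (use E(2) in blast)
  have KD: "snd c ` E \<subseteq> D" unfolding D_def using E(2) by blast
  obtain e where e: "0 < e" "(\<Union>x\<in>snd c ` E. ball x e) \<subseteq> D"
    by (rule compact_subset_open_imp_ball_epsilon_subset[OF cK oD KD])
  define K2 where "K2 = {x + u | x u. x \<in> snd c ` E \<and> u \<in> cball 0 (e / 2)}"
  have cK2: "compact K2" unfolding K2_def by (rule compact_sums[OF cK compact_cball])
  have inK2: "snd c x + u \<in> K2" if "x \<in> E" "norm u \<le> e / 2" for x u
    unfolding K2_def using that mem_cball_0[of u "e / 2"] by blast
  have K2D: "y \<in> D" if "y \<in> K2" for y
  proof -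
    obtain x u where "x \<in> snd c ` E" "norm u \<le> e / 2" "y = x + u" using \<open>y \<in> K2\<close> unfolding K2_def mem_cball_0 by blast
    then have "y \<in> ball x e" using e(1) by (simp add: dist_norm)
    then show ?thesis using e(2) \<open>x \<in> snd c ` E\<close> by blast
  qed
  then have "continuous_on K2 T" by (intro continuous_on_subset[OF Tcont]) auto
  then have "bounded (T ` K2)" using cK2 by (intro compact_imp_bounded compact_continuous_image)
  then obtain B where B: "0 < B" "\<And>y. y \<in> K2 \<Longrightarrow> norm (T y) \<le> B" unfolding bounded_pos by auto
  \<comment> \<open>Each component, restricted to a line, is bounded by \<open>B\<close> on discs of
    radius \<open>e / 8\<close>, so its derivative is at most \<open>8 * B / e\<close>; the norm is
    at most the sum over the components.\<close>
  define C0 where "C0 = real CARD('n) * (8 * B / e)"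
  have Lip: "dist (T (snd c x)) (T y) \<le> C0 * dist (snd c x) y" if x: "x \<in> E" and y: "dist (snd c x) y \<le> e / 8" for x y
  proof -
    define w where "w = sgn (y - snd c x)"
    define s where "s = norm (y - snd c x)"
    have nw: "norm w \<le> 1" unfolding w_def by (simp add: norm_sgn)
    have sw: "snd c x + of_real s *s w = y"
    proof -
      have "of_real s *s w = s *\<^sub>R w"
        by (simp only: vec_eq_iff vector_smult_component vector_scaleR_component) (simp add: scaleR_conv_of_real)
      also have "\<dots> = y - snd c x" unfolding s_def w_def by (cases "y = snd c x") (auto simp: sgn_div_norm)
      finally show ?thesis by simp
    qed
    have s: "0 \<le> s" "s \<le> e / 8" using y unfolding s_def by (auto simp: dist_norm norm_minus_commute)
    have comp: "norm (T (snd c x) $ k - T y $ k) \<le> 8 * B / e * s" for k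
    proof -
      define h where "h = (\<lambda>t. T (snd c x + t *s w) $ k)"
      have in2: "snd c x + t *s w \<in> K2" if "norm t \<le> e / 2" for t
      proof (rule inK2[OF x])
        have "norm t * norm w \<le> norm t" using nw by (intro mult_left_le) auto
        then show "norm (t *s w) \<le> e / 2" using that by (simp add: norm_smult)
      qed
      have hd: "\<exists>l. (h has_field_derivative l) (at t)" if "norm t \<le> e / 2" for t
      proof -
        obtain L where L: "(T has_derivative L) (at (snd c x + t *s w))" "\<And>a v. L (a *s v) = a *s L v"
          using Tder[OF K2D[OF in2[OF \<open>norm t \<le> e / 2\<close>]]] by blast
        show ?thesis unfolding h_def using line_field_derivative[OF L] by blast
      qed
      have hol: "h holomorphic_on cball 0 (e / 2)"
      proof (rule holomorphic_onI)
        fix t :: complex assume "t \<in> cball 0 (e / 2)"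
        then have "norm t \<le> e / 2" by simp
        from hd[OF this] obtain l where "(h has_field_derivative l) (at t)" ..
        then have "h field_differentiable at t" unfolding field_differentiable_def by blast
        then show "h field_differentiable at t within cball 0 (e / 2)" by (rule field_differentiable_at_within)
      qed
      have hB: "norm (h t) \<le> B" if "norm t \<le> e / 2" for t
        using B(2)[OF in2[OF that]] Finite_Cartesian_Product.norm_nth_le[of "T (snd c x + t *s w)" k] unfolding h_def by linarith
      have db: "norm (deriv h t) \<le> 8 * B / e" if "norm t \<le> e / 8" for t
      proof -
        have sub: "cball t (e / 8) \<subseteq> cball 0 (e / 2)"
        proof
          fix a assume "a \<in> cball t (e / 8)"
          then have "norm (a - t) \<le> e / 8" by (simp add: dist_norm norm_minus_commute)
          then show "a \<in> cball 0 (e / 2)" using norm_triangle_ineq[of t "a - t"] that e(1) by simp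
        qed
        have "norm ((deriv ^^ 1) h t) \<le> fact 1 * B / (e / 8) ^ 1"
        proof (rule Cauchy_inequality)
          show "h holomorphic_on ball t (e / 8)" by (rule holomorphic_on_subset[OF hol]) (use sub ball_subset_cball in blast)
          show "continuous_on (cball t (e / 8)) h" by (rule continuous_on_subset[OF holomorphic_on_imp_continuous_on[OF hol] sub])
          show "0 < e / 8" using e(1) by simp
          fix a assume "norm (t - a) = e / 8"
          then have "a \<in> cball t (e / 8)" by (simp add: dist_norm)
          then show "norm (h a) \<le> B" using sub by (intro hB) auto
        qed
        then show ?thesis by (simp add: mult.commute)
      qed
      have "norm (h 0 - h (of_real s)) \<le> 8 * B / e * norm (0 - complex_of_real s)"
      proof (rule field_differentiable_bound[of "cball 0 (e / 8)" h "deriv h"])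
        show "(h has_field_derivative deriv h t) (at t within cball 0 (e / 8))" if "t \<in> cball 0 (e / 8)" for t
        proof -
          have "norm t \<le> e / 2" using that e(1) by auto
          from hd[OF this] obtain l where "(h has_field_derivative l) (at t)" ..
          then show ?thesis using DERIV_imp_deriv has_field_derivative_at_within by metis
        qed
        show "norm (deriv h t) \<le> 8 * B / e" if "t \<in> cball 0 (e / 8)" for t using that by (intro db) simp
      qed (use s e(1) in auto)
      then show ?thesis unfolding h_def sw using s(1) by simp
    qed
    have "norm (T (snd c x) - T y) \<le> (\<Sum>k\<in>UNIV. norm ((T (snd c x) - T y) $ k))"
      unfolding norm_vec_def by (rule L2_set_le_sum) simp
    also have "\<dots> \<le> (\<Sum>k\<in>(UNIV::'n set). 8 * B / e * s)" by (rule sum_mono) (use comp in simp)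
    also have "\<dots> = C0 * s" unfolding C0_def by simp
    finally show ?thesis unfolding s_def by (simp add: dist_norm norm_minus_commute)
  qed
  have Tx: "T (snd c x) = snd c' x" if "x \<in> E" for x unfolding T_def transition_def using that E(2) c by auto
  show thesis
  proof (rule that[of "max 2 C0" "e / 8"])
    fix x y assume x: "x \<in> E" and y: "dist (snd c x) y \<le> e / 8"
    have "y \<in> ball (snd c x) e" using y e(1) by simp
    then show "y \<in> snd c ` (fst c \<inter> fst c')" using e(2) x unfolding D_def by blast
    have "C0 * dist (snd c x) y \<le> max 2 C0 * dist (snd c x) y" by (intro mult_right_mono) auto
    then show "dist (snd c' x) (transition c c' y) \<le> max 2 C0 * dist (snd c x) y"
      using Lip[OF x y, unfolded Tx[OF x]] unfolding T_def by linarith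
  qed (use e(1) in auto)
qed

text \<open>Uniform continuity gives an additive error on unit vectors; the lower bound
  \<open>l\<close> of \<open>Q\<close> turns it into a factor, which is compatible with
  homogeneity.\<close>

lemma Q_uniform:
  assumes c: "c \<in> charts" and K: "compact K" "K \<subseteq> chart_image c" and e: "0 < e"
  obtains d where "0 < d" "\<And>z z' w. z \<in> K \<Longrightarrow> z' \<in> K \<Longrightarrow> dist z z' < d \<Longrightarrow> Q c z' w \<le> (1 + e) * Q c z w"
proof -
  obtain l N where l: "0 < l" "\<And>z w. z \<in> K \<Longrightarrow> l * (norm w)\<^sup>2 \<le> Q c z w" using Q_bounds[OF c K] by metis
  let ?S = "K \<times> sphere (0::complex^'n) 1"
  have "uniformly_continuous_on ?S (\<lambda>(z, w). Q c z w)"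
    by (intro compact_uniformly_continuous compact_Times K compact_sphere continuous_on_subset[OF Q_continuous[OF c]]) (use K in auto)
  moreover have "0 < e * l" using e l by simp
  ultimately obtain d where d: "0 < d" "\<And>a b. a \<in> ?S \<Longrightarrow> b \<in> ?S \<Longrightarrow> dist b a < d \<Longrightarrow> dist ((\<lambda>(z, w). Q c z w) b) ((\<lambda>(z, w). Q c z w) a) < e * l"
    unfolding uniformly_continuous_on_def by meson
  show thesis
  proof (rule that[OF d(1)])
    fix z z' w assume z: "z \<in> K" "z' \<in> K" "dist z z' < d"
    show "Q c z' w \<le> (1 + e) * Q c z w"
    proof (cases "w = 0")
      case False
      define u where "u = of_real (1 / norm w) *s w"
      have nu: "norm u = 1" unfolding u_def norm_smult using False by (simp add: norm_divide)
      have wu: "w = of_real (norm w) *s u" unfolding u_def using False by (simp add: vector_smult_assoc)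
      have "dist ((\<lambda>(z, w). Q c z w) (z', u)) ((\<lambda>(z, w). Q c z w) (z, u)) < e * l"
        by (rule d(2)) (use z nu in \<open>auto simp: dist_Pair_Pair dist_commute\<close>)
      then have "Q c z' u \<le> Q c z u + e * l" by (simp add: dist_real_def abs_less_iff)
      also have "e * l \<le> e * Q c z u" using l(2)[OF z(1), of u] nu e by (intro mult_left_mono) auto
      finally have "Q c z' u \<le> (1 + e) * Q c z u" by (simp add: algebra_simps)
      then have "(norm w)\<^sup>2 * Q c z' u \<le> (norm w)\<^sup>2 * ((1 + e) * Q c z u)" by (rule mult_left_mono) simp
      moreover have "Q c y w = (norm w)\<^sup>2 * Q c y u" for y using Q_smult[of c y "of_real (norm w)" u] wu by simp
      ultimately show ?thesis by (simp add: algebra_simps)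
    qed simp
  qed
qed

section \<open>Suprema over coordinate balls\<close>

definition sup_ball :: "('a, 'n) chart \<Rightarrow> real \<Rightarrow> ('a \<Rightarrow> ereal) \<Rightarrow> 'a \<Rightarrow> ereal" where
  "sup_ball c \<delta> v x = (SUP y\<in>cball (snd c x) \<delta>. v (chart_inv c y))"

lemma sup_ball_upper: "y \<in> cball (snd c x) d \<Longrightarrow> v (chart_inv c y) \<le> sup_ball c d v x"
  unfolding sup_ball_def by (rule SUP_upper)

lemma sup_ball_attained:
  assumes c: "c \<in> charts" and v: "wsh \<kappa> v" and d: "0 < d" "cball (snd c x) d \<subseteq> chart_image c"
  obtains y where "y \<in> cball (snd c x) d" "sup_ball c d v x = v (chart_inv c y)"
proof -
  have "usc_on (\<lambda>z. v (chart_inv c z)) (chart_image c)" using v c unfolding wsh_def by (intro usc_chart) auto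
  then have "usc_on (\<lambda>z. v (chart_inv c z)) (cball (snd c x) d)" using d(2) by (rule usc_on_subset)
  moreover have "cball (snd c x) d \<noteq> {}" using d(1) by simp
  ultimately obtain y where y: "y \<in> cball (snd c x) d" "\<forall>z\<in>cball (snd c x) d. v (chart_inv c z) \<le> v (chart_inv c y)"
    using usc_attains_max[OF compact_cball] by blast
  have "sup_ball c d v x \<le> v (chart_inv c y)" unfolding sup_ball_def by (rule SUP_least) (use y(2) in blast)
  then show thesis using that[OF y(1)] sup_ball_upper[OF y(1), of v] by (meson antisym)
qed

lemma cball_in_larger: "z \<in> ball p (3 * r) \<Longrightarrow> d < r \<Longrightarrow> cball z d \<subseteq> ball p (4 * (r::real))"
proof
  fix y assume "z \<in> ball p (3 * r)" "d < r" "y \<in> cball z d"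
  then show "y \<in> ball p (4 * r)" using dist_triangle[of p y z] by simp
qed

text \<open>As the supremum is attained, it is below \<open>t\<close> exactly if the closed ball
  lies in the open sublevel set, and by compactness this is an open condition on the centre.\<close>

lemma sup_ball_usc:
  assumes c: "c \<in> charts" and v: "wsh \<kappa> v" and r: "cball p (4 * r) \<subseteq> chart_image c" and d: "0 < d" "d < r"
  shows "usc_on (sup_ball c d v) {x \<in> fst c. snd c x \<in> ball p (3 * r)}"
  unfolding usc_on_open_iff[OF open_chart_preimage[OF c open_ball]]
proof
  fix t
  define G where "G = {z \<in> chart_image c. v (chart_inv c z) < t}"
  have "usc_on (\<lambda>z. v (chart_inv c z)) (chart_image c)" using v c unfolding wsh_def by (intro usc_chart) auto
  then have oG: "open G" unfolding G_def usc_on_open_iff[OF chart_topological(2)[OF c]] by (rule spec)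
  define Z where "Z = {z \<in> ball p (3 * r). cball z d \<subseteq> G}"
  have oZ: "open Z"
  proof (subst open_subopen, intro ballI)
    fix z assume z: "z \<in> Z"
    obtain e where e: "0 < e" "(\<Union>y\<in>cball z d. ball y e) \<subseteq> G"
      by (rule compact_subset_open_imp_ball_epsilon_subset[OF compact_cball oG]) (use z in \<open>auto simp: Z_def\<close>)
    have cG: "cball z' d \<subseteq> G" if "z' \<in> ball z e" for z'
    proof
      fix y assume y: "y \<in> cball z' d"
      have "y - z' + z \<in> cball z d" using y by (simp add: dist_norm norm_minus_commute)
      moreover have "y \<in> ball (y - z' + z) e" using that by (simp add: dist_norm norm_minus_commute)
      ultimately show "y \<in> G" using e(2) by blast
    qed
    have "ball z e \<inter> ball p (3 * r) \<subseteq> Z" unfolding Z_def using cG by blast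
    moreover have "z \<in> ball z e \<inter> ball p (3 * r)" using z e(1) unfolding Z_def by simp
    ultimately show "\<exists>T. open T \<and> z \<in> T \<and> T \<subseteq> Z" using open_Int[OF open_ball open_ball] by blast
  qed
  have "{x \<in> {x \<in> fst c. snd c x \<in> ball p (3 * r)}. sup_ball c d v x < t} = {x \<in> fst c. snd c x \<in> Z}"
  proof (intro equalityI subsetI)
    fix x assume x: "x \<in> {x \<in> {x \<in> fst c. snd c x \<in> ball p (3 * r)}. sup_ball c d v x < t}"
    have "cball (snd c x) d \<subseteq> ball p (4 * r)" by (rule cball_in_larger) (use x d in auto)
    then have "cball (snd c x) d \<subseteq> chart_image c" using r ball_subset_cball by blast
    moreover have "v (chart_inv c y) < t" if "y \<in> cball (snd c x) d" for y
      using sup_ball_upper[OF that, of v] x by (auto intro: le_less_trans)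
    ultimately show "x \<in> {x \<in> fst c. snd c x \<in> Z}" using x unfolding Z_def G_def by blast
  next
    fix x assume x: "x \<in> {x \<in> fst c. snd c x \<in> Z}"
    then have G: "cball (snd c x) d \<subseteq> G" unfolding Z_def by blast
    then have "cball (snd c x) d \<subseteq> chart_image c" unfolding G_def by blast
    then obtain y where "y \<in> cball (snd c x) d" "sup_ball c d v x = v (chart_inv c y)" by (rule sup_ball_attained[OF c v d(1)])
    then have "sup_ball c d v x < t" using G unfolding G_def by (simp only:) blast
    then show "x \<in> {x \<in> {x \<in> fst c. snd c x \<in> ball p (3 * r)}. sup_ball c d v x < t}" using x unfolding Z_def by blast
  qed
  then show "open {x \<in> {x \<in> fst c. snd c x \<in> ball p (3 * r)}. sup_ball c d v x < t}"
    using open_chart_preimage[OF c oZ] by simp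
qed

text \<open>Near \<open>x\<close> the supremum is bounded from below by the translate of \<open>v\<close> which attains it at \<open>x\<close>.\<close>

lemma sup_ball_wsub:
  assumes c: "c \<in> charts" and v: "wsh 1 v" and r: "cball p (4 * r) \<subseteq> chart_image c" and \<delta>: "0 < \<delta>" "\<delta> < r" "\<delta> < d"
    and d: "\<And>z z' w. z \<in> cball p (4 * r) \<Longrightarrow> z' \<in> cball p (4 * r) \<Longrightarrow> dist z z' < d \<Longrightarrow> Q c z' w \<le> (1 + e) * Q c z w"
    and b: "0 \<le> b" "\<And>z w. z \<in> cball p (4 * r) \<Longrightarrow> 2 * b * (norm w)\<^sup>2 \<le> e * Q c z w"
    and x: "x \<in> fst c" "snd c x \<in> ball p (3 * r)"
  shows "wsub (1 + 2 * e) (\<lambda>x. sup_ball c \<delta> v x - ereal (b * (norm (snd c x - p))\<^sup>2)) x"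
proof -
  define z where "z = snd c x"
  have z: "z \<in> ball p (3 * r)" using x by (simp add: z_def)
  have zr: "cball z \<delta> \<subseteq> ball p (4 * r)" by (rule cball_in_larger[OF z \<delta>(2)])
  then have "cball z \<delta> \<subseteq> chart_image c" using r ball_subset_cball by blast
  then obtain y0 where y0: "y0 \<in> cball z \<delta>" "sup_ball c \<delta> v x = v (chart_inv c y0)"
    by (rule sup_ball_attained[OF c v \<delta>(1), of x, folded z_def]) (rule that)
  \<comment> \<open>The translate of \<open>v\<close> by \<open>h\<close> lies below the supremum
    because \<open>norm h\<close> is at most \<open>\<delta>\<close>, and it agrees with the
    supremum at \<open>z\<close>.\<close>
  define h where "h = y0 - z"
  have h: "norm h \<le> \<delta>" using y0(1) by (simp add: h_def dist_norm norm_minus_commute)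
  have y0in: "dist p y0 < 4 * r" using zr y0(1) by auto
  \<comment> \<open>Keeps the translated disc in the large ball and within \<open>d\<close> of
    \<open>z\<close>, where \<open>Q\<close> has changed by a factor of at most
    \<open>1 + e\<close>, and the original disc in the ball of radius \<open>3 * r\<close>.\<close>
  define e1 where "e1 = min (4 * r - dist p y0) (min (d - \<delta>) (3 * r - dist p z))"
  have e1: "0 < e1" using y0in z \<delta>(3) by (simp add: e1_def)
  have z4: "z \<in> cball p (4 * r)" using z \<delta> by auto
  have "\<exists>k0>0. \<forall>k. 0 < k \<and> k < k0 \<longrightarrow>
     disc_sub (\<lambda>t. sup_ball c \<delta> v (chart_inv c (z + (of_real k * t) *s w)) - ereal (b * (norm (snd c (chart_inv c (z + (of_real k * t) *s w)) - p))\<^sup>2))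
       (k\<^sup>2 * ((1 + 2 * e) * Q c z w + \<eta>) / 2)" if \<eta>: "0 < \<eta>" for w \<eta>
  proof -
    define k0 where "k0 = e1 / (norm w + 1)"
    have k0: "0 < k0" using e1 by (simp add: k0_def add_nonneg_pos)
    show ?thesis
    proof (intro exI[of _ k0] conjI allI impI k0)
      fix k assume k: "0 < k \<and> k < k0"
      have "k * norm w \<le> k * (norm w + 1)" using k by (intro mult_left_mono) auto
      also have "\<dots> < e1" using k unfolding k0_def by (subst (asm) pos_less_divide_eq) (auto simp: add_nonneg_pos)
      finally have kw: "k * norm w < e1" .
      define w' where "w' = of_real k *s w"
      have nw': "norm w' = k * norm w" unfolding w'_def using k by (simp only: norm_smult norm_of_real abs_of_pos)
      have small: "norm (t *s w') < e1" if "norm t \<le> 1" for t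
      proof -
        have "norm t * norm w' \<le> 1 * norm w'" using that by (intro mult_right_mono) auto
        then show ?thesis using kw by (simp add: norm_smult nw')
      qed
      have in4: "y0 + t *s w' \<in> cball p (4 * r)" "dist z (y0 + t *s w') < d" "z + t *s w' \<in> ball p (3 * r)" if "norm t \<le> 1" for t
      proof -
        have s: "norm (t *s w') < 4 * r - dist p y0" "norm (t *s w') < d - \<delta>" "norm (t *s w') < 3 * r - dist p z"
          using small[OF that] unfolding e1_def by simp_all
        have du: "dist u (u + t *s w') = norm (t *s w')" for u by (simp add: dist_norm)
        show "y0 + t *s w' \<in> cball p (4 * r)" using dist_triangle[of p "y0 + t *s w'" y0] s(1) du[of y0] by simp
        show "z + t *s w' \<in> ball p (3 * r)" using dist_triangle[of p "z + t *s w'" z] s(3) du[of z] by simp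
        show "dist z (y0 + t *s w') < d" using dist_triangle[of z "y0 + t *s w'" y0] s(2) du[of y0] y0(1) by simp
      qed
      have "disc_sub (\<lambda>t. v (chart_inv c (y0 + t *s w'))) ((1 + e) * Q c z w' / 2)"
      proof (rule wsh_disc_sub[OF v _ c])
        fix t :: complex assume t: "norm t \<le> 1"
        show "y0 + t *s w' \<in> chart_image c" using in4(1)[OF t] r by blast
        show "1 * Q c (y0 + t *s w') w' \<le> (1 + e) * Q c z w'" using d[OF z4 in4(1)[OF t] in4(2)[OF t], of w'] by simp
      qed simp
      from disc_sub_add_quadratic[OF this, of "- b" z w' p]
      have "disc_sub (\<lambda>t. v (chart_inv c (y0 + t *s w')) + ereal (- b * (norm (z + t *s w' - p))\<^sup>2)) ((1 + e) * Q c z w' / 2 - - b * (norm w')\<^sup>2)" .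
      \<comment> \<open>One \<open>e\<close> accounts for the change of \<open>Q\<close> under the
        translation, the other for the quadratic penalty.\<close>
      moreover have "(1 + e) * Q c z w' / 2 - - b * (norm w')\<^sup>2 \<le> k\<^sup>2 * ((1 + 2 * e) * Q c z w + \<eta>) / 2"
      proof -
        have h: "2 * b * (norm w')\<^sup>2 \<le> e * Q c z w'" by (rule b(2)[OF z4])
        have eq: "(1 + 2 * e) * Q c z w' = (1 + e) * Q c z w' + e * Q c z w'" by (simp add: algebra_simps)
        have Qw: "Q c z w' = k\<^sup>2 * Q c z w" unfolding w'_def Q_smult by simp
        have "(1 + e) * Q c z w' / 2 - - b * (norm w')\<^sup>2 \<le> (1 + 2 * e) * Q c z w' / 2"
          using h unfolding eq add_divide_distrib by linarith
        also have "(1 + 2 * e) * Q c z w' / 2 = (1 + 2 * e) * (k\<^sup>2 * Q c z w) / 2" by (simp only: Qw)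
        also have "(1 + 2 * e) * (k\<^sup>2 * Q c z w) / 2 \<le> (1 + 2 * e) * (k\<^sup>2 * Q c z w) / 2 + k\<^sup>2 * \<eta> / 2" using \<eta> by simp
        also have "\<dots> = k\<^sup>2 * ((1 + 2 * e) * Q c z w + \<eta>) / 2" by (simp add: algebra_simps add_divide_distrib)
        finally show ?thesis .
      qed
      ultimately have "disc_sub (\<lambda>t. v (chart_inv c (y0 + t *s w')) + ereal (- b * (norm (z + t *s w' - p))\<^sup>2)) (k\<^sup>2 * ((1 + 2 * e) * Q c z w + \<eta>) / 2)"
        by (rule disc_sub_mono)
      then show "disc_sub (\<lambda>t. sup_ball c \<delta> v (chart_inv c (z + (of_real k * t) *s w)) - ereal (b * (norm (snd c (chart_inv c (z + (of_real k * t) *s w)) - p))\<^sup>2))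
       (k\<^sup>2 * ((1 + 2 * e) * Q c z w + \<eta>) / 2)"
      proof (rule disc_sub_touching)
        have xz: "chart_inv c z = x" unfolding z_def using c x by simp
        show "v (chart_inv c (y0 + 0 *s w')) + ereal (- b * (norm (z + 0 *s w' - p))\<^sup>2) =
          sup_ball c \<delta> v (chart_inv c (z + (of_real k * 0) *s w)) - ereal (b * (norm (snd c (chart_inv c (z + (of_real k * 0) *s w)) - p))\<^sup>2)"
          by (simp add: xz y0(2) minus_ereal_def z_def[symmetric])
        fix t :: complex assume "norm t = 1"
        then have t: "norm t \<le> 1" by simp
        have zeq: "z + (of_real k * t) *s w = z + t *s w'" unfolding w'_def by (simp add: vector_smult_assoc mult.commute)
        have "z + t *s w' \<in> chart_image c" using in4(3)[OF t] r \<delta> by (auto simp: subset_eq)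
        then have sn: "snd c (chart_inv c (z + t *s w')) = z + t *s w'" by (rule chart_inv_right)
        have "v (chart_inv c (y0 + t *s w')) \<le> sup_ball c \<delta> v (chart_inv c (z + t *s w'))"
          by (rule sup_ball_upper) (use h in \<open>simp add: sn dist_norm h_def norm_minus_commute\<close>)
        then show "v (chart_inv c (y0 + t *s w')) + ereal (- b * (norm (z + t *s w' - p))\<^sup>2) \<le>
          sup_ball c \<delta> v (chart_inv c (z + (of_real k * t) *s w)) - ereal (b * (norm (snd c (chart_inv c (z + (of_real k * t) *s w)) - p))\<^sup>2)"
          unfolding zeq sn minus_ereal_def by (intro add_mono) auto
      qed
    qed
  qed
  then show ?thesis unfolding wsub_def z_def using c x by blast
qed

text \<open>In another chart the ball of radius \<open>\<delta>\<close> is contained in one of radius \<open>C \<delta>\<close>. By the three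
  circles theorem the factor \<open>C\<close> is harmless as \<open>ln C / ln (R / \<delta>)\<close> tends to 0 with \<open>\<delta>\<close>.\<close>

lemma sup_ball_compare:
  assumes c: "c \<in> charts" and r: "cball p (4 * r) \<subseteq> chart_image c"
    and c': "c' \<in> charts" and r': "0 < r'" "cball p' (4 * r') \<subseteq> chart_image c'" and r0: "0 < r" and e: "0 < e" and mM: "m \<le> M"
  obtains \<delta>0 where "0 < \<delta>0" "\<And>\<delta> v x. 0 < \<delta> \<Longrightarrow> \<delta> < \<delta>0 \<Longrightarrow> wsh 1 v \<Longrightarrow> (\<And>x. ereal m \<le> v x \<and> v x \<le> ereal M) \<Longrightarrow>
     x \<in> fst c \<Longrightarrow> snd c x \<in> ball p (3 * r) \<Longrightarrow> x \<in> fst c' \<Longrightarrow> snd c' x \<in> ball p' r' \<Longrightarrow>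
     sup_ball c \<delta> v x \<le> sup_ball c' \<delta> v x + ereal e"
proof -
  define E where "E = {x \<in> fst c. snd c x \<in> cball p (3 * r)} \<inter> {x \<in> fst c'. snd c' x \<in> cball p' r'}"
  have "cball p (3 * r) \<subseteq> chart_image c" "cball p' r' \<subseteq> chart_image c'" using r r' r0 by (auto simp: subset_eq)
  then have "closed E" unfolding E_def using chart_cball_preimage(1)[OF c] chart_cball_preimage(1)[OF c'] by (intro closed_Int) blast+
  then have cE: "compact E" using compact_Int_closed[OF compact_UNIV, of E] by simp
  have Efst: "E \<subseteq> fst c \<inter> fst c'" unfolding E_def by blast
  obtain C d where C: "1 < C" "0 < d" and dom: "\<And>x y. x \<in> E \<Longrightarrow> dist (snd c x) y \<le> d \<Longrightarrow> y \<in> snd c ` (fst c \<inter> fst c')"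
    and Lip: "\<And>x y. x \<in> E \<Longrightarrow> dist (snd c x) y \<le> d \<Longrightarrow> dist (snd c' x) (transition c c' y) \<le> C * dist (snd c x) y"
    by (rule transition_Lipschitz[OF c c' cE Efst]) (rule that, assumption+)
  obtain l N where N: "0 \<le> N" "\<And>z w. z \<in> cball p' (4 * r') \<Longrightarrow> Q c' z w \<le> N * (norm w)\<^sup>2"
    using Q_bounds[OF c' compact_cball r'(2)] by metis
  define q where "q = (N + 1) / 2"
  have q0: "0 < q" using N(1) by (simp add: q_def add_nonneg_pos)
  define S where "S = M - m + q * r'\<^sup>2"
  have S0: "0 \<le> S" unfolding S_def using mM q0 by simp
  \<comment> \<open>A lower bound for \<open>ln (r' / \<delta>)\<close> which brings the logarithmic
    term of the three circles estimate below \<open>e / 2\<close>.\<close>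
  define L where "L = max 1 (2 * S * ln C / e)"
  \<comment> \<open>In turn: the range of the Lipschitz estimate, two bounds giving
    \<open>q * \<delta>\<^sup>2 \<le> e / 2\<close>, room for the distorted ball in radius
    \<open>r'\<close>, and the bound \<open>L\<close>.\<close>
  define \<delta>0 where "\<delta>0 = min (min d 1) (min (e / (2 * q)) (min (r' / C) (r' / exp L)))"
  show thesis
  proof (rule that[of \<delta>0])
    show "0 < \<delta>0" unfolding \<delta>0_def using C e q0 r' by simp
    fix \<delta> v x assume \<delta>: "0 < \<delta>" "\<delta> < \<delta>0" and v: "wsh 1 v" and vb: "\<And>x. ereal m \<le> v x \<and> v x \<le> ereal M"
      and x: "x \<in> fst c" "snd c x \<in> ball p (3 * r)" "x \<in> fst c'" "snd c' x \<in> ball p' r'"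
    have d1: "\<delta> < d" "\<delta> < 1" "\<delta> < e / (2 * q)" "\<delta> < r' / C" "\<delta> < r' / exp L" using \<delta>(2) unfolding \<delta>0_def by simp_all
    have xE: "x \<in> E" unfolding E_def using x by auto
    define z' where "z' = snd c' x"
    have z': "z' \<in> ball p' r'" using x by (simp add: z'_def)
    have C\<delta>: "C * \<delta> < r'" using d1(4) C by (simp add: less_divide_eq mult.commute)
    have "1 * \<delta> < C * \<delta>" using C \<delta> by (intro mult_strict_right_mono) auto
    then have \<delta>r: "\<delta> < r'" using C\<delta> by simp
    have zin: "cball z' r' \<subseteq> cball p' (4 * r')"
    proof
      fix y assume "y \<in> cball z' r'"
      then show "y \<in> cball p' (4 * r')" using dist_triangle[of p' y z'] z' r'(1) by simp
    qed
    define vr where "vr = (\<lambda>x. real_of_ereal (v x))"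
    have vr: "v x = ereal (vr x)" for x using vb[of x] unfolding vr_def by (cases "v x") auto
    have vrM: "m \<le> vr x" "vr x \<le> M" for x using vb[of x] unfolding vr by auto
    have "cball z' \<delta> \<subseteq> chart_image c'" using zin r'(2) \<delta>r by (auto simp: subset_eq)
    then obtain y0 where y0: "y0 \<in> cball z' \<delta>" "sup_ball c' \<delta> v x = v (chart_inv c' y0)"
      by (rule sup_ball_attained[OF c' v \<delta>(1), of x, folded z'_def]) (rule that)
    define a where "a = vr (chart_inv c' y0)"
    have sa: "sup_ball c' \<delta> v x = ereal a" using y0(2) unfolding a_def vr .
    have va: "vr (chart_inv c' y) \<le> a" if "y \<in> cball z' \<delta>" for y
      using sup_ball_upper[of y c' x \<delta> v] that unfolding sa z'_def vr by simp
    have "vr (chart_inv c y) \<le> a + e" if y: "y \<in> cball (snd c x) \<delta>" for y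
    proof -
      have yd: "dist (snd c x) y \<le> d" using y d1(1) by simp
      define y' where "y' = transition c c' y"
      have "dist z' y' \<le> C * dist (snd c x) y" unfolding z'_def y'_def by (rule Lip[OF xE yd])
      also have "\<dots> \<le> C * \<delta>" using y C by (intro mult_left_mono) auto
      finally have dy: "dist z' y' \<le> C * \<delta>" .
      obtain x1 where x1: "x1 \<in> fst c" "x1 \<in> fst c'" "y = snd c x1" using dom[OF xE yd] by blast
      have inv: "chart_inv c y = chart_inv c' y'" unfolding y'_def transition_def x1(3) using x1 c c' by simp
      have "vr (chart_inv c' y') \<le> a + e"
      proof (cases "dist z' y' \<le> \<delta>")
        case True
        then have "vr (chart_inv c' y') \<le> a" by (intro va) simp
        then show ?thesis using e by simp
      next
        case False
        have aM: "m \<le> a" "a \<le> M" unfolding a_def using vrM by auto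
        have "vr (chart_inv c' y') \<le> a + q * \<delta>\<^sup>2 + (M - a + q * r'\<^sup>2) / ln (r' / \<delta>) * ln (dist z' y' / \<delta>)"
        proof (rule three_circles[OF c' v vr \<delta>(1) \<delta>r])
          show "cball z' r' \<subseteq> chart_image c'" using zin r'(2) by blast
          show "Q c' y w \<le> N * (norm w)\<^sup>2" if "y \<in> cball z' r'" for y w using N(2) zin that by blast
        qed (use N(1) vrM va aM False dy C\<delta> q_def in auto)
        moreover have "q * \<delta>\<^sup>2 \<le> e / 2"
        proof -
          have "\<delta>\<^sup>2 \<le> \<delta> * 1" unfolding power2_eq_square using \<delta> d1(2) by (intro mult_left_mono) auto
          then have "q * \<delta>\<^sup>2 \<le> q * \<delta>" using q0 by simp
          also have "\<dots> \<le> e / 2" using d1(3) q0 by (simp add: field_simps)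
          finally show ?thesis .
        qed
        moreover have "(M - a + q * r'\<^sup>2) / ln (r' / \<delta>) * ln (dist z' y' / \<delta>) \<le> e / 2"
        proof -
          have "exp L \<le> r' / \<delta>" using d1(5) \<delta>(1) by (simp add: field_simps)
          then have "ln (exp L) \<le> ln (r' / \<delta>)" by (subst ln_le_cancel_iff) (use \<delta> r'(1) in auto)
          then have Ll: "L \<le> ln (r' / \<delta>)" by simp
          have L1: "1 \<le> L" unfolding L_def by simp
          have num: "0 \<le> M - a + q * r'\<^sup>2" "M - a + q * r'\<^sup>2 \<le> S" unfolding S_def using aM q0 by simp_all
          have "dist z' y' / \<delta> \<le> C" using dy \<delta>(1) by (simp add: divide_le_eq)
          moreover have dp: "1 < dist z' y' / \<delta>" using False \<delta>(1) by simp
          ultimately have lC: "ln (dist z' y' / \<delta>) \<le> ln C" by (subst ln_le_cancel_iff) (use C in auto)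
          have l0: "0 \<le> ln (dist z' y' / \<delta>)" using dp by simp
          have "(M - a + q * r'\<^sup>2) / ln (r' / \<delta>) \<le> S / L" using num Ll L1 by (intro frac_le) auto
          then have "(M - a + q * r'\<^sup>2) / ln (r' / \<delta>) * ln (dist z' y' / \<delta>) \<le> S / L * ln C"
            using lC l0 S0 L1 by (intro mult_mono) auto
          also have "\<dots> \<le> e / 2"
          proof -
            have "2 * S * ln C / e \<le> L" unfolding L_def by simp
            then have "2 * S * ln C \<le> L * e" using e by (simp add: divide_le_eq)
            then show ?thesis using L1 by (simp add: field_simps)
          qed
          finally show ?thesis .
        qed
        ultimately show ?thesis by linarith
      qed
      then show ?thesis unfolding inv .
    qed
    then show "sup_ball c \<delta> v x \<le> sup_ball c' \<delta> v x + ereal e" unfolding sa unfolding sup_ball_def vr by (intro SUP_least) simp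
  qed
qed

text \<open>Nearness on the manifold is expressed by a neighbourhood \<open>W\<close> of the
  diagonal, as no metric is fixed on it; over a compact ball it contains all pairs at some small
  coordinate distance.\<close>

lemma entourage_in_chart:
  fixes W :: "('a \<times> 'a) set"
  assumes c: "c \<in> charts" and r: "cball p r \<subseteq> chart_image c" and W: "open W" "\<And>x. (x, x) \<in> W"
  obtains e where "0 < e" "\<And>z y. z \<in> cball p r \<Longrightarrow> dist z y \<le> e \<Longrightarrow> (chart_inv c z, chart_inv c y) \<in> W"
proof -
  define P where "P = (chart_image c \<times> chart_image c) \<inter> (\<lambda>x. (chart_inv c (fst x), chart_inv c (snd x))) -` W"
  have "continuous_on (chart_image c \<times> chart_image c) (\<lambda>x. (chart_inv c (fst x), chart_inv c (snd x)))"
    by (intro continuous_on_Pair continuous_on_compose2[OF chart_topological(4)[OF c]] continuous_on_fst continuous_on_snd continuous_on_id) auto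
  then have oP: "open P" unfolding P_def
    by (rule continuous_open_preimage[OF _ open_Times[OF chart_topological(2)[OF c] chart_topological(2)[OF c]] W(1)])
  have "compact ((\<lambda>z. (z, z)) ` cball p r)" by (intro compact_continuous_image continuous_intros compact_cball)
  moreover have "(\<lambda>z. (z, z)) ` cball p r \<subseteq> P" unfolding P_def using r W(2) by auto
  ultimately obtain e where e: "0 < e" "(\<Union>x\<in>(\<lambda>z. (z, z)) ` cball p r. ball x e) \<subseteq> P"
    by (rule compact_subset_open_imp_ball_epsilon_subset[OF _ oP])
  show thesis
  proof (rule that[of "e / 2"])
    fix z y assume z: "z \<in> cball p r" and y: "dist z y \<le> e / 2"
    have "dist (z, z) (z, y) = dist z y" by (simp add: dist_Pair_Pair)
    then have "(z, y) \<in> ball (z, z) e" using y e(1) by simp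
    then have "(z, y) \<in> P" using e(2) z by blast
    then show "(chart_inv c z, chart_inv c y) \<in> W" unfolding P_def by simp
  qed (use e(1) in simp)
qed

text \<open>The regularization is the maximum over a finite atlas of the suprema over small coordinate
  balls. The penalties \<open>\<eta> |z - p|\<^sup>2 / r\<^sup>2\<close> make the maximum insensitive to the boundaries of the
  charts, since suprema taken in different charts differ by at most \<open>2 \<eta>\<close>.\<close>

lemma regularize:
  fixes W :: "('a \<times> 'a) set"
  assumes mM: "m \<le> M" and \<epsilon>: "0 < \<epsilon>" and W: "open W" "\<And>x. (x, x) \<in> W"
  obtains O1 where "open O1" "x0 \<in> O1" "\<And>v. wsh 1 v \<Longrightarrow> (\<And>x. ereal m \<le> v x \<and> v x \<le> ereal M) \<Longrightarrow>
     \<exists>u\<in>PSH A g. (\<forall>x. \<exists>y. (x, y) \<in> W \<and> u x \<le> v y + ereal \<epsilon>) \<and> (\<forall>x\<in>O1. \<forall>y\<in>O1. v y \<le> u x + ereal \<epsilon>)"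
proof -
  have "\<forall>i. \<exists>c r. c \<in> charts \<and> i \<in> fst c \<and> 0 < r \<and> cball (snd c i) (4 * r) \<subseteq> chart_image c"
  proof
    fix i
    obtain c where c: "c \<in> charts" "i \<in> fst c" by (rule chart_at)
    obtain R where R: "0 < R" "cball (snd c i) R \<subseteq> chart_image c" by (rule chart_ball[OF c]) (rule that, assumption+)
    show "\<exists>c r. c \<in> charts \<and> i \<in> fst c \<and> 0 < r \<and> cball (snd c i) (4 * r) \<subseteq> chart_image c"
      by (rule exI[of _ c], rule exI[of _ "R / 4"]) (use c R in simp)
  qed
  then obtain c r where cr: "\<And>i. c i \<in> charts" "\<And>i. i \<in> fst (c i)" "\<And>i. 0 < r i" "\<And>i. cball (snd (c i) i) (4 * r i) \<subseteq> chart_image (c i)"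
    by metis
  define p where "p = (\<lambda>i. snd (c i) i)"
  have rc: "cball (p i) (4 * r i) \<subseteq> chart_image (c i)" for i unfolding p_def by (rule cr(4))
  define D where "D = (\<lambda>i h. {x \<in> fst (c i). snd (c i) x \<in> ball (p i) h})"
  have oD: "open (D i h)" for i h unfolding D_def by (rule open_chart_preimage[OF cr(1) open_ball])
  have iD: "i \<in> D i (r i)" for i unfolding D_def p_def using cr(2,3) by simp
  obtain I where I: "finite I" "UNIV \<subseteq> (\<Union>i\<in>I. D i (r i))"
    by (rule compactE_image[OF compact_UNIV, of UNIV "\<lambda>i. D i (r i)"]) (use oD iD in auto)
  have "\<forall>i. \<exists>l>0. \<forall>z\<in>cball (p i) (4 * r i). \<forall>w. l * (norm w)\<^sup>2 \<le> Q (c i) z w"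
    using Q_bounds[OF cr(1) compact_cball rc] by metis
  then obtain l where l: "\<And>i. 0 < l i" "\<And>i z w. z \<in> cball (p i) (4 * r i) \<Longrightarrow> l i * (norm w)\<^sup>2 \<le> Q (c i) z w" by metis
  \<comment> \<open>A bound for the modulus of the regularization, which lies between
    \<open>m - 1\<close> and \<open>M\<close>. The final scaling then changes it by at most
    \<open>2 * \<epsilon>1 * S = \<epsilon> / 2\<close>.\<close>
  define S where "S = max \<bar>m\<bar> \<bar>M\<bar> + 1"
  have S: "0 < S" unfolding S_def by simp
  define \<epsilon>1 where "\<epsilon>1 = \<epsilon> / (4 * S)"
  have \<epsilon>1: "0 < \<epsilon>1" "2 * \<epsilon>1 * S = \<epsilon> / 2" unfolding \<epsilon>1_def using \<epsilon> S by simp_all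
  \<comment> \<open>So small that the penalties are paid for by
    \<open>\<epsilon>1 * \<omega>\<close> in every chart, and that they fit into the remaining
    \<open>\<epsilon> / 2\<close>.\<close>
  define \<eta> where "\<eta> = Min (insert (min 1 (\<epsilon> / 2)) ((\<lambda>i. \<epsilon>1 * l i * (r i)\<^sup>2 / 2) ` I))"
  have \<eta>0: "0 < \<eta>" unfolding \<eta>_def using I(1) \<epsilon> \<epsilon>1 l(1) cr(3) by (subst Min_gr_iff) (auto simp: less_imp_neq[symmetric])
  have "\<eta> \<le> min 1 (\<epsilon> / 2)" unfolding \<eta>_def using I(1) by (intro Min_le) auto
  then have \<eta>1: "\<eta> \<le> 1" "\<eta> \<le> \<epsilon> / 2" by simp_all
  have \<eta>l: "\<eta> \<le> \<epsilon>1 * l i * (r i)\<^sup>2 / 2" if "i \<in> I" for i unfolding \<eta>_def using I(1) that by (intro Min_le) auto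
  define b where "b = (\<lambda>i. \<eta> / (r i)\<^sup>2)"
  have rsq: "0 < (r i)\<^sup>2" for i using cr(3)[of i] by simp
  have b0: "0 \<le> b i" for i unfolding b_def using \<eta>0 by simp
  have bl: "2 * b i * (norm w)\<^sup>2 \<le> \<epsilon>1 * Q (c i) z w" if "i \<in> I" "z \<in> cball (p i) (4 * r i)" for i z w
  proof -
    have "2 * b i \<le> \<epsilon>1 * l i" unfolding b_def using \<eta>l[OF that(1)] rsq[of i] by (simp add: field_simps)
    then have "2 * b i * (norm w)\<^sup>2 \<le> \<epsilon>1 * l i * (norm w)\<^sup>2" by (rule mult_right_mono) simp
    also have "\<dots> = \<epsilon>1 * (l i * (norm w)\<^sup>2)" by simp
    also have "\<dots> \<le> \<epsilon>1 * Q (c i) z w" using l(2)[OF that(2)] \<epsilon>1(1) by (intro mult_left_mono) auto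
    finally show ?thesis .
  qed
  have "\<exists>d>0. \<forall>z z' w. z \<in> cball (p i) (4 * r i) \<longrightarrow> z' \<in> cball (p i) (4 * r i) \<longrightarrow> dist z z' < d \<longrightarrow> Q (c i) z' w \<le> (1 + \<epsilon>1) * Q (c i) z w" for i
    by (rule Q_uniform[OF cr(1) compact_cball rc \<epsilon>1(1)]) blast
  then have "\<forall>i. \<exists>d>0. \<forall>z z' w. z \<in> cball (p i) (4 * r i) \<longrightarrow> z' \<in> cball (p i) (4 * r i) \<longrightarrow> dist z z' < d \<longrightarrow> Q (c i) z' w \<le> (1 + \<epsilon>1) * Q (c i) z w" ..
  then obtain d where d: "\<And>i. 0 < d i"
    "\<And>i z z' w. z \<in> cball (p i) (4 * r i) \<Longrightarrow> z' \<in> cball (p i) (4 * r i) \<Longrightarrow> dist z z' < d i \<Longrightarrow> Q (c i) z' w \<le> (1 + \<epsilon>1) * Q (c i) z w"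
    by metis
  have "\<exists>e>0. \<forall>z y. z \<in> cball (p i) (2 * r i) \<longrightarrow> dist z y \<le> e \<longrightarrow> (chart_inv (c i) z, chart_inv (c i) y) \<in> W" for i
  proof -
    have "cball (p i) (2 * r i) \<subseteq> cball (p i) (4 * r i)" using cr(3)[of i] by (intro subset_cball) simp
    then have sub: "cball (p i) (2 * r i) \<subseteq> chart_image (c i)" using rc by blast
    show ?thesis
    proof (rule entourage_in_chart[OF cr(1) sub W], goal_cases)
      case (1 e)
      show ?case by (intro exI[of _ e] conjI allI impI 1(1)) (rule 1(2), assumption+)
    qed
  qed
  then have "\<forall>i. \<exists>e>0. \<forall>z y. z \<in> cball (p i) (2 * r i) \<longrightarrow> dist z y \<le> e \<longrightarrow> (chart_inv (c i) z, chart_inv (c i) y) \<in> W" ..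
  then obtain e where e: "\<And>i. 0 < e i" "\<And>i z y. z \<in> cball (p i) (2 * r i) \<Longrightarrow> dist z y \<le> e i \<Longrightarrow> (chart_inv (c i) z, chart_inv (c i) y) \<in> W"
    by metis
  have "\<exists>\<delta>0>0. \<forall>\<delta> v x. 0 < \<delta> \<longrightarrow> \<delta> < \<delta>0 \<longrightarrow> wsh 1 v \<longrightarrow> (\<forall>x. ereal m \<le> v x \<and> v x \<le> ereal M) \<longrightarrow>
     x \<in> D i (3 * r i) \<longrightarrow> x \<in> D j (r j) \<longrightarrow> sup_ball (c i) \<delta> v x \<le> sup_ball (c j) \<delta> v x + ereal (2 * \<eta>)" for i j
  proof (rule sup_ball_compare[OF cr(1) rc cr(1) cr(3) rc cr(3) _ mM, of "2 * \<eta>" i j], goal_cases)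
    case (2 \<delta>0)
    show ?case
    proof (rule exI[of _ \<delta>0], intro conjI 2(1) allI impI)
      fix \<delta> v x assume a: "0 < \<delta>" "\<delta> < \<delta>0" "wsh 1 v" "\<forall>x. ereal m \<le> v x \<and> v x \<le> ereal M" "x \<in> D i (3 * r i)" "x \<in> D j (r j)"
      show "sup_ball (c i) \<delta> v x \<le> sup_ball (c j) \<delta> v x + ereal (2 * \<eta>)"
        by (rule 2(2)[OF a(1,2,3) a(4)[rule_format]]) (use a(5,6) in \<open>auto simp: D_def\<close>)
    qed
  qed (use \<eta>0 in simp)
  then have "\<forall>i j. \<exists>\<delta>0>0. \<forall>\<delta> v x. 0 < \<delta> \<longrightarrow> \<delta> < \<delta>0 \<longrightarrow> wsh 1 v \<longrightarrow> (\<forall>x. ereal m \<le> v x \<and> v x \<le> ereal M) \<longrightarrow>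
     x \<in> D i (3 * r i) \<longrightarrow> x \<in> D j (r j) \<longrightarrow> sup_ball (c i) \<delta> v x \<le> sup_ball (c j) \<delta> v x + ereal (2 * \<eta>)" by blast
  then obtain \<delta>0 where \<delta>0: "\<And>i j. 0 < \<delta>0 i j" "\<And>i j. \<forall>\<delta> v x. 0 < \<delta> \<longrightarrow> \<delta> < \<delta>0 i j \<longrightarrow> wsh 1 v \<longrightarrow> (\<forall>x. ereal m \<le> v x \<and> v x \<le> ereal M) \<longrightarrow>
     x \<in> D i (3 * r i) \<longrightarrow> x \<in> D j (r j) \<longrightarrow> sup_ball (c i) \<delta> v x \<le> sup_ball (c j) \<delta> v x + ereal (2 * \<eta>)"
    by (metis (no_types))
  define X where "X = insert 1 (r ` I \<union> d ` I \<union> e ` I \<union> (\<lambda>(i, j). \<delta>0 i j) ` (I \<times> I))"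
  have X: "finite X" "\<And>x. x \<in> X \<Longrightarrow> 0 < x" unfolding X_def using I(1) cr(3) d(1) e(1) \<delta>0(1) by auto
  define \<delta> where "\<delta> = Min X / 2"
  have "0 < Min X" using X by (subst Min_gr_iff) (auto simp: X_def)
  then have \<delta>: "0 < \<delta>" "\<And>x. x \<in> X \<Longrightarrow> \<delta> < x" unfolding \<delta>_def using Min_le[OF X(1)] by fastforce+
  have \<delta>I: "\<delta> < r i" "\<delta> < d i" "\<delta> \<le> e i" if "i \<in> I" for i
    using \<delta>(2)[of "r i"] \<delta>(2)[of "d i"] \<delta>(2)[of "e i"] that unfolding X_def by simp_all
  have \<delta>IJ: "\<delta> < \<delta>0 i j" if "i \<in> I" "j \<in> I" for i j by (rule \<delta>(2)) (use that in \<open>auto simp: X_def\<close>)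
  obtain i0 where i0: "i0 \<in> I" "x0 \<in> D i0 (r i0)" using I(2) by blast
  \<comment> \<open>Two points of \<open>O1\<close> are within \<open>\<delta>\<close> of each other
    in the chart \<open>c i0\<close>, so the supremum taken at one of them sees the value at the
    other.\<close>
  define O1 where "O1 = D i0 (r i0) \<inter> {x \<in> fst (c i0). snd (c i0) x \<in> ball (snd (c i0) x0) (\<delta> / 2)}"
  have oO1: "open O1" unfolding O1_def by (intro open_Int oD open_chart_preimage[OF cr(1) open_ball])
  have x0O1: "x0 \<in> O1" using i0 \<delta>(1) unfolding O1_def D_def by simp
  have "\<exists>u\<in>PSH A g. (\<forall>x. \<exists>y. (x, y) \<in> W \<and> u x \<le> v y + ereal \<epsilon>) \<and> (\<forall>x\<in>O1. \<forall>y\<in>O1. v y \<le> u x + ereal \<epsilon>)"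
    if v: "wsh 1 v" and vb: "\<And>x. ereal m \<le> v x \<and> v x \<le> ereal M" for v
  proof -
    let ?s = "\<lambda>i x. sup_ball (c i) \<delta> v x"
    have Dmono: "h \<le> h' \<Longrightarrow> D i h \<subseteq> D i h'" for i h h' unfolding D_def by auto
    have att: "\<exists>y\<in>cball (snd (c i) x) \<delta>. ?s i x = v (chart_inv (c i) y)" if "i \<in> I" "x \<in> D i (3 * r i)" for i x
    proof -
      have "cball (snd (c i) x) \<delta> \<subseteq> ball (p i) (4 * r i)" by (rule cball_in_larger) (use that \<delta>I in \<open>auto simp: D_def\<close>)
      then have "cball (snd (c i) x) \<delta> \<subseteq> chart_image (c i)" using rc ball_subset_cball by blast
      from sup_ball_attained[OF cr(1) v \<delta>(1) this] show ?thesis by metis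
    qed
    define sr where "sr = (\<lambda>i x. real_of_ereal (?s i x))"
    have sr: "?s i x = ereal (sr i x)" "m \<le> sr i x" "sr i x \<le> M" if ix: "i \<in> I" "x \<in> D i (3 * r i)" for i x
    proof -
      obtain y where y: "?s i x = v (chart_inv (c i) y)" using att[OF ix] by blast
      have "ereal m \<le> ?s i x" "?s i x \<le> ereal M" unfolding y using vb by blast+
      then show "?s i x = ereal (sr i x)" "m \<le> sr i x" "sr i x \<le> M" unfolding sr_def by (cases "?s i x"; simp)+
    qed
    \<comment> \<open>The penalty is at most \<open>\<eta>\<close> on the inner ball of radius
      \<open>r i\<close> and at least \<open>4 * \<eta>\<close> outside of radius
      \<open>2 * r i\<close>.\<close>
    define pen where "pen = (\<lambda>i x. b i * (norm (snd (c i) x - p i))\<^sup>2)"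
    have pen0: "0 \<le> pen i x" for i x unfolding pen_def using b0 by simp
    have pen1: "pen i x \<le> \<eta>" if "x \<in> D i (r i)" for i x
    proof -
      have "norm (snd (c i) x - p i) \<le> r i" using that by (simp add: D_def dist_norm norm_minus_commute)
      then have "b i * (norm (snd (c i) x - p i))\<^sup>2 \<le> b i * (r i)\<^sup>2" using b0 by (intro mult_left_mono power_mono) auto
      then show ?thesis unfolding pen_def b_def using rsq[of i] by simp
    qed
    have pen4: "4 * \<eta> \<le> pen i x" if "x \<in> fst (c i)" "x \<notin> D i (2 * r i)" for i x
    proof -
      have "2 * r i \<le> norm (snd (c i) x - p i)" using that by (simp add: D_def dist_norm norm_minus_commute)
      then have "b i * (2 * r i)\<^sup>2 \<le> b i * (norm (snd (c i) x - p i))\<^sup>2" using b0 cr(3)[of i] by (intro mult_left_mono power_mono) auto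
      then show ?thesis unfolding pen_def b_def using rsq[of i] by (simp add: power_mult_distrib)
    qed
    define tm where "tm = (\<lambda>i x. sr i x - pen i x)"
    define Ax where "Ax = (\<lambda>x. {i \<in> I. x \<in> D i (2 * r i)})"
    define u where "u = (\<lambda>x. Max ((\<lambda>i. tm i x) ` Ax x))"
    have D23: "D i (2 * r i) \<subseteq> D i (3 * r i)" and D12: "D i (r i) \<subseteq> D i (2 * r i)" for i
      using cr(3)[of i] by (intro Dmono, simp)+
    have cov: "\<exists>j\<in>I. x \<in> D j (r j)" for x using I(2) by blast
    have finA: "finite (Ax x)" and neA: "Ax x \<noteq> {}" for x
      using I(1) cov[of x] D12 unfolding Ax_def by auto
    have u_ge: "tm i x \<le> u x" if "i \<in> Ax x" for i x unfolding u_def using finA that by (intro Max_ge) auto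
    have u_in: "\<exists>i\<in>Ax x. u x = tm i x" for x
    proof -
      have "u x \<in> (\<lambda>i. tm i x) ` Ax x" unfolding u_def by (rule Max_in) (use finA neA in auto)
      then show ?thesis by blast
    qed
    \<comment> \<open>The maximum runs over a set of indices that jumps. Between the radii
      \<open>2 * r i\<close> and \<open>3 * r i\<close> a chart with \<open>x\<close> in its inner
      ball wins: the comparison costs \<open>2 * \<eta>\<close>, its own penalty at most
      \<open>\<eta>\<close>, against \<open>4 * \<eta>\<close>. So no term is noticed when it enters
      or leaves.\<close>
    have dom: "tm i x \<le> u x" if ix: "i \<in> I" "x \<in> D i (3 * r i)" for i x
    proof (cases "x \<in> D i (2 * r i)")
      case True
      then show ?thesis using ix by (intro u_ge) (simp add: Ax_def)
    next
      case False
      obtain j where j: "j \<in> I" "x \<in> D j (r j)" using cov by blast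
      have j3: "x \<in> D j (3 * r j)" using j D12 D23 by blast
      have "?s i x \<le> ?s j x + ereal (2 * \<eta>)"
        using \<delta>0(2)[of i j, rule_format, OF \<delta>(1) \<delta>IJ[OF ix(1) j(1)] v] vb ix(2) j(2) by blast
      then have "sr i x \<le> sr j x + 2 * \<eta>" unfolding sr(1)[OF ix] sr(1)[OF j(1) j3] by simp
      moreover have "4 * \<eta> \<le> pen i x" by (rule pen4) (use ix False in \<open>auto simp: D_def\<close>)
      moreover have "tm j x \<le> u x" by (rule u_ge) (use j D12 in \<open>auto simp: Ax_def\<close>)
      ultimately show ?thesis using pen1[OF j(2)] \<eta>0 unfolding tm_def by linarith
    qed
    have uM: "u x \<le> M" for x
    proof -
      obtain i where i: "i \<in> Ax x" "u x = tm i x" using u_in by blast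
      then have "sr i x \<le> M" using D23 by (intro sr(3)) (auto simp: Ax_def)
      then show ?thesis using pen0[of i x] unfolding i(2) tm_def by linarith
    qed
    have um: "m - 1 \<le> u x" for x
    proof -
      obtain j where j: "j \<in> I" "x \<in> D j (r j)" using cov by blast
      have j3: "x \<in> D j (3 * r j)" using j D12 D23 by blast
      show ?thesis using dom[OF j(1) j3] sr(2)[OF j(1) j3] pen1[OF j(2)] \<eta>1(1) unfolding tm_def by linarith
    qed
    have tmE: "?s i x - ereal (pen i x) = ereal (tm i x)" if "i \<in> I" "x \<in> D i (3 * r i)" for i x
      unfolding sr(1)[OF that] tm_def by simp
    have sub: "wsub (1 + 2 * \<epsilon>1) (\<lambda>x. ereal (u x)) x" for x
    proof -
      obtain i where i: "i \<in> I" "x \<in> D i (2 * r i)" "u x = tm i x" using u_in[of x] unfolding Ax_def by blast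
      have x3: "x \<in> fst (c i)" "snd (c i) x \<in> ball (p i) (3 * r i)" using i(2) D23 unfolding D_def by blast+
      have "wsub (1 + 2 * \<epsilon>1) (\<lambda>x. ?s i x - ereal (pen i x)) x" unfolding pen_def
        by (rule sup_ball_wsub[OF cr(1) v rc \<delta>(1) \<delta>I(1)[OF i(1)] \<delta>I(2)[OF i(1)] d(2) b0 bl[OF i(1)] x3])
      then show ?thesis
      proof (rule wsub_cong_near[OF _ oD i(2)])
        show "?s i x - ereal (pen i x) = ereal (u x)" using tmE[OF i(1)] i(2,3) D23 by (metis subsetD)
        show "?s i y - ereal (pen i y) \<le> ereal (u y)" if y: "y \<in> D i (2 * r i)" for y
        proof -
          have y3: "y \<in> D i (3 * r i)" using y D23 by blast
          show ?thesis unfolding tmE[OF i(1) y3] using dom[OF i(1) y3] by simp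
        qed
      qed
    qed
    have "open {x. ereal (u x) < t}" for t
    proof (subst open_subopen, intro ballI)
      fix x assume x: "x \<in> {x. ereal (u x) < t}"
      have "\<exists>G. open G \<and> x \<in> G \<and> (\<forall>y\<in>G \<inter> D i (2 * r i). ereal (tm i y) < t)" if i: "i \<in> I" for i
      proof (cases "x \<in> D i (3 * r i)")
        case True
        define G where "G = {y \<in> D i (3 * r i). ?s i y - ereal (pen i y) < t}"
        have us: "usc_on (?s i) (D i (3 * r i))" unfolding D_def by (rule sup_ball_usc[OF cr(1) v rc \<delta>(1) \<delta>I(1)[OF i]])
        have cs: "continuous_on (D i (3 * r i)) (pen i)" unfolding pen_def
          by (intro continuous_intros continuous_on_subset[OF chart_topological(3)[OF cr(1)[of i]]]) (auto simp: D_def)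
        have "open G" using usc_on_minus_continuous[OF us cs] unfolding usc_on_open_iff[OF oD] G_def by (rule spec)
        moreover have "x \<in> G"
        proof -
          have "?s i x - ereal (pen i x) \<le> ereal (u x)" unfolding tmE[OF i True] using dom[OF i True] by simp
          moreover have "ereal (u x) < t" using x by simp
          ultimately have "?s i x - ereal (pen i x) < t" by (rule le_less_trans)
          then show ?thesis unfolding G_def using True by blast
        qed
        moreover have "ereal (tm i y) < t" if "y \<in> G \<inter> D i (2 * r i)" for y
        proof -
          have y: "y \<in> D i (3 * r i)" "?s i y - ereal (pen i y) < t" using that unfolding G_def by blast+
          then show ?thesis using tmE[OF i y(1)] by simp
        qed
        ultimately show ?thesis by blast
      next
        case False
        \<comment> \<open>Far from the ball of radius \<open>2 * r i\<close> the index
          \<open>i\<close> does not compete, and the complement of the closed ball is a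
          neighbourhood of \<open>x\<close>.\<close>
        define G where "G = - {y \<in> fst (c i). snd (c i) y \<in> cball (p i) (2 * r i)}"
        have "cball (p i) (2 * r i) \<subseteq> cball (p i) (4 * r i)" using cr(3)[of i] by (intro subset_cball) simp
        then have "cball (p i) (2 * r i) \<subseteq> chart_image (c i)" using rc by blast
        then have "open G" unfolding G_def using chart_cball_preimage(1)[OF cr(1)] by (intro open_Compl) blast
        moreover have "x \<in> G" using False cr(3)[of i] unfolding G_def D_def by auto
        moreover have "G \<inter> D i (2 * r i) = {}" unfolding G_def D_def by auto
        ultimately show ?thesis by blast
      qed
      then have "\<forall>i\<in>I. \<exists>G. open G \<and> x \<in> G \<and> (\<forall>y\<in>G \<inter> D i (2 * r i). ereal (tm i y) < t)" by blast
      then obtain G where G: "\<And>i. i \<in> I \<Longrightarrow> open (G i)" "\<And>i. i \<in> I \<Longrightarrow> x \<in> G i"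
        "\<And>i y. i \<in> I \<Longrightarrow> y \<in> G i \<Longrightarrow> y \<in> D i (2 * r i) \<Longrightarrow> ereal (tm i y) < t" by (metis IntI)
      have "open (\<Inter>i\<in>I. G i)" by (rule open_INT[OF I(1)]) (use G(1) in blast)
      moreover have "ereal (u y) < t" if y: "y \<in> (\<Inter>i\<in>I. G i)" for y
      proof -
        obtain i where "i \<in> I" "y \<in> D i (2 * r i)" "u y = tm i y" using u_in[of y] unfolding Ax_def by blast
        then show ?thesis using G(3)[of i y] y by simp
      qed
      ultimately show "\<exists>T. open T \<and> x \<in> T \<and> T \<subseteq> {x. ereal (u x) < t}" using G(2) by (intro exI[of _ "\<Inter>i\<in>I. G i"]) auto
    qed
    then have "usc_on (\<lambda>x. ereal (u x)) UNIV" unfolding usc_on_open_iff[OF open_UNIV] by simp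
    moreover have "ereal (u x) \<noteq> \<infinity>" for x by simp
    ultimately have wu: "wsh (1 + 2 * \<epsilon>1) (\<lambda>x. ereal (u x))" unfolding wsh_def using sub by blast
    \<comment> \<open>\<open>u\<close> has the sub-mean value property for
      \<open>(1 + 2 * \<epsilon>1) * \<omega>\<close>, so it must be scaled back to become a
      competitor.\<close>
    define a where "a = 1 / (1 + 2 * \<epsilon>1)"
    have a: "0 < a" "a * (1 + 2 * \<epsilon>1) = 1" unfolding a_def using \<epsilon>1(1) by simp_all
    define U where "U = (\<lambda>x. ereal a * ereal (u x) + ereal 0)"
    have UPSH: "U \<in> PSH A g" unfolding U_def
      by (rule wsh_bounded_PSH_affine[OF wu a, of "m - 1"]) (use um in simp)
    have close: "\<bar>a * u x - u x\<bar> \<le> \<epsilon> / 2" for x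
    proof -
      have a2: "1 - a = 2 * \<epsilon>1 * a" using a(2) by (simp add: algebra_simps)
      have "a \<le> 1" using a2 \<epsilon>1(1) a(1) mult_pos_pos[of "2 * \<epsilon>1" a] by linarith
      then have a1: "0 \<le> 1 - a" "1 - a \<le> 2 * \<epsilon>1" unfolding a2 using \<epsilon>1(1) a(1) by (simp_all add: mult_left_le)
      have "\<bar>u x\<bar> \<le> S" using uM[of x] um[of x] unfolding S_def by linarith
      then have "(1 - a) * \<bar>u x\<bar> \<le> 2 * \<epsilon>1 * S" using a1 by (intro mult_mono) auto
      moreover have "a * u x - u x = - ((1 - a) * u x)" by (simp add: algebra_simps)
      ultimately show ?thesis using \<epsilon>1(2) a1(1) by (simp only: abs_minus_cancel abs_mult abs_of_nonneg)
    qed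
    have cl: "a * u x \<le> u x + \<epsilon> / 2" "u x \<le> a * u x + \<epsilon> / 2" for x using close[of x] by linarith+
    have "\<exists>y. (x, y) \<in> W \<and> U x \<le> v y + ereal \<epsilon>" for x
    proof -
      obtain i where i: "i \<in> I" "x \<in> D i (2 * r i)" "u x = tm i x" using u_in[of x] unfolding Ax_def by blast
      have x3: "x \<in> D i (3 * r i)" using i(2) D23 by blast
      obtain y where y: "y \<in> cball (snd (c i) x) \<delta>" "?s i x = v (chart_inv (c i) y)" using att[OF i(1) x3] by blast
      have "(chart_inv (c i) (snd (c i) x), chart_inv (c i) y) \<in> W"
        by (rule e(2)) (use i(2) y(1) \<delta>I(3)[OF i(1)] in \<open>auto simp: D_def\<close>)
      moreover have "chart_inv (c i) (snd (c i) x) = x" using i(2) cr(1) unfolding D_def by simp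
      ultimately have xy: "(x, chart_inv (c i) y) \<in> W" by simp
      have "v (chart_inv (c i) y) = ereal (sr i x)" using y(2) sr(1)[OF i(1) x3] by simp
      moreover have "a * u x \<le> sr i x + \<epsilon>" using cl(1)[of x] pen0[of i x] \<epsilon> unfolding i(3) tm_def by linarith
      ultimately have "U x \<le> v (chart_inv (c i) y) + ereal \<epsilon>" unfolding U_def by simp
      then show ?thesis using xy by blast
    qed
    moreover have "v y \<le> U x + ereal \<epsilon>" if xy: "x \<in> O1" "y \<in> O1" for x y
    proof -
      have x: "x \<in> D i0 (r i0)" "snd (c i0) x \<in> ball (snd (c i0) x0) (\<delta> / 2)" and y: "y \<in> fst (c i0)" "snd (c i0) y \<in> ball (snd (c i0) x0) (\<delta> / 2)"
        using xy unfolding O1_def by auto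
      have x3: "x \<in> D i0 (3 * r i0)" using x(1) D12 D23 by blast
      have "snd (c i0) y \<in> cball (snd (c i0) x) \<delta>"
        using dist_triangle[of "snd (c i0) x" "snd (c i0) y" "snd (c i0) x0"] x(2) y(2) by (simp add: dist_commute)
      then have "v (chart_inv (c i0) (snd (c i0) y)) \<le> ?s i0 x" by (rule sup_ball_upper)
      moreover have "chart_inv (c i0) (snd (c i0) y) = y" using y(1) cr(1) by simp
      ultimately have "v y \<le> ereal (sr i0 x)" using sr(1)[OF i0(1) x3] by simp
      also have "sr i0 x \<le> a * u x + \<epsilon>" using dom[OF i0(1) x3] pen1[OF x(1)] cl(2)[of x] \<eta>1(2) unfolding tm_def by linarith
      then have "ereal (sr i0 x) \<le> U x + ereal \<epsilon>" unfolding U_def by simp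
      finally show ?thesis .
    qed
    ultimately show ?thesis using UPSH by blast
  qed
  then show thesis using that[OF oO1 x0O1] by blast
qed

section \<open>Continuity of weighted extremal functions\<close>

text \<open>Components are open and closed, so nothing has to match. This discards the values on
  other components, where a competitor may be arbitrarily large.\<close>

lemma wsh_comp_glue:
  assumes v: "wsh \<kappa> v" and \<kappa>: "0 \<le> \<kappa>"
  shows "wsh \<kappa> (\<lambda>x. if x \<in> comp a then v x else ereal m)" (is "wsh \<kappa> ?u")
proof -
  have ov: "open {x. v x < t}" for t using v unfolding wsh_def usc_on_open_iff[OF open_UNIV] by simp
  have "open {x. ?u x < t}" for t
  proof -
    have eq: "{x. ?u x < t} = (comp a \<inter> {x. v x < t}) \<union> (- comp a \<inter> (if ereal m < t then UNIV else {}))" by auto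
    show ?thesis unfolding eq by (intro open_Un open_Int comp_open ov open_Compl comp_closed) simp
  qed
  then have "usc_on ?u UNIV" unfolding usc_on_open_iff[OF open_UNIV] by simp
  moreover have "wsub \<kappa> ?u x" for x
  proof (cases "x \<in> comp a")
    case True
    have "wsub \<kappa> v x" using v unfolding wsh_def by blast
    then show ?thesis by (rule wsub_cong_near[OF _ comp_open True]) (use True in simp_all)
  next
    case False
    then have "x \<in> - comp a" by simp
    from wsub_cong_near[OF wsub_const[OF \<kappa>, of m x] open_Compl[OF comp_closed] this] show ?thesis using False by simp
  qed
  moreover have "?u x \<noteq> \<infinity>" for x using v unfolding wsh_def by simp
  ultimately show ?thesis unfolding wsh_def by blast
qed

lemma weighted_upper: "v \<in> PSH A g \<Longrightarrow> (\<And>y. y \<in> E \<Longrightarrow> v y \<le> ereal (\<phi> y)) \<Longrightarrow> v x \<le> weighted_extremal_fun A g E \<phi> x"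
  unfolding weighted_extremal_fun_def by (rule SUP_upper) auto

text \<open>Arbitrarily large constants on the component of \<open>x0\<close> are admissible, so the
  extremal function is \<open>\<infinity>\<close> on this open set.\<close>

lemma weighted_isCont_of_disjoint:
  assumes m: "\<And>y. y \<in> K \<Longrightarrow> m \<le> \<phi> y" and dis: "comp x0 \<inter> K = {}"
  shows "isCont (weighted_extremal_fun A g K \<phi>) x0"
proof -
  have inf: "weighted_extremal_fun A g K \<phi> x = \<infinity>" if x: "x \<in> comp x0" for x
  proof (rule ereal_top)
    fix t :: real
    let ?v = "\<lambda>x. if x \<in> comp x0 then ereal t else ereal m"
    have "?v \<in> PSH A g" by (rule wsh_imp_PSH[OF wsh_comp_glue[OF wsh_const], where b = "min t m"]) auto
    then have "?v x \<le> weighted_extremal_fun A g K \<phi> x" by (rule weighted_upper) (use m dis in auto)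
    then show "ereal t \<le> weighted_extremal_fun A g K \<phi> x" using x by simp
  qed
  have "\<forall>\<^sub>F x in at x0. weighted_extremal_fun A g K \<phi> x = \<infinity>"
    unfolding eventually_at_topological using inf comp_open[of x0] comp_self[of x0] by blast
  then show ?thesis unfolding isCont_def inf[OF comp_self] by (rule tendsto_eventually)
qed

text \<open>Near a point \<open>b\<close> of \<open>K\<close> the functions below \<open>\<phi>\<close> on \<open>K\<close> are almost below \<open>\<phi> b\<close>, since
  \<open>\<phi>\<close> is almost constant on a small coordinate ball \<open>B\<close> and the extremal function of \<open>K \<inter> B\<close> is
  continuous at \<open>b\<close>.\<close>

lemma le_near_weight:
  assumes b: "b \<in> K" and cont: "isCont (extremal_fun A g K) b" and \<phi>: "continuous_on UNIV \<phi>" and d: "0 < d"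
  obtains W where "open W" "b \<in> W" "\<And>v m y. wsh 1 v \<Longrightarrow> (\<And>x. ereal m \<le> v x) \<Longrightarrow> (\<And>x. x \<in> K \<Longrightarrow> v x \<le> ereal (\<phi> x)) \<Longrightarrow>
     y \<in> W \<Longrightarrow> v y \<le> ereal (\<phi> b + d)"
proof -
  obtain c where c: "c \<in> charts" "b \<in> fst c" by (rule chart_at)
  \<comment> \<open>Half of \<open>d\<close> is spent on the variation of the weight over
    \<open>B\<close>, the other half on the extremal function of
    \<open>K \<inter> B\<close>.\<close>
  define G where "G = {x. \<phi> x < \<phi> b + d / 2}"
  have oG: "open G" unfolding G_def by (rule open_Collect_less[OF \<phi> continuous_on_const])
  have "open (snd c ` (fst c \<inter> G))" by (rule open_chart_image_subset[OF c(1)]) (use chart_topological(1)[OF c(1)] oG in auto)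
  moreover have "snd c b \<in> snd c ` (fst c \<inter> G)" using c(2) d by (auto simp: G_def)
  ultimately obtain r where r: "0 < r" "cball (snd c b) r \<subseteq> snd c ` (fst c \<inter> G)" using open_contains_cball by blast
  define B where "B = {x \<in> fst c. snd c x \<in> cball (snd c b) r}"
  have "closed_coordinate_ball A b r B" unfolding closed_coordinate_ball_def B_def
    by (intro conjI r(1) bexI[of _ c]) (use c r(2) in auto)
  then have "isCont (extremal_fun A g (K \<inter> B)) b" using extremal_local[OF b] cont by blast
  moreover have bB: "b \<in> K \<inter> B" using b c(2) r(1) by (simp add: B_def)
  moreover have "0 < d / 2" using d by simp
  ultimately have "\<exists>W. open W \<and> b \<in> W \<and> (\<forall>x\<in>W. extremal_fun A g (K \<inter> B) x < ereal (d / 2))"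
    unfolding extremal_isCont_iff[OF bB] by (elim allE impE)
  then obtain W where W: "open W" "b \<in> W" "\<And>x. x \<in> W \<Longrightarrow> extremal_fun A g (K \<inter> B) x < ereal (d / 2)" by blast
  have BG: "x \<in> G" if x: "x \<in> B" for x
  proof -
    have "snd c x \<in> snd c ` (fst c \<inter> G)" using x r(2) unfolding B_def by blast
    then obtain x' where x': "x' \<in> fst c" "x' \<in> G" "snd c x = snd c x'" by blast
    have e: "chart_inv c (snd c x) = x" "chart_inv c (snd c x') = x'" using x x'(1) c(1) unfolding B_def by simp_all
    have "x = x'" using e(1) unfolding x'(3) e(2) by (rule sym)
    then show ?thesis using x'(2) by (simp only:)
  qed
  show thesis
  proof (rule that[OF W(1,2)])
    fix v m y assume v: "wsh 1 v" "\<And>x. ereal m \<le> v x" "\<And>x. x \<in> K \<Longrightarrow> v x \<le> ereal (\<phi> x)" and y: "y \<in> W"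
    \<comment> \<open>Subtracting \<open>\<phi> b + d / 2\<close> turns \<open>v\<close> into an
      unweighted competitor for \<open>K \<inter> B\<close>.\<close>
    let ?u = "\<lambda>x. ereal 1 * v x + ereal (- (\<phi> b + d / 2))"
    have "?u y \<le> extremal_fun A g (K \<inter> B) y"
    proof (rule extremal_upper)
      show "?u \<in> PSH A g" by (rule wsh_bounded_PSH_affine[OF v(1) _ _ v(2)]) auto
      fix x assume x: "x \<in> K \<inter> B"
      then have "\<phi> x < \<phi> b + d / 2" using BG unfolding G_def by blast
      moreover have "v x \<le> ereal (\<phi> x)" using x v(3) by blast
      ultimately show "?u x \<le> 0" by (cases "v x") auto
    qed
    then have "?u y < ereal (d / 2)" using W(3)[OF y] by (rule le_less_trans)
    then show "v y \<le> ereal (\<phi> b + d)" by (cases "v y") auto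
  qed
qed

lemma isCont_ereal_of_near:
  fixes V :: "'a \<Rightarrow> ereal"
  assumes fin: "V x0 = ereal c0" and near: "\<And>e. 0 < e \<Longrightarrow> \<exists>G. open G \<and> x0 \<in> G \<and> (\<forall>x\<in>G. \<forall>y\<in>G. V y \<le> V x + ereal e)"
  shows "isCont V x0"
  unfolding isCont_def
proof (rule order_tendstoI)
  fix t assume "t < V x0"
  then obtain s where s: "t < ereal s" "s < c0" using ereal_dense2[of t "V x0"] fin by auto
  have "0 < c0 - s" using s(2) by simp
  from near[OF this] obtain G where G: "open G" "x0 \<in> G" "\<And>x y. x \<in> G \<Longrightarrow> y \<in> G \<Longrightarrow> V y \<le> V x + ereal (c0 - s)" by blast
  have "t < V x" if x: "x \<in> G" for x
  proof -
    have "ereal s \<le> V x" using G(3)[OF x G(2)] unfolding fin by (cases "V x") auto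
    then show ?thesis using s(1) by (rule less_le_trans[rotated])
  qed
  then show "\<forall>\<^sub>F x in at x0. t < V x" unfolding eventually_at_topological using G(1,2) by blast
next
  fix t assume "V x0 < t"
  then obtain s where s: "ereal s < t" "c0 < s" using ereal_dense2[of "V x0" t] fin by auto
  have "0 < s - c0" using s(2) by simp
  from near[OF this] obtain G where G: "open G" "x0 \<in> G" "\<And>x y. x \<in> G \<Longrightarrow> y \<in> G \<Longrightarrow> V y \<le> V x + ereal (s - c0)" by blast
  have "V x < t" if x: "x \<in> G" for x
  proof -
    have "V x \<le> ereal s" using G(3)[OF G(2) x] unfolding fin by simp
    then show ?thesis using s(1) by (rule le_less_trans)
  qed
  then show "\<forall>\<^sub>F x in at x0. V x < t" unfolding eventually_at_topological using G(1,2) by blast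
qed

text \<open>It suffices to bound the value at \<open>y\<close> by that at \<open>x\<close> plus
  \<open>d\<close> for all \<open>x\<close>, \<open>y\<close> near \<open>x0\<close>. A competitor
  is replaced by a member of the bounded class \<open>F\<close> and regularized; the result exceeds
  the weight on \<open>K\<close> by at most \<open>3 * e\<close>, because its values there are
  controlled by those of the original at nearby points, where \<open>le_near_weight\<close>
  applies.\<close>

lemma weighted_continuous:
  assumes K: "compact K" and \<phi>: "continuous_on UNIV \<phi>" and cont: "continuous_on UNIV (extremal_fun A g K)"
  shows "continuous_on UNIV (weighted_extremal_fun A g K \<phi>)"
proof (rule continuous_at_imp_continuous_on, intro ballI)
  fix x0
  let ?V = "weighted_extremal_fun A g K \<phi>"
  have "bounded (\<phi> ` K)" by (intro compact_imp_bounded compact_continuous_image continuous_on_subset[OF \<phi>] K) simp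
  then obtain \<Phi> where "\<forall>x\<in>\<phi> ` K. norm x \<le> \<Phi>" unfolding bounded_iff by blast
  then have \<Phi>: "- \<Phi> \<le> \<phi> y" "\<phi> y \<le> \<Phi>" if "y \<in> K" for y using that by (auto simp: abs_le_iff)
  \<comment> \<open>Below the weight on \<open>K\<close>, so truncating at \<open>m\<close> respects
    the constraint; also at most 0, hence at most \<open>B\<close>.\<close>
  define m where "m = - \<bar>\<Phi>\<bar>"
  have m: "m \<le> \<phi> y" if "y \<in> K" for y using \<Phi>[OF that] unfolding m_def by linarith
  show "isCont ?V x0"
  proof (cases "comp x0 \<inter> K = {}")
    case True
    show ?thesis
    proof (rule weighted_isCont_of_disjoint[of K m \<phi>])
      show "m \<le> \<phi> y" if "y \<in> K" for y by (rule m[OF that])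
    qed (rule True)
  next
    case False
    have cK: "isCont (extremal_fun A g K) b" for b using cont by (simp add: continuous_on_eq_continuous_at)
    obtain b0 where b0: "b0 \<in> comp x0" "b0 \<in> K" using False by blast
    \<comment> \<open>Near a point of \<open>K\<close> in the component all truncated competitors
      are at most \<open>1 + \<bar>\<Phi>\<bar>\<close>. This is the open set from which Harnack
      bounds them on the whole component.\<close>
    have "\<exists>W. open W \<and> b0 \<in> W \<and> (\<forall>x\<in>W. extremal_fun A g K x < ereal 1)"
      using cK[of b0, unfolded extremal_isCont_iff[OF b0(2)]] zero_less_one by (elim allE impE)
    then obtain W0 where W0: "open W0" "b0 \<in> W0" "\<And>x. x \<in> W0 \<Longrightarrow> extremal_fun A g K x < ereal 1" by blast
    have N0: "open (W0 \<inter> comp x0)" "W0 \<inter> comp x0 \<subseteq> comp x0" "W0 \<inter> comp x0 \<noteq> {}"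
      using W0 b0 comp_open by auto
    obtain B where B: "0 \<le> B" "\<And>v x. wsh 1 v \<Longrightarrow> (\<And>x. x \<in> W0 \<inter> comp x0 \<Longrightarrow> v x \<le> ereal (1 + \<bar>\<Phi>\<bar>)) \<Longrightarrow> x \<in> comp x0 \<Longrightarrow> v x \<le> ereal B"
    proof (rule comp_bound[OF N0, of "1 + \<bar>\<Phi>\<bar>"], goal_cases)
      case (1 B)
      show thesis by (rule 1(1)) (fact 1)+
    qed
    have mB: "m \<le> B" using B(1) unfolding m_def by simp
    \<comment> \<open>The bounds are uniform, as \<open>regularize\<close> requires: its radius and
      neighbourhood depend only on \<open>m\<close>, \<open>B\<close>, \<open>W\<close> and the
      error.\<close>
    define F where "F = {v. wsh 1 v \<and> (\<forall>x. ereal m \<le> v x \<and> v x \<le> ereal B) \<and> (\<forall>y\<in>K. v y \<le> ereal (\<phi> y))}"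
    have compF: "\<exists>v'\<in>F. \<forall>x\<in>comp x0. v x \<le> v' x" if v: "v \<in> PSH A g" "\<And>y. y \<in> K \<Longrightarrow> v y \<le> ereal (\<phi> y)" for v
    proof -
      let ?v = "\<lambda>x. max (v x) (ereal m)"
      have w: "wsh 1 ?v" by (rule wsh_max_const[OF PSH_imp_wsh[OF v(1)]]) simp
      have vK: "?v y \<le> ereal (\<phi> y)" if "y \<in> K" for y using v(2)[OF that] m[OF that] by simp
      have "?v x \<le> ereal B" if x: "x \<in> comp x0" for x
      proof (rule B(2)[OF w _ x])
        fix y assume y: "y \<in> W0 \<inter> comp x0"
        have "?v y + ereal (- \<bar>\<Phi>\<bar>) \<le> extremal_fun A g K y"
        proof (rule extremal_upper[OF PSH_shift_trunc[OF v(1)]])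
          fix k assume k: "k \<in> K"
          have "?v k \<le> ereal \<bar>\<Phi>\<bar>" using order_trans[OF vK[OF k], of "ereal \<bar>\<Phi>\<bar>"] \<Phi>(2)[OF k] by simp
          then show "?v k + ereal (- \<bar>\<Phi>\<bar>) \<le> 0" by (cases "?v k") auto
        qed
        also have "\<dots> < ereal 1" using y W0(3) by blast
        finally show "?v y \<le> ereal (1 + \<bar>\<Phi>\<bar>)" by (cases "?v y") auto
      qed
      then have "(\<lambda>x. if x \<in> comp x0 then ?v x else ereal m) \<in> F"
        unfolding F_def using wsh_comp_glue[OF w, of x0 m] vK m mB by auto
      then show ?thesis by (intro bexI[of _ "\<lambda>x. if x \<in> comp x0 then ?v x else ereal m"]) auto
    qed
    have VB: "?V x \<le> ereal B" if x: "x \<in> comp x0" for x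
      unfolding weighted_extremal_fun_def
    proof (rule SUP_least)
      fix v assume "v \<in> {v \<in> PSH A g. \<forall>y\<in>K. v y \<le> ereal (\<phi> y)}"
      then obtain v' where "v' \<in> F" "v x \<le> v' x" using compF[of v] x by blast
      then show "v x \<le> ereal B" unfolding F_def by (auto intro: order_trans)
    qed
    have Vm: "ereal m \<le> ?V x" for x by (rule weighted_upper[OF const_PSH]) (use m in simp)
    have near: "\<exists>G. open G \<and> x0 \<in> G \<and> (\<forall>x\<in>G. \<forall>y\<in>G. ?V y \<le> ?V x + ereal d)" if "0 < d" for d
    proof -
      \<comment> \<open>Three parts for lowering the regularization below the weight, one for its
        loss near \<open>x0\<close>.\<close>
      define e where "e = d / 4"
      have e: "0 < e" using that by (simp add: e_def)
      have "\<exists>W. open W \<and> b \<in> W \<and> (\<forall>v\<in>F. \<forall>y\<in>W. v y \<le> ereal (\<phi> b + e))" if b: "b \<in> K" for b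
      proof (rule le_near_weight[OF b cK \<phi> e], goal_cases)
        case (1 W)
        show ?case
        proof (intro exI[of _ W] conjI 1(1,2) ballI)
          fix v y assume v: "v \<in> F" and y: "y \<in> W"
          have f: "wsh 1 v" "\<And>x. ereal m \<le> v x" "\<And>x. x \<in> K \<Longrightarrow> v x \<le> ereal (\<phi> x)" using v unfolding F_def by blast+
          show "v y \<le> ereal (\<phi> b + e)" by (rule 1(3)[OF f y])
        qed
      qed
      then have "\<forall>b\<in>K. \<exists>W. open W \<and> b \<in> W \<and> (\<forall>v\<in>F. \<forall>y\<in>W. v y \<le> ereal (\<phi> b + e))" by blast
      then obtain H where H: "\<And>b. b \<in> K \<Longrightarrow> open (H b)" "\<And>b. b \<in> K \<Longrightarrow> b \<in> H b"
        "\<And>b v y. b \<in> K \<Longrightarrow> v \<in> F \<Longrightarrow> y \<in> H b \<Longrightarrow> v y \<le> ereal (\<phi> b + e)" by metis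
      define N where "N = (\<lambda>b. {x. \<phi> b - e < \<phi> x})"
      have oN: "open (N b)" for b unfolding N_def by (rule open_Collect_less[OF continuous_on_const \<phi>])
      \<comment> \<open>Only pairs whose first point is in \<open>K\<close> are constrained: both
        points then lie in a common set \<open>H b\<close>, with the weight at the first not much
        below \<open>\<phi> b\<close>. Closedness of \<open>K\<close> makes \<open>W\<close>
        open.\<close>
      define W where "W = ((- K) \<times> UNIV) \<union> (\<Union>b\<in>K. (H b \<inter> N b) \<times> H b)"
      have oW: "open W" unfolding W_def
        using compact_imp_closed[OF K] H(1) oN by (intro open_Un open_UN ballI open_Times open_Int open_Compl) auto
      have dW: "(x, x) \<in> W" for x using H(2)[of x] e unfolding W_def N_def by auto
      have uK: "v y \<le> ereal (\<phi> k + 2 * e)" if "(k, y) \<in> W" "k \<in> K" "v \<in> F" for k y v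
      proof -
        obtain b where b: "b \<in> K" "k \<in> N b" "y \<in> H b" using \<open>(k, y) \<in> W\<close> \<open>k \<in> K\<close> unfolding W_def by blast
        have "v y \<le> ereal (\<phi> b + e)" by (rule H(3)[OF b(1) \<open>v \<in> F\<close> b(3)])
        also have "\<dots> \<le> ereal (\<phi> k + 2 * e)" using b(2) unfolding N_def by simp
        finally show ?thesis .
      qed
      show ?thesis
      proof (rule regularize[OF mB e oW dW, of x0], goal_cases)
        case (1 O1)
        have "?V y \<le> ?V x + ereal d" if xy: "x \<in> O1 \<inter> comp x0" "y \<in> O1 \<inter> comp x0" for x y
        proof -
          have Vx: "?V x \<noteq> - \<infinity>" using Vm[of x] by auto
          have "v y \<le> ?V x + ereal d" if v: "v \<in> PSH A g" "\<forall>y\<in>K. v y \<le> ereal (\<phi> y)" for v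
          proof -
            obtain v' where v': "v' \<in> F" "v y \<le> v' y" using compF[of v] v xy(2) by blast
            have fv: "wsh 1 v'" "\<And>x. ereal m \<le> v' x \<and> v' x \<le> ereal B" using v'(1) unfolding F_def by blast+
            from 1(3)[OF fv] obtain u where u: "u \<in> PSH A g" "\<And>x. \<exists>y. (x, y) \<in> W \<and> u x \<le> v' y + ereal e"
              "\<And>x y. x \<in> O1 \<Longrightarrow> y \<in> O1 \<Longrightarrow> v' y \<le> u x + ereal e" by blast
            \<comment> \<open>On \<open>K\<close> the regularization is at most the value of
              \<open>v'\<close> at a \<open>W\<close>-close point plus \<open>e\<close>, thus at
              most \<open>\<phi> k + 3 * e\<close>; lowered by \<open>3 * e\<close> it
              competes.\<close>
            have "max (u x) (ereal m) + ereal (- (3 * e)) \<le> ?V x"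
            proof (rule weighted_upper[OF PSH_shift_trunc[OF u(1)]])
              fix k assume k: "k \<in> K"
              obtain z where z: "(k, z) \<in> W" "u k \<le> v' z + ereal e" using u(2) by blast
              have "u k \<le> ereal (\<phi> k + 2 * e) + ereal e" using z(2) add_right_mono[OF uK[OF z(1) k v'(1)]] by (rule order_trans)
              then have "max (u k) (ereal m) \<le> ereal (\<phi> k + 3 * e)" using m[OF k] e by (auto simp: add.assoc)
              then show "max (u k) (ereal m) + ereal (- (3 * e)) \<le> ereal (\<phi> k)" by (cases "max (u k) (ereal m)") auto
            qed
            moreover have "u x \<le> max (u x) (ereal m)" by simp
            moreover have "v y \<le> u x + ereal e" using v'(2) u(3)[of x y] xy by (auto intro: order_trans)
            moreover have "d = 4 * e" by (simp add: e_def)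
            ultimately show ?thesis using Vx
              by (cases "u x"; cases "?V x"; cases "v y") (auto simp: max_def split: if_splits)
          qed
          then show ?thesis unfolding weighted_extremal_fun_def[of _ _ _ _ y] by (intro SUP_least) blast
        qed
        moreover have "open (O1 \<inter> comp x0)" "x0 \<in> O1 \<inter> comp x0" using 1(1,2) comp_open by auto
        ultimately show ?case by blast
      qed
    qed
    obtain c0 where "?V x0 = ereal c0" using VB[of x0] Vm[of x0] by (cases "?V x0") auto
    from isCont_ereal_of_near[OF this near] show ?thesis .
  qed
qed

end

theorem theorem1p4:
  fixes A :: "('a::t2_space, 'n::finite) chart set"
    and g :: "('a, 'n) metric_coeffs"
    and K B :: "'a set" and a :: 'a and r :: real
  assumes "compact_hermitian_manifold A g"
    and "compact K" and "a \<in> K"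
    and "closed_coordinate_ball A a r B"
  shows "(isCont (extremal_fun A g K) a \<longleftrightarrow> isCont (extremal_fun A g (K \<inter> B)) a) \<and>
         (\<forall>\<phi> :: 'a \<Rightarrow> real.
            continuous_on UNIV \<phi> \<longrightarrow> continuous_on UNIV (extremal_fun A g K) \<longrightarrow>
            continuous_on UNIV (weighted_extremal_fun A g K \<phi>))"
proof -
  interpret hermitian_mfd A g by unfold_locales (rule assms(1))
  show ?thesis using extremal_local[OF assms(3,4)] weighted_continuous[OF assms(2)] by blast
qed

end
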